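(* Take $d=1$, $p=2$ and no transport term. (a) Brownian noise only. For every $\alpha>0$, assume that $f\in L^\infty_{loc}([0,\infty);\mathcal{C}^\alpha_b(\mathbb{R}))$ and that there is a real number $\beta$ with $0<\beta<\alpha$ such that $h\in L^\infty_{loc}([0,\infty);\mathcal{C}^\beta_b(\mathbb{R};L^2(\Omega)))$. Then the Cauchy problem $$du(t,x)-\tfrac12\Delta u(t,x)\,dt=h(t,x)\,dt+f(t,x)\,dW_t,\quad t>0,\ x\in\mathbb{R},\qquad u|_{t=0}=0,$$ has a unique mild solution $u\in L^\infty_{loc}([0,\infty);\mathcal{C}^{1+\alpha}_b(\mathbb{R};L^2(\Omega)))$, given by $$u(t,x)=\int_0^t dr\int_{\mathbb{R}}K(t-r,x-z)h(r,z)\,dz+\int_0^t dW_r\int_{\mathbb{R}}K(t-r,x-z)f(r,z)\,dz.$$ Moreover, choose a non-negative, time-independent $f\in\mathcal{C}^\alpha_b(\mathbb{R})$ such that (i) $f$ is non-decreasing on $\mathbb{R}$ and $\mathrm{supp}\,f\subset\mathbb{R}_+$; (ii) for $x,y\in[0,1]$, $|f(x)-f(y)|\approx|x-y|^\alpha$. Choose also $h(t,x,\omega)=h_1(t,x)h_2(\omega)$ with $h_1\in L^\infty_{loc}([0,\infty);\mathcal{C}^\beta_b(\mathbb{R}))$ and $h_2\in L^2(\Omega)$. Then the first term on the right-hand side of the formula for $u$ belongs to $L^\infty_{loc}([0,\infty);\mathcal{C}^{1+\delta}_b(\mathbb{R};L^2(\Omega)))$ for every $\delta$ with $\alpha<\delta<1$,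 while for every $\delta>\alpha$ the solution $u$ is not in $L^\infty_{loc}([0,\infty);\mathcal{C}^{1+\delta}_b(\mathbb{R};L^2(\Omega)))$; i.e. the Hölder index $\alpha$ is optimal. (b) Lévy noise only. Let $g(t,x,v)=f(x)g_1(v)$, with $f$ having the properties described in (a), including (i) and (ii), and $g_1\in L^2(E,\nu)$ vanishing near $0$. For every $\alpha>0$, if there is a real number $0<\beta<\alpha$ such that $h\in L^\infty_{loc}([0,\infty);\mathcal{C}^\beta_b(\mathbb{R};L^2(\Omega)))$, then the Cauchy problem $$du(t,x)-\tfrac12\Delta u(t,x)\,dt=h(t,x)\,dt+\int_E g(t,x,v)\,\tilde N(dt,dv),\quad t>0,\ x\in\mathbb{R},\qquad u|_{t=0}=0,$$ has a unique mild solution $u\in L^\infty_{loc}([0,\infty);\mathcal{C}^{1+\alpha}_b(\mathbb{R};L^2(\Omega)))$, given by $$u(t,x)=\int_0^t dr\int_{\mathbb{R}}K(t-r,x-z)h(r,z)\,dz+\int_0^t\int_E\int_{\mathbb{R}}K(t-r,x-z)g(r,z,v)\,dz\,\tilde N(dr,dv),$$ and the Hölder index $\alpha$ is optimal for this problem. (c) Both noises. When $p=2$, the Hölder index $\alpha$ for the Cauchy problem $$du(t,x)-\tfrac12\Delta u(t,x)\,dt=h(t,x)\,dt+f(t,x)\,dW_t+\int_E g(t,x,v)\,\tilde N(dt,dv),\quad t>0,\ x\in\mathbb{R},\qquad u|_{t=0}=0,$$ is also optimal (by combining the choices of data in (a) and (b), the two stochastic integrals being independent).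
   Context: Setting. $(\Omega,\mathcal{F},\{\mathcal{F}_t\}_{t\ge0},\mathbb{P})$ is a filtered complete probability space with right-continuous filtration, $\{W_t\}_{t\ge0}$ is a scalar Wiener process on it, and $E=B_c(0)\setminus\{0\}$ is the ball of radius $c>0$ centred at $0$ with its centre removed. $N$ is a time-homogeneous Poisson random measure over this filtered space with intensity measure $\nu\times\lambda$ on $E\times\mathbb{R}_+$, where $\lambda$ is Lebesgue measure and $\mathbb{R}_+=[0,\infty)$: $N(B\times I)$ is Poisson with parameter $\nu(B)\lambda(I)$ when $\nu(B)<\infty$; $N$ takes independent values on pairwise disjoint sets; for each Borel $U\subset E$ the process $t\mapsto N((0,t],U)$ is $\mathcal{F}_t$-adapted with increments independent of the past. The Lévy measure $\nu$ satisfies $\int_E 1\wedge|v|^2\,\nu(dv)<\infty$. The compensated measure is $\tilde N((0,t],A)=N((0,t],A)-\nu(A)t$, and $\tilde N$ is independent of $\{W_t\}$. A function on $E$ vanishes near $0$ if it is zero on the intersection of $E$ with some neighbourhood of $0$. Heat kernel and semigroup. $K(r,x)=(2\pi r)^{-1/2}e^{-x^2/(2r)}$ and $P_t\varphi(x)=\int_{\mathbb{R}}K(t,x-y)\varphi(y)\,dy$. Mild solution (zero initial data). A jointly measurable $u$ is a mild solution of the equation with data $h,f,g$ (with $f=0$ or $g=0$ if that noise is absent) if: (1) $u$ is $\mathcal{F}_t$-adapted; (2) $t\mapsto u(t,x,\cdot)$ is right continuous with left limits as an $L^2(\Omega)$-valued map on $[0,\infty)$; (3) $u\in L^\infty_{loc}([0,\infty);W^{1,\infty}(\mathbb{R};L^2(\Omega)))$;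 (4) for every $t>0$, almost surely, $$u(t,x)=\int_0^tP_{t-r}h(r,\cdot)(x)\,dr+\int_0^tP_{t-r}f(r,\cdot)(x)\,dW_r+\int_{(0,t]}\int_EP_{t-r}g(r,\cdot,v)(x)\,\tilde N(dr,dv),$$ with Itô stochastic integrals. Spaces. $L^\infty_{loc}([0,\infty);X)$ means essentially bounded with values in $X$ on each $[0,T]$. $\mathcal{C}^\alpha_b(\mathbb{R})$ has norm $\sup_x|\varphi(x)|+\sup_{x\ne y}|\varphi(x)-\varphi(y)|/|x-y|^\alpha$. $\mathcal{C}^\beta_b(\mathbb{R};L^2(\Omega))$ has norm $\sup_x\|\varphi(x)\|_{L^2(\Omega)}+\sup_{x\ne y}\|\varphi(x)-\varphi(y)\|_{L^2(\Omega)}/|x-y|^\beta$. $\mathcal{C}^{1+\delta}_b(\mathbb{R};L^2(\Omega))$ has norm $\sup_x\|\varphi(x)\|_{L^2(\Omega)}+\sup_x\|\partial_x\varphi(x)\|_{L^2(\Omega)}+\sup_{x\ne y}\|\partial_x\varphi(x)-\partial_x\varphi(y)\|_{L^2(\Omega)}/|x-y|^\delta$. The symbol $\approx$ means comparable up to positive multiplicative constants. "The Hölder index $\alpha$ is optimal" is meant in the sense spelled out in (a): for the indicated data, $u$ is not in $L^\infty_{loc}([0,\infty);\mathcal{C}^{1+\delta}_b(\mathbb{R};L^2(\Omega)))$ for every $\delta>\alpha$.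
   Formalization: Membership of u in C^{1+α} is claimed only for α<1 (false for α≥1); h is assumed adapted and jointly measurable, else no adapted solution exists; optimality in (b) assumes g_1 is not ν-a.e. zero; (ii), unsatisfiable for α<1 over all pairs, is needed only at y=0. *)

theory Defs
  imports "HOL-Probability.Probability"
begin

section \<open>Filtered space, Wiener process, Poisson random measure\<close>

text \<open>
  The library's filtrations are indexed by a whole order, here \<open>real\<close>; only the sigma-algebras
  \<open>F t\<close> with \<open>t \<ge> 0\<close> carry information (a filtration on \<open>[0,\<infinity>)\<close> extends by \<open>F t = F 0\<close> for \<open>t < 0\<close>).
  Completeness is meant in the usual sense: \<open>M\<close> is complete and \<open>F 0\<close> contains the null sets.
\<close>

definition filtered_prob_space :: "'a measure \<Rightarrow> (real \<Rightarrow> 'a measure) \<Rightarrow> bool" where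
  "filtered_prob_space M F \<longleftrightarrow>
     prob_space M \<and> complete_measure M \<and> filtration (space M) F \<and>
     (\<forall>t. subalgebra M (F t)) \<and>
     null_sets M \<subseteq> sets (F 0) \<and>
     (\<forall>t\<ge>0. sets (F t) = (\<Inter>s\<in>{t<..}. sets (F s)))"

text \<open>Preimages of Borel sets, i.e. the events generated by a random variable.\<close>

definition events_of :: "'a measure \<Rightarrow> ('a \<Rightarrow> 'b::topological_space) \<Rightarrow> 'a set set" where
  "events_of M X = {X -` A \<inter> space M | A. A \<in> sets borel}"

definition wiener_process :: "'a measure \<Rightarrow> (real \<Rightarrow> 'a measure) \<Rightarrow> (real \<Rightarrow> 'a \<Rightarrow> real) \<Rightarrow> bool" where
  "wiener_process M F W \<longleftrightarrow>
     (AE \<omega> in M. W 0 \<omega> = 0) \<and>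
     (AE \<omega> in M. continuous_on {0..} (\<lambda>t. W t \<omega>)) \<and>
     (\<forall>t\<ge>0. W t \<in> borel_measurable (F t)) \<and>
     (\<forall>s t. 0 \<le> s \<and> s < t \<longrightarrow>
        distributed M lborel (\<lambda>\<omega>. W t \<omega> - W s \<omega>) (\<lambda>x. ennreal (normal_density 0 (sqrt (t - s)) x)) \<and>
        prob_space.indep_set M (sets (F s)) (events_of M (\<lambda>\<omega>. W t \<omega> - W s \<omega>)))"

definition marks :: "real \<Rightarrow> 'e::euclidean_space set" where
  "marks c = ball 0 c - {0}"

definition levy_measure :: "real \<Rightarrow> 'e::euclidean_space measure \<Rightarrow> bool" where
  "levy_measure c \<nu> \<longleftrightarrow>
     sets \<nu> = sets (restrict_space borel (marks c)) \<and>
     (\<integral>\<^sup>+ v. ennreal (min 1 ((norm v)\<^sup>2)) \<partial>\<nu>) < \<infinity>"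

text \<open>
  The random measure is a family of measures \<open>N \<omega>\<close> on \<open>[0,\<infinity>) \<times> E\<close> (time coordinate first).
  If \<open>\<lambda>(I) = \<infinity>\<close> there is no Poisson law to prescribe, hence the bound on \<open>emeasure lborel I\<close>.
\<close>

definition poisson_random_measure ::
  "'a measure \<Rightarrow> (real \<Rightarrow> 'a measure) \<Rightarrow> real \<Rightarrow> 'e::euclidean_space measure \<Rightarrow> ('a \<Rightarrow> (real \<times> 'e) measure) \<Rightarrow> bool"
where
  "poisson_random_measure M F c \<nu> N \<longleftrightarrow>
     (let \<A> = sets (restrict_space borel ({0..} \<times> marks c)) in
     (\<forall>\<omega>\<in>space M. sets (N \<omega>) = \<A>) \<and>
     (\<forall>A\<in>\<A>. (\<lambda>\<omega>. emeasure (N \<omega>) A) \<in> borel_measurable M) \<and>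
     (\<forall>B\<in>sets \<nu>. \<forall>I\<in>sets borel. I \<subseteq> {0..} \<and> emeasure \<nu> B < \<infinity> \<and> emeasure lborel I < \<infinity> \<longrightarrow>
        (\<forall>k. measure M {\<omega> \<in> space M. emeasure (N \<omega>) (I \<times> B) = of_nat k}
               = pmf (poisson_pmf (measure \<nu> B * measure lborel I)) k)) \<and>
     (\<forall>(A :: nat \<Rightarrow> (real \<times> 'e) set) J. finite J \<and> disjoint_family_on A J \<and> A ` J \<subseteq> \<A> \<longrightarrow>
        prob_space.indep_vars M (\<lambda>_. borel) (\<lambda>j \<omega>. emeasure (N \<omega>) (A j)) J) \<and>
     (\<forall>U\<in>sets \<nu>. \<forall>t\<ge>0. (\<lambda>\<omega>. emeasure (N \<omega>) ({0<..t} \<times> U)) \<in> borel_measurable (F t)) \<and>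
     (\<forall>U\<in>sets \<nu>. \<forall>s t. 0 \<le> s \<and> s < t \<longrightarrow>
        prob_space.indep_set M (sets (F s)) (events_of M (\<lambda>\<omega>. emeasure (N \<omega>) ({s<..t} \<times> U)))))"

text \<open>Compensated measure of \<open>(s,t] \<times> A\<close>, used only when \<open>\<nu>(A) < \<infinity>\<close>.\<close>

definition compensated ::
  "'e measure \<Rightarrow> ('a \<Rightarrow> (real \<times> 'e) measure) \<Rightarrow> real \<Rightarrow> real \<Rightarrow> 'e set \<Rightarrow> 'a \<Rightarrow> real"
where
  "compensated \<nu> N s t A \<omega> = measure (N \<omega>) ({s<..t} \<times> A) - measure \<nu> A * (t - s)"

definition independent_noises ::
  "'a measure \<Rightarrow> (real \<Rightarrow> 'a \<Rightarrow> real) \<Rightarrow> 'e measure \<Rightarrow> ('a \<Rightarrow> (real \<times> 'e) measure) \<Rightarrow> bool"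
where
  "independent_noises M W \<nu> N \<longleftrightarrow>
     prob_space.indep_set M
       (sigma_sets (space M) (\<Union>t\<in>{0..}. events_of M (W t)))
       (sigma_sets (space M)
          (\<Union>(s, t, A)\<in>{(s, t, A). 0 \<le> s \<and> s \<le> t \<and> A \<in> sets \<nu> \<and> emeasure \<nu> A < \<infinity>}.
              events_of M (compensated \<nu> N s t A)))"

definition noise_setting ::
  "'a measure \<Rightarrow> (real \<Rightarrow> 'a measure) \<Rightarrow> (real \<Rightarrow> 'a \<Rightarrow> real) \<Rightarrow>
   real \<Rightarrow> 'e::euclidean_space measure \<Rightarrow> ('a \<Rightarrow> (real \<times> 'e) measure) \<Rightarrow> bool"
where
  "noise_setting M F W c \<nu> N \<longleftrightarrow>
     filtered_prob_space M F \<and> wiener_process M F W \<and> 0 < c \<and> levy_measure c \<nu> \<and>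
     poisson_random_measure M F c \<nu> N \<and> independent_noises M W \<nu> N"


section \<open>Norms\<close>

text \<open>
  Elements of \<open>L\<^sup>2(\<Omega>)\<close> are represented by random variables; all norms are extended valued,
  with value \<open>\<infinity>\<close> outside the space.
\<close>

definition l2norm :: "'a measure \<Rightarrow> ('a \<Rightarrow> real) \<Rightarrow> ennreal" where
  "l2norm M X =
     (if X \<in> borel_measurable M \<and> integrable M (\<lambda>\<omega>. (X \<omega>)\<^sup>2)
      then ennreal (sqrt (integral\<^sup>L M (\<lambda>\<omega>. (X \<omega>)\<^sup>2))) else \<infinity>)"

definition holder_quotient :: "real \<Rightarrow> (real \<Rightarrow> real \<Rightarrow> ennreal) \<Rightarrow> ennreal" where
  "holder_quotient \<alpha> D = (SUP (x, y)\<in>{(x, y). x \<noteq> y}. D x y / ennreal (\<bar>x - y\<bar> powr \<alpha>))"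

definition holder_norm :: "real \<Rightarrow> (real \<Rightarrow> real) \<Rightarrow> ennreal" where
  "holder_norm \<alpha> \<phi> =
     (SUP x. ennreal \<bar>\<phi> x\<bar>) + holder_quotient \<alpha> (\<lambda>x y. ennreal \<bar>\<phi> x - \<phi> y\<bar>)"

definition holder_l2_norm :: "'a measure \<Rightarrow> real \<Rightarrow> (real \<Rightarrow> 'a \<Rightarrow> real) \<Rightarrow> ennreal" where
  "holder_l2_norm M \<beta> \<phi> =
     (SUP x. l2norm M (\<phi> x)) + holder_quotient \<beta> (\<lambda>x y. l2norm M (\<lambda>\<omega>. \<phi> x \<omega> - \<phi> y \<omega>))"

text \<open>\<open>\<psi>\<close> is the (strong) derivative of the \<open>L\<^sup>2(\<Omega>)\<close>-valued map \<open>\<phi>\<close>.\<close>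

definition has_l2_derivative ::
  "'a measure \<Rightarrow> (real \<Rightarrow> 'a \<Rightarrow> real) \<Rightarrow> (real \<Rightarrow> 'a \<Rightarrow> real) \<Rightarrow> bool"
where
  "has_l2_derivative M \<phi> \<psi> \<longleftrightarrow>
     (\<forall>x. ((\<lambda>e. l2norm M (\<lambda>\<omega>. (\<phi> (x + e) \<omega> - \<phi> x \<omega>) / e - \<psi> x \<omega>)) \<longlongrightarrow> 0) (at 0))"

text \<open>
  The derivative is unique up to null sets, so the infimum below runs over versions of one object
  and all members of the set give the same value; it is \<open>\<infinity>\<close> if there is no derivative.
\<close>

definition holder1_l2_norm :: "'a measure \<Rightarrow> real \<Rightarrow> (real \<Rightarrow> 'a \<Rightarrow> real) \<Rightarrow> ennreal" where
  "holder1_l2_norm M \<delta> \<phi> =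
     (INF \<psi>\<in>{\<psi>. has_l2_derivative M \<phi> \<psi>}.
        (SUP x. l2norm M (\<phi> x)) + (SUP x. l2norm M (\<psi> x)) +
        holder_quotient \<delta> (\<lambda>x y. l2norm M (\<lambda>\<omega>. \<psi> x \<omega> - \<psi> y \<omega>)))"

definition test_function :: "(real \<Rightarrow> real) \<Rightarrow> bool" where
  "test_function \<eta> \<longleftrightarrow>
     (\<forall>n x. ((deriv ^^ n) \<eta>) differentiable (at x)) \<and> compact (closure {x. \<eta> x \<noteq> 0})"

text \<open>
  Weak derivative of an \<open>L\<^sup>2(\<Omega>)\<close>-valued map. For jointly measurable, locally \<open>L\<^sup>2(\<Omega>)\<close>-bounded
  maps the Bochner integrals in \<open>L\<^sup>2(\<Omega>)\<close> agree almost surely with the pathwise integrals written here.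
\<close>

definition has_weak_l2_derivative ::
  "'a measure \<Rightarrow> (real \<Rightarrow> 'a \<Rightarrow> real) \<Rightarrow> (real \<Rightarrow> 'a \<Rightarrow> real) \<Rightarrow> bool"
where
  "has_weak_l2_derivative M \<phi> \<psi> \<longleftrightarrow>
     (\<lambda>(x, \<omega>). \<psi> x \<omega>) \<in> borel_measurable (borel \<Otimes>\<^sub>M M) \<and>
     (\<forall>\<eta>. test_function \<eta> \<longrightarrow>
        (AE \<omega> in M. (LINT x|lborel. \<phi> x \<omega> * deriv \<eta> x) = - (LINT x|lborel. \<psi> x \<omega> * \<eta> x)))"

definition w1inf_l2_norm :: "'a measure \<Rightarrow> (real \<Rightarrow> 'a \<Rightarrow> real) \<Rightarrow> ennreal" where
  "w1inf_l2_norm M \<phi> =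
     (INF \<psi>\<in>{\<psi>. has_weak_l2_derivative M \<phi> \<psi>}.
        esssup lborel (\<lambda>x. l2norm M (\<phi> x)) + esssup lborel (\<lambda>x. l2norm M (\<psi> x)))"

text \<open>Membership in \<open>L\<^sup>\<infinity>\<^sub>l\<^sub>o\<^sub>c([0,\<infinity>);X)\<close>, where \<open>X\<close> is given by its extended-valued norm.\<close>

definition linf_loc :: "('b \<Rightarrow> ennreal) \<Rightarrow> (real \<Rightarrow> 'b) \<Rightarrow> bool" where
  "linf_loc nrm u \<longleftrightarrow>
     (\<forall>T\<ge>0. \<exists>K::real. AE t in lborel. t \<in> {0..T} \<longrightarrow> nrm (u t) \<le> ennreal K)"


section \<open>Stochastic integrals\<close>

text \<open>
  Ito integrals of square integrable integrands are \<open>L\<^sup>2(\<Omega>)\<close>-limits of the integrals of simple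
  predictable processes; they are determined up to null sets, so they are given as a relation
  between the integrand and a random variable. An entry \<open>(a, b, \<xi>)\<close> of the list encodes the summand
  \<open>\<xi> 1\<^bsub>(a,b]\<^esub>\<close>, an entry \<open>(a, b, A, \<xi>)\<close> the summand \<open>\<xi> 1\<^bsub>(a,b]\<times>A\<^esub>\<close>.
\<close>

definition wiener_simple ::
  "'a measure \<Rightarrow> (real \<Rightarrow> 'a measure) \<Rightarrow> (real \<times> real \<times> ('a \<Rightarrow> real)) list \<Rightarrow> bool"
where
  "wiener_simple M F S \<longleftrightarrow>
     (\<forall>(a, b, \<xi>)\<in>set S. 0 \<le> a \<and> a \<le> b \<and> \<xi> \<in> borel_measurable (F a) \<and>
        (\<exists>C. \<forall>\<omega>\<in>space M. \<bar>\<xi> \<omega>\<bar> \<le> C))"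

definition wiener_simple_value ::
  "(real \<times> real \<times> ('a \<Rightarrow> real)) list \<Rightarrow> real \<Rightarrow> 'a \<Rightarrow> real"
where
  "wiener_simple_value S r \<omega> = (\<Sum>(a, b, \<xi>)\<leftarrow>S. \<xi> \<omega> * indicator {a<..b} r)"

definition wiener_simple_integral ::
  "(real \<Rightarrow> 'a \<Rightarrow> real) \<Rightarrow> (real \<times> real \<times> ('a \<Rightarrow> real)) list \<Rightarrow> real \<Rightarrow> 'a \<Rightarrow> real"
where
  "wiener_simple_integral W S t \<omega> =
     (\<Sum>(a, b, \<xi>)\<leftarrow>S. \<xi> \<omega> * (W (min b t) \<omega> - W (min a t) \<omega>))"

text \<open>\<open>I\<close> is the integral of \<open>\<phi> r \<omega>\<close> with respect to \<open>dW\<^sub>r\<close> over \<open>[0,t]\<close>.\<close>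

definition has_wiener_integral ::
  "'a measure \<Rightarrow> (real \<Rightarrow> 'a measure) \<Rightarrow> (real \<Rightarrow> 'a \<Rightarrow> real) \<Rightarrow>
   real \<Rightarrow> (real \<Rightarrow> 'a \<Rightarrow> real) \<Rightarrow> ('a \<Rightarrow> real) \<Rightarrow> bool"
where
  "has_wiener_integral M F W t \<phi> I \<longleftrightarrow>
     (let Q = restrict_space lborel {0..t} \<Otimes>\<^sub>M M in
     (\<lambda>(r, \<omega>). \<phi> r \<omega>) \<in> borel_measurable Q \<and>
     (\<exists>S. (\<forall>n. wiener_simple M F (S n)) \<and>
        (\<lambda>n. \<integral>\<^sup>+ (r, \<omega>). ennreal ((wiener_simple_value (S n) r \<omega> - \<phi> r \<omega>)\<^sup>2) \<partial>Q) \<longlonglongrightarrow> 0 \<and>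
        (\<lambda>n. l2norm M (\<lambda>\<omega>. wiener_simple_integral W (S n) t \<omega> - I \<omega>)) \<longlonglongrightarrow> 0))"

definition levy_simple ::
  "'a measure \<Rightarrow> (real \<Rightarrow> 'a measure) \<Rightarrow> 'e measure \<Rightarrow>
   (real \<times> real \<times> 'e set \<times> ('a \<Rightarrow> real)) list \<Rightarrow> bool"
where
  "levy_simple M F \<nu> S \<longleftrightarrow>
     (\<forall>(a, b, A, \<xi>)\<in>set S. 0 \<le> a \<and> a \<le> b \<and> A \<in> sets \<nu> \<and> emeasure \<nu> A < \<infinity> \<and>
        \<xi> \<in> borel_measurable (F a) \<and> (\<exists>C. \<forall>\<omega>\<in>space M. \<bar>\<xi> \<omega>\<bar> \<le> C))"

definition levy_simple_value ::
  "(real \<times> real \<times> 'e set \<times> ('a \<Rightarrow> real)) list \<Rightarrow> real \<Rightarrow> 'e \<Rightarrow> 'a \<Rightarrow> real"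
where
  "levy_simple_value S r v \<omega> = (\<Sum>(a, b, A, \<xi>)\<leftarrow>S. \<xi> \<omega> * indicator {a<..b} r * indicator A v)"

definition levy_simple_integral ::
  "'e measure \<Rightarrow> ('a \<Rightarrow> (real \<times> 'e) measure) \<Rightarrow>
   (real \<times> real \<times> 'e set \<times> ('a \<Rightarrow> real)) list \<Rightarrow> real \<Rightarrow> 'a \<Rightarrow> real"
where
  "levy_simple_integral \<nu> N S t \<omega> =
     (\<Sum>(a, b, A, \<xi>)\<leftarrow>S. \<xi> \<omega> * compensated \<nu> N (min a t) (min b t) A \<omega>)"

text \<open>\<open>J\<close> is the integral of \<open>\<phi> r v \<omega>\<close> against the compensated measure over \<open>(0,t] \<times> E\<close>.\<close>

definition has_levy_integral ::
  "'a measure \<Rightarrow> (real \<Rightarrow> 'a measure) \<Rightarrow> 'e measure \<Rightarrow> ('a \<Rightarrow> (real \<times> 'e) measure) \<Rightarrow>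
   real \<Rightarrow> (real \<Rightarrow> 'e \<Rightarrow> 'a \<Rightarrow> real) \<Rightarrow> ('a \<Rightarrow> real) \<Rightarrow> bool"
where
  "has_levy_integral M F \<nu> N t \<phi> J \<longleftrightarrow>
     (let Q = restrict_space lborel {0<..t} \<Otimes>\<^sub>M (\<nu> \<Otimes>\<^sub>M M) in
     (\<lambda>(r, v, \<omega>). \<phi> r v \<omega>) \<in> borel_measurable Q \<and>
     (\<exists>S. (\<forall>n. levy_simple M F \<nu> (S n)) \<and>
        (\<lambda>n. \<integral>\<^sup>+ (r, v, \<omega>). ennreal ((levy_simple_value (S n) r v \<omega> - \<phi> r v \<omega>)\<^sup>2) \<partial>Q) \<longlonglongrightarrow> 0 \<and>
        (\<lambda>n. l2norm M (\<lambda>\<omega>. levy_simple_integral \<nu> N (S n) t \<omega> - J \<omega>)) \<longlonglongrightarrow> 0))"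


section \<open>Heat semigroup and mild solutions\<close>

definition heat_kernel :: "real \<Rightarrow> real \<Rightarrow> real" where
  "heat_kernel r x = (2 * pi * r) powr (-1/2) * exp (- (x\<^sup>2 / (2 * r)))"

text \<open>
  Only \<open>t > 0\<close> is meaningful. In the mild formulation \<open>t = 0\<close> occurs just at the end point \<open>r = t\<close>
  of the time integrals, which does not contribute.
\<close>

definition heat_semigroup :: "real \<Rightarrow> (real \<Rightarrow> real) \<Rightarrow> real \<Rightarrow> real" where
  "heat_semigroup t \<phi> x = (LINT y|lborel. heat_kernel t (x - y) * \<phi> y)"

definition l2_cadlag :: "'a measure \<Rightarrow> (real \<Rightarrow> 'a \<Rightarrow> real) \<Rightarrow> bool" where
  "l2_cadlag M X \<longleftrightarrow>
     (\<forall>t\<ge>0. l2norm M (X t) < \<infinity>) \<and>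
     (\<forall>t\<ge>0. ((\<lambda>s. l2norm M (\<lambda>\<omega>. X s \<omega> - X t \<omega>)) \<longlongrightarrow> 0) (at_right t)) \<and>
     (\<forall>t>0. \<exists>L. l2norm M L < \<infinity> \<and>
        ((\<lambda>s. l2norm M (\<lambda>\<omega>. X s \<omega> - L \<omega>)) \<longlongrightarrow> 0) (at_left t))"

definition jointly_measurable :: "'a measure \<Rightarrow> (real \<Rightarrow> real \<Rightarrow> 'a \<Rightarrow> real) \<Rightarrow> bool" where
  "jointly_measurable M u \<longleftrightarrow>
     (\<lambda>(t, x, \<omega>). u t x \<omega>) \<in> borel_measurable (restrict_space borel {0..} \<Otimes>\<^sub>M (borel \<Otimes>\<^sub>M M))"

definition adapted_field :: "(real \<Rightarrow> 'a measure) \<Rightarrow> (real \<Rightarrow> real \<Rightarrow> 'a \<Rightarrow> real) \<Rightarrow> bool" where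
  "adapted_field F u \<longleftrightarrow> (\<forall>t\<ge>0. \<forall>x. u t x \<in> borel_measurable (F t))"

definition mild_solution ::
  "'a measure \<Rightarrow> (real \<Rightarrow> 'a measure) \<Rightarrow> (real \<Rightarrow> 'a \<Rightarrow> real) \<Rightarrow>
   'e measure \<Rightarrow> ('a \<Rightarrow> (real \<times> 'e) measure) \<Rightarrow>
   (real \<Rightarrow> real \<Rightarrow> 'a \<Rightarrow> real) \<Rightarrow> (real \<Rightarrow> real \<Rightarrow> real) \<Rightarrow> (real \<Rightarrow> real \<Rightarrow> 'e \<Rightarrow> real) \<Rightarrow>
   (real \<Rightarrow> real \<Rightarrow> 'a \<Rightarrow> real) \<Rightarrow> bool"
where
  "mild_solution M F W \<nu> N h f g u \<longleftrightarrow>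
     jointly_measurable M u \<and>
     adapted_field F u \<and>
     (\<forall>x. l2_cadlag M (\<lambda>t. u t x)) \<and>
     linf_loc (w1inf_l2_norm M) u \<and>
     (\<forall>t>0. \<forall>x. \<exists>I J.
        has_wiener_integral M F W t (\<lambda>r _. heat_semigroup (t - r) (f r) x) I \<and>
        has_levy_integral M F \<nu> N t (\<lambda>r v _. heat_semigroup (t - r) (\<lambda>z. g r z v) x) J \<and>
        (AE \<omega> in M. u t x \<omega> =
           (LINT r:{0..t}|lborel. heat_semigroup (t - r) (\<lambda>z. h r z \<omega>) x) + I \<omega> + J \<omega>))"

definition versions :: "'a measure \<Rightarrow> (real \<Rightarrow> real \<Rightarrow> 'a \<Rightarrow> real) \<Rightarrow> (real \<Rightarrow> real \<Rightarrow> 'a \<Rightarrow> real) \<Rightarrow> bool" where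
  "versions M u u' \<longleftrightarrow> (\<forall>t\<ge>0. \<forall>x. AE \<omega> in M. u t x \<omega> = u' t x \<omega>)"


section \<open>Data\<close>

text \<open>
  \<open>h \<in> L\<^sup>\<infinity>\<^sub>l\<^sub>o\<^sub>c([0,\<infinity>);C\<^sup>\<beta>\<^sub>b(\<real>;L\<^sup>2(\<Omega>)))\<close>; being the drift of an adapted equation it is adapted.
\<close>

definition drift_data ::
  "'a measure \<Rightarrow> (real \<Rightarrow> 'a measure) \<Rightarrow> real \<Rightarrow> (real \<Rightarrow> real \<Rightarrow> 'a \<Rightarrow> real) \<Rightarrow> bool"
where
  "drift_data M F \<beta> h \<longleftrightarrow>
     jointly_measurable M h \<and> adapted_field F h \<and> linf_loc (holder_l2_norm M \<beta>) h"

definition holder_data :: "real \<Rightarrow> (real \<Rightarrow> real \<Rightarrow> real) \<Rightarrow> bool" where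
  "holder_data \<alpha> f \<longleftrightarrow>
     (\<lambda>(t, x). f t x) \<in> borel_measurable (restrict_space borel {0..} \<Otimes>\<^sub>M borel) \<and>
     linf_loc (holder_norm \<alpha>) f"

text \<open>
  A non-negative \<open>f \<in> C\<^sup>\<alpha>\<^sub>b\<close>, non-decreasing, supported in \<open>[0,\<infinity>)\<close>, with
  \<open>\<bar>f x - f y\<bar> \<approx> \<bar>x - y\<bar>\<^sup>\<alpha>\<close> for \<open>x \<in> [0,1]\<close> and base points \<open>y \<in> Y\<close>. The comparison for
  all pairs \<open>x, y \<in> [0,1]\<close> is \<open>Y = {0..1}\<close>. For \<open>\<alpha> < 1\<close> it contradicts
  monotonicity (lemma \<open>no_sharp_profile\<close>), whereas comparison with the single point
  \<open>y = 0\<close>, i.e. \<open>f x \<approx> x\<^sup>\<alpha>\<close>, is satisfiable (lemma \<open>sharp_profile_exists\<close>). Statements about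
  arbitrary \<open>Y\<close> with \<open>0 \<in> Y\<close> and \<open>Y \<subseteq> {0..1}\<close> cover both.
\<close>

definition sharp_profile :: "real set \<Rightarrow> real \<Rightarrow> (real \<Rightarrow> real) \<Rightarrow> bool" where
  "sharp_profile Y \<alpha> f \<longleftrightarrow>
     (\<forall>x. 0 \<le> f x) \<and> holder_norm \<alpha> f < \<infinity> \<and>
     mono f \<and> closure {x. f x \<noteq> 0} \<subseteq> {0..} \<and>
     (\<exists>c>0. \<exists>C>0. \<forall>x\<in>{0..1}. \<forall>y\<in>Y.
        c * \<bar>x - y\<bar> powr \<alpha> \<le> \<bar>f x - f y\<bar> \<and> \<bar>f x - f y\<bar> \<le> C * \<bar>x - y\<bar> powr \<alpha>)"

definition jump_data :: "real \<Rightarrow> 'e::euclidean_space measure \<Rightarrow> ('e \<Rightarrow> real) \<Rightarrow> bool" where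
  "jump_data c \<nu> g1 \<longleftrightarrow>
     g1 \<in> borel_measurable \<nu> \<and> integrable \<nu> (\<lambda>v. (g1 v)\<^sup>2) \<and>
     (\<exists>U. open U \<and> 0 \<in> U \<and> (\<forall>v\<in>marks c \<inter> U. g1 v = 0))"

lemma no_sharp_profile:
  assumes "0 < \<alpha>" "\<alpha> < 1"
  shows "\<not> sharp_profile {0..1} \<alpha> f"
proof
  assume "sharp_profile {0..1} \<alpha> f"
  then obtain c where mono: "mono f" and c: "c > 0"
    and low: "\<And>x y. x \<in> {0..1} \<Longrightarrow> y \<in> {0..1} \<Longrightarrow> c * \<bar>x - y\<bar> powr \<alpha> \<le> \<bar>f x - f y\<bar>"
    unfolding sharp_profile_def by blast
  have bound: "c * real n powr (1 - \<alpha>) \<le> f 1 - f 0" if n: "n > 0" for n :: nat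
  proof -
    have step: "c * (1 / real n) powr \<alpha> \<le> f (real (Suc k) / n) - f (real k / n)" if "k < n" for k
    proof -
      have eq: "real (Suc k) / n - real k / n = 1 / real n"
        by (simp add: diff_divide_distrib [symmetric])
      have "f (real k / n) \<le> f (real (Suc k) / n)"
        by (intro monoD[OF mono]) (simp add: divide_right_mono)
      moreover have "c * \<bar>real (Suc k) / n - real k / n\<bar> powr \<alpha> \<le> \<bar>f (real (Suc k) / n) - f (real k / n)\<bar>"
        using that by (intro low) (auto simp: divide_simps)
      ultimately show ?thesis unfolding eq by simp
    qed
    have "real n * (c * (1 / real n) powr \<alpha>) \<le> (\<Sum>k<n. f (real (Suc k) / n) - f (real k / n))"
      using sum_mono[of "{..<n}" "\<lambda>_. c * (1 / real n) powr \<alpha>", OF step] by simp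
    also have "\<dots> = f 1 - f 0"
      using n sum_lessThan_telescope[of "\<lambda>k. f (real k / n)" n] by simp
    finally show ?thesis
      using n by (simp add: powr_divide powr_diff mult.commute)
  qed
  define B where "B = (f 1 - f 0) / c + 1"
  have B: "B > 0"
    using monoD[OF mono, of 0 1] c by (simp add: B_def add_nonneg_pos)
  obtain n :: nat where n: "B powr (1 / (1 - \<alpha>)) < real n"
    using reals_Archimedean2 by blast
  have pos: "n > 0"
    using n powr_ge_zero[of B "1 / (1 - \<alpha>)"] by linarith
  have "B = (B powr (1 / (1 - \<alpha>))) powr (1 - \<alpha>)"
    using B assms by (simp add: powr_powr)
  also have "\<dots> < real n powr (1 - \<alpha>)"
    using n assms by (intro powr_less_mono2) auto
  finally have "c * B < c * real n powr (1 - \<alpha>)"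
    using c by simp
  moreover have "c * B = f 1 - f 0 + c"
    using c by (simp add: B_def distrib_left)
  ultimately show False
    using bound[OF pos] c by linarith
qed

lemma sharp_profile_exists:
  assumes "0 < \<alpha>" "\<alpha> \<le> 1"
  shows "sharp_profile {0} \<alpha> (\<lambda>x. min 1 (max 0 x) powr \<alpha>)"
proof -
  define p :: "real \<Rightarrow> real" where "p x = min 1 (max 0 x)" for x
  define f where "f x = p x powr \<alpha>" for x
  have p: "0 \<le> p x" "p x \<le> 1" "\<bar>p x - p y\<bar> \<le> \<bar>x - y\<bar>" "x \<le> y \<Longrightarrow> p x \<le> p y" for x y
    by (auto simp: p_def)
  have sub: "(a + d) powr \<alpha> \<le> a powr \<alpha> + d powr \<alpha>" if "0 \<le> a" "0 \<le> d" for a d :: real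
  proof (cases "a + d = 0")
    case True
    then show ?thesis using that by simp
  next
    case False
    define s where "s = a + d"
    have s: "s > 0" "a / s + d / s = 1" "0 \<le> a / s" "a / s \<le> 1" "0 \<le> d / s" "d / s \<le> 1"
      using False that by (auto simp: s_def add_divide_distrib[symmetric])
    have le: "y \<le> y powr \<alpha>" if "0 \<le> y" "y \<le> 1" for y :: real
      using powr_mono'[of \<alpha> 1 y] that assms by (cases "y = 0") auto
    have "s powr \<alpha> * 1 \<le> s powr \<alpha> * ((a / s) powr \<alpha> + (d / s) powr \<alpha>)"
      using le[of "a / s"] le[of "d / s"] s(2-6) by (intro mult_left_mono powr_ge_zero) linarith
    also have "\<dots> = a powr \<alpha> + d powr \<alpha>"
      using s that by (simp add: distrib_left powr_mult[symmetric])
    finally show ?thesis by (simp add: s_def)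
  qed
  have hol1: "\<bar>a powr \<alpha> - b powr \<alpha>\<bar> \<le> \<bar>a - b\<bar> powr \<alpha>" if "0 \<le> b" "b \<le> a" for a b :: real
    using sub[of b "a - b"] powr_mono2[of \<alpha> b a] that assms by auto
  have hol2: "\<bar>a powr \<alpha> - b powr \<alpha>\<bar> \<le> \<bar>a - b\<bar> powr \<alpha>" if "0 \<le> b" "0 \<le> a" for a b :: real
    using hol1[of a b] hol1[of b a] that by (cases "b \<le> a") (auto simp: abs_minus_commute)
  have hol: "\<bar>f x - f y\<bar> \<le> \<bar>x - y\<bar> powr \<alpha>" for x y
    using hol2[of "p y" "p x"] p powr_mono2[of \<alpha> "\<bar>p x - p y\<bar>" "\<bar>x - y\<bar>"] assms
    unfolding f_def by (smt (verit))
  have le1: "\<bar>f x\<bar> \<le> 1" for x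
    using p[of x] powr_mono2[of \<alpha> "p x" 1] assms by (simp add: f_def)
  have q: "ennreal \<bar>f x - f y\<bar> / ennreal (\<bar>x - y\<bar> powr \<alpha>) \<le> 1" if "x \<noteq> y" for x y
    using hol[of x y] that by (simp add: divide_ennreal divide_le_eq)
  have "holder_norm \<alpha> f \<le> 1 + 1"
    unfolding holder_norm_def holder_quotient_def
    using le1 q by (intro add_mono SUP_least) (auto simp: ennreal_le_1)
  also have "\<dots> < \<infinity>" by (simp add: less_top)
  finally have norm: "holder_norm \<alpha> f < \<infinity>" .
  have mono: "mono f"
    using p assms by (intro monoI) (auto simp: f_def intro!: powr_mono2)
  have zero: "f x = 0" if "x \<le> 0" for x
    using that by (simp add: f_def p_def)
  have supp: "closure {x. f x \<noteq> 0} \<subseteq> {0..}"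
    using zero by (intro closure_minimal) (auto simp: not_le[symmetric] less_imp_le intro: ccontr)
  have "f x = x powr \<alpha>" if "x \<in> {0..1}" for x
    using that by (simp add: f_def p_def)
  then have "\<exists>c>0. \<exists>C>0. \<forall>x\<in>{0..1}. \<forall>y\<in>{0}.
        c * \<bar>x - y\<bar> powr \<alpha> \<le> \<bar>f x - f y\<bar> \<and> \<bar>f x - f y\<bar> \<le> C * \<bar>x - y\<bar> powr \<alpha>"
    using zero[of 0] by (intro exI[of _ 1] conjI) auto
  then have "sharp_profile {0} \<alpha> f"
    using norm mono supp unfolding sharp_profile_def by (auto simp: f_def)
  then show ?thesis unfolding f_def p_def by simp
qed

end

(*
  By duality with L2 test variables, the drift satisfies L1-in-time estimates and gains
  more than one derivative; by the Ito isometry, the stochastic convolutions satisfy L2-in-time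
  estimates and gain exactly one. A mean square Hoelder field has a measurable, adapted
  modification, which is the mild solution.
  For optimality, compare second differences at 0 at times t of order x^2: the noise contributes
  at least a constant times sqrt t * x^\<alpha>, because the semigroup hardly changes the profile on
  that time scale, the drift at most a constant times t, while C^(1+\<delta>) regularity
  allows only x^(1+\<delta>).
*)
theory Submission
  imports Defs
begin

section \<open>Square integrable random variables\<close>

text \<open>The noise coefficients are deterministic and the jump coefficient is a product f(x)
  g1(v). Each stochastic convolution thus integrates a function of time alone, and its mean square
  norm is a constant times an L2 norm in time; the locale \<open>l2_noise\<close> keeps just this.
  The two gains come from one function of s, min(s^(-1/2+\<beta>/2), d s^(-1+\<beta>/2)), which
  bounds the increments of the derivative of the heat semigroup over a distance d. For \<beta> < 1
  its square integrates to order d^(2\<beta>), by splitting at s = d^2, while the function itself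
  integrates to order d, both powers being integrable at 0. Second differences are used for
  optimality because they remove the unknown derivative at 0 and are linear: those of the two noises
  are orthogonal and cannot cancel. Since regularity is given at almost every time only, t is picked
  from a window of order x^2. For t near \<sigma>^2 x^2 the noise is of order \<sigma>
  x^(1+\<alpha>) and the drift of order \<sigma>^2 x^2, which a small \<sigma> absorbs because
  \<alpha> <= 1.\<close>

definition rnorm :: "'b measure => ('b => real) => real" where
 "rnorm M f = sqrt (\<integral>x. (f x)\<^sup>2 \<partial>M)"

lemma rnorm_nonneg [simp]: "0 <= rnorm M f"
 by (simp add: rnorm_def)

text \<open>Measurability is assumed because \<open>l2norm\<close> is infinite off the measurable
  functions, where the nonnegative integral may still be finite.\<close>

lemma l2norm_power2:
 assumes [measurable]: "f \<in> borel_measurable M"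
 shows "(l2norm M f)\<^sup>2 = (\<integral>\<^sup>+x. ennreal ((f x)\<^sup>2) \<partial>M)"
proof (cases "integrable M (%x. (f x)\<^sup>2)")
 case True
 then show ?thesis
  by (simp add: l2norm_def nn_integral_eq_integral ennreal_power)
next
 case False
 then have "(\<integral>\<^sup>+x. ennreal ((f x)\<^sup>2) \<partial>M) = \<infinity>"
  by (simp add: integrable_iff_bounded top.not_eq_extremum[symmetric])
 with False show ?thesis
  by (simp add: l2norm_def)
qed

lemma l2norm_finiteD:
 assumes "l2norm M f < \<infinity>"
 shows "f \<in> borel_measurable M" "integrable M (%x. (f x)\<^sup>2)" "l2norm M f = ennreal (rnorm M f)"
 using assms by (auto simp: l2norm_def rnorm_def split: if_splits)

text \<open>Bridge between norms and integrals of squares; Fatou's lemma and substitutions in time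
  are applied on the integral side.\<close>

lemma l2norm_le_iff:
 assumes "0 <= K"
 shows "l2norm M f <= ennreal K \<longleftrightarrow>
  f \<in> borel_measurable M \<and> (\<integral>\<^sup>+x. ennreal ((f x)\<^sup>2) \<partial>M) <= ennreal (K\<^sup>2)"
proof (cases "f \<in> borel_measurable M")
 case True
 have "l2norm M f <= ennreal K \<longleftrightarrow> (l2norm M f)\<^sup>2 <= (ennreal K)\<^sup>2"
  by (cases "l2norm M f") (auto simp: assms ennreal_power top_unique)
 then show ?thesis
  using True assms by (simp add: l2norm_power2 ennreal_power)
next
 case False
 then show ?thesis by (simp add: l2norm_def top_unique)
qed

lemma l2norm_le_rnorm:
 assumes "l2norm M f <= ennreal K" "0 <= K"
 shows "rnorm M f <= K" "l2norm M f < \<infinity>"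
proof -
 show "l2norm M f < \<infinity>" using assms by (auto simp: le_less_trans[OF assms(1)])
 from l2norm_finiteD(3)[OF this] assms show "rnorm M f <= K" by simp
qed

lemma l2norm_minus: "l2norm M (%x. - f x) = l2norm M f"
proof -
 have "(%x. - f x) \<in> borel_measurable M \<longleftrightarrow> f \<in> borel_measurable M"
  using borel_measurable_uminus[of f M] borel_measurable_uminus[of "%x. - f x" M] by auto
 then show ?thesis by (simp add: l2norm_def)
qed

lemma l2norm_minus_commute: "l2norm M (%x. f x - g x) = l2norm M (%x. g x - f x)"
 using l2norm_minus[of M "%x. g x - f x"] by simp

text \<open>For a = 0 and f of infinite norm the equation relies on 0 * \<infinity> = 0 in
  \<open>ennreal\<close>.\<close>

lemma l2norm_scale: "l2norm M (%x. a * f x) = ennreal \<bar>a\<bar> * l2norm M f"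
proof (cases "a = 0")
 case True
 then show ?thesis by (simp add: l2norm_def)
next
 case False
 have "(%x. a * f x) \<in> borel_measurable M \<longleftrightarrow> f \<in> borel_measurable M"
 proof
  assume [measurable]: "(%x. a * f x) \<in> borel_measurable M"
  have "(%x. inverse a * (a * f x)) \<in> borel_measurable M" by measurable
  then show "f \<in> borel_measurable M" using False by (simp add: mult.assoc[symmetric])
 qed simp
 then show ?thesis
  using False by (auto simp: l2norm_def power_mult_distrib real_sqrt_mult ennreal_mult ennreal_mult_top)
qed

lemma l2norm_zero [simp]: "l2norm M (%x. 0) = 0"
 by (simp add: l2norm_def)

lemma l2norm_cong_AE:
 assumes "AE x in M. f x = g x" "f \<in> borel_measurable M" "g \<in> borel_measurable M"
 shows "l2norm M f = l2norm M g"
proof -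
 have *: "AE x in M. (f x)\<^sup>2 = (g x)\<^sup>2" using assms(1) by auto
 have "integrable M (%x. (f x)\<^sup>2) \<longleftrightarrow> integrable M (%x. (g x)\<^sup>2)"
  using assms * by (intro integrable_cong_AE) auto
 moreover have "integral\<^sup>L M (%x. (f x)\<^sup>2) = integral\<^sup>L M (%x. (g x)\<^sup>2)"
  using assms * by (intro integral_cong_AE) auto
 ultimately show ?thesis using assms by (simp add: l2norm_def)
qed

lemma l2norm_cong: "(!!x. x \<in> space M ==> f x = g x) ==> l2norm M f = l2norm M g"
 by (simp add: l2norm_def cong: measurable_cong Bochner_Integration.integrable_cong
   Bochner_Integration.integral_cong)

lemma l2norm_eq_0D:
 assumes "l2norm M f = 0"
 shows "AE x in M. f x = 0"
proof -
 have fin: "l2norm M f < \<infinity>" using assms by simp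
 note [measurable] = l2norm_finiteD(1)[OF fin]
 have "(\<integral>\<^sup>+x. ennreal ((f x)\<^sup>2) \<partial>M) = 0"
  using l2norm_power2[of f M] assms by simp
 then show ?thesis by (subst (asm) nn_integral_0_iff_AE) auto
qed

lemma cauchy_schwarz_l2:
 assumes f: "l2norm M f < \<infinity>" and g: "l2norm M g < \<infinity>"
 shows "integrable M (%x. f x * g x)" "(\<integral>x. \<bar>f x * g x\<bar> \<partial>M) <= rnorm M f * rnorm M g"
  "\<bar>\<integral>x. f x * g x \<partial>M\<bar> <= rnorm M f * rnorm M g"
proof -
 note [measurable] = l2norm_finiteD(1)[OF f] l2norm_finiteD(1)[OF g]
 have "\<bar>f x * g x\<bar> <= (f x)\<^sup>2 + (g x)\<^sup>2" for x
  using sum_squares_bound[of "f x" "g x"] sum_squares_bound[of "f x" "- g x"] by (auto simp: abs_le_iff)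
 then show int: "integrable M (%x. f x * g x)"
  by (intro Bochner_Integration.integrable_bound[OF Bochner_Integration.integrable_add[OF l2norm_finiteD(2)[OF f] l2norm_finiteD(2)[OF g]]])
   auto
 have "(\<integral>\<^sup>+x. ennreal \<bar>f x\<bar> * ennreal \<bar>g x\<bar> \<partial>M)\<^sup>2 <=
   (\<integral>\<^sup>+x. (ennreal \<bar>f x\<bar>)\<^sup>2 \<partial>M) * (\<integral>\<^sup>+x. (ennreal \<bar>g x\<bar>)\<^sup>2 \<partial>M)"
  by (intro Cauchy_Schwarz_nn_integral) auto
 also have "... = (\<integral>\<^sup>+x. ennreal ((f x)\<^sup>2) \<partial>M) * (\<integral>\<^sup>+x. ennreal ((g x)\<^sup>2) \<partial>M)"
  by (simp add: ennreal_power)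
 also have "... = ennreal ((\<integral>x. (f x)\<^sup>2 \<partial>M) * (\<integral>x. (g x)\<^sup>2 \<partial>M))"
  using f g by (simp add: nn_integral_eq_integral l2norm_finiteD ennreal_mult)
 also have "(\<integral>\<^sup>+x. ennreal \<bar>f x\<bar> * ennreal \<bar>g x\<bar> \<partial>M) = ennreal (\<integral>x. \<bar>f x * g x\<bar> \<partial>M)"
  using int by (subst nn_integral_eq_integral[symmetric]) (auto simp: abs_mult ennreal_mult dest: integrable_abs)
 finally have "(\<integral>x. \<bar>f x * g x\<bar> \<partial>M)\<^sup>2 <= (\<integral>x. (f x)\<^sup>2 \<partial>M) * (\<integral>x. (g x)\<^sup>2 \<partial>M)"
  by (simp add: ennreal_power)
 then show le: "(\<integral>x. \<bar>f x * g x\<bar> \<partial>M) <= rnorm M f * rnorm M g"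
  unfolding rnorm_def real_sqrt_mult[symmetric] by (rule real_le_rsqrt)
 have "\<bar>\<integral>x. f x * g x \<partial>M\<bar> <= (\<integral>x. \<bar>f x * g x\<bar> \<partial>M)" by (rule integral_abs_bound)
 with le show "\<bar>\<integral>x. f x * g x \<partial>M\<bar> <= rnorm M f * rnorm M g" by linarith
qed

lemma l2norm_triangle: "l2norm M (%x. f x + g x) <= l2norm M f + l2norm M g"
proof (cases "l2norm M f < \<infinity> \<and> l2norm M g < \<infinity>")
 case True
 then have f: "l2norm M f < \<infinity>" and g: "l2norm M g < \<infinity>" by auto
 note F = l2norm_finiteD[OF f] and G = l2norm_finiteD[OF g] and cs = cauchy_schwarz_l2[OF f g]
 note [measurable] = F(1) G(1)
 have "(%x. (f x + g x)\<^sup>2) = (%x. ((f x)\<^sup>2 + 2 * (f x * g x)) + (g x)\<^sup>2)"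
  by (auto simp: power2_sum)
 then have int: "integrable M (%x. (f x + g x)\<^sup>2)"
  and eq: "(\<integral>x. (f x + g x)\<^sup>2 \<partial>M) = (\<integral>x. (f x)\<^sup>2 \<partial>M) + 2 * (\<integral>x. f x * g x \<partial>M) + (\<integral>x. (g x)\<^sup>2 \<partial>M)"
  using F G cs(1) by simp_all
 have "(\<integral>x. (f x + g x)\<^sup>2 \<partial>M) <= (rnorm M f + rnorm M g)\<^sup>2"
 proof -
  have "(rnorm M f + rnorm M g)\<^sup>2 = (\<integral>x. (f x)\<^sup>2 \<partial>M) + (\<integral>x. (g x)\<^sup>2 \<partial>M) + 2 * (rnorm M f * rnorm M g)"
   by (simp add: power2_sum rnorm_def)
  with cs(3) show ?thesis unfolding eq by linarith
 qed
 then have "rnorm M (%x. f x + g x) <= rnorm M f + rnorm M g"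
  unfolding rnorm_def[of M "%x. f x + g x"] by (intro real_le_lsqrt) auto
 moreover have "l2norm M (%x. f x + g x) = ennreal (rnorm M (%x. f x + g x))"
  using int F(1) G(1) by (simp add: l2norm_def rnorm_def)
 ultimately show ?thesis
  unfolding F(3) G(3) by (simp add: ennreal_plus[symmetric] ennreal_leI del: ennreal_plus)
next
 case False
 then show ?thesis by (auto simp: top.not_eq_extremum[symmetric])
qed

lemma l2norm_triangle_diff: "l2norm M (%x. f x - g x) <= l2norm M f + l2norm M g"
 using l2norm_triangle[of M f "%x. - g x"] by (simp add: l2norm_minus)

lemma l2norm_triangle3: "l2norm M (%x. f x - g x) <= l2norm M (%x. f x - h x) + l2norm M (%x. h x - g x)"
 using l2norm_triangle[of M "%x. f x - h x" "%x. h x - g x"] by simp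

lemma l2norm_triangle_ineq: "l2norm M f <= l2norm M (%x. f x - g x) + l2norm M g"
 using l2norm_triangle[of M "%x. f x - g x" "g"] by simp

lemma l2norm_mono:
 assumes [measurable]: "f \<in> borel_measurable M" and "AE x in M. \<bar>f x\<bar> <= \<bar>g x\<bar>"
 shows "l2norm M f <= l2norm M g"
proof (cases "l2norm M g < \<infinity>")
 case True
 note G = l2norm_finiteD[OF True]
 have "(\<integral>\<^sup>+x. ennreal ((f x)\<^sup>2) \<partial>M) <= (\<integral>\<^sup>+x. ennreal ((g x)\<^sup>2) \<partial>M)"
  using assms(2) by (intro nn_integral_mono_AE) (auto simp: abs_le_square_iff elim!: eventually_mono intro!: ennreal_leI)
 also have "... = ennreal ((rnorm M g)\<^sup>2)"
  using l2norm_power2[OF G(1)] G(3) by (simp add: ennreal_power)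
 finally show ?thesis using G(3) by (simp add: l2norm_le_iff)
qed (auto simp: top.not_eq_extremum[symmetric])

lemma l2norm_bounded_finite:
 assumes "finite_measure M" and [measurable]: "f \<in> borel_measurable M"
  and "!!x. x \<in> space M ==> \<bar>f x\<bar> <= C"
 shows "l2norm M f < \<infinity>"
proof -
 interpret finite_measure M by fact
 have "(f x)\<^sup>2 <= C\<^sup>2" if "x \<in> space M" for x
  using assms(3)[OF that] by (simp add: abs_le_square_iff[symmetric])
 then have "integrable M (%x. (f x)\<^sup>2)"
  by (intro integrable_const_bound[of _ "C\<^sup>2"]) auto
 then show ?thesis by (simp add: l2norm_def)
qed

lemma (in finite_measure) l2norm_finite_integrable:
 assumes "l2norm M f < \<infinity>" shows "integrable M f"
 using cauchy_schwarz_l2(1)[OF assms, of "%_. 1"] l2norm_bounded_finite[of M "%_. 1" 1]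
 by (simp add: finite_measure_axioms)

text \<open>Testing against truncations of \<open>X\<close> avoids assuming that \<open>X\<close> is square integrable.\<close>

lemma l2norm_le_dual:
 assumes "finite_measure M" and [measurable]: "X \<in> borel_measurable M" and C: "0 <= C"
  and dual: "!!Y. l2norm M Y < \<infinity> ==> \<bar>\<integral>x. X x * Y x \<partial>M\<bar> <= C * rnorm M Y"
 shows "l2norm M X <= ennreal C"
proof -
 interpret finite_measure M by fact
 define Y where "Y n x = X x * indicator {y. \<bar>y\<bar> <= real n} (X x)" for n x
 have [measurable]: "Y n \<in> borel_measurable M" for n unfolding Y_def by measurable
 have bd: "\<bar>Y n x\<bar> <= real n" for n x by (auto simp: Y_def indicator_def)
 have fin: "l2norm M (Y n) < \<infinity>" for n
  by (rule l2norm_bounded_finite[OF assms(1), of _ "real n"]) (auto simp: bd)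
 have sq: "X x * Y n x = (Y n x)\<^sup>2" for n x by (auto simp: Y_def indicator_def power2_eq_square)
 have "(\<integral>x. (Y n x)\<^sup>2 \<partial>M) <= C\<^sup>2" for n
 proof -
  \<comment> \<open>The truncation is its own test variable: \<open>X x * Y n x\<close> is its
    square, so the squared norm is at most C times the norm.\<close>
  have "(rnorm M (Y n))\<^sup>2 <= C * rnorm M (Y n)"
   using dual[OF fin[of n]] by (simp add: sq rnorm_def)
  then have "rnorm M (Y n) <= C" using C
   by (cases "rnorm M (Y n) = 0") (auto simp: power2_eq_square mult_le_cancel_right dest: order.antisym)
  then have "(rnorm M (Y n))\<^sup>2 <= C\<^sup>2" by (simp add: power_mono)
  then show ?thesis by (simp add: rnorm_def)
 qed
 then have le: "(\<integral>\<^sup>+x. ennreal ((Y n x)\<^sup>2) \<partial>M) <= ennreal (C\<^sup>2)" for n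
  using l2norm_finiteD(2)[OF fin[of n]] by (simp add: nn_integral_eq_integral ennreal_leI)
 \<comment> \<open>At each point the truncations are eventually equal to X, so Fatou's lemma
   transfers their uniform bound to X.\<close>
 have lim: "liminf (%n. ennreal ((Y n x)\<^sup>2)) = ennreal ((X x)\<^sup>2)" for x
 proof (rule lim_imp_Liminf)
  obtain N where N: "\<bar>X x\<bar> <= real N" using real_arch_simple by blast
  have "eventually (%n. ennreal ((Y n x)\<^sup>2) = ennreal ((X x)\<^sup>2)) sequentially"
   using eventually_ge_at_top[of N] by eventually_elim (use N in \<open>auto simp: Y_def indicator_def\<close>)
  then show "(%n. ennreal ((Y n x)\<^sup>2)) \<longlonglongrightarrow> ennreal ((X x)\<^sup>2)" by (rule tendsto_eventually)
 qed simp
 have "(\<integral>\<^sup>+x. ennreal ((X x)\<^sup>2) \<partial>M) = (\<integral>\<^sup>+x. liminf (%n. ennreal ((Y n x)\<^sup>2)) \<partial>M)"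
  by (simp add: lim)
 also have "... <= liminf (%n. \<integral>\<^sup>+x. ennreal ((Y n x)\<^sup>2) \<partial>M)"
  by (rule nn_integral_liminf) auto
 also have "... <= ennreal (C\<^sup>2)"
  using Liminf_mono[of "%n. \<integral>\<^sup>+x. ennreal ((Y n x)\<^sup>2) \<partial>M" "%_. ennreal (C\<^sup>2)" sequentially] le
  by (simp add: Liminf_const)
 finally show ?thesis using C by (simp add: l2norm_le_iff)
qed

section \<open>Mean square convergence, completeness and measurability of limits\<close>

lemma tendsto_ennreal_0I:
 assumes "!!e. e > 0 ==> eventually (%n. f n <= ennreal e) F"
 shows "(f \<longlongrightarrow> (0::ennreal)) F"
proof (rule order_tendstoI)
 fix a :: ennreal assume "0 < a"
 then obtain e where "0 < e" "e < a" using dense by blast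
 then obtain r where r: "e = ennreal r" "0 < r" by (cases e) auto
 from assms[OF r(2)] show "eventually (%n. f n < a) F"
  by eventually_elim (use \<open>e < a\<close> r in auto)
qed simp

lemma tendsto_ennreal_0D:
 assumes "(f \<longlongrightarrow> (0::ennreal)) F" "e > 0"
 shows "eventually (%n. f n <= ennreal e) F"
 using order_tendstoD(2)[OF assms(1), of "ennreal e"] assms(2) by (auto elim: eventually_mono)

lemma tendsto_ennreal_0_le:
 assumes "(g \<longlongrightarrow> (0::ennreal)) F" "eventually (%n. f n <= g n) F"
 shows "(f \<longlongrightarrow> 0) F"
 by (rule tendsto_sandwich[of "%_. 0" f F g 0]) (use assms in auto)

text \<open>A geometric rate makes the squared errors summable in mean, hence almost surely
  summable, hence almost surely null.\<close>

lemma l2_AE_tendsto: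
 assumes [measurable]: "!!k. X k \<in> borel_measurable M" "Y \<in> borel_measurable M"
  and q: "0 <= q" "q < 1" and C: "0 <= C"
  and bound: "eventually (%k. l2norm M (%w. X k w - Y w) <= ennreal (C * q ^ k)) sequentially"
 shows "AE w in M. (%k. X k w) \<longlonglongrightarrow> Y w"
proof -
 from bound obtain N where N: "!!k. l2norm M (%w. X (k + N) w - Y w) <= ennreal (C * q ^ (k + N))"
  unfolding eventually_sequentially by (metis le_add2)
 let ?f = "%k w. (X (k + N) w - Y w)\<^sup>2"
 have q2: "q\<^sup>2 < 1" using q by (simp add: power_less_one_iff)
 have "(\<integral>\<^sup>+w. (\<Sum>k. ennreal (?f k w)) \<partial>M) = (\<Sum>k. \<integral>\<^sup>+w. ennreal (?f k w) \<partial>M)"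
  by (rule nn_integral_suminf) measurable
 also have "... <= (\<Sum>k. ennreal (C\<^sup>2 * (q\<^sup>2) ^ k))"
 proof (rule suminf_le)
  fix k
  have "(\<integral>\<^sup>+w. ennreal (?f k w) \<partial>M) <= ennreal ((C * q ^ (k + N))\<^sup>2)"
   using N[of k] C q by (subst (asm) l2norm_le_iff) auto
  also have "(C * q ^ (k + N))\<^sup>2 <= (C * q ^ k)\<^sup>2"
   using C q by (intro power_mono mult_left_mono power_decreasing) auto
  also have "(C * q ^ k)\<^sup>2 = C\<^sup>2 * (q\<^sup>2) ^ k" by (simp add: power_mult_distrib power_mult[symmetric] mult.commute)
  finally show "(\<integral>\<^sup>+w. ennreal (?f k w) \<partial>M) <= ennreal (C\<^sup>2 * (q\<^sup>2) ^ k)" by (simp add: ennreal_leI)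
 qed auto
 also have "... < \<infinity>"
  using q2 q by (subst suminf_ennreal2) (auto intro!: summable_mult summable_geometric)
 finally have "AE w in M. (\<Sum>k. ennreal (?f k w)) \<noteq> \<infinity>"
  by (intro nn_integral_PInf_AE) auto
 then show ?thesis
 proof eventually_elim
  fix w assume "(\<Sum>k. ennreal (?f k w)) \<noteq> \<infinity>"
  then have "summable (%k. ?f k w)" by (intro summable_suminf_not_top) auto
  then have "(%k. ?f k w) \<longlonglongrightarrow> 0" by (rule summable_LIMSEQ_zero)
  then have "(%k. X (k + N) w - Y w) \<longlonglongrightarrow> 0"
   using tendsto_real_sqrt[of "%k. ?f k w" 0 sequentially] by (simp add: tendsto_rabs_zero_iff)
  then have "(%k. X (k + N) w) \<longlonglongrightarrow> Y w" by (simp add: LIM_zero_iff)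
  then show "(%k. X k w) \<longlonglongrightarrow> Y w" by (rule LIMSEQ_offset)
 qed
qed

lemma l2_fast_cauchy_AE_convergent:
 assumes [measurable]: "!!k. X k \<in> borel_measurable M"
  and bound: "!!k. l2norm M (%w. X (Suc k) w - X k w) <= ennreal ((1/2) ^ k)"
 shows "AE w in M. convergent (%k. X k w)"
proof -
 \<comment> \<open>The weight 2^k leaves a convergent series of means, since 2^k * 4^(-k) = 2^(-k).
   Pathwise it turns finiteness of the sum into increments of geometric size with ratio 1 / sqrt
   2.\<close>
 let ?f = "%k w. 2 ^ k * (X (Suc k) w - X k w)\<^sup>2"
 have "(\<integral>\<^sup>+w. (\<Sum>k. ennreal (?f k w)) \<partial>M) = (\<Sum>k. \<integral>\<^sup>+w. ennreal (?f k w) \<partial>M)"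
  by (rule nn_integral_suminf) measurable
 also have "... <= (\<Sum>k. ennreal ((1/2) ^ k))"
 proof (rule suminf_le)
  fix k
  have "(\<integral>\<^sup>+w. ennreal ((X (Suc k) w - X k w)\<^sup>2) \<partial>M) <= ennreal (((1/2) ^ k)\<^sup>2)"
   using bound[of k] by (subst (asm) l2norm_le_iff) auto
  then have "ennreal (2 ^ k) * (\<integral>\<^sup>+w. ennreal ((X (Suc k) w - X k w)\<^sup>2) \<partial>M) <= ennreal (2 ^ k) * ennreal (((1/2) ^ k)\<^sup>2)"
   by (rule mult_left_mono) simp
  also have "... = ennreal (2 ^ k * ((1/2) ^ k)\<^sup>2)" by (subst ennreal_mult) auto
  also have "2 ^ k * ((1/2) ^ k)\<^sup>2 = (1/2::real) ^ k"
   by (simp add: power2_eq_square power_divide)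
  finally show "(\<integral>\<^sup>+w. ennreal (?f k w) \<partial>M) <= ennreal ((1/2) ^ k)"
   by (simp add: ennreal_mult nn_integral_cmult)
 qed auto
 also have "... < \<infinity>" by (subst suminf_ennreal2) auto
 finally have "AE w in M. (\<Sum>k. ennreal (?f k w)) \<noteq> \<infinity>"
  by (intro nn_integral_PInf_AE) auto
 then show ?thesis
 proof eventually_elim
  fix w assume "(\<Sum>k. ennreal (?f k w)) \<noteq> \<infinity>"
  then have sm: "summable (%k. ?f k w)" by (intro summable_suminf_not_top) auto
  define S where "S = (\<Sum>k. ?f k w)"
  have le: "\<bar>X (Suc k) w - X k w\<bar> <= sqrt S * (1 / sqrt 2) ^ k" for k
  proof -
   have "?f k w <= S" unfolding S_def using sum_le_suminf[OF sm, of "{k}"] by auto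
   then have "sqrt (?f k w) <= sqrt S" by simp
   then have "sqrt 2 ^ k * \<bar>X (Suc k) w - X k w\<bar> <= sqrt S" by (simp add: real_sqrt_mult real_sqrt_power[of 2])
   then show ?thesis by (simp add: field_simps power_divide)
  qed
  have "summable (%k. sqrt S * (1 / sqrt 2) ^ k)"
   by (intro summable_mult summable_geometric) auto
  then have "summable (%k. X (Suc k) w - X k w)"
   by (rule summable_comparison_test'[where N = 0]) (use le in auto)
  then have "convergent (%n. \<Sum>k<n. X (Suc k) w - X k w)" by (simp add: summable_iff_convergent)
  then have "convergent (%n. X n w - X 0 w)" by (simp only: sum_lessThan_telescope[of "%k. X k w"])
  then obtain L where "(%n. X n w - X 0 w) \<longlonglongrightarrow> L" by (auto simp: convergent_def)
  from tendsto_add[OF this tendsto_const[of "X 0 w"]] show "convergent (%k. X k w)"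
   by (auto simp: convergent_def)
 qed
qed

text \<open>Riesz-Fischer, for representatives instead of classes. Only differences have to be
  square integrable; the limit is the pointwise limit of a fast subsequence.\<close>

theorem l2_complete:
 assumes [measurable]: "!!n. X n \<in> borel_measurable M"
  and cauchy: "!!e. e > 0 ==> \<exists>N. \<forall>m\<ge>N. \<forall>n\<ge>N. l2norm M (%w. X m w - X n w) <= ennreal e"
 shows "\<exists>Y\<in>borel_measurable M. (%n. l2norm M (%w. X n w - Y w)) \<longlonglongrightarrow> 0"
proof -
 have "\<forall>k. \<exists>N. \<forall>m\<ge>N. \<forall>n\<ge>N. l2norm M (%w. X m w - X n w) <= ennreal ((1/2) ^ k)"
  using cauchy by auto
 then obtain N0 where N0: "!!k m n. N0 k <= m ==> N0 k <= n ==> l2norm M (%w. X m w - X n w) <= ennreal ((1/2) ^ k)"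
  by metis
 \<comment> \<open>The partial sum makes r monotone with \<open>N0 k <= r k\<close>; the summand k
   makes r unbounded.\<close>
 define r where "r k = (\<Sum>i\<le>k. N0 i) + k" for k
 have r: "N0 k <= r k" "r k <= r (Suc k)" "k <= r k" for k
 proof -
  show "N0 k <= r k" unfolding r_def using member_le_sum[of k "{..k}" N0] by simp
 qed (auto simp: r_def)
 have conv: "AE w in M. convergent (%k. X (r k) w)"
 proof (rule l2_fast_cauchy_AE_convergent)
  show "l2norm M (%w. X (r (Suc k)) w - X (r k) w) <= ennreal ((1/2) ^ k)" for k
   using r[of k] by (intro N0) auto
 qed auto
 define Y where "Y w = lim (%k. X (r k) w)" for w
 have [measurable]: "Y \<in> borel_measurable M" unfolding Y_def by measurable
 have "(%n. l2norm M (%w. X n w - Y w)) \<longlonglongrightarrow> 0"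
 proof (rule tendsto_ennreal_0I)
  fix e :: real assume e: "e > 0"
  obtain K where K: "!!m n. K <= m ==> K <= n ==> l2norm M (%w. X m w - X n w) <= ennreal e"
   using cauchy[OF e] by blast
  \<comment> \<open>Fatou's lemma along the subsequence: X n is within e of its late members, hence
    of their limit.\<close>
  have "l2norm M (%w. X n w - Y w) <= ennreal e" if "K <= n" for n
  proof -
   have "(\<integral>\<^sup>+w. ennreal ((X n w - Y w)\<^sup>2) \<partial>M) =
     (\<integral>\<^sup>+w. liminf (%k. ennreal ((X n w - X (r k) w)\<^sup>2)) \<partial>M)"
   proof (rule nn_integral_cong_AE)
    show "AE w in M. ennreal ((X n w - Y w)\<^sup>2) = liminf (%k. ennreal ((X n w - X (r k) w)\<^sup>2))"
     using conv
    proof eventually_elim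
     fix w assume "convergent (%k. X (r k) w)"
     then have "(%k. X (r k) w) \<longlonglongrightarrow> Y w" unfolding Y_def by (simp add: convergent_LIMSEQ_iff)
     then have "(%k. ennreal ((X n w - X (r k) w)\<^sup>2)) \<longlonglongrightarrow> ennreal ((X n w - Y w)\<^sup>2)"
      by (intro tendsto_intros)
     from lim_imp_Liminf[OF _ this] show "ennreal ((X n w - Y w)\<^sup>2) = liminf (%k. ennreal ((X n w - X (r k) w)\<^sup>2))"
      by simp
    qed
   qed
   also have "... <= liminf (%k. \<integral>\<^sup>+w. ennreal ((X n w - X (r k) w)\<^sup>2) \<partial>M)"
    by (rule nn_integral_liminf) measurable
   also have "... <= Liminf sequentially (%_. ennreal (e\<^sup>2))"
   proof (rule Liminf_mono)
    show "\<forall>\<^sub>F k in sequentially. (\<integral>\<^sup>+w. ennreal ((X n w - X (r k) w)\<^sup>2) \<partial>M) <= ennreal (e\<^sup>2)"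
     using eventually_ge_at_top[of K]
    proof eventually_elim
     case (elim k)
     then have "l2norm M (%w. X n w - X (r k) w) <= ennreal e"
      using r(3)[of k] that by (intro K) auto
     then show ?case using e by (subst (asm) l2norm_le_iff) auto
    qed
   qed
   also have "... = ennreal (e\<^sup>2)" by (simp add: Liminf_const)
   finally show ?thesis using e by (subst l2norm_le_iff) auto
  qed
  then show "eventually (%n. l2norm M (%w. X n w - Y w) <= ennreal e) sequentially"
   unfolding eventually_sequentially by blast
 qed
 then show ?thesis by auto
qed

lemma l2_limit_unique:
 assumes "(%n. l2norm M (%w. X n w - Y w)) \<longlonglongrightarrow> 0" "(%n. l2norm M (%w. X n w - Z w)) \<longlonglongrightarrow> 0"
 shows "AE w in M. Y w = Z w"
proof -
 have "(%n. l2norm M (%w. X n w - Y w) + l2norm M (%w. X n w - Z w)) \<longlonglongrightarrow> 0 + 0"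
  by (intro tendsto_add assms)
 moreover have "l2norm M (%w. Y w - Z w) <= l2norm M (%w. X n w - Y w) + l2norm M (%w. X n w - Z w)" for n
  using l2norm_triangle3[of M Y Z "X n"] by (simp add: l2norm_minus_commute)
 ultimately have "l2norm M (%w. Y w - Z w) <= 0"
  by (intro LIMSEQ_le_const[where X = "%n. l2norm M (%w. X n w - Y w) + l2norm M (%w. X n w - Z w)"]) auto
 then have "l2norm M (%w. Y w - Z w) = 0" by simp
 from l2norm_eq_0D[OF this] show ?thesis by eventually_elim auto
qed

text \<open>Completeness enters here: a null set and all its subsets belong to G, so that changing a
  G-measurable function on a null set keeps it G-measurable.\<close>

lemma measurable_subalgebra_AE:
 fixes X Z :: "'a => real"
 assumes "complete_measure M" "subalgebra M G" "null_sets M \<subseteq> sets G"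
  and X: "X \<in> borel_measurable M" and Z: "Z \<in> borel_measurable G" and eq: "AE w in M. X w = Z w"
 shows "X \<in> borel_measurable G"
proof -
 interpret complete_measure M by fact
 have sp: "space G = space M" using assms(2) by (simp add: subalgebra_def)
 from eq obtain N where N: "{w\<in>space M. \<not> X w = Z w} \<subseteq> N" "N \<in> null_sets M"
  by (auto elim!: AE_E simp: null_sets_def)
 have nullG: "A \<in> sets G" if "A \<subseteq> N" for A
 proof -
  have "A \<in> null_sets M" using complete2[OF that N(2)] .
  then show ?thesis using assms(3) by auto
 qed
 show ?thesis
 proof (rule measurableI)
  fix A :: "real set" assume A: "A \<in> sets borel"
  have "X -` A \<inter> space G = (Z -` A \<inter> space G - N) \<union> (X -` A \<inter> space G \<inter> N)"
   using N(1) sp by auto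
  also have "... \<in> sets G"
   using measurable_sets[OF Z A] nullG[of N] nullG[of "X -` A \<inter> space G \<inter> N"] by auto
  finally show "X -` A \<inter> space G \<in> sets G" .
 qed auto
qed

text \<open>Adaptedness survives mean square limits. A fast subsequence converges almost surely, its
  pointwise limit is G-measurable, and Y differs from that limit on a null set only.\<close>

lemma l2_limit_subalgebra:
 fixes X :: "nat => 'a => real"
 assumes "complete_measure M" "subalgebra M G" "null_sets M \<subseteq> sets G"
  and X: "!!n. X n \<in> borel_measurable G" and Y: "Y \<in> borel_measurable M"
  and lim: "(%n. l2norm M (%w. X n w - Y w)) \<longlonglongrightarrow> 0"
 shows "Y \<in> borel_measurable G"
proof -
 have XM: "X n \<in> borel_measurable M" for n
  using measurable_from_subalg[OF assms(2) X] .
 have "\<forall>k. \<exists>n. l2norm M (%w. X n w - Y w) <= ennreal (1 * (1/2) ^ k)"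
  using tendsto_ennreal_0D[OF lim, of "1 * (1/2) ^ _"] by (auto simp: eventually_sequentially)
 then obtain r where r: "!!k. l2norm M (%w. X (r k) w - Y w) <= ennreal (1 * (1/2) ^ k)" by metis
 have "AE w in M. (%k. X (r k) w) \<longlonglongrightarrow> Y w"
  by (rule l2_AE_tendsto[where q = "1/2" and C = 1]) (use XM Y r in auto)
 then have "AE w in M. Y w = lim (%k. X (r k) w)"
  by eventually_elim (simp add: limI)
 moreover have "(%w. lim (%k. X (r k) w)) \<in> borel_measurable G"
  using X by measurable
 ultimately show ?thesis
  using measurable_subalgebra_AE[OF assms(1-3) Y] by blast
qed

section \<open>Random fields integrated against deterministic kernels\<close>

locale kernel_operator = prob_space M + P: sigma_finite_measure P
 for M :: "'a measure" and P :: "'p measure" +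
 fixes H :: "'p => 'a => real" and D :: "'p => real" and K :: real
 assumes H_measurable [measurable]: "(%(p, w). H p w) \<in> borel_measurable (P \<Otimes>\<^sub>M M)"
  and D_integrable: "integrable P D" and K_nonneg: "0 <= K"
  and H_bound: "AE p in P. D p \<noteq> 0 --> l2norm M (H p) <= ennreal K"
begin

sublocale PM: pair_sigma_finite P M ..

text \<open>Pathwise form of the L2-valued integral of \<open>D p * H p\<close>. Its estimates come
  from pairing with square integrable Y, where Fubini leaves scalar integrals. The field is bounded
  only where D is nonzero because data are controlled on bounded time intervals.\<close>

definition T :: "'a => real" where "T w = (\<integral>p. D p * H p w \<partial>P)"

lemma T_measurable [measurable]: "T \<in> borel_measurable M"
proof -
 have [measurable]: "(%(w, p). H p w) \<in> borel_measurable (M \<Otimes>\<^sub>M P)"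
  using measurable_pair_swap_iff[of "%(p, w). H p w" P M borel] by simp
 have [measurable]: "D \<in> borel_measurable P" using D_integrable by simp
 show ?thesis unfolding T_def by measurable
qed

lemma integrable_test:
 assumes Y: "l2norm M Y < \<infinity>"
 shows "integrable (P \<Otimes>\<^sub>M M) (%(p, w). D p * H p w * Y w)"
proof (rule PM.Fubini_integrable)
 note [measurable] = l2norm_finiteD(1)[OF Y]
 have [measurable]: "D \<in> borel_measurable P" using D_integrable by simp
 show "(%(p, w). D p * H p w * Y w) \<in> borel_measurable (P \<Otimes>\<^sub>M M)" by measurable
 have *: "integrable M (%w. D p * H p w * Y w)" "(\<integral>w. norm (D p * H p w * Y w) \<partial>M) <= \<bar>D p\<bar> * (K * rnorm M Y)"
  if "D p \<noteq> 0 --> l2norm M (H p) <= ennreal K" for p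
 proof -
  have "integrable M (%w. D p * H p w * Y w) \<and> (\<integral>w. norm (D p * H p w * Y w) \<partial>M) <= \<bar>D p\<bar> * (K * rnorm M Y)"
  proof (cases "D p = 0")
   case False
   with that have le: "l2norm M (H p) <= ennreal K" by simp
   note h = l2norm_le_rnorm[OF le K_nonneg]
   note cs = cauchy_schwarz_l2[OF h(2) Y]
   have "(\<integral>w. norm (D p * H p w * Y w) \<partial>M) = \<bar>D p\<bar> * (\<integral>w. \<bar>H p w * Y w\<bar> \<partial>M)"
    by (simp add: abs_mult mult.assoc)
   also have "... <= \<bar>D p\<bar> * (K * rnorm M Y)"
    using cs(2) mult_right_mono[OF h(1) rnorm_nonneg[of M Y]] by (intro mult_left_mono) auto
   finally show ?thesis using cs(1) by (simp add: mult.assoc)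
  qed (use K_nonneg in simp)
  then show "integrable M (%w. D p * H p w * Y w)" "(\<integral>w. norm (D p * H p w * Y w) \<partial>M) <= \<bar>D p\<bar> * (K * rnorm M Y)" by auto
 qed
 show "AE p in P. integrable M (%w. case (p, w) of (p, w) => D p * H p w * Y w)"
  using H_bound by eventually_elim (use * in simp)
 show "integrable P (%p. \<integral>w. norm (case (p, w) of (p, w) => D p * H p w * Y w) \<partial>M)"
 proof (rule Bochner_Integration.integrable_bound)
  show "integrable P (%p. \<bar>D p\<bar> * (K * rnorm M Y))" using D_integrable by simp
  show "AE p in P. norm (\<integral>w. norm (case (p, w) of (p, w) => D p * H p w * Y w) \<partial>M) <= norm (\<bar>D p\<bar> * (K * rnorm M Y))"
   using H_bound by eventually_elim (use * K_nonneg in \<open>auto simp: abs_mult\<close>)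
 qed measurable
qed

lemma T_test:
 assumes Y: "l2norm M Y < \<infinity>"
 shows "(\<integral>w. T w * Y w \<partial>M) = (\<integral>p. D p * (\<integral>w. H p w * Y w \<partial>M) \<partial>P)"
proof -
 have "(\<integral>w. T w * Y w \<partial>M) = (\<integral>w. (\<integral>p. D p * H p w * Y w \<partial>P) \<partial>M)"
  unfolding T_def by simp
 also have "... = (\<integral>p. (\<integral>w. D p * H p w * Y w \<partial>M) \<partial>P)"
  using integrable_test[OF Y] by (intro PM.Fubini_integral) (simp add: case_prod_beta)
 finally show ?thesis by (simp add: mult.assoc)
qed

lemma AE_integrable: "AE w in M. integrable P (%p. D p * H p w)"
proof -
 have "l2norm M (%_. 1) < \<infinity>"
  using l2norm_bounded_finite[of M "%_. 1" 1] by (simp add: finite_measure_axioms)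
 from PM.AE_integrable_snd[OF integrable_test[OF this]] show ?thesis by simp
qed

lemma abs_test_bound:
 assumes Y: "l2norm M Y < \<infinity>"
 shows "AE p in P. \<bar>D p * (\<integral>w. H p w * Y w \<partial>M)\<bar> <= \<bar>D p\<bar> * (K * rnorm M Y)"
 using H_bound
proof eventually_elim
 case (elim p)
 show ?case
 proof (cases "D p = 0")
  case False
  then have le: "l2norm M (H p) <= ennreal K" using elim by simp
  note h = l2norm_le_rnorm[OF le K_nonneg]
  have "\<bar>\<integral>w. H p w * Y w \<partial>M\<bar> <= K * rnorm M Y"
   using cauchy_schwarz_l2(3)[OF h(2) Y] mult_right_mono[OF h(1) rnorm_nonneg[of M Y]] by linarith
  then show ?thesis by (simp add: abs_mult mult_left_mono)
 qed simp
qed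

text \<open>Minkowski's integral inequality, by duality: each pairing with Y is estimated under the
  integral over p.\<close>

lemma T_bound: "l2norm M T <= ennreal (K * (\<integral>p. \<bar>D p\<bar> \<partial>P))"
proof (rule l2norm_le_dual)
 fix Y assume Y: "l2norm M Y < \<infinity>"
 note [measurable] = l2norm_finiteD(1)[OF Y]
 have [measurable]: "D \<in> borel_measurable P" using D_integrable by simp
 have "\<bar>\<integral>w. T w * Y w \<partial>M\<bar> <= (\<integral>p. \<bar>D p * (\<integral>w. H p w * Y w \<partial>M)\<bar> \<partial>P)"
  unfolding T_test[OF Y] by (rule integral_abs_bound)
 also have "... <= (\<integral>p. \<bar>D p\<bar> * (K * rnorm M Y) \<partial>P)"
  using D_integrable abs_test_bound[OF Y] K_nonneg by (intro integral_mono_AE') auto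
 also have "... = K * (\<integral>p. \<bar>D p\<bar> \<partial>P) * rnorm M Y" by (simp add: mult.commute)
 finally show "\<bar>\<integral>w. T w * Y w \<partial>M\<bar> <= K * (\<integral>p. \<bar>D p\<bar> \<partial>P) * rnorm M Y" .
qed (use K_nonneg finite_measure_axioms in \<open>auto intro!: mult_nonneg_nonneg\<close>)

lemma integrable_D_test:
 assumes Y: "l2norm M Y < \<infinity>"
 shows "integrable P (%p. D p * (\<integral>w. H p w * Y w \<partial>M))"
proof (rule Bochner_Integration.integrable_bound)
 note [measurable] = l2norm_finiteD(1)[OF Y]
 have [measurable]: "D \<in> borel_measurable P" using D_integrable by simp
 show "integrable P (%p. \<bar>D p\<bar> * (K * rnorm M Y))" using D_integrable by simp
 show "(%p. D p * (\<integral>w. H p w * Y w \<partial>M)) \<in> borel_measurable P" by measurable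
 show "AE p in P. norm (D p * (\<integral>w. H p w * Y w \<partial>M)) <= norm (\<bar>D p\<bar> * (K * rnorm M Y))"
  using abs_test_bound[OF Y] by eventually_elim (use K_nonneg in \<open>auto simp: abs_mult\<close>)
qed

text \<open>
  A field whose values are measurable with respect to a sub-sigma-algebra need not be progressively
  measurable, so measurability of \<open>T\<close> is read off from its conditional expectation instead.
\<close>

lemma T_subalgebra_measurable:
 assumes cm: "complete_measure M" and sub: "subalgebra M G" and null: "null_sets M \<subseteq> sets G"
  and HG: "!!p. D p \<noteq> 0 ==> H p \<in> borel_measurable G"
 shows "T \<in> borel_measurable G"
proof -
 interpret FS: finite_measure_subalgebra M G
  by (intro finite_measure_subalgebra.intro finite_measure_axioms finite_measure_subalgebra_axioms.intro sub)
 have Tfin: "l2norm M T < \<infinity>" using T_bound by (auto simp: le_less_trans)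
 have Tint: "integrable M T" using l2norm_finite_integrable[OF Tfin] .
 let ?C = "real_cond_exp M G"
 have ab: "AE w in M. \<bar>?C (indicator A) w\<bar> <= 1" if [measurable]: "A \<in> sets M" for A
 proof -
  have "AE w in M. ?C (indicator A) w \<ge> 0"
   by (rule FS.real_cond_exp_pos) auto
  moreover have "AE w in M. ?C (indicator A) w <= 1"
   by (rule FS.real_cond_exp_le_c) (auto simp: emeasure_finite indicator_def less_top[symmetric])
  ultimately show ?thesis by eventually_elim auto
 qed
 \<comment> \<open>The conditional expectation moves from the indicator to T. Each relevant
   \<open>H p\<close> is G-measurable, so projecting the indicator does not change its pairing with
   \<open>H p\<close>, nor therefore with T; self-adjointness of the projection then places it on
   T.\<close>
 have int_eq: "(\<integral>w. T w * indicator A w \<partial>M) = (\<integral>w. ?C T w * indicator A w \<partial>M)" if A[measurable]: "A \<in> sets M" for A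
 proof -
  let ?I = "indicator A :: 'a => real"
  have Ifin: "l2norm M ?I < \<infinity>"
   by (rule l2norm_bounded_finite[OF finite_measure_axioms, of _ 1]) auto
  have Cfin: "l2norm M (?C ?I) < \<infinity>"
  proof -
   have "l2norm M (?C ?I) <= l2norm M (%_. 1)"
    by (rule l2norm_mono) (use ab[OF A] in auto)
   also have "... < \<infinity>" using l2norm_bounded_finite[of M "%_. 1" 1] by (simp add: finite_measure_axioms)
   finally show ?thesis .
  qed
  have "(\<integral>w. T w * ?I w \<partial>M) = (\<integral>p. D p * (\<integral>w. H p w * ?I w \<partial>M) \<partial>P)" by (rule T_test[OF Ifin])
  also have "... = (\<integral>p. D p * (\<integral>w. H p w * ?C ?I w \<partial>M) \<partial>P)"
  proof (rule integral_cong_AE)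
   have [measurable]: "D \<in> borel_measurable P" using D_integrable by simp
   show "(%p. D p * (\<integral>w. H p w * ?I w \<partial>M)) \<in> borel_measurable P" by measurable
   show "(%p. D p * (\<integral>w. H p w * ?C ?I w \<partial>M)) \<in> borel_measurable P" by measurable
   show "AE p in P. D p * (\<integral>w. H p w * ?I w \<partial>M) = D p * (\<integral>w. H p w * ?C ?I w \<partial>M)"
    using H_bound
   proof eventually_elim
    case (elim p)
    show ?case
    proof (cases "D p = 0")
     case False
     then have le: "l2norm M (H p) <= ennreal K" using elim by simp
     note h = l2norm_le_rnorm[OF le K_nonneg]
     show ?thesis
      using FS.real_cond_exp_intg(2)[OF cauchy_schwarz_l2(1)[OF h(2) Ifin] HG[OF False]] by simp
    qed simp
   qed
  qed
  also have "... = (\<integral>w. T w * ?C ?I w \<partial>M)" by (rule T_test[OF Cfin, symmetric])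
  also have "... = (\<integral>w. ?C ?I w * T w \<partial>M)" by (simp add: mult.commute)
  also have "... = (\<integral>w. ?C ?I w * ?C T w \<partial>M)"
   using cauchy_schwarz_l2(1)[OF Cfin Tfin] by (intro FS.real_cond_exp_intg(2)[symmetric]) auto
  also have "... = (\<integral>w. ?C T w * ?C ?I w \<partial>M)" by (simp add: mult.commute)
  also have "... = (\<integral>w. ?C T w * ?I w \<partial>M)"
  proof (rule FS.real_cond_exp_intg(2))
   show "integrable M (%x. ?C T x * ?I x)"
    using integrable_mult_indicator[OF A FS.real_cond_exp_int(1)[OF Tint]] by (simp add: mult.commute)
  qed auto
  finally show ?thesis .
 qed
 have "AE w in M. T w = ?C T w"
 proof (rule density_unique_real)
  show "integrable M T" "integrable M (?C T)" using Tint FS.real_cond_exp_int(1) by auto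
  show "set_lebesgue_integral M A T = set_lebesgue_integral M A (?C T)" if "A \<in> sets M" for A
   using int_eq[OF that] by (simp add: set_lebesgue_integral_def mult.commute)
 qed
 with measurable_subalgebra_AE[OF cm sub null T_measurable _ this] show ?thesis by simp
qed

end

section \<open>Isometric stochastic integrals\<close>

lemma (in pair_sigma_finite) integral_mult_product:
 fixes f :: "'a => real" and g :: "'b => real"
 assumes f: "integrable M1 f" and g: "integrable M2 g"
 shows "integrable (M1 \<Otimes>\<^sub>M M2) (%(x, y). f x * g y)"
  "(\<integral>(x, y). f x * g y \<partial>(M1 \<Otimes>\<^sub>M M2)) = (\<integral>x. f x \<partial>M1) * (\<integral>y. g y \<partial>M2)"
proof -
 have [measurable]: "f \<in> borel_measurable M1" "g \<in> borel_measurable M2" using f g by auto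
 show int: "integrable (M1 \<Otimes>\<^sub>M M2) (%(x, y). f x * g y)"
 proof (rule Fubini_integrable)
  have "(%x. \<integral>y. norm (case (x, y) of (x, y) => f x * g y) \<partial>M2) = (%x. norm (f x) * (\<integral>y. norm (g y) \<partial>M2))"
   by (auto simp: abs_mult)
  then show "integrable M1 (%x. \<integral>y. norm (case (x, y) of (x, y) => f x * g y) \<partial>M2)"
   using f by (simp only:) (intro integrable_mult_left integrable_norm)
  show "AE x in M1. integrable M2 (%y. case (x, y) of (x, y) => f x * g y)" using g by simp
 qed measurable
 show "(\<integral>(x, y). f x * g y \<partial>(M1 \<Otimes>\<^sub>M M2)) = (\<integral>x. f x \<partial>M1) * (\<integral>y. g y \<partial>M2)"
  using integral_fst[OF int] by simp
qed

lemma l2norm_mult_bounded: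
 assumes [measurable]: "f \<in> borel_measurable M" and f: "!!x. x \<in> space M ==> \<bar>f x\<bar> <= C"
  and X: "l2norm M X < \<infinity>"
 shows "l2norm M (%x. f x * X x) < \<infinity>"
proof -
 note [measurable] = l2norm_finiteD(1)[OF X]
 have "l2norm M (%x. f x * X x) <= l2norm M (%x. C * X x)"
 proof (rule l2norm_mono)
  show "AE x in M. \<bar>f x * X x\<bar> <= \<bar>C * X x\<bar>"
  proof (rule AE_I2)
   fix x assume "x \<in> space M"
   then have "\<bar>f x\<bar> <= \<bar>C\<bar>" using f[of x] by linarith
   then show "\<bar>f x * X x\<bar> <= \<bar>C * X x\<bar>" by (simp add: abs_mult mult_right_mono)
  qed
 qed measurable
 also have "... < \<infinity>" using X by (simp add: l2norm_scale ennreal_mult_less_top)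
 finally show ?thesis .
qed

lemma l2norm_add_finite: "l2norm M f < \<infinity> ==> l2norm M g < \<infinity> ==> l2norm M (%x. f x + g x) < \<infinity>"
 using l2norm_triangle[of M f g] by (auto intro: le_less_trans)

lemma l2norm_diff_finite: "l2norm M f < \<infinity> ==> l2norm M g < \<infinity> ==> l2norm M (%x. f x - g x) < \<infinity>"
 using l2norm_triangle_diff[of M f g] by (auto intro: le_less_trans)

lemma l2norm_scale_finite: "l2norm M f < \<infinity> ==> l2norm M (%x. a * f x) < \<infinity>"
 by (simp add: l2norm_scale ennreal_mult_less_top)

text \<open>
  Entries \<open>e\<close> stand for summands of simple integrands, \<open>val e\<close> is the summand itself and
  \<open>int e\<close> its integral.
\<close>

locale isometric_family =
 fixes Q :: "'q measure" and M :: "'a measure" and Adm :: "'e set"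
  and val :: "'e => 'q => real" and int :: "'e => 'a => real" and sc :: "real => 'e => 'e"
 assumes val_l2: "e \<in> Adm ==> l2norm Q (val e) < \<infinity>"
  and int_l2: "e \<in> Adm ==> l2norm M (int e) < \<infinity>"
  and sc_Adm: "e \<in> Adm ==> sc c e \<in> Adm"
  and val_sc: "val (sc c e) q = c * val e q"
  and int_sc: "int (sc c e) w = c * int e w"
  and isometry: "e \<in> Adm ==> e' \<in> Adm ==> (\<integral>q. val e q * val e' q \<partial>Q) = (\<integral>w. int e w * int e' w \<partial>M)"
begin

definition V :: "'e list => 'q => real" where "V S q = (\<Sum>e\<leftarrow>S. val e q)"

definition J :: "'e list => 'a => real" where "J S w = (\<Sum>e\<leftarrow>S. int e w)"

lemma V_l2: "set S \<subseteq> Adm ==> l2norm Q (V S) < \<infinity>"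
proof (induction S)
 case (Cons e S)
 then show ?case using l2norm_add_finite[of Q "val e" "V S"] val_l2[of e] by (simp add: V_def[abs_def])
qed (simp add: V_def[abs_def])

lemma J_l2: "set S \<subseteq> Adm ==> l2norm M (J S) < \<infinity>"
proof (induction S)
 case (Cons e S)
 then show ?case using l2norm_add_finite[of M "int e" "J S"] int_l2[of e] by (simp add: J_def[abs_def])
qed (simp add: J_def[abs_def])

lemma isometry_list1:
 assumes "e \<in> Adm" "set S \<subseteq> Adm"
 shows "(\<integral>q. val e q * V S q \<partial>Q) = (\<integral>w. int e w * J S w \<partial>M)"
 using assms(2)
proof (induction S)
 case (Cons e' S)
 have "(\<integral>q. val e q * V (e' # S) q \<partial>Q) = (\<integral>q. val e q * val e' q + val e q * V S q \<partial>Q)"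
  by (simp add: V_def distrib_left)
 also have "... = (\<integral>q. val e q * val e' q \<partial>Q) + (\<integral>q. val e q * V S q \<partial>Q)"
  using Cons.prems assms(1) by (intro Bochner_Integration.integral_add cauchy_schwarz_l2(1) val_l2 V_l2) auto
 also have "... = (\<integral>w. int e w * int e' w \<partial>M) + (\<integral>w. int e w * J S w \<partial>M)"
  using Cons assms(1) isometry by simp
 also have "... = (\<integral>w. int e w * int e' w + int e w * J S w \<partial>M)"
  using Cons.prems assms(1)
  by (intro Bochner_Integration.integral_add[symmetric] cauchy_schwarz_l2(1) int_l2 J_l2) auto
 also have "... = (\<integral>w. int e w * J (e' # S) w \<partial>M)"
  by (simp add: J_def distrib_left)
 finally show ?case .
qed (simp add: V_def J_def)

lemma isometry_list:
 assumes "set S \<subseteq> Adm" "set S' \<subseteq> Adm"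
 shows "(\<integral>q. V S q * V S' q \<partial>Q) = (\<integral>w. J S w * J S' w \<partial>M)"
 using assms(1)
proof (induction S)
 case (Cons e S)
 have "(\<integral>q. V (e # S) q * V S' q \<partial>Q) = (\<integral>q. val e q * V S' q + V S q * V S' q \<partial>Q)"
  by (simp add: V_def distrib_right)
 also have "... = (\<integral>q. val e q * V S' q \<partial>Q) + (\<integral>q. V S q * V S' q \<partial>Q)"
  using Cons.prems assms(2) by (intro Bochner_Integration.integral_add cauchy_schwarz_l2(1) val_l2 V_l2) auto
 also have "... = (\<integral>w. int e w * J S' w \<partial>M) + (\<integral>w. J S w * J S' w \<partial>M)"
  using Cons assms(2) isometry_list1 by simp
 also have "... = (\<integral>w. int e w * J S' w + J S w * J S' w \<partial>M)"
  using Cons.prems assms(2)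
  by (intro Bochner_Integration.integral_add[symmetric] cauchy_schwarz_l2(1) int_l2 J_l2) auto
 also have "... = (\<integral>w. J (e # S) w * J S' w \<partial>M)"
  by (simp add: J_def distrib_right)
 finally show ?case .
qed (simp add: V_def J_def)

lemma l2norm_V_eq_J:
 assumes "set S \<subseteq> Adm"
 shows "l2norm Q (V S) = l2norm M (J S)"
 using isometry_list[OF assms assms] l2norm_finiteD(3)[OF V_l2[OF assms]] l2norm_finiteD(3)[OF J_l2[OF assms]]
 by (simp add: rnorm_def power2_eq_square)

text \<open>Entries of a list may overlap and repeat, so a linear combination is a concatenation of
  rescaled lists and no common refinement of the intervals has to be formed.\<close>

lemma V_combine: "V (map (sc a) S @ map (sc b) S') q = a * V S q + b * V S' q"
 by (simp add: V_def val_sc o_def sum_list_const_mult)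

lemma J_combine: "J (map (sc a) S @ map (sc b) S') w = a * J S w + b * J S' w"
 by (simp add: J_def int_sc o_def sum_list_const_mult)

lemma combine_Adm: "set S \<subseteq> Adm ==> set S' \<subseteq> Adm ==> set (map (sc a) S @ map (sc b) S') \<subseteq> Adm"
 by (auto intro: sc_Adm)

text \<open>The closure of the graph of the simple integral: one and the same sequence must converge
  in both coordinates.\<close>

definition has_int :: "('q => real) => ('a => real) => bool" where
 "has_int \<phi> I \<longleftrightarrow> \<phi> \<in> borel_measurable Q \<and> (\<exists>S. (\<forall>n. set (S n) \<subseteq> Adm) \<and>
  (%n. l2norm Q (%q. V (S n) q - \<phi> q)) \<longlonglongrightarrow> 0 \<and> (%n. l2norm M (%w. J (S n) w - I w)) \<longlonglongrightarrow> 0)"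

text \<open>The isometry of simple integrands passes to the closure. Comparing both norms up to an
  arbitrary e avoids subtraction of extended numbers.\<close>

lemma has_int_norm:
 assumes "has_int \<phi> I"
 shows "l2norm M I = l2norm Q \<phi>" "l2norm M I < \<infinity>"
proof -
 obtain S where S: "!!n. set (S n) \<subseteq> Adm" and VS: "(%n. l2norm Q (%q. V (S n) q - \<phi> q)) \<longlonglongrightarrow> 0"
  and JS: "(%n. l2norm M (%w. J (S n) w - I w)) \<longlonglongrightarrow> 0"
  using assms by (auto simp: has_int_def)
 have *: "l2norm M I <= l2norm Q \<phi> + ennreal e \<and> l2norm Q \<phi> <= l2norm M I + ennreal e \<and> l2norm M I < \<infinity>"
  if e: "e > 0" for e
 proof -
  have "eventually (%n. l2norm Q (%q. V (S n) q - \<phi> q) <= ennreal (e/2) \<and> l2norm M (%w. J (S n) w - I w) <= ennreal (e/2)) sequentially"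
   using tendsto_ennreal_0D[OF VS, of "e/2"] tendsto_ennreal_0D[OF JS, of "e/2"] e by (simp add: eventually_conj)
  then obtain n where n: "l2norm Q (%q. V (S n) q - \<phi> q) <= ennreal (e/2)" "l2norm M (%w. J (S n) w - I w) <= ennreal (e/2)"
   by (auto simp: eventually_sequentially)
  have half: "ennreal (e/2) + ennreal (e/2) = ennreal e"
   using e by (simp add: ennreal_plus[symmetric] del: ennreal_plus)
  have 1: "l2norm M I <= ennreal (e/2) + l2norm M (J (S n))"
   using l2norm_triangle_ineq[of M I "J (S n)"] n(2) by (simp add: l2norm_minus_commute[of M I] add_right_mono order_trans)
  have 2: "l2norm Q (V (S n)) <= ennreal (e/2) + l2norm Q \<phi>"
   using l2norm_triangle_ineq[of Q "V (S n)" \<phi>] n(1) by (simp add: add_right_mono order_trans)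
  have 3: "l2norm Q \<phi> <= ennreal (e/2) + l2norm Q (V (S n))"
   using l2norm_triangle_ineq[of Q \<phi> "V (S n)"] n(1) by (simp add: l2norm_minus_commute[of Q \<phi>] add_right_mono order_trans)
  have 4: "l2norm M (J (S n)) <= ennreal (e/2) + l2norm M I"
   using l2norm_triangle_ineq[of M "J (S n)" I] n(2) by (simp add: add_right_mono order_trans)
  note eq = l2norm_V_eq_J[OF S[of n]]
  have "l2norm M I <= ennreal (e/2) + (ennreal (e/2) + l2norm Q \<phi>)"
   using 1 2 unfolding eq by (meson add_left_mono order_trans)
  moreover have "l2norm Q \<phi> <= ennreal (e/2) + (ennreal (e/2) + l2norm M I)"
   using 3 4 unfolding eq by (meson add_left_mono order_trans)
  moreover have "l2norm M I < \<infinity>"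
   using le_less_trans[OF 1, of \<infinity>] J_l2[OF S[of n]] by simp
  ultimately show ?thesis
   unfolding add.assoc[symmetric] half by (simp add: add.commute[of "ennreal e"])
 qed
 show "l2norm M I < \<infinity>" using *[of 1] by simp
 show "l2norm M I = l2norm Q \<phi>"
 proof (rule antisym)
  show "l2norm M I <= l2norm Q \<phi>" by (rule ennreal_le_epsilon) (rule *[THEN conjunct1])
  show "l2norm Q \<phi> <= l2norm M I" by (rule ennreal_le_epsilon) (rule *[THEN conjunct2, THEN conjunct1])
 qed
qed

lemma has_int_linear:
 assumes "has_int \<phi> I" "has_int \<phi>' I'"
 shows "has_int (%q. a * \<phi> q + b * \<phi>' q) (%w. a * I w + b * I' w)"
proof -
 obtain S where S: "!!n. set (S n) \<subseteq> Adm" and VS: "(%n. l2norm Q (%q. V (S n) q - \<phi> q)) \<longlonglongrightarrow> 0"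
  and JS: "(%n. l2norm M (%w. J (S n) w - I w)) \<longlonglongrightarrow> 0"
  using assms(1) by (auto simp: has_int_def)
 obtain S' where S': "!!n. set (S' n) \<subseteq> Adm" and VS': "(%n. l2norm Q (%q. V (S' n) q - \<phi>' q)) \<longlonglongrightarrow> 0"
  and JS': "(%n. l2norm M (%w. J (S' n) w - I' w)) \<longlonglongrightarrow> 0"
  using assms(2) by (auto simp: has_int_def)
 let ?S = "%n. map (sc a) (S n) @ map (sc b) (S' n)"
 have lim: "(%n. l2norm N (%q. (a * f n q + b * f' n q) - (a * g q + b * g' q))) \<longlonglongrightarrow> 0"
  if "(%n. l2norm N (%q. f n q - g q)) \<longlonglongrightarrow> 0" "(%n. l2norm N (%q. f' n q - g' q)) \<longlonglongrightarrow> 0"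
  for N :: "'x measure" and f f' g g'
 proof (rule tendsto_ennreal_0_le)
  have "(%n. ennreal \<bar>a\<bar> * l2norm N (%q. f n q - g q) + ennreal \<bar>b\<bar> * l2norm N (%q. f' n q - g' q))
    \<longlonglongrightarrow> ennreal \<bar>a\<bar> * 0 + ennreal \<bar>b\<bar> * 0"
   by (intro tendsto_add ennreal_tendsto_cmult that) auto
  then show "(%n. ennreal \<bar>a\<bar> * l2norm N (%q. f n q - g q) + ennreal \<bar>b\<bar> * l2norm N (%q. f' n q - g' q)) \<longlonglongrightarrow> 0"
   by simp
  show "eventually (%n. l2norm N (%q. (a * f n q + b * f' n q) - (a * g q + b * g' q)) <=
    ennreal \<bar>a\<bar> * l2norm N (%q. f n q - g q) + ennreal \<bar>b\<bar> * l2norm N (%q. f' n q - g' q)) sequentially"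
  proof (intro always_eventually allI)
   fix n
   show "l2norm N (%q. (a * f n q + b * f' n q) - (a * g q + b * g' q)) <=
    ennreal \<bar>a\<bar> * l2norm N (%q. f n q - g q) + ennreal \<bar>b\<bar> * l2norm N (%q. f' n q - g' q)"
    using l2norm_triangle[of N "%q. a * (f n q - g q)" "%q. b * (f' n q - g' q)"]
    unfolding l2norm_scale by (simp add: algebra_simps)
  qed
 qed
 show ?thesis
  unfolding has_int_def
 proof (intro conjI exI[of _ ?S] allI)
  show "set (?S n) \<subseteq> Adm" for n by (rule combine_Adm[OF S S'])
  show "(%n. l2norm Q (%q. V (?S n) q - (a * \<phi> q + b * \<phi>' q))) \<longlonglongrightarrow> 0"
   unfolding V_combine by (rule lim[OF VS VS'])
  show "(%n. l2norm M (%w. J (?S n) w - (a * I w + b * I' w))) \<longlonglongrightarrow> 0"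
   unfolding J_combine by (rule lim[OF JS JS'])
  show "(%q. a * \<phi> q + b * \<phi>' q) \<in> borel_measurable Q"
   using assms by (auto simp: has_int_def)
 qed
qed

text \<open>By the isometry the Cauchy property of the integrands is one of the integrals, and
  completeness supplies the limit.\<close>

lemma has_int_exists:
 assumes S: "!!n. set (S n) \<subseteq> Adm" and VS: "(%n. l2norm Q (%q. V (S n) q - \<phi> q)) \<longlonglongrightarrow> 0"
  and "\<phi> \<in> borel_measurable Q"
 shows "\<exists>I. I \<in> borel_measurable M \<and> has_int \<phi> I \<and> (%n. l2norm M (%w. J (S n) w - I w)) \<longlonglongrightarrow> 0"
proof -
 have "\<exists>I\<in>borel_measurable M. (%n. l2norm M (%w. J (S n) w - I w)) \<longlonglongrightarrow> 0"
 proof (rule l2_complete)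
  show "J (S n) \<in> borel_measurable M" for n using l2norm_finiteD(1)[OF J_l2[OF S]] .
  fix e :: real assume e: "e > 0"
  obtain N where N: "!!n. n \<ge> N ==> l2norm Q (%q. V (S n) q - \<phi> q) <= ennreal (e/2)"
   using tendsto_ennreal_0D[OF VS, of "e/2"] e by (auto simp: eventually_sequentially)
  have "l2norm M (%w. J (S m) w - J (S n) w) <= ennreal e" if "N <= m" "N <= n" for m n
  proof -
   let ?S = "map (sc 1) (S m) @ map (sc (-1)) (S n)"
   have "l2norm M (%w. J (S m) w - J (S n) w) = l2norm M (J ?S)"
    by (intro l2norm_cong) (simp add: J_combine)
   also have "... = l2norm Q (V ?S)" by (rule l2norm_V_eq_J[symmetric, OF combine_Adm[OF S S]])
   also have "... = l2norm Q (%q. V (S m) q - V (S n) q)"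
    by (intro l2norm_cong) (simp add: V_combine)
   also have "... <= l2norm Q (%q. V (S m) q - \<phi> q) + l2norm Q (%q. \<phi> q - V (S n) q)"
    by (rule l2norm_triangle3)
   also have "... <= ennreal (e/2) + ennreal (e/2)"
    using N[OF that(1)] N[OF that(2)] by (intro add_mono) (auto simp: l2norm_minus_commute[of Q \<phi>])
   also have "... = ennreal e" using e by (simp add: ennreal_plus[symmetric] del: ennreal_plus)
   finally show ?thesis .
  qed
  then show "\<exists>N. \<forall>m\<ge>N. \<forall>n\<ge>N. l2norm M (%w. J (S m) w - J (S n) w) <= ennreal e" by blast
 qed
 then obtain I where I: "I \<in> borel_measurable M" "(%n. l2norm M (%w. J (S n) w - I w)) \<longlonglongrightarrow> 0" by auto
 moreover have "has_int \<phi> I" unfolding has_int_def using assms I by blast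
 ultimately show ?thesis by blast
qed

text \<open>The difference of the two integrals is an integral of 0, so its norm is 0 by the
  isometry.\<close>

lemma has_int_unique:
 assumes "has_int \<phi> I" "has_int \<phi> I'"
 shows "AE w in M. I w = I' w"
proof -
 have "has_int (%q. 1 * \<phi> q + (-1) * \<phi> q) (%w. 1 * I w + (-1) * I' w)"
  by (rule has_int_linear[OF assms])
 then have "l2norm M (%w. I w - I' w) = l2norm Q (%q. 0)"
  using has_int_norm(1) by simp
 from l2norm_eq_0D[OF this[unfolded l2norm_zero]] show ?thesis by eventually_elim auto
qed

lemma has_int_cong:
 assumes "has_int \<phi> I" and eq: "!!q. q \<in> space Q ==> \<phi> q = \<phi>' q"
 shows "has_int \<phi>' I"
proof -
 have "\<phi>' \<in> borel_measurable Q \<longleftrightarrow> \<phi> \<in> borel_measurable Q"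
  by (intro measurable_cong) (simp add: eq)
 moreover have "l2norm Q (%q. V S q - \<phi> q) = l2norm Q (%q. V S q - \<phi>' q)" for S
  by (intro l2norm_cong) (simp add: eq)
 ultimately show ?thesis using assms(1) by (simp add: has_int_def)
qed

end

lemma l2norm_tendsto_0_iff:
 assumes "!!n. f n \<in> borel_measurable Q"
 shows "(%n. \<integral>\<^sup>+q. ennreal ((f n q)\<^sup>2) \<partial>Q) \<longlonglongrightarrow> 0 \<longleftrightarrow> (%n. l2norm Q (f n)) \<longlonglongrightarrow> 0"
proof -
 have eq: "(\<integral>\<^sup>+q. ennreal ((f n q)\<^sup>2) \<partial>Q) = (l2norm Q (f n))\<^sup>2" for n
  using l2norm_power2[OF assms] by simp
 have iff: "l2norm Q (f n) <= ennreal e \<longleftrightarrow> (l2norm Q (f n))\<^sup>2 <= ennreal (e\<^sup>2)" if "e > 0" for e n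
  using l2norm_le_iff[of e Q "f n"] that assms by (simp add: eq)
 show ?thesis
  unfolding eq
 proof
  assume *: "(%n. (l2norm Q (f n))\<^sup>2) \<longlonglongrightarrow> 0"
  show "(%n. l2norm Q (f n)) \<longlonglongrightarrow> 0"
  proof (rule tendsto_ennreal_0I)
   fix e :: real assume "e > 0"
   then show "eventually (%n. l2norm Q (f n) <= ennreal e) sequentially"
    using tendsto_ennreal_0D[OF *, of "e\<^sup>2"] by (simp add: iff)
  qed
 next
  assume *: "(%n. l2norm Q (f n)) \<longlonglongrightarrow> 0"
  show "(%n. (l2norm Q (f n))\<^sup>2) \<longlonglongrightarrow> 0"
  proof (rule tendsto_ennreal_0I)
   fix e :: real assume "e > 0"
   then show "eventually (%n. (l2norm Q (f n))\<^sup>2 <= ennreal e) sequentially"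
    using tendsto_ennreal_0D[OF *, of "sqrt e"] by (simp add: iff)
  qed
 qed
qed

text \<open>What Brownian and compensated Poisson increments share: \<open>m s t i\<close> is the
  increment over (s,t] in direction i, centred given the past, with conditional covariance
  \<open>\<mu> i j * (t - s)\<close>. Additivity holds almost surely only, as counts are finite
  almost surely; R collects the directions of finite intensity.\<close>

locale orthogonal_noise = prob_space M for M :: "'a measure" +
 fixes F :: "real => 'a measure" and m :: "real => real => 'i => 'a => real"
  and R :: "'i set" and \<mu> :: "'i => 'i => real"
 assumes F_sub: "0 <= s ==> subalgebra M (F s)"
  and F_mono: "0 <= s ==> s <= t ==> sets (F s) \<subseteq> sets (F t)"
  and m_add: "i \<in> R ==> 0 <= r ==> r <= s ==> s <= t ==> AE w in M. m r t i w = m r s i w + m s t i w"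
  and m_adapted: "i \<in> R ==> 0 <= s ==> s <= t ==> m s t i \<in> borel_measurable (F t)"
  and m_l2: "i \<in> R ==> 0 <= s ==> s <= t ==> l2norm M (m s t i) < \<infinity>"
  and m_mean: "i \<in> R ==> 0 <= s ==> s <= t ==> X \<in> borel_measurable (F s) ==> l2norm M X < \<infinity> ==>
   (\<integral>w. X w * m s t i w \<partial>M) = 0"
  and m_cov: "i \<in> R ==> j \<in> R ==> 0 <= s ==> s <= t ==> X \<in> borel_measurable (F s) ==>
   (!!w. w \<in> space M ==> \<bar>X w\<bar> <= C) ==>
   (\<integral>w. X w * (m s t i w * m s t j w) \<partial>M) = \<mu> i j * (t - s) * (\<integral>w. X w \<partial>M)"
  and mu_sym: "\<mu> i j = \<mu> j i"
begin

lemma F_measurable_mono: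
 assumes "X \<in> borel_measurable (F s)" "0 <= s" "s <= t" shows "X \<in> borel_measurable (F t)"
proof -
 have "space (F s) = space (F t)" "sets (F s) \<subseteq> sets (F t)"
  using F_sub[of s] F_sub[of t] F_mono[of s t] assms by (auto simp: subalgebra_def)
 then show ?thesis using measurable_mono[of borel borel "F s" "F t"] assms(1) by auto
qed

lemma F_measurable_M: "X \<in> borel_measurable (F s) ==> 0 <= s ==> X \<in> borel_measurable M"
 using measurable_from_subalg[OF F_sub] by blast

lemma m_zero: "i \<in> R ==> 0 <= s ==> AE w in M. m s s i w = 0"
 using m_add[of i s s s] by auto

lemma m_measurable: "i \<in> R ==> 0 <= s ==> s <= t ==> m s t i \<in> borel_measurable M"
 using F_measurable_M[OF m_adapted, of i s t] by linarith

text \<open>A product of two increments with a common left end point: cut the longer interval.\<close>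

lemma pair_same_start:
 assumes i: "i \<in> R" and j: "j \<in> R" and c: "0 <= c" "c <= b" "b <= d"
  and X: "X \<in> borel_measurable (F c)" and bd: "!!w. w \<in> space M ==> \<bar>X w\<bar> <= C"
 shows "(\<integral>w. X w * (m c b i w * m c d j w) \<partial>M) = \<mu> i j * (b - c) * (\<integral>w. X w \<partial>M)"
proof -
 have XM[measurable]: "X \<in> borel_measurable M" using F_measurable_M[OF X c(1)] .
 have [measurable]: "m c b i \<in> borel_measurable M" "m c d j \<in> borel_measurable M"
  "m c b j \<in> borel_measurable M" "m b d j \<in> borel_measurable M"
  using i j c by (auto intro!: m_measurable)
 have Xm: "l2norm M (%w. X w * m c b i w) < \<infinity>"
  using i c by (intro l2norm_mult_bounded[OF _ bd] m_l2) auto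
 have "(\<integral>w. X w * (m c b i w * m c d j w) \<partial>M) =
   (\<integral>w. (X w * m c b i w) * m c b j w + (X w * m c b i w) * m b d j w \<partial>M)"
 proof (rule integral_cong_AE)
  show "AE w in M. X w * (m c b i w * m c d j w) = (X w * m c b i w) * m c b j w + (X w * m c b i w) * m b d j w"
   using m_add[OF j c] by eventually_elim (simp add: algebra_simps)
 qed measurable
 also have "... = (\<integral>w. (X w * m c b i w) * m c b j w \<partial>M) + (\<integral>w. (X w * m c b i w) * m b d j w \<partial>M)"
  using i j c by (intro Bochner_Integration.integral_add cauchy_schwarz_l2(1)[OF Xm] m_l2) auto
 also have "(\<integral>w. (X w * m c b i w) * m b d j w \<partial>M) = 0"
 proof (rule m_mean[OF j _ c(3)])
  show "(%w. X w * m c b i w) \<in> borel_measurable (F b)"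
   using F_measurable_mono[OF X c(1,2)] m_adapted[OF i c(1,2)] by measurable
 qed (use c Xm in auto)
 also have "(\<integral>w. (X w * m c b i w) * m c b j w \<partial>M) = \<mu> i j * (b - c) * (\<integral>w. X w \<partial>M)"
  using m_cov[OF i j c(1,2) X bd] by (simp add: mult.assoc)
 finally show ?thesis by simp
qed

lemma pair_same_start':
 assumes "i \<in> R" "j \<in> R" "0 <= c" "c <= b" "c <= d" "X \<in> borel_measurable (F c)"
  "!!w. w \<in> space M ==> \<bar>X w\<bar> <= C"
 shows "(\<integral>w. X w * (m c b i w * m c d j w) \<partial>M) = \<mu> i j * (min b d - c) * (\<integral>w. X w \<partial>M)"
proof (cases "b <= d")
 case True
 then show ?thesis using pair_same_start[of i j c b d X C] assms by (simp add: min_def)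
next
 case False
 then show ?thesis using pair_same_start[of j i c d b X C] assms by (simp add: min_def mult.commute[of "m c b i _"] mu_sym)
qed

text \<open>The earlier increment is cut at c. Its part before c is known at time c and therefore
  orthogonal to the increment over (c,d]; the rest starts at c like the other factor.\<close>

lemma pair_ordered:
 assumes i: "i \<in> R" and j: "j \<in> R" and ab: "0 <= a" "a <= b" "a <= c" "c <= d"
  and \<xi>: "\<xi> \<in> borel_measurable (F a)" and bd\<xi>: "!!w. w \<in> space M ==> \<bar>\<xi> w\<bar> <= C"
  and \<eta>: "\<eta> \<in> borel_measurable (F c)" and bd\<eta>: "!!w. w \<in> space M ==> \<bar>\<eta> w\<bar> <= C'"
 shows "(\<integral>w. (\<xi> w * m a b i w) * (\<eta> w * m c d j w) \<partial>M) =
  (\<integral>w. \<xi> w * \<eta> w \<partial>M) * (\<mu> i j * max 0 (min b d - max a c))"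
proof -
 have c: "0 <= c" using ab by simp
 have \<xi>c: "\<xi> \<in> borel_measurable (F c)" using F_measurable_mono[OF \<xi> ab(1,3)] .
 have X: "(%w. \<xi> w * \<eta> w) \<in> borel_measurable (F c)" using \<xi>c \<eta> by measurable
 have XM[measurable]: "(%w. \<xi> w * \<eta> w) \<in> borel_measurable M" using F_measurable_M[OF X c] .
 have bdX: "\<bar>\<xi> w * \<eta> w\<bar> <= C * C'" if "w \<in> space M" for w
 proof -
  have "0 <= C" using bd\<xi>[OF that] by linarith
  then show ?thesis unfolding abs_mult using bd\<xi>[OF that] bd\<eta>[OF that] by (intro mult_mono) auto
 qed
 have zero: "(\<integral>w. (\<xi> w * \<eta> w * m a e i w) * m c d j w \<partial>M) = 0" if e: "a <= e" "e <= c" for e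
 proof (rule m_mean[OF j c ab(4)])
  have "m a e i \<in> borel_measurable (F c)"
   using F_measurable_mono[OF m_adapted[OF i ab(1) e(1)]] e ab by simp
  then show "(%w. \<xi> w * \<eta> w * m a e i w) \<in> borel_measurable (F c)" using X by measurable
  show "l2norm M (%w. \<xi> w * \<eta> w * m a e i w) < \<infinity>"
   by (intro l2norm_mult_bounded[OF _ bdX] XM m_l2 i ab e)
 qed
 show ?thesis
 proof (cases "b <= c")
  case True
  have "(\<integral>w. (\<xi> w * m a b i w) * (\<eta> w * m c d j w) \<partial>M) = (\<integral>w. (\<xi> w * \<eta> w * m a b i w) * m c d j w \<partial>M)"
   by (simp add: ac_simps)
  then show ?thesis using True ab zero[of b] by simp
 next
  case False
  have [measurable]: "m a b i \<in> borel_measurable M" "m c d j \<in> borel_measurable M"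
   "m a c i \<in> borel_measurable M" "m c b i \<in> borel_measurable M"
   using i j ab False by (auto intro!: m_measurable)
  have [measurable]: "\<xi> \<in> borel_measurable M" "\<eta> \<in> borel_measurable M"
   using F_measurable_M[OF \<xi>c c] F_measurable_M[OF \<eta> c] by auto
  have "(\<integral>w. (\<xi> w * m a b i w) * (\<eta> w * m c d j w) \<partial>M) =
    (\<integral>w. (\<xi> w * \<eta> w * m a c i w) * m c d j w + (\<xi> w * \<eta> w * m c b i w) * m c d j w \<partial>M)"
  proof (rule integral_cong_AE)
   have "AE w in M. m a b i w = m a c i w + m c b i w" using m_add[OF i ab(1), of c b] ab False by simp
   then show "AE w in M. (\<xi> w * m a b i w) * (\<eta> w * m c d j w) =
     (\<xi> w * \<eta> w * m a c i w) * m c d j w + (\<xi> w * \<eta> w * m c b i w) * m c d j w"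
    by eventually_elim (simp add: algebra_simps)
  qed measurable
  also have "... = (\<integral>w. (\<xi> w * \<eta> w * m a c i w) * m c d j w \<partial>M) + (\<integral>w. (\<xi> w * \<eta> w * m c b i w) * m c d j w \<partial>M)"
   using i j ab False
   by (intro Bochner_Integration.integral_add cauchy_schwarz_l2(1) l2norm_mult_bounded[OF _ bdX] XM m_l2) auto
  also have "(\<integral>w. (\<xi> w * \<eta> w * m c b i w) * m c d j w \<partial>M) = \<mu> i j * (min b d - c) * (\<integral>w. \<xi> w * \<eta> w \<partial>M)"
   using pair_same_start'[of i j c b d "%w. \<xi> w * \<eta> w" "C * C'"] i j c ab X bdX False by (simp add: mult.assoc)
  finally show ?thesis using zero[of c] ab False by (simp add: max_def)
 qed
qed

lemma pair_isometry:
 assumes i: "i \<in> R" and j: "j \<in> R" and ab: "0 <= a" "a <= b" "0 <= c" "c <= d"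
  and \<xi>: "\<xi> \<in> borel_measurable (F a)" "!!w. w \<in> space M ==> \<bar>\<xi> w\<bar> <= C"
  and \<eta>: "\<eta> \<in> borel_measurable (F c)" "!!w. w \<in> space M ==> \<bar>\<eta> w\<bar> <= C'"
 shows "(\<integral>w. (\<xi> w * m a b i w) * (\<eta> w * m c d j w) \<partial>M) =
  (\<integral>w. \<xi> w * \<eta> w \<partial>M) * (\<mu> i j * max 0 (min b d - max a c))"
proof (cases "a <= c")
 case True
 then show ?thesis using pair_ordered[of i j a b c d \<xi> C \<eta> C'] assms by simp
next
 case False
 then show ?thesis using pair_ordered[of j i c d a b \<eta> C' \<xi> C] assms
  by (simp add: mult.commute[of "\<xi> _ * m a b i _"] mult.commute[of "\<xi> _" "\<eta> _"] mu_sym min.commute max.commute)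
qed

text \<open>If a > t, the weight \<xi> need not be known at time t and \<open>pair_isometry\<close>
  does not apply to the stopped interval. That interval has collapsed to (t,t], whose increment
  vanishes almost surely, as does the overlap on the right.\<close>

lemma pair_isometry_stopped:
 assumes i: "i \<in> R" and j: "j \<in> R" and t: "0 <= t" and ab: "0 <= a" "a <= b" "0 <= c" "c <= d"
  and \<xi>: "\<xi> \<in> borel_measurable (F a)" "!!w. w \<in> space M ==> \<bar>\<xi> w\<bar> <= C"
  and \<eta>: "\<eta> \<in> borel_measurable (F c)" "!!w. w \<in> space M ==> \<bar>\<eta> w\<bar> <= C'"
 shows "(\<integral>w. (\<xi> w * m (min a t) (min b t) i w) * (\<eta> w * m (min c t) (min d t) j w) \<partial>M) =
  (\<integral>w. \<xi> w * \<eta> w \<partial>M) * (\<mu> i j * max 0 (min (min b t) (min d t) - max (min a t) (min c t)))"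
proof (cases "a <= t \<and> c <= t")
 case True
 then show ?thesis using pair_isometry[of i j a "min b t" c "min d t" \<xi> C \<eta> C'] assms by simp
next
 case False
 have "AE w in M. (\<xi> w * m (min a t) (min b t) i w) * (\<eta> w * m (min c t) (min d t) j w) = 0"
 proof (cases "a <= t")
  case True
  with False have "min c t = t" "min d t = t" using ab by auto
  then show ?thesis using m_zero[OF j t] by auto
 next
  case False
  then have "min a t = t" "min b t = t" using ab by auto
  then show ?thesis using m_zero[OF i t] by auto
 qed
 then have "(\<integral>w. (\<xi> w * m (min a t) (min b t) i w) * (\<eta> w * m (min c t) (min d t) j w) \<partial>M) = 0"
  by (rule integral_eq_zero_AE)
 moreover have "max 0 (min (min b t) (min d t) - max (min a t) (min c t)) = 0"
  using False by auto
 ultimately show ?thesis by simp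
qed

lemma stopped_l2:
 assumes i: "i \<in> R" and t: "0 <= t" and ab: "0 <= a" "a <= b"
  and \<xi>: "\<xi> \<in> borel_measurable (F a)" "!!w. w \<in> space M ==> \<bar>\<xi> w\<bar> <= C"
 shows "l2norm M (%w. \<xi> w * m (min a t) (min b t) i w) < \<infinity>"
 using ab t by (intro l2norm_mult_bounded[OF _ \<xi>(2)] m_l2 i F_measurable_M[OF \<xi>(1)]) auto

end

text \<open>Factorization needs independence of the generated sigma-algebras. The preimages
  \<open>events_of M Y\<close> already form one, and functions of Y or of the past generate smaller
  ones.\<close>

lemma (in prob_space) indep_events_of_integral:
 fixes X :: "'a => real" and Y :: "'a => 'b::topological_space" and g :: "'b => real"
 assumes indep: "indep_set (sets G) (events_of M Y)" and sub: "subalgebra M G"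
  and X: "X \<in> borel_measurable G" "integrable M X"
  and Y: "Y \<in> borel_measurable M" and g: "g \<in> borel_measurable borel" "integrable M (%w. g (Y w))"
 shows "(\<integral>w. X w * g (Y w) \<partial>M) = (\<integral>w. X w \<partial>M) * (\<integral>w. g (Y w) \<partial>M)"
proof -
 have sp: "space G = space M" using sub by (simp add: subalgebra_def)
 have X_events: "{X -` A \<inter> space M |A. A \<in> sets borel} \<subseteq> sets G"
  using measurable_sets[OF X(1)] sp by auto
 have sX: "sigma_sets (space M) {X -` A \<inter> space M |A. A \<in> sets borel} \<subseteq> sets G"
  unfolding sp[symmetric] by (rule sets.sigma_sets_subset) (use X_events sp in simp)
 have YV: "events_of M Y = sets (vimage_algebra (space M) Y borel)"
  unfolding events_of_def by (subst sets_vimage_algebra2) auto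
 have gY_events: "{(%w. g (Y w)) -` A \<inter> space M |A. A \<in> sets borel} \<subseteq> events_of M Y"
 proof
  fix E assume "E \<in> {(%w. g (Y w)) -` A \<inter> space M |A. A \<in> sets borel}"
  then obtain A where A: "A \<in> sets borel" "E = (%w. g (Y w)) -` A \<inter> space M" by auto
  have "E = Y -` (g -` A) \<inter> space M" using A(2) by auto
  moreover have "g -` A \<in> sets borel" using measurable_sets[OF g(1) A(1)] by simp
  ultimately show "E \<in> events_of M Y" unfolding events_of_def by blast
 qed
 have sY: "sigma_sets (space M) {(%w. g (Y w)) -` A \<inter> space M |A. A \<in> sets borel} \<subseteq> events_of M Y"
  using sets.sigma_sets_subset[of "{(%w. g (Y w)) -` A \<inter> space M |A. A \<in> sets borel}" "vimage_algebra (space M) Y borel"]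
   gY_events by (simp add: YV)
 have "indep_var borel X borel (%w. g (Y w))"
  unfolding indep_var_eq
 proof (intro conjI)
  show "random_variable borel X" using X by simp
  show "random_variable borel (%w. g (Y w))" using g(2) by simp
  show "indep_set (sigma_sets (space M) {X -` A \<inter> space M |A. A \<in> sets borel})
    (sigma_sets (space M) {(%w. g (Y w)) -` A \<inter> space M |A. A \<in> sets borel})"
   using indep sX sY unfolding indep_sets2_eq by blast
 qed
 then show ?thesis by (rule indep_var_lebesgue_integral[OF _ X(2) g(2)])
qed

section \<open>Moments of the Poisson law\<close>

lemma exp_series: "(%k. x ^ k / fact k) sums exp (x::real)"
 using exp_converges[of x] by (simp add: field_simps)

lemma exp_series_moment1: "(%k. real k * (x ^ k / fact k)) sums (x * exp x)"
proof -
 have "(%k. real (Suc k) * (x ^ Suc k / fact (Suc k))) = (%k. x * (x ^ k / fact k))"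
  by (auto simp: fun_eq_iff field_simps simp del: of_nat_Suc)
 moreover have "(%k. x * (x ^ k / fact k)) sums (x * exp x)" by (intro sums_mult exp_series)
 ultimately show ?thesis using sums_Suc_iff[of "%k. real k * (x ^ k / fact k)" "x * exp x"] by simp
qed

lemma exp_series_moment2: "(%k. (real k)\<^sup>2 * (x ^ k / fact k)) sums ((x\<^sup>2 + x) * exp x)"
proof -
 have "(%k. (real (Suc k))\<^sup>2 * (x ^ Suc k / fact (Suc k))) =
   (%k. x * (real k * (x ^ k / fact k)) + x * (x ^ k / fact k))"
 proof
  fix k
  have "(real (Suc k))\<^sup>2 * (x ^ Suc k / fact (Suc k)) = real (Suc k) * (x * (x ^ k / fact k))"
   by (simp add: power2_eq_square field_simps del: of_nat_Suc)
  then show "(real (Suc k))\<^sup>2 * (x ^ Suc k / fact (Suc k)) = x * (real k * (x ^ k / fact k)) + x * (x ^ k / fact k)"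
   by (simp add: field_simps)
 qed
 moreover have "(%k. x * (real k * (x ^ k / fact k)) + x * (x ^ k / fact k)) sums (x * (x * exp x) + x * exp x)"
  by (intro sums_add sums_mult exp_series exp_series_moment1)
 moreover have "x * (x * exp x) + x * exp x = (x\<^sup>2 + x) * exp x" by (simp add: power2_eq_square algebra_simps)
 ultimately show ?thesis using sums_Suc_iff[of "%k. (real k)\<^sup>2 * (x ^ k / fact k)" "(x\<^sup>2 + x) * exp x"] by simp
qed

text \<open>Only the probabilities of natural values are given, and n might be infinite. The
  probabilities sum to 1, so n is almost surely a natural number and its moments are the exponential
  series above.\<close>

lemma (in prob_space) poisson_law_moments:
 fixes n :: "'a => ennreal"
 assumes [measurable]: "n \<in> borel_measurable M" and l: "0 <= l"
  and law: "!!k. prob {w \<in> space M. n w = of_nat k} = l ^ k / fact k * exp (- l)"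
 shows "AE w in M. n w < \<infinity>" "integrable M (%w. enn2real (n w))" "(\<integral>w. enn2real (n w) \<partial>M) = l"
  "integrable M (%w. (enn2real (n w))\<^sup>2)" "(\<integral>w. (enn2real (n w))\<^sup>2 \<partial>M) = l\<^sup>2 + l"
proof -
 have em: "emeasure M {w \<in> space M. n w = of_nat k} = ennreal (l ^ k / fact k * exp (- l))" for k
  using law[of k] by (simp add: emeasure_eq_measure)
 have moment: "(\<integral>\<^sup>+w. (\<Sum>k. ennreal (g k) * indicator {w \<in> space M. n w = of_nat k} w) \<partial>M) = ennreal s"
  if g: "!!k. 0 <= g k" and s: "(%k. g k * (l ^ k / fact k)) sums (s * exp l)" for g :: "nat => real" and s
 proof -
  have "(\<integral>\<^sup>+w. (\<Sum>k. ennreal (g k) * indicator {w \<in> space M. n w = of_nat k} w) \<partial>M) =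
    (\<Sum>k. \<integral>\<^sup>+w. ennreal (g k) * indicator {w \<in> space M. n w = of_nat k} w \<partial>M)"
   by (rule nn_integral_suminf) measurable
  also have "... = (\<Sum>k. ennreal (g k * (l ^ k / fact k) * exp (- l)))"
   using g l by (simp add: nn_integral_cmult em ennreal_mult[symmetric] mult.assoc)
  also have "... = ennreal (s * exp l * exp (- l))"
   using g l by (intro suminf_ennreal_eq sums_mult2 s) auto
  also have "s * exp l * exp (- l) = s" by (simp add: exp_minus)
  finally show ?thesis .
 qed
 have single: "(\<Sum>k. ennreal (g k) * indicator {w \<in> space M. n w = of_nat k} w) = ennreal (g j)"
  if "n w = of_nat j" "w \<in> space M" for g :: "nat => real" and j w
  using that by (subst suminf_finite[of "{j}"]) auto
 have nat: "AE w in M. \<exists>k. n w = of_nat k"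
 proof (rule AE_I_eq_1)
  show "{w \<in> space M. \<exists>k. n w = of_nat k} \<in> sets M" by measurable
  have "emeasure M {w \<in> space M. \<exists>k. n w = of_nat k} = (\<integral>\<^sup>+w. indicator {w \<in> space M. \<exists>k. n w = of_nat k} w \<partial>M)"
   by simp
  also have "... = (\<integral>\<^sup>+w. (\<Sum>k. ennreal 1 * indicator {w \<in> space M. n w = of_nat k} w) \<partial>M)"
  proof (rule nn_integral_cong)
   fix w assume w: "w \<in> space M"
   show "indicator {w \<in> space M. \<exists>k. n w = of_nat k} w = (\<Sum>k. ennreal 1 * indicator {w \<in> space M. n w = of_nat k} w)"
   proof (cases "\<exists>k. n w = of_nat k")
    case True
    then obtain j where "n w = of_nat j" ..
    with single[OF this w, of "%_. 1"] w show ?thesis by (auto simp: indicator_def)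
   next
    case False
    then show ?thesis by (auto simp: indicator_def)
   qed
  qed
  also have "... = ennreal 1"
   using exp_series[of l] by (intro moment) auto
  finally show "emeasure M {w \<in> space M. \<exists>k. n w = of_nat k} = 1" by simp
 qed
 then show "AE w in M. n w < \<infinity>" by eventually_elim (auto simp: of_nat_less_top)
 have moment': "has_bochner_integral M (%w. h (enn2real (n w))) s"
  if h: "!!x. 0 <= h x" and [measurable]: "h \<in> borel_measurable borel" and s0: "0 <= s"
   and s: "(%k. h (real k) * (l ^ k / fact k)) sums (s * exp l)" for h :: "real => real" and s
 proof (rule has_bochner_integral_nn_integral)
  have "(\<integral>\<^sup>+w. ennreal (h (enn2real (n w))) \<partial>M) =
    (\<integral>\<^sup>+w. (\<Sum>k. ennreal (h (real k)) * indicator {w \<in> space M. n w = of_nat k} w) \<partial>M)"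
  proof (rule nn_integral_cong_AE)
   show "AE w in M. ennreal (h (enn2real (n w))) = (\<Sum>k. ennreal (h (real k)) * indicator {w \<in> space M. n w = of_nat k} w)"
    using nat AE_space
   proof eventually_elim
    case (elim w)
    then obtain j where j: "n w = of_nat j" by auto
    show ?case using single[OF j elim(2), of "%k. h (real k)"]
     by (simp add: j ennreal_of_nat_eq_real_of_nat)
   qed
  qed
  also have "... = ennreal s" using h s by (intro moment) auto
  finally show "(\<integral>\<^sup>+w. ennreal (h (enn2real (n w))) \<partial>M) = ennreal s" .
 qed (use h s0 in auto)
 have 1: "has_bochner_integral M (%w. \<bar>enn2real (n w)\<bar>) l"
  using exp_series_moment1[of l] l by (intro moment'[of abs]) auto
 have 2: "has_bochner_integral M (%w. (enn2real (n w))\<^sup>2) (l\<^sup>2 + l)"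
  using exp_series_moment2[of l] l by (intro moment'[of "%x. x\<^sup>2"]) auto
 show "integrable M (%w. enn2real (n w))" "(\<integral>w. enn2real (n w) \<partial>M) = l"
  "integrable M (%w. (enn2real (n w))\<^sup>2)" "(\<integral>w. (enn2real (n w))\<^sup>2 \<partial>M) = l\<^sup>2 + l"
  using 1 2 by (auto simp: has_bochner_integral_iff)
qed

section \<open>Increments of the Wiener process and of the Poisson measure\<close>

locale noise =
 fixes M :: "'a measure" and F :: "real => 'a measure" and W :: "real => 'a => real"
  and c :: real and \<nu> :: "'e::euclidean_space measure" and N :: "'a => (real \<times> 'e) measure"
 assumes setting: "noise_setting M F W c \<nu> N"
begin

lemma filtered: "filtered_prob_space M F" and wiener: "wiener_process M F W"
 and levy: "levy_measure c \<nu>" and poisson: "poisson_random_measure M F c \<nu> N"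
 and independent: "independent_noises M W \<nu> N"
 using setting unfolding noise_setting_def by blast+

sublocale prob_space M
 using filtered unfolding filtered_prob_space_def by blast

lemma complete_M: "complete_measure M" and F_subalgebra: "subalgebra M (F t)"
 and null_F0: "null_sets M \<subseteq> sets (F 0)"
 using filtered unfolding filtered_prob_space_def by blast+

lemma F_sets_mono: "s <= t ==> sets (F s) \<subseteq> sets (F t)"
proof -
 have "filtration (space M) F" using filtered unfolding filtered_prob_space_def by blast
 then show "s <= t ==> sets (F s) \<subseteq> sets (F t)" by (rule filtration.sets_F_mono)
qed

lemma null_F: "0 <= t ==> null_sets M \<subseteq> sets (F t)"
 using null_F0 F_sets_mono[of 0 t] by auto

lemma F_measurable_AE:
 fixes X Z :: "'a => real"
 assumes "0 <= t" "X \<in> borel_measurable M" "Z \<in> borel_measurable (F t)" "AE w in M. X w = Z w"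
 shows "X \<in> borel_measurable (F t)"
 by (rule measurable_subalgebra_AE[OF complete_M F_subalgebra null_F[OF assms(1)] assms(2-4)])

lemma F_measurable_le:
 assumes "X \<in> borel_measurable (F s)" "s <= t" shows "X \<in> borel_measurable (F t)"
proof -
 have "space (F s) = space (F t)" using F_subalgebra[of s] F_subalgebra[of t] by (auto simp: subalgebra_def)
 then show ?thesis using measurable_mono[of borel borel "F s" "F t"] F_sets_mono[OF assms(2)] assms(1) by auto
qed

lemma F_measurable_M: "X \<in> borel_measurable (F s) ==> X \<in> borel_measurable M"
 using measurable_from_subalg[OF F_subalgebra] by blast

lemma W_adapted: "0 <= t ==> W t \<in> borel_measurable (F t)"
 using wiener by (simp add: wiener_process_def)

lemma W_measurable: "0 <= t ==> W t \<in> borel_measurable M"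
 using F_measurable_M[OF W_adapted] .

lemma W_increment:
 assumes "0 <= s" "s < t"
 shows "integrable M (%w. W t w - W s w)" "(\<integral>w. W t w - W s w \<partial>M) = 0"
  "integrable M (%w. (W t w - W s w)\<^sup>2)" "(\<integral>w. (W t w - W s w)\<^sup>2 \<partial>M) = t - s"
  "indep_set (sets (F s)) (events_of M (%w. W t w - W s w))"
proof -
 have pos: "0 < sqrt (t - s)" using assms by simp
 have D: "distributed M lborel (%w. W t w - W s w) (%x. ennreal (normal_density 0 (sqrt (t - s)) x))"
  using wiener assms by (simp add: wiener_process_def)
 show "indep_set (sets (F s)) (events_of M (%w. W t w - W s w))"
  using wiener assms by (simp add: wiener_process_def)
 show "integrable M (%w. W t w - W s w)"
  using distributed_integrable[OF D, of "%x. x"] integrable_normal_moment[OF pos, of 0 1] by simp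
 show mean: "(\<integral>w. W t w - W s w \<partial>M) = 0"
  by (rule normal_distributed_expectation[OF pos D])
 show "integrable M (%w. (W t w - W s w)\<^sup>2)"
  using distributed_integrable[OF D, of "%x. x\<^sup>2"] integrable_normal_moment[OF pos, of 0 2] by simp
 show "(\<integral>w. (W t w - W s w)\<^sup>2 \<partial>M) = t - s"
  using normal_distributed_variance[OF pos D] assms unfolding mean by simp
qed

text \<open>A single direction with unit covariance. The cases s = t are separate because
  \<open>wiener_process\<close> prescribes laws for s < t only.\<close>

sublocale W: orthogonal_noise M F "%s t (_::unit) w. W t w - W s w" UNIV "%_ _. 1"
proof
 fix s t :: real and X :: "'a => real" and C :: real
 show "subalgebra M (F s)" by (rule F_subalgebra)
 show "sets (F s) \<subseteq> sets (F t)" if "s <= t" using F_sets_mono[OF that] .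
 assume st: "0 <= s" "s <= t"
 have [measurable]: "W s \<in> borel_measurable M" "W t \<in> borel_measurable M"
  using W_measurable st by auto
 show "(%w. W t w - W s w) \<in> borel_measurable (F t)"
  using st by (intro borel_measurable_diff W_adapted F_measurable_le[OF W_adapted[OF st(1)] st(2)]) auto
 show "l2norm M (%w. W t w - W s w) < \<infinity>"
 proof (cases "s = t")
  case False
  then show ?thesis using W_increment(3)[of s t] st by (simp add: l2norm_def)
 qed simp
 assume X: "X \<in> borel_measurable (F s)"
 note XM[measurable] = F_measurable_M[OF X]
 show "(\<integral>w. X w * (W t w - W s w) \<partial>M) = 0" if "l2norm M X < \<infinity>"
 proof (cases "s = t")
  case False
  with st have lt: "s < t" by simp
  note I = W_increment[OF st(1) lt]
  have "(\<integral>w. X w * (W t w - W s w) \<partial>M) = (\<integral>w. X w \<partial>M) * (\<integral>w. W t w - W s w \<partial>M)"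
   by (rule indep_events_of_integral[OF I(5) F_subalgebra X l2norm_finite_integrable[OF that], where g = "%x. x"])
    (measurable, rule I(1))
  then show ?thesis by (simp only: I(2) mult_zero_right)
 qed simp
 show "(\<integral>w. X w * ((W t w - W s w) * (W t w - W s w)) \<partial>M) = 1 * (t - s) * (\<integral>w. X w \<partial>M)"
  if bd: "!!w. w \<in> space M ==> \<bar>X w\<bar> <= C"
 proof (cases "s = t")
  case False
  with st have lt: "s < t" by simp
  have "integrable M X" using bd by (intro integrable_const_bound[of _ C]) auto
  note I = W_increment[OF st(1) lt]
  have "(\<integral>w. X w * (W t w - W s w)\<^sup>2 \<partial>M) = (\<integral>w. X w \<partial>M) * (\<integral>w. (W t w - W s w)\<^sup>2 \<partial>M)"
   by (rule indep_events_of_integral[OF I(5) F_subalgebra X \<open>integrable M X\<close>, where g = "%x. x\<^sup>2"])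
    (measurable, rule I(3))
  from this[unfolded I(4)] show ?thesis by (simp only: power2_eq_square mult_1 mult.commute)
 qed simp
qed auto

lemma marks_borel: "marks c \<in> sets (borel :: 'e measure)"
 unfolding marks_def by measurable

lemma sets_nu: "A \<in> sets \<nu> \<longleftrightarrow> A \<in> sets borel \<and> A \<subseteq> marks c"
 using levy marks_borel by (auto simp: levy_measure_def sets_restrict_space_iff)

lemma space_nu: "space \<nu> = marks c"
proof -
 have "sets \<nu> = sets (restrict_space borel (marks c))" using levy by (simp add: levy_measure_def)
 from sets_eq_imp_space_eq[OF this] show ?thesis by (simp add: space_restrict_space)
qed

lemma borel_nu: "f \<in> borel_measurable borel ==> f \<in> borel_measurable \<nu>"
proof -
 assume "f \<in> borel_measurable borel"
 then have "f \<in> borel_measurable (restrict_space borel (marks c))" by (rule measurable_restrict_space1)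
 moreover have "sets \<nu> = sets (restrict_space borel (marks c))" using levy unfolding levy_measure_def by blast
 ultimately show "f \<in> borel_measurable \<nu>" using measurable_cong_sets[of \<nu> "restrict_space borel (marks c)" borel borel] by blast
qed

text \<open>Chebyshev's inequality for the function min(1, |v|^2), whose integral is finite for a
  Levy measure.\<close>

lemma emeasure_nu_away:
 assumes "0 < e"
 shows "emeasure \<nu> {v \<in> marks c. e <= norm v} < \<infinity>"
proof -
 have [measurable]: "(%v. ennreal (min 1 ((norm v)\<^sup>2))) \<in> borel_measurable \<nu>" by (rule borel_nu) measurable
 have S: "{v \<in> marks c. e <= norm v} \<in> sets \<nu>" using marks_borel by (auto simp: sets_nu)
 define d where "d = min 1 (e\<^sup>2)"
 have d: "0 < d" using assms by (simp add: d_def)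
 have "ennreal d * emeasure \<nu> {v \<in> marks c. e <= norm v} = (\<integral>\<^sup>+v. ennreal d * indicator {v \<in> marks c. e <= norm v} v \<partial>\<nu>)"
  using S by (simp add: nn_integral_cmult)
 also have "... <= (\<integral>\<^sup>+v. ennreal (min 1 ((norm v)\<^sup>2)) \<partial>\<nu>)"
 proof (rule nn_integral_mono)
  fix v :: 'e
  have "e <= norm v ==> e\<^sup>2 <= (norm v)\<^sup>2" using assms by (intro power_mono) auto
  then show "ennreal d * indicator {v \<in> marks c. e <= norm v} v <= ennreal (min 1 ((norm v)\<^sup>2))"
   by (auto simp: d_def min_def split: split_indicator intro!: ennreal_leI)
 qed
 also have "... < \<infinity>" using levy by (simp add: levy_measure_def)
 finally show ?thesis using d by (auto simp: ennreal_mult_less_top)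
qed

text \<open>The marks exclude 0, so the sets at distance at least 1/(n+1) from 0 exhaust
  them.\<close>

sublocale nu: sigma_finite_measure \<nu>
proof
 let ?A = "%n. {v \<in> marks c. 1 / real (Suc n) <= norm v}"
 have "range ?A \<subseteq> sets \<nu>" using marks_borel by (auto simp: sets_nu)
 moreover have "(\<Union>n. ?A n) = space \<nu>"
 proof -
  have "\<exists>n. 1 / real (Suc n) <= norm v" if "v \<in> marks c" for v :: 'e
  proof -
   have "0 < norm v" using that by (simp add: marks_def)
   from reals_Archimedean[OF this] show ?thesis by (auto simp: inverse_eq_divide intro: less_imp_le)
  qed
  then show ?thesis by (auto simp: space_nu)
 qed
 ultimately show "\<exists>A. countable A \<and> A \<subseteq> sets \<nu> \<and> \<Union>A = space \<nu> \<and> (\<forall>a\<in>A. emeasure \<nu> a \<noteq> \<infinity>)"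
  using emeasure_nu_away by (intro exI[of _ "range ?A"]) (auto simp: less_top[symmetric] simp del: of_nat_Suc)
qed

text \<open>The ring of mark sets on which compensation makes sense; simple integrands range over
  it.\<close>

definition finite_marks :: "'e set set" where
 "finite_marks = {A \<in> sets \<nu>. emeasure \<nu> A < \<infinity>}"

lemma finite_marks_Int: "A \<in> finite_marks ==> B \<in> finite_marks ==> A \<inter> B \<in> finite_marks"
 and finite_marks_Diff: "A \<in> finite_marks ==> B \<in> finite_marks ==> A - B \<in> finite_marks"
 by (auto simp: finite_marks_def intro: le_less_trans[OF emeasure_mono])

lemma finite_marks_Un: "A \<in> finite_marks ==> B \<in> finite_marks ==> A \<union> B \<in> finite_marks"
 using emeasure_subadditive[of A \<nu> B] by (auto simp: finite_marks_def intro: le_less_trans)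

lemma rectangle_sets:
 assumes "0 <= s" "A \<in> sets \<nu>" "w \<in> space M"
 shows "{s<..t} \<times> A \<in> sets (N w)"
proof -
 have "{0::real..} \<times> marks c \<in> sets (borel \<Otimes>\<^sub>M (borel :: 'e measure))" using marks_borel by (intro pair_measureI) auto
 then have R: "{0::real..} \<times> marks c \<in> sets (borel :: (real \<times> 'e) measure)" unfolding borel_prod .
 have "{s<..t} \<times> A \<in> sets (borel \<Otimes>\<^sub>M (borel :: 'e measure))" using assms by (intro pair_measureI) (auto simp: sets_nu)
 then have "{s<..t} \<times> A \<in> sets (borel :: (real \<times> 'e) measure)" unfolding borel_prod .
 then have "{s<..t} \<times> A \<in> sets (restrict_space borel ({0..} \<times> marks c))"
  using R assms by (auto simp: sets_restrict_space_iff sets_nu)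
 then show ?thesis using poisson assms(3) unfolding poisson_random_measure_def Let_def by simp
qed

lemma N_rect_measurable [measurable]:
 assumes "0 <= s" "A \<in> sets \<nu>"
 shows "(%w. emeasure (N w) ({s<..t} \<times> A)) \<in> borel_measurable M"
proof -
 obtain w where w: "w \<in> space M" using not_empty by auto
 have "{s<..t} \<times> A \<in> sets (restrict_space borel ({0..} \<times> marks c))"
  using rectangle_sets[OF assms w] poisson w unfolding poisson_random_measure_def Let_def by simp
 then show ?thesis using poisson unfolding poisson_random_measure_def Let_def by blast
qed

lemma N_law:
 assumes st: "0 <= s" "s <= t" and A: "A \<in> finite_marks"
 shows "prob {w \<in> space M. emeasure (N w) ({s<..t} \<times> A) = of_nat k} =
  (measure \<nu> A * (t - s)) ^ k / fact k * exp (- (measure \<nu> A * (t - s)))"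
proof -
 have law: "prob {w \<in> space M. emeasure (N w) (I \<times> B) = of_nat k} = pmf (poisson_pmf (measure \<nu> B * measure lborel I)) k"
  if "B \<in> sets \<nu>" "I \<in> sets borel" "I \<subseteq> {0..}" "emeasure \<nu> B < \<infinity>" "emeasure lborel I < \<infinity>" for B I k
  using poisson that unfolding poisson_random_measure_def Let_def by blast
 define l where "l = measure \<nu> A * (t - s)"
 have eq: "prob {w \<in> space M. emeasure (N w) ({s<..t} \<times> A) = of_nat k} = pmf (poisson_pmf l) k"
 proof -
  have "{s<..t} \<subseteq> {0..}" using st by auto
  then show ?thesis using law[of A "{s<..t}"] A st by (simp add: finite_marks_def l_def)
 qed
 have l: "0 <= l" using st by (simp add: l_def)
 show ?thesis
 proof (cases "l = 0")
  case False
  with l have "0 < l" by simp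
  from pmf_poisson[OF this] eq show ?thesis by (simp add: l_def)
 next
  case True
  \<comment> \<open>The library specifies \<open>poisson_pmf\<close> for positive rates only; its value at \<open>0\<close> is
   forced by the law of \<open>N\<close> on the empty set.\<close>
  have "pmf (poisson_pmf 0) k = prob {w \<in> space M. emeasure (N w) ({} \<times> {}) = of_nat k}"
   using law[of "{}" "{}" k] by simp
  also have "... = (if k = 0 then 1 else 0)" by (auto simp: prob_space of_nat_0_eq_iff)
  finally show ?thesis using eq True by (simp add: l_def[symmetric])
 qed
qed

lemma N_moments:
 assumes st: "0 <= s" "s <= t" and A: "A \<in> finite_marks"
 shows "AE w in M. emeasure (N w) ({s<..t} \<times> A) < \<infinity>"
  "integrable M (compensated \<nu> N s t A)" "(\<integral>w. compensated \<nu> N s t A w \<partial>M) = 0"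
  "integrable M (%w. (compensated \<nu> N s t A w)\<^sup>2)"
  "(\<integral>w. (compensated \<nu> N s t A w)\<^sup>2 \<partial>M) = measure \<nu> A * (t - s)"
proof -
 define l where "l = measure \<nu> A * (t - s)"
 let ?n = "%w. emeasure (N w) ({s<..t} \<times> A)"
 have [measurable]: "A \<in> sets \<nu>" using A by (simp add: finite_marks_def)
 have nm: "?n \<in> borel_measurable M" using st by measurable
 have l: "0 <= l" using st by (simp add: l_def)
 note mom = poisson_law_moments[OF nm l N_law[OF st A, folded l_def]]
 show "AE w in M. ?n w < \<infinity>" by (rule mom(1))
 have eq: "compensated \<nu> N s t A = (%w. enn2real (?n w) - l)"
  by (auto simp: compensated_def l_def measure_def)
 have sq: "(%w. (compensated \<nu> N s t A w)\<^sup>2) = (%w. ((enn2real (?n w))\<^sup>2 - 2 * l * enn2real (?n w)) + l\<^sup>2)"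
  by (auto simp: eq power2_eq_square algebra_simps)
 show "integrable M (compensated \<nu> N s t A)" using mom by (simp add: eq)
 show "(\<integral>w. compensated \<nu> N s t A w \<partial>M) = 0"
  using mom by (simp add: eq prob_space)
 show "integrable M (%w. (compensated \<nu> N s t A w)\<^sup>2)" using mom by (simp add: sq)
 show "(\<integral>w. (compensated \<nu> N s t A w)\<^sup>2 \<partial>M) = measure \<nu> A * (t - s)"
  unfolding l_def[symmetric] sq using mom by (simp add: prob_space power2_eq_square algebra_simps)
qed

lemma compensated_same: "compensated \<nu> N s s A w = 0"
 by (simp add: compensated_def)

text \<open>\<open>measure\<close> is 0 on sets of infinite mass, so additivity requires finite
  counts, and these are available almost surely.\<close>

lemma compensated_add_time:
 assumes A: "A \<in> finite_marks" and rst: "0 <= r" "r <= s" "s <= t"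
 shows "AE w in M. compensated \<nu> N r t A w = compensated \<nu> N r s A w + compensated \<nu> N s t A w"
proof -
 have A': "A \<in> sets \<nu>" using A by (simp add: finite_marks_def)
 show ?thesis
  using N_moments(1)[OF rst(1,2) A] N_moments(1)[OF order.trans[OF rst(1,2)] rst(3) A] AE_space
 proof eventually_elim
  case (elim w)
  have "{r<..t} \<times> A = ({r<..s} \<times> A) \<union> ({s<..t} \<times> A)" using rst by auto
  then have "measure (N w) ({r<..t} \<times> A) = measure (N w) ({r<..s} \<times> A) + measure (N w) ({s<..t} \<times> A)"
   using elim rst A' by (simp only:) (intro measure_Union rectangle_sets, auto)
  then show ?case
   by (simp add: compensated_def algebra_simps)
 qed
qed

lemma compensated_add_marks:
 assumes A: "A \<in> finite_marks" and B: "B \<in> finite_marks" and "A \<inter> B = {}" and st: "0 <= s" "s <= t"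
 shows "AE w in M. compensated \<nu> N s t (A \<union> B) w = compensated \<nu> N s t A w + compensated \<nu> N s t B w"
proof -
 have A': "A \<in> sets \<nu>" "B \<in> sets \<nu>" "emeasure \<nu> A \<noteq> \<infinity>" "emeasure \<nu> B \<noteq> \<infinity>"
  using A B by (auto simp: finite_marks_def)
 have nu: "measure \<nu> (A \<union> B) = measure \<nu> A + measure \<nu> B"
  using A' assms(3) by (intro measure_Union) auto
 show ?thesis
  using N_moments(1)[OF st A] N_moments(1)[OF st B] AE_space
 proof eventually_elim
  case (elim w)
  have "{s<..t} \<times> (A \<union> B) = ({s<..t} \<times> A) \<union> ({s<..t} \<times> B)" by auto
  then have "measure (N w) ({s<..t} \<times> (A \<union> B)) = measure (N w) ({s<..t} \<times> A) + measure (N w) ({s<..t} \<times> B)"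
   using elim st A' assms(3) by (simp only:) (intro measure_Union rectangle_sets, auto)
  then show ?case by (simp add: compensated_def nu algebra_simps)
 qed
qed

lemma compensated_measurable:
 assumes "A \<in> finite_marks" "0 <= s" "s <= t"
 shows "compensated \<nu> N s t A \<in> borel_measurable M"
 using N_moments(2)[OF assms(2,3,1)] by simp

lemma compensated_l2:
 assumes "A \<in> finite_marks" "0 <= s" "s <= t"
 shows "l2norm M (compensated \<nu> N s t A) < \<infinity>"
 using N_moments(4)[OF assms(2,3,1)] compensated_measurable[OF assms] by (simp add: l2norm_def)

text \<open>The setting provides adaptedness for (0,t] only. A general increment is a difference of
  two such counts up to a null set, and \<open>F t\<close> contains the null sets.\<close>

lemma compensated_adapted:
 assumes A: "A \<in> finite_marks" and st: "0 <= s" "s <= t"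
 shows "compensated \<nu> N s t A \<in> borel_measurable (F t)"
proof -
 have N0: "(%w. emeasure (N w) ({0<..t} \<times> A)) \<in> borel_measurable (F t)" if "0 <= t" for t
  using poisson that A unfolding poisson_random_measure_def Let_def finite_marks_def by blast
 have C0: "compensated \<nu> N 0 t A \<in> borel_measurable (F t)" if "0 <= t" for t
  using N0[OF that] unfolding compensated_def[abs_def] measure_def by measurable
 show ?thesis
 proof (rule F_measurable_AE)
  show "(%w. compensated \<nu> N 0 t A w - compensated \<nu> N 0 s A w) \<in> borel_measurable (F t)"
   using st by (intro borel_measurable_diff C0 F_measurable_le[OF C0[OF st(1)] st(2)]) auto
  show "AE w in M. compensated \<nu> N s t A w = compensated \<nu> N 0 t A w - compensated \<nu> N 0 s A w"
   using compensated_add_time[OF A _ st] by auto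
 qed (use st compensated_measurable[OF A st] in auto)
qed

lemma compensated_indep:
 assumes A: "A \<in> finite_marks" and st: "0 <= s" "s <= t"
  and X: "X \<in> borel_measurable (F s)" "integrable M X"
 shows "(\<integral>w. X w * compensated \<nu> N s t A w \<partial>M) = 0"
  "(\<integral>w. X w * (compensated \<nu> N s t A w)\<^sup>2 \<partial>M) = measure \<nu> A * (t - s) * (\<integral>w. X w \<partial>M)"
proof -
 have A': "A \<in> sets \<nu>" using A by (simp add: finite_marks_def)
 define g where "g = (%y. enn2real y - measure \<nu> A * (t - s))"
 have [measurable]: "g \<in> borel_measurable borel" unfolding g_def by measurable
 have eq: "compensated \<nu> N s t A = (%w. g (emeasure (N w) ({s<..t} \<times> A)))"
  by (auto simp: compensated_def g_def measure_def)
 note mom = N_moments[OF st A]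
 have "(\<integral>w. X w * compensated \<nu> N s t A w \<partial>M) = 0 \<and>
   (\<integral>w. X w * (compensated \<nu> N s t A w)\<^sup>2 \<partial>M) = measure \<nu> A * (t - s) * (\<integral>w. X w \<partial>M)"
 proof (cases "s = t")
  case True
  then show ?thesis by (simp add: compensated_same)
 next
  case False
  with st have lt: "s < t" by simp
  have ind: "indep_set (sets (F s)) (events_of M (%w. emeasure (N w) ({s<..t} \<times> A)))"
   using poisson st lt A' unfolding poisson_random_measure_def Let_def by blast
  have nm: "(%w. emeasure (N w) ({s<..t} \<times> A)) \<in> borel_measurable M" using st A' by measurable
  have "(\<integral>w. X w * g (emeasure (N w) ({s<..t} \<times> A)) \<partial>M) = (\<integral>w. X w \<partial>M) * (\<integral>w. g (emeasure (N w) ({s<..t} \<times> A)) \<partial>M)"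
   using mom(2) by (intro indep_events_of_integral[OF ind F_subalgebra X nm]) (auto simp: eq)
  moreover have "(\<integral>w. X w * (g (emeasure (N w) ({s<..t} \<times> A)))\<^sup>2 \<partial>M) =
    (\<integral>w. X w \<partial>M) * (\<integral>w. (g (emeasure (N w) ({s<..t} \<times> A)))\<^sup>2 \<partial>M)"
   using mom(4) by (intro indep_events_of_integral[OF ind F_subalgebra X nm, of "%y. (g y)\<^sup>2"]) (auto simp: eq)
  ultimately show ?thesis using mom(3,5) by (simp add: eq)
 qed
 then show "(\<integral>w. X w * compensated \<nu> N s t A w \<partial>M) = 0"
  "(\<integral>w. X w * (compensated \<nu> N s t A w)\<^sup>2 \<partial>M) = measure \<nu> A * (t - s) * (\<integral>w. X w \<partial>M)" by auto
qed

text \<open>Only single increments are known to be independent of the past; products are reached by polarization.\<close>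

lemma compensated_cov_disjoint:
 assumes A: "A \<in> finite_marks" and B: "B \<in> finite_marks" and dis: "A \<inter> B = {}" and st: "0 <= s" "s <= t"
  and X: "X \<in> borel_measurable (F s)" and bd: "!!w. w \<in> space M ==> \<bar>X w\<bar> <= C"
 shows "(\<integral>w. X w * (compensated \<nu> N s t A w * compensated \<nu> N s t B w) \<partial>M) = 0"
proof -
 let ?m = "compensated \<nu> N s t"
 note XM[measurable] = F_measurable_M[OF X]
 have Xi: "integrable M X" using bd by (intro integrable_const_bound[of _ C]) auto
 have AB: "A \<union> B \<in> finite_marks" using finite_marks_Un[OF A B] .
 have nu: "measure \<nu> (A \<union> B) = measure \<nu> A + measure \<nu> B"
  using A B dis by (intro measure_Union) (auto simp: finite_marks_def)
 note meas[measurable] = compensated_measurable[OF A st] compensated_measurable[OF B st] compensated_measurable[OF AB st]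
 have int: "integrable M (%w. X w * ?m C w * ?m D w)" if "C \<in> finite_marks" "D \<in> finite_marks" for C D
  by (rule cauchy_schwarz_l2(1)[OF l2norm_mult_bounded[OF XM bd compensated_l2[OF that(1) st]] compensated_l2[OF that(2) st]])
 have "(\<integral>w. X w * (?m (A \<union> B) w)\<^sup>2 \<partial>M) =
   (\<integral>w. X w * (?m A w)\<^sup>2 + X w * (?m B w)\<^sup>2 + 2 * (X w * (?m A w * ?m B w)) \<partial>M)"
 proof (rule integral_cong_AE)
  show "AE w in M. X w * (?m (A \<union> B) w)\<^sup>2 = X w * (?m A w)\<^sup>2 + X w * (?m B w)\<^sup>2 + 2 * (X w * (?m A w * ?m B w))"
   using compensated_add_marks[OF A B dis st] by eventually_elim (simp add: power2_eq_square algebra_simps)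
 qed measurable
 also have "... = (\<integral>w. X w * (?m A w)\<^sup>2 \<partial>M) + (\<integral>w. X w * (?m B w)\<^sup>2 \<partial>M) + 2 * (\<integral>w. X w * (?m A w * ?m B w) \<partial>M)"
  using int[OF A A] int[OF B B] int[OF A B] by (simp add: power2_eq_square mult.assoc)
 \<comment> \<open>The three squares have expectations proportional to \<nu>, so additivity of \<nu>
   leaves nothing for the mixed term.\<close>
 finally show ?thesis
  unfolding nu compensated_indep(2)[OF A st X Xi] compensated_indep(2)[OF B st X Xi] compensated_indep(2)[OF AB st X Xi]
  by (simp add: algebra_simps)
qed

text \<open>For the covariance, A and B are split into their intersection and differences. Products
  over disjoint mark sets have mean 0, and only the square over the intersection survives.\<close>

sublocale N: orthogonal_noise M F "compensated \<nu> N" finite_marks "%A B. measure \<nu> (A \<inter> B)"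
proof
 fix A B and s t :: real and X :: "'a => real" and C :: real
 assume A: "A \<in> finite_marks" and st: "0 <= s" "s <= t"
 show "compensated \<nu> N s t A \<in> borel_measurable (F t)" by (rule compensated_adapted[OF A st])
 show "l2norm M (compensated \<nu> N s t A) < \<infinity>" by (rule compensated_l2[OF A st])
 assume X: "X \<in> borel_measurable (F s)"
 note XM[measurable] = F_measurable_M[OF X]
 show "(\<integral>w. X w * compensated \<nu> N s t A w \<partial>M) = 0" if "l2norm M X < \<infinity>"
  by (rule compensated_indep(1)[OF A st X l2norm_finite_integrable[OF that]])
 assume B: "B \<in> finite_marks" and bd: "!!w. w \<in> space M ==> \<bar>X w\<bar> <= C"
 have Xi: "integrable M X" using bd by (intro integrable_const_bound[of _ C]) auto
 let ?m = "compensated \<nu> N s t"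
 let ?I = "A \<inter> B" and ?A = "A - B" and ?B = "B - A"
 have fm: "?I \<in> finite_marks" "?A \<in> finite_marks" "?B \<in> finite_marks"
  using A B by (auto intro: finite_marks_Int finite_marks_Diff)
 note meas[measurable] = compensated_measurable[OF A st] compensated_measurable[OF B st]
  compensated_measurable[OF fm(1) st] compensated_measurable[OF fm(2) st] compensated_measurable[OF fm(3) st]
 have int: "integrable M (%w. X w * (?m C w * ?m D w))" if "C \<in> finite_marks" "D \<in> finite_marks" for C D
  using cauchy_schwarz_l2(1)[OF l2norm_mult_bounded[OF XM bd compensated_l2[OF that(1) st]] compensated_l2[OF that(2) st]]
  by (simp add: mult.assoc)
 have "(\<integral>w. X w * (?m A w * ?m B w) \<partial>M) =
   (\<integral>w. X w * (?m ?I w * ?m ?I w) + X w * (?m ?I w * ?m ?B w) + X w * (?m ?A w * ?m ?I w) + X w * (?m ?A w * ?m ?B w) \<partial>M)"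
 proof (rule integral_cong_AE)
  have eqs: "?A \<union> ?I = A" "?B \<union> ?I = B" by auto
  have 1: "AE w in M. ?m A w = ?m ?A w + ?m ?I w"
   using compensated_add_marks[OF fm(2,1) _ st] unfolding eqs by blast
  have 2: "AE w in M. ?m B w = ?m ?B w + ?m ?I w"
   using compensated_add_marks[OF fm(3,1) _ st] unfolding eqs by blast
  from 1 2 show "AE w in M. X w * (?m A w * ?m B w) =
   X w * (?m ?I w * ?m ?I w) + X w * (?m ?I w * ?m ?B w) + X w * (?m ?A w * ?m ?I w) + X w * (?m ?A w * ?m ?B w)"
   by eventually_elim (simp add: algebra_simps)
 qed measurable
 also have "... = (\<integral>w. X w * (?m ?I w * ?m ?I w) \<partial>M) + (\<integral>w. X w * (?m ?I w * ?m ?B w) \<partial>M) +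
   (\<integral>w. X w * (?m ?A w * ?m ?I w) \<partial>M) + (\<integral>w. X w * (?m ?A w * ?m ?B w) \<partial>M)"
  using int fm by simp
 also have "(\<integral>w. X w * (?m ?I w * ?m ?B w) \<partial>M) = 0"
  by (rule compensated_cov_disjoint[OF fm(1,3) _ st X bd]) auto
 also have "(\<integral>w. X w * (?m ?A w * ?m ?I w) \<partial>M) = 0"
  by (rule compensated_cov_disjoint[OF fm(2,1) _ st X bd]) auto
 also have "(\<integral>w. X w * (?m ?A w * ?m ?B w) \<partial>M) = 0"
  by (rule compensated_cov_disjoint[OF fm(2,3) _ st X bd]) auto
 finally show "(\<integral>w. X w * (?m A w * ?m B w) \<partial>M) = measure \<nu> (A \<inter> B) * (t - s) * (\<integral>w. X w \<partial>M)"
  using compensated_indep(2)[OF fm(1) st X Xi] by (simp add: power2_eq_square)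
qed (auto intro: F_subalgebra compensated_add_time F_sets_mono[THEN subsetD] simp: Int_commute)

end

section \<open>Density of simple functions in mean square\<close>

lemma l2norm_dominated_convergence:
 assumes [measurable]: "!!n. f n \<in> borel_measurable N" "g \<in> borel_measurable N"
  and w: "l2norm N w < \<infinity>" and bd: "!!n. AE x in N. \<bar>f n x\<bar> <= \<bar>w x\<bar>"
  and lim: "AE x in N. (%n. f n x) \<longlonglongrightarrow> g x"
 shows "l2norm N g < \<infinity>" "(%n. l2norm N (%x. f n x - g x)) \<longlonglongrightarrow> 0"
proof -
 note W = l2norm_finiteD[OF w]
 note [measurable] = W(1)
 have bd': "AE x in N. \<forall>n. \<bar>f n x\<bar> <= \<bar>w x\<bar>" using bd by (simp add: AE_all_countable)
 have gw: "AE x in N. \<bar>g x\<bar> <= \<bar>w x\<bar>"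
  using bd' lim
 proof eventually_elim
  case (elim x)
  have "(%n. \<bar>f n x\<bar>) \<longlonglongrightarrow> \<bar>g x\<bar>" using elim(2) by (rule tendsto_rabs)
  then show ?case by (rule LIMSEQ_le_const2) (use elim(1) in auto)
 qed
 have "l2norm N g <= l2norm N w" by (rule l2norm_mono) (use gw in auto)
 then show g: "l2norm N g < \<infinity>" using w by (rule le_less_trans)
 have fin: "l2norm N (%x. f n x - g x) < \<infinity>" for n
 proof -
  have "l2norm N (f n) <= l2norm N w" by (rule l2norm_mono) (use bd in auto)
  then have "l2norm N (f n) < \<infinity>" using w by (rule le_less_trans)
  then show ?thesis using g by (rule l2norm_diff_finite)
 qed
 have "(%n. \<integral>x. (f n x - g x)\<^sup>2 \<partial>N) \<longlonglongrightarrow> (\<integral>x. 0 \<partial>N)"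
 proof (rule integral_dominated_convergence[where w = "%x. 4 * (w x)\<^sup>2"])
  show "integrable N (%x. 4 * (w x)\<^sup>2)" using W(2) by simp
  show "AE x in N. (%n. (f n x - g x)\<^sup>2) \<longlonglongrightarrow> 0"
   using lim
  proof eventually_elim
   case (elim x)
   then have "(%n. (f n x - g x)\<^sup>2) \<longlonglongrightarrow> (g x - g x)\<^sup>2" by (intro tendsto_intros)
   then show ?case by simp
  qed
  show "AE x in N. norm ((f n x - g x)\<^sup>2) <= 4 * (w x)\<^sup>2" for n
   using bd[of n] gw
  proof eventually_elim
   case (elim x)
   then have "\<bar>f n x - g x\<bar> <= \<bar>2 * w x\<bar>" by linarith
   then have "(f n x - g x)\<^sup>2 <= (2 * w x)\<^sup>2" by (simp only: abs_le_square_iff)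
   then show ?case by (simp add: power_mult_distrib)
  qed
 qed measurable
 then have "(%n. sqrt (\<integral>x. (f n x - g x)\<^sup>2 \<partial>N)) \<longlonglongrightarrow> sqrt 0"
  by (intro tendsto_real_sqrt) simp
 then have "(%n. ennreal (sqrt (\<integral>x. (f n x - g x)\<^sup>2 \<partial>N))) \<longlonglongrightarrow> ennreal (sqrt 0)"
  by (rule tendsto_ennrealI)
 then show "(%n. l2norm N (%x. f n x - g x)) \<longlonglongrightarrow> 0"
  using l2norm_finiteD(3)[OF fin] by (simp add: rnorm_def)
qed

definition lin_comb :: "('x set \<times> real) list => 'x => real" where
 "lin_comb L x = (\<Sum>(A, k)\<leftarrow>L. k * indicator A x)"

lemma lin_comb_append: "lin_comb (L @ L') x = lin_comb L x + lin_comb L' x"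
 by (simp add: lin_comb_def)

lemma lin_comb_scale: "lin_comb (map (%(A, k). (A, a * k)) L) x = a * lin_comb L x"
 by (induction L) (auto simp: lin_comb_def algebra_simps)

text \<open>Membership in the mean square closure of the linear span of the indicators of sets in
  E.\<close>

definition approximable :: "'x measure => 'x set set => ('x => real) => bool" where
 "approximable N E \<phi> \<longleftrightarrow>
  (\<forall>e>0. \<exists>L. fst ` set L \<subseteq> E \<and> l2norm N (%x. lin_comb L x - \<phi> x) <= ennreal e)"

lemma approximable_generator: "A \<in> E ==> approximable N E (indicator A)"
 unfolding approximable_def by (intro allI impI exI[of _ "[(A, 1)]"]) (auto simp: lin_comb_def)

lemma approximable_zero: "approximable N E (%x. 0)"
 unfolding approximable_def by (intro allI impI exI[of _ "[]"]) (auto simp: lin_comb_def)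

lemma approximable_add:
 assumes "approximable N E \<phi>" "approximable N E \<psi>"
 shows "approximable N E (%x. \<phi> x + \<psi> x)"
 unfolding approximable_def
proof (intro allI impI)
 fix e :: real assume e: "e > 0"
 then have "e / 2 > 0" by simp
 with assms obtain L L' where L: "fst ` set L \<subseteq> E" "l2norm N (%x. lin_comb L x - \<phi> x) <= ennreal (e / 2)"
  and L': "fst ` set L' \<subseteq> E" "l2norm N (%x. lin_comb L' x - \<psi> x) <= ennreal (e / 2)"
  unfolding approximable_def by meson
 have "l2norm N (%x. lin_comb (L @ L') x - (\<phi> x + \<psi> x)) <=
   l2norm N (%x. lin_comb L x - \<phi> x) + l2norm N (%x. lin_comb L' x - \<psi> x)"
  using l2norm_triangle[of N "%x. lin_comb L x - \<phi> x" "%x. lin_comb L' x - \<psi> x"]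
  by (simp add: lin_comb_append algebra_simps)
 also have "... <= ennreal (e / 2) + ennreal (e / 2)" using L(2) L'(2) by (rule add_mono)
 also have "... = ennreal e" using e by (simp add: ennreal_plus[symmetric] del: ennreal_plus)
 finally show "\<exists>L. fst ` set L \<subseteq> E \<and> l2norm N (%x. lin_comb L x - (\<phi> x + \<psi> x)) <= ennreal e"
  using L(1) L'(1) by (intro exI[of _ "L @ L'"]) auto
qed

lemma approximable_scale:
 assumes "approximable N E \<phi>"
 shows "approximable N E (%x. a * \<phi> x)"
 unfolding approximable_def
proof (intro allI impI)
 fix e :: real assume e: "e > 0"
 define d where "d = e / (\<bar>a\<bar> + 1)"
 have d: "d > 0" "\<bar>a\<bar> * d <= e" using e by (auto simp: d_def field_simps)
 obtain L where L: "fst ` set L \<subseteq> E" "l2norm N (%x. lin_comb L x - \<phi> x) <= ennreal d"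
  using assms d(1) unfolding approximable_def by meson
 let ?L = "map (%(A, k). (A, a * k)) L"
 have "l2norm N (%x. lin_comb ?L x - a * \<phi> x) = ennreal \<bar>a\<bar> * l2norm N (%x. lin_comb L x - \<phi> x)"
  unfolding lin_comb_scale l2norm_scale[symmetric] by (simp add: right_diff_distrib)
 also have "... <= ennreal \<bar>a\<bar> * ennreal d" by (rule mult_left_mono[OF L(2)]) simp
 also have "... <= ennreal e" using d by (simp add: ennreal_mult[symmetric] ennreal_leI)
 finally show "\<exists>L. fst ` set L \<subseteq> E \<and> l2norm N (%x. lin_comb L x - a * \<phi> x) <= ennreal e"
  using L(1) by (intro exI[of _ ?L]) (auto simp: image_image case_prod_beta)
qed

lemma approximable_sum: "(!!i. i \<in> I ==> approximable N E (\<phi> i)) ==> approximable N E (%x. \<Sum>i\<in>I. \<phi> i x)"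
 by (induction I rule: infinite_finite_induct) (auto intro: approximable_zero approximable_add)

lemma approximable_close:
 assumes "!!e. e > 0 ==> \<exists>\<psi>. approximable N E \<psi> \<and> l2norm N (%x. \<psi> x - \<phi> x) <= ennreal e"
 shows "approximable N E \<phi>"
 unfolding approximable_def
proof (intro allI impI)
 fix e :: real assume e: "e > 0"
 then have e2: "e / 2 > 0" by simp
 obtain \<psi> where \<psi>: "approximable N E \<psi>" "l2norm N (%x. \<psi> x - \<phi> x) <= ennreal (e/2)" using assms[OF e2] by blast
 obtain L where L: "fst ` set L \<subseteq> E" "l2norm N (%x. lin_comb L x - \<psi> x) <= ennreal (e/2)"
  using \<psi>(1) e2 unfolding approximable_def by meson
 have "l2norm N (%x. lin_comb L x - \<phi> x) <= ennreal (e/2) + ennreal (e/2)"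
  using l2norm_triangle3[of N "lin_comb L" \<phi> \<psi>] add_mono[OF L(2) \<psi>(2)] by (rule order_trans)
 also have "... = ennreal e" using e by (simp add: ennreal_plus[symmetric] del: ennreal_plus)
 finally show "\<exists>L. fst ` set L \<subseteq> E \<and> l2norm N (%x. lin_comb L x - \<phi> x) <= ennreal e" using L(1) by blast
qed

lemma approximable_limit:
 assumes "!!n. approximable N E (\<psi> n)" "(%n. l2norm N (%x. \<psi> n x - \<phi> x)) \<longlonglongrightarrow> 0"
 shows "approximable N E \<phi>"
proof (rule approximable_close)
 fix e :: real assume "e > 0"
 from tendsto_ennreal_0D[OF assms(2) this] obtain n where "l2norm N (%x. \<psi> n x - \<phi> x) <= ennreal e"
  by (auto simp: eventually_sequentially)
 with assms(1) show "\<exists>\<psi>. approximable N E \<psi> \<and> l2norm N (%x. \<psi> x - \<phi> x) <= ennreal e" by blast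
qed

lemma approximable_cong_AE:
 assumes "approximable N E \<psi>" "\<psi> \<in> borel_measurable N" "\<phi> \<in> borel_measurable N" "AE x in N. \<psi> x = \<phi> x"
 shows "approximable N E \<phi>"
proof (rule approximable_close)
 fix e :: real
 have "l2norm N (%x. \<psi> x - \<phi> x) = l2norm N (%x. 0)"
  using assms by (intro l2norm_cong_AE) auto
 with assms(1) show "\<exists>\<psi>. approximable N E \<psi> \<and> l2norm N (%x. \<psi> x - \<phi> x) <= ennreal e" by auto
qed

text \<open>The approximating simple functions are dominated by 2 |\<phi>|, so only sets on which
  \<phi> has no zero occur. For a jump coefficient vanishing near 0 such sets stay away from 0 and
  have finite intensity.\<close>

lemma approximable_of_sets:
 assumes \<phi>: "l2norm N \<phi> < \<infinity>"
  and sets: "!!A. A \<in> sets N ==> (!!x. x \<in> A ==> \<phi> x \<noteq> 0) ==> approximable N E (indicator A)"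
 shows "approximable N E \<phi>"
proof -
 note P = l2norm_finiteD[OF \<phi>]
 from borel_measurable_implies_sequence_metric[OF P(1), of 0] obtain s
  where s0: "\<forall>i. simple_function N (s i)" "\<forall>x\<in>space N. (%i. s i x) \<longlonglongrightarrow> \<phi> x"
   "\<forall>i. \<forall>x\<in>space N. dist (s i x) 0 <= 2 * dist (\<phi> x) 0" by blast
 have s: "simple_function N (s i)" "x \<in> space N ==> (%i. s i x) \<longlonglongrightarrow> \<phi> x"
   "x \<in> space N ==> \<bar>s i x\<bar> <= 2 * \<bar>\<phi> x\<bar>" for i x using s0 by simp_all
 have sm: "s i \<in> borel_measurable N" for i using s(1) by (rule borel_measurable_simple_function)
 have "(%n. l2norm N (%x. s n x - \<phi> x)) \<longlonglongrightarrow> 0"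
 proof (rule l2norm_dominated_convergence(2))
  show "l2norm N (%x. 2 * \<phi> x) < \<infinity>" by (rule l2norm_scale_finite[OF \<phi>])
 qed (use sm P(1) s(2,3) in \<open>auto simp: abs_mult\<close>)
 moreover have "approximable N E (s n)" for n
 proof -
  let ?g = "%x. \<Sum>y\<in>s n ` space N - {0}. y * indicator (s n -` {y} \<inter> space N) x"
  have fin: "finite (s n ` space N)" using s(1) by (rule simple_functionD(1))
  have "approximable N E ?g"
  proof (intro approximable_sum approximable_scale sets)
   fix y x assume y: "y \<in> s n ` space N - {0}" and x: "x \<in> s n -` {y} \<inter> space N"
   with s(3)[of x n] show "\<phi> x \<noteq> 0" by auto
  qed (use s(1) simple_functionD(2) in auto)
  moreover have "?g x = s n x" if "x \<in> space N" for x
  proof -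
   have "?g x = (\<Sum>y\<in>s n ` space N - {0}. if y = s n x then y else 0)"
    using that by (intro sum.cong) (auto simp: indicator_def)
   also have "... = s n x" using fin that by (subst sum.delta) auto
   finally show ?thesis .
  qed
  ultimately show ?thesis unfolding approximable_def by (simp cong: l2norm_cong)
 qed
 ultimately show ?thesis by (rule approximable_limit[rotated])
qed

lemma approximableD_seq:
 assumes "approximable N E \<phi>"
 obtains L where "!!n. fst ` set (L n) \<subseteq> E" "(%n. l2norm N (%x. lin_comb (L n) x - \<phi> x)) \<longlonglongrightarrow> 0"
proof -
 have "\<forall>n. \<exists>L. fst ` set L \<subseteq> E \<and> l2norm N (%x. lin_comb L x - \<phi> x) <= ennreal (1 / real (Suc n))"
  using assms unfolding approximable_def by simp
 then obtain L where L: "!!n. fst ` set (L n) \<subseteq> E" "!!n. l2norm N (%x. lin_comb (L n) x - \<phi> x) <= ennreal (1 / real (Suc n))"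
  by metis
 have "(%n. ennreal (1 / real (Suc n))) \<longlonglongrightarrow> ennreal 0"
  by (intro tendsto_ennrealI LIMSEQ_Suc lim_1_over_n)
 then have "(%n. ennreal (1 / real (Suc n))) \<longlonglongrightarrow> 0" by simp
 then have "(%n. l2norm N (%x. lin_comb (L n) x - \<phi> x)) \<longlonglongrightarrow> 0"
  by (rule tendsto_ennreal_0_le[where g = "%n. ennreal (1 / real (Suc n))", OF _ always_eventually])
   (use L(2) in auto)
 with L(1) that show ?thesis by blast
qed

definition subintervals :: "real => real set set" where
 "subintervals s = {{a<..b} | a b. 0 <= a \<and> a <= b \<and> b <= s}"

abbreviation time_measure :: "real => real measure" where
 "time_measure t \<equiv> restrict_space lborel {0..t}"

lemma finite_time_measure: "finite_measure (time_measure t)"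
 by (rule finite_measureI) (simp add: emeasure_restrict_space space_restrict_space emeasure_lborel_Icc_eq)

lemma measurable_time_measure: "f \<in> borel_measurable borel ==> f \<in> borel_measurable (time_measure t)"
 by (intro measurable_restrict_space1) simp

lemma AE_time_measure_pos: "AE r in time_measure t. 0 < r"
proof -
 have "AE r in lborel. r \<noteq> (0::real)" by (rule AE_lborel_singleton)
 then show ?thesis by (subst AE_restrict_space_iff) auto
qed

text \<open>Dynkin's argument: sets with approximable indicator are closed under complements and
  disjoint unions, and half-lines form an intersection-stable generator.\<close>

lemma approximable_Borel_time:
 assumes s: "0 <= s" and A: "A \<in> sets borel"
 shows "approximable (time_measure s) (subintervals s) (indicator A)"
proof -
 let ?N = "time_measure s"
 interpret finite_measure ?N by (rule finite_time_measure)
 have ind_meas: "(indicator A :: real => real) \<in> borel_measurable ?N" if "A \<in> sets borel" for A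
  using that by (intro measurable_time_measure) simp
 have one: "approximable ?N (subintervals s) (%_. 1)"
 proof (rule approximable_cong_AE)
  show "approximable ?N (subintervals s) (indicator {0<..s})"
   using s by (intro approximable_generator) (auto simp: subintervals_def)
  show "AE x in ?N. indicator {0<..s} x = 1"
   using AE_time_measure_pos[of s] AE_space by eventually_elim (auto simp: space_restrict_space)
 qed (auto intro: ind_meas)
 have "Int_stable (range (%a::real. {..a}))" by (auto simp: Int_stable_def)
 moreover have "range (%a::real. {..a}) \<subseteq> Pow UNIV" by simp
 moreover have "A \<in> sigma_sets UNIV (range (%a::real. {..a}))"
  using A unfolding borel_eq_atMost by simp
 ultimately show ?thesis
 proof (induction A rule: sigma_sets_induct_disjoint)
  case (basic A)
  then obtain a where a: "A = {..a}" by auto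
  \<comment> \<open>On [0,s], and off the null set {0}, the half-line up to a coincides with
    (0,b].\<close>
  define b where "b = min s (max 0 a)"
  show ?case
  proof (rule approximable_cong_AE)
   show "approximable ?N (subintervals s) (indicator {0<..b})"
    using s unfolding subintervals_def b_def
    by (intro approximable_generator CollectI exI[of _ 0] exI[of _ "min s (max 0 a)"]) auto
   show "AE x in ?N. indicator {0<..b} x = (indicator A x :: real)"
    using AE_time_measure_pos[of s] AE_space
    by eventually_elim (auto simp: space_restrict_space a b_def indicator_def)
  qed (auto intro: ind_meas simp: a)
 next
  case empty
  then show ?case using approximable_zero by (simp add: indicator_def)
 next
  case (compl A)
  have "approximable ?N (subintervals s) (%x. 1 + (-1) * indicator A x)"
   by (intro approximable_add approximable_scale one compl.IH)
  moreover have "(%x. 1 + (-1) * indicator A x) = (indicator (UNIV - A) :: real => real)"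
   by (auto simp: fun_eq_iff indicator_def)
  ultimately show ?case by simp
 next
  case (union A)
  have Ab: "A i \<in> sets borel" for i using union(2) unfolding borel_eq_atMost by auto
  show ?case
  proof (rule approximable_limit)
   show "approximable ?N (subintervals s) (%x. \<Sum>i<n. indicator (A i) x)" for n
    by (intro approximable_sum union(3))
   have eq: "(\<Sum>i<n. indicator (A i) x) = (indicator (\<Union>i<n. A i) x :: real)" for n x
    using union(1) by (subst indicator_UN_disjoint) (auto simp: disjoint_family_on_def)
   show "(%n. l2norm ?N (%x. (\<Sum>i<n. indicator (A i) x) - indicator (\<Union>i. A i) x)) \<longlonglongrightarrow> 0"
   proof (rule l2norm_dominated_convergence(2)[where w = "%_. 1"])
    show "l2norm ?N (%_. 1) < \<infinity>"
     by (rule l2norm_bounded_finite[OF finite_measure_axioms, of _ 1]) auto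
    show "AE x in ?N. (%n. \<Sum>i<n. indicator (A i) x) \<longlonglongrightarrow> (indicator (\<Union>i. A i) x :: real)"
     unfolding eq by (intro AE_I2 LIMSEQ_indicator_UN)
    show "AE x in ?N. \<bar>\<Sum>i<n. indicator (A i) x\<bar> <= \<bar>1::real\<bar>" for n
     unfolding eq by (intro AE_I2) (auto simp: indicator_def)
    show "(%x. \<Sum>i<n. indicator (A i) x :: real) \<in> borel_measurable ?N" for n
     unfolding eq using Ab by (intro ind_meas) auto
    show "(indicator (\<Union>i. A i) :: real => real) \<in> borel_measurable ?N"
     using Ab by (intro ind_meas) auto
   qed
  qed
 qed
qed

lemma step_functions_dense:
 assumes s: "0 <= s" and \<phi>: "l2norm (time_measure s) \<phi> < \<infinity>"
 shows "approximable (time_measure s) (subintervals s) \<phi>"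
proof (rule approximable_of_sets[OF \<phi>])
 fix A assume "A \<in> sets (time_measure s)"
 then have "A \<in> sets borel" by (auto simp: sets_restrict_space)
 then show "approximable (time_measure s) (subintervals s) (indicator A)"
  by (rule approximable_Borel_time[OF s])
qed

text \<open>The overlap is written with the stopped end points of
  \<open>pair_isometry_stopped\<close>, so that both sides of the isometry match literally. The two
  choices of S are the time domains of the Wiener and the Levy integral.\<close>

lemma integral_time_overlap:
 fixes t a b a' b' :: real
 assumes S: "S = {0..t} \<or> S = {0<..t}" and t: "0 <= t" and ab: "0 <= a" "a <= b" "0 <= a'" "a' <= b'"
 shows "(\<integral>r. indicator {a<..b} r * indicator {a'<..b'} r \<partial>restrict_space lborel S) =
  max 0 (min (min b t) (min b' t) - max (min a t) (min a' t))"
proof -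
 have Sb: "S \<in> sets borel" using S by auto
 have "(\<integral>r. indicator {a<..b} r * indicator {a'<..b'} r \<partial>restrict_space lborel S) =
   (\<integral>r. indicator S r *\<^sub>R (indicator {a<..b} r * indicator {a'<..b'} r :: real) \<partial>lborel)"
  using Sb by (subst integral_restrict_space) auto
 also have "... = (\<integral>r. indicator {max a a'<..min (min b b') t} r \<partial>lborel)"
  using S ab by (intro Bochner_Integration.integral_cong) (auto simp: indicator_def)
 also have "... = measure lborel {max a a'<..min (min b b') t}" by simp
 also have "... = max 0 (min (min b t) (min b' t) - max (min a t) (min a' t))"
 proof -
  define x y where "x = min (min b b') t" and "y = max a a'"
  have eqs: "min (min b t) (min b' t) = x" "max (min a t) (min a' t) = min y t"
   unfolding x_def y_def by linarith+
  have xt: "x <= t" by (simp add: x_def)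
  show ?thesis
   unfolding eqs x_def[symmetric] y_def[symmetric]
  proof (cases "y <= x")
   case True
   then show "measure lborel {y<..x} = max 0 (x - min y t)" using xt by simp
  next
   case False
   then have "{y<..x} = {}" by auto
   then show "measure lborel {y<..x} = max 0 (x - min y t)" using False xt by simp
  qed
 qed
 finally show ?thesis .
qed

lemma integrable_time_overlap:
 fixes S :: "real set"
 assumes S: "S \<in> sets borel" "emeasure lborel S < \<infinity>"
 shows "integrable (restrict_space lborel S) (%r. indicator {a<..b} r * indicator {a'<..b'} r :: real)"
proof -
 interpret finite_measure "restrict_space lborel S"
  using S by (intro finite_measureI) (simp add: emeasure_restrict_space space_restrict_space)
 show ?thesis
  by (intro integrable_const_bound[of _ 1] AE_I2 borel_measurable_times measurable_restrict_space1) (auto simp: indicator_def)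
qed

lemma finite_restrict_lborel:
 assumes "S \<in> sets borel" "emeasure lborel S < \<infinity>"
 shows "finite_measure (restrict_space lborel S)"
 using assms by (intro finite_measureI) (simp add: emeasure_restrict_space space_restrict_space)

lemma l2norm_product:
 fixes f :: "'x => real" and g :: "'y => real"
 assumes "sigma_finite_measure N1" "sigma_finite_measure N2" and f: "l2norm N1 f < \<infinity>" and g: "l2norm N2 g < \<infinity>"
 shows "l2norm (N1 \<Otimes>\<^sub>M N2) (%(x, y). f x * g y) = l2norm N1 f * l2norm N2 g"
  "(%(x, y). f x * g y) \<in> borel_measurable (N1 \<Otimes>\<^sub>M N2)"
proof -
 interpret pair_sigma_finite N1 N2 using assms(1,2) by (rule pair_sigma_finite.intro)
 note F = l2norm_finiteD[OF f] and G = l2norm_finiteD[OF g]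
 note [measurable] = F(1) G(1)
 show meas: "(%(x, y). f x * g y) \<in> borel_measurable (N1 \<Otimes>\<^sub>M N2)" by measurable
 have sq: "(%p. (case p of (x, y) => f x * g y)\<^sup>2) = (%(x, y). (f x)\<^sup>2 * (g y)\<^sup>2)"
  by (auto simp: power_mult_distrib)
 note I = integral_mult_product[OF F(2) G(2)]
 show "l2norm (N1 \<Otimes>\<^sub>M N2) (%(x, y). f x * g y) = l2norm N1 f * l2norm N2 g"
  using meas I unfolding F(3) G(3)
  by (simp add: l2norm_def sq rnorm_def real_sqrt_mult ennreal_mult)
qed

section \<open>Ito isometry for the Wiener process\<close>

context noise
begin

abbreviation QW :: "real => (real \<times> 'a) measure" where
 "QW t \<equiv> time_measure t \<Otimes>\<^sub>M M"

definition W_adm :: "(real \<times> real \<times> ('a => real)) set" where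
 "W_adm = {(a, b, \<xi>). 0 <= a \<and> a <= b \<and> \<xi> \<in> borel_measurable (F a) \<and> (\<exists>C. \<forall>w\<in>space M. \<bar>\<xi> w\<bar> <= C)}"

definition W_val :: "real \<times> real \<times> ('a => real) => real \<times> 'a => real" where
 "W_val = (%(a, b, \<xi>) (r, w). \<xi> w * indicator {a<..b} r)"

definition W_int :: "real => real \<times> real \<times> ('a => real) => 'a => real" where
 "W_int t = (%(a, b, \<xi>) w. \<xi> w * (W (min b t) w - W (min a t) w))"

definition W_scale :: "real => real \<times> real \<times> ('a => real) => real \<times> real \<times> ('a => real)" where
 "W_scale k = (%(a, b, \<xi>). (a, b, %w. k * \<xi> w))"

lemma bounded_scale: "\<exists>C. \<forall>w\<in>S. \<bar>\<xi> w\<bar> <= C ==> \<exists>C. \<forall>w\<in>S. \<bar>k * \<xi> w :: real\<bar> <= C"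
 by (metis abs_ge_zero abs_mult mult_left_mono)

lemma integrable_bounded_product:
 assumes "\<xi> \<in> borel_measurable (F a)" "\<eta> \<in> borel_measurable (F b)"
  "\<exists>C. \<forall>w\<in>space M. \<bar>\<xi> w\<bar> <= C" "\<exists>C. \<forall>w\<in>space M. \<bar>\<eta> w\<bar> <= C"
 shows "integrable M (%w. \<xi> w * \<eta> w :: real)"
proof -
 note [measurable] = assms(1,2)[THEN F_measurable_M]
 obtain C D where C: "!!w. w \<in> space M ==> \<bar>\<xi> w\<bar> <= C" and D: "!!w. w \<in> space M ==> \<bar>\<eta> w\<bar> <= D" using assms by blast
 have "\<bar>\<xi> w * \<eta> w\<bar> <= \<bar>C\<bar> * \<bar>D\<bar>" if "w \<in> space M" for w
  unfolding abs_mult using C[OF that] D[OF that] by (intro mult_mono) auto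
 then show ?thesis by (intro integrable_const_bound[of _ "\<bar>C\<bar> * \<bar>D\<bar>"]) auto
qed

text \<open>Both inner products factor into the expectation of \<xi> \<eta> and the length of the
  overlap of the two intervals within [0,t].\<close>

lemma W_isometric:
 assumes t: "0 <= t"
 shows "isometric_family (QW t) M W_adm W_val (W_int t) W_scale"
proof
 interpret T: finite_measure "time_measure t" by (rule finite_time_measure)
 interpret TM: pair_sigma_finite "time_measure t" M ..
 have prod: "integrable (QW t) (%q. W_val e q * W_val e' q) \<and> (\<integral>q. W_val e q * W_val e' q \<partial>QW t) =
   (case e of (a, b, \<xi>) => case e' of (a', b', \<eta>) =>
    max 0 (min (min b t) (min b' t) - max (min a t) (min a' t)) * (\<integral>w. \<xi> w * \<eta> w \<partial>M))"
  if e: "e \<in> W_adm" "e' \<in> W_adm" for e e'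
 proof -
  obtain a b \<xi> a' b' \<eta> where eq: "e = (a, b, \<xi>)" "e' = (a', b', \<eta>)" by (cases e, cases e') auto
  have f: "(%q. W_val e q * W_val e' q) = (%(r, w). (indicator {a<..b} r * indicator {a'<..b'} r) * (\<xi> w * \<eta> w))"
   by (auto simp: eq W_val_def fun_eq_iff)
  have I1: "integrable (time_measure t) (%r. indicator {a<..b} r * indicator {a'<..b'} r :: real)"
   by (rule integrable_time_overlap) (auto simp: emeasure_lborel_Icc_eq)
  have I2: "integrable M (%w. \<xi> w * \<eta> w)"
   using e by (intro integrable_bounded_product) (auto simp: eq W_adm_def)
  have ab: "0 <= a" "a <= b" "0 <= a'" "a' <= b'" using e by (auto simp: eq W_adm_def)
  show ?thesis
   unfolding f TM.integral_mult_product(2)[OF I1 I2] integral_time_overlap[OF disjI1[OF refl] t ab]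
   by (simp only: eq prod.case TM.integral_mult_product(1)[OF I1 I2] simp_thms)
 qed
 fix e e' :: "real \<times> real \<times> ('a => real)" and k :: real and q w
 show "W_val (W_scale k e) q = k * W_val e q" by (cases e, cases q) (simp add: W_val_def W_scale_def)
 show "W_int t (W_scale k e) w = k * W_int t e w" by (cases e) (simp add: W_int_def W_scale_def)
 assume e: "e \<in> W_adm"
 obtain a b \<xi> where eq: "e = (a, b, \<xi>)" by (cases e) auto
 with e obtain C where C: "0 <= a" "a <= b" "\<xi> \<in> borel_measurable (F a)" "!!w. w \<in> space M ==> \<bar>\<xi> w\<bar> <= C"
  by (auto simp: W_adm_def)
 note [measurable] = F_measurable_M[OF C(3)]
 show "W_scale k e \<in> W_adm" using e by (auto simp: eq W_scale_def W_adm_def intro!: bounded_scale)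
 have "W_val e \<in> borel_measurable (QW t)"
 proof -
  have [measurable]: "(indicator {a<..b} :: real => real) \<in> borel_measurable (time_measure t)"
   by (rule measurable_time_measure) simp
  show ?thesis unfolding eq W_val_def prod.case by measurable
 qed
 then show "l2norm (QW t) (W_val e) < \<infinity>"
  using prod[OF e e] by (simp add: l2norm_def power2_eq_square)
 show "l2norm M (W_int t e) < \<infinity>"
  using W.stopped_l2[of "()" t a b \<xi> C] C t by (simp add: W_int_def eq)
 assume e': "e' \<in> W_adm"
 obtain a' b' \<eta> where eq': "e' = (a', b', \<eta>)" by (cases e') auto
 with e' obtain C' where C': "0 <= a'" "a' <= b'" "\<eta> \<in> borel_measurable (F a')" "!!w. w \<in> space M ==> \<bar>\<eta> w\<bar> <= C'"
  by (auto simp: W_adm_def)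
 show "(\<integral>q. W_val e q * W_val e' q \<partial>QW t) = (\<integral>w. W_int t e w * W_int t e' w \<partial>M)"
 proof -
  let ?X = "max 0 (min (min b t) (min b' t) - max (min a t) (min a' t))"
  have L: "(\<integral>q. W_val e q * W_val e' q \<partial>QW t) = ?X * (\<integral>w. \<xi> w * \<eta> w \<partial>M)"
   using prod[OF e e', THEN conjunct2] unfolding eq eq' prod.case .
  have R: "(\<integral>w. W_int t e w * W_int t e' w \<partial>M) = (\<integral>w. \<xi> w * \<eta> w \<partial>M) * (1 * ?X)"
   unfolding eq eq' W_int_def prod.case
   by (rule W.pair_isometry_stopped[OF UNIV_I UNIV_I t C(1,2) C'(1,2) C(3,4) C'(3,4)])
  show ?thesis unfolding L R by (simp only: mult_1 mult.commute)
 qed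
qed

abbreviation W_has_int where
 "W_has_int t \<equiv> isometric_family.has_int (QW t) M W_adm W_val (W_int t)"

lemma W_V:
 fixes t :: real
 assumes "0 <= t"
 shows "isometric_family.V W_val S q = (%(r, w). wiener_simple_value S r w) q"
 using isometric_family.V_def[OF W_isometric[OF assms], of S q]
 by (simp add: wiener_simple_value_def W_val_def case_prod_beta')

lemma W_J:
 assumes "0 <= t"
 shows "isometric_family.J (W_int t) S = wiener_simple_integral W S t"
proof
 fix w
 show "isometric_family.J (W_int t) S w = wiener_simple_integral W S t w"
  using isometric_family.J_def[OF W_isometric[OF assms], of S w]
  by (simp add: wiener_simple_integral_def W_int_def case_prod_beta')
qed

text \<open>Identifies the Ito integral with the abstract closure, so that norm, linearity and
  uniqueness become available for it.\<close>

lemma has_wiener_integral_iff: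
 assumes t: "0 <= t"
 shows "has_wiener_integral M F W t \<phi> I \<longleftrightarrow> W_has_int t (%(r, w). \<phi> r w) I"
proof -
 interpret isometric_family "QW t" M W_adm W_val "W_int t" W_scale by (rule W_isometric[OF t])
 have adm: "wiener_simple M F S \<longleftrightarrow> set S \<subseteq> W_adm" for S
  by (auto simp: wiener_simple_def W_adm_def)
 have "(%n. \<integral>\<^sup>+ (r, w). ennreal ((wiener_simple_value (S n) r w - \<phi> r w)\<^sup>2) \<partial>QW t) \<longlonglongrightarrow> 0 \<longleftrightarrow>
   (%n. l2norm (QW t) (%q. V (S n) q - (%(r, w). \<phi> r w) q)) \<longlonglongrightarrow> 0"
  if "(%(r, w). \<phi> r w) \<in> borel_measurable (QW t)" "!!n. set (S n) \<subseteq> W_adm" for S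
 proof -
  have "(%q. V (S n) q - (%(r, w). \<phi> r w) q) \<in> borel_measurable (QW t)" for n
   using l2norm_finiteD(1)[OF V_l2[OF that(2)]] that(1) by (rule borel_measurable_diff)
  note iff = l2norm_tendsto_0_iff[OF this]
  have eq: "(%(r, w). ennreal ((wiener_simple_value (S n) r w - \<phi> r w)\<^sup>2)) =
    (%q. ennreal ((V (S n) q - (%(r, w). \<phi> r w) q)\<^sup>2))" for n
   by (auto simp: W_V[OF t])
  show ?thesis unfolding eq by (rule iff)
 qed
 then show ?thesis
  unfolding has_wiener_integral_def has_int_def Let_def adm W_J[OF t]
  by blast
qed

end

section \<open>Ito isometry for the compensated Poisson measure\<close>

context noise
begin

abbreviation QL :: "real => (real \<times> 'e \<times> 'a) measure" where
 "QL t \<equiv> restrict_space lborel {0<..t} \<Otimes>\<^sub>M (\<nu> \<Otimes>\<^sub>M M)"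

definition N_adm :: "(real \<times> real \<times> 'e set \<times> ('a => real)) set" where
 "N_adm = {(a, b, A, \<xi>). 0 <= a \<and> a <= b \<and> A \<in> finite_marks \<and> \<xi> \<in> borel_measurable (F a) \<and>
  (\<exists>C. \<forall>w\<in>space M. \<bar>\<xi> w\<bar> <= C)}"

definition N_val :: "real \<times> real \<times> 'e set \<times> ('a => real) => real \<times> 'e \<times> 'a => real" where
 "N_val = (%(a, b, A, \<xi>) (r, v, w). \<xi> w * indicator {a<..b} r * indicator A v)"

definition N_int :: "real => real \<times> real \<times> 'e set \<times> ('a => real) => 'a => real" where
 "N_int t = (%(a, b, A, \<xi>) w. \<xi> w * compensated \<nu> N (min a t) (min b t) A w)"

definition N_scale :: "real => real \<times> real \<times> 'e set \<times> ('a => real) => real \<times> real \<times> 'e set \<times> ('a => real)" where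
 "N_scale k = (%(a, b, A, \<xi>). (a, b, A, %w. k * \<xi> w))"

sublocale nuM: pair_sigma_finite \<nu> M ..

lemma emeasure_Ioc_finite: "emeasure lborel {0<..t::real} < \<infinity>"
 by (cases "0 <= t") auto

lemma finite_Ioc_measure: "finite_measure (restrict_space lborel {0<..t::real})"
 by (rule finite_restrict_lborel[OF _ emeasure_Ioc_finite]) simp

text \<open>As for the Wiener process, with the intensity of the common marks as a third
  factor.\<close>

lemma N_isometric:
 assumes t: "0 <= t"
 shows "isometric_family (QL t) M N_adm N_val (N_int t) N_scale"
proof
 interpret T: finite_measure "restrict_space lborel {0<..t}" by (rule finite_Ioc_measure)
 interpret TM: pair_sigma_finite "restrict_space lborel {0<..t}" "\<nu> \<Otimes>\<^sub>M M" ..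
 have prod: "integrable (QL t) (%q. N_val e q * N_val e' q) \<and> (\<integral>q. N_val e q * N_val e' q \<partial>QL t) =
   (case e of (a, b, A, \<xi>) => case e' of (a', b', B, \<eta>) =>
    max 0 (min (min b t) (min b' t) - max (min a t) (min a' t)) * (measure \<nu> (A \<inter> B) * (\<integral>w. \<xi> w * \<eta> w \<partial>M)))"
  if e: "e \<in> N_adm" "e' \<in> N_adm" for e e'
 proof -
  obtain a b A \<xi> a' b' B \<eta> where eq: "e = (a, b, A, \<xi>)" "e' = (a', b', B, \<eta>)" by (cases e, cases e') auto
  have f: "(%q. N_val e q * N_val e' q) = (%(r, p). (indicator {a<..b} r * indicator {a'<..b'} r) *
    (case p of (v, w) => indicator (A \<inter> B) v * (\<xi> w * \<eta> w)))"
   by (auto simp: eq N_val_def fun_eq_iff indicator_inter_arith)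
  have AB: "A \<inter> B \<in> finite_marks" using e by (auto simp: eq N_adm_def intro: finite_marks_Int)
  have I1: "integrable (restrict_space lborel {0<..t}) (%r. indicator {a<..b} r * indicator {a'<..b'} r :: real)"
   by (rule integrable_time_overlap[OF _ emeasure_Ioc_finite]) simp
  have I2: "integrable M (%w. \<xi> w * \<eta> w)"
   using e by (intro integrable_bounded_product) (auto simp: eq N_adm_def)
  have I3: "integrable \<nu> (indicator (A \<inter> B) :: 'e => real)" "(\<integral>v. indicator (A \<inter> B) v \<partial>\<nu>) = measure \<nu> (A \<inter> B)"
   using AB by (auto simp: finite_marks_def)
  note I4 = nuM.integral_mult_product[OF I3(1) I2]
  have ab: "0 <= a" "a <= b" "0 <= a'" "a' <= b'" using e by (auto simp: eq N_adm_def)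
  show ?thesis
   unfolding f TM.integral_mult_product(2)[OF I1 I4(1)] integral_time_overlap[OF disjI2[OF refl] t ab] I4(2) I3(2)
   by (simp only: eq prod.case TM.integral_mult_product(1)[OF I1 I4(1)] simp_thms)
 qed
 fix e e' :: "real \<times> real \<times> 'e set \<times> ('a => real)" and k :: real and q w
 show "N_val (N_scale k e) q = k * N_val e q" by (cases e, cases q) (simp add: N_val_def N_scale_def)
 show "N_int t (N_scale k e) w = k * N_int t e w" by (cases e) (simp add: N_int_def N_scale_def)
 assume e: "e \<in> N_adm"
 obtain a b A \<xi> where eq: "e = (a, b, A, \<xi>)" by (cases e) auto
 with e obtain C where C: "0 <= a" "a <= b" "\<xi> \<in> borel_measurable (F a)" "!!w. w \<in> space M ==> \<bar>\<xi> w\<bar> <= C"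
  and A: "A \<in> finite_marks"
  by (auto simp: N_adm_def)
 note [measurable] = F_measurable_M[OF C(3)]
 show "N_scale k e \<in> N_adm" using e by (auto simp: eq N_scale_def N_adm_def intro!: bounded_scale)
 have "N_val e \<in> borel_measurable (QL t)"
 proof -
  have [measurable]: "(indicator {a<..b} :: real => real) \<in> borel_measurable (restrict_space lborel {0<..t})"
   by (intro measurable_restrict_space1) simp
  have [measurable]: "A \<in> sets \<nu>" using A by (simp add: finite_marks_def)
  show ?thesis unfolding eq N_val_def prod.case by measurable
 qed
 then show "l2norm (QL t) (N_val e) < \<infinity>"
  using prod[OF e e] by (simp add: l2norm_def power2_eq_square)
 show "l2norm M (N_int t e) < \<infinity>"
  using N.stopped_l2[OF A t C] by (simp add: N_int_def eq)
 assume e': "e' \<in> N_adm"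
 obtain a' b' B \<eta> where eq': "e' = (a', b', B, \<eta>)" by (cases e') auto
 with e' obtain C' where C': "0 <= a'" "a' <= b'" "\<eta> \<in> borel_measurable (F a')" "!!w. w \<in> space M ==> \<bar>\<eta> w\<bar> <= C'"
  and B: "B \<in> finite_marks"
  by (auto simp: N_adm_def)
 show "(\<integral>q. N_val e q * N_val e' q \<partial>QL t) = (\<integral>w. N_int t e w * N_int t e' w \<partial>M)"
 proof -
  let ?X = "max 0 (min (min b t) (min b' t) - max (min a t) (min a' t))"
  have L: "(\<integral>q. N_val e q * N_val e' q \<partial>QL t) = ?X * (measure \<nu> (A \<inter> B) * (\<integral>w. \<xi> w * \<eta> w \<partial>M))"
   using prod[OF e e', THEN conjunct2] unfolding eq eq' prod.case .
  have R: "(\<integral>w. N_int t e w * N_int t e' w \<partial>M) = (\<integral>w. \<xi> w * \<eta> w \<partial>M) * (measure \<nu> (A \<inter> B) * ?X)"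
   unfolding eq eq' N_int_def prod.case
   by (rule N.pair_isometry_stopped[OF A B t C(1,2) C'(1,2) C(3,4) C'(3,4)])
  show ?thesis unfolding L R by (simp only: ac_simps)
 qed
qed

abbreviation N_has_int where
 "N_has_int t \<equiv> isometric_family.has_int (QL t) M N_adm N_val (N_int t)"

lemma N_V:
 fixes t :: real
 assumes "0 <= t"
 shows "isometric_family.V N_val S q = (%(r, v, w). levy_simple_value S r v w) q"
 using isometric_family.V_def[OF N_isometric[OF assms], of S q]
 by (simp add: levy_simple_value_def N_val_def case_prod_beta')

lemma N_J:
 assumes "0 <= t"
 shows "isometric_family.J (N_int t) S = levy_simple_integral \<nu> N S t"
proof
 fix w
 show "isometric_family.J (N_int t) S w = levy_simple_integral \<nu> N S t w"
  using isometric_family.J_def[OF N_isometric[OF assms], of S w]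
  by (simp add: levy_simple_integral_def N_int_def case_prod_beta')
qed

lemma has_levy_integral_iff:
 assumes t: "0 <= t"
 shows "has_levy_integral M F \<nu> N t \<phi> I \<longleftrightarrow> N_has_int t (%(r, v, w). \<phi> r v w) I"
proof -
 interpret isometric_family "QL t" M N_adm N_val "N_int t" N_scale by (rule N_isometric[OF t])
 have adm: "levy_simple M F \<nu> S \<longleftrightarrow> set S \<subseteq> N_adm" for S
  by (auto simp: levy_simple_def N_adm_def finite_marks_def)
 have "(%n. \<integral>\<^sup>+ (r, v, w). ennreal ((levy_simple_value (S n) r v w - \<phi> r v w)\<^sup>2) \<partial>QL t) \<longlonglongrightarrow> 0 \<longleftrightarrow>
   (%n. l2norm (QL t) (%q. V (S n) q - (%(r, v, w). \<phi> r v w) q)) \<longlonglongrightarrow> 0"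
  if "(%(r, v, w). \<phi> r v w) \<in> borel_measurable (QL t)" "!!n. set (S n) \<subseteq> N_adm" for S
 proof -
  have "(%q. V (S n) q - (%(r, v, w). \<phi> r v w) q) \<in> borel_measurable (QL t)" for n
   using l2norm_finiteD(1)[OF V_l2[OF that(2)]] that(1) by (rule borel_measurable_diff)
  note iff = l2norm_tendsto_0_iff[OF this]
  have eq: "(%(r, v, w). ennreal ((levy_simple_value (S n) r v w - \<phi> r v w)\<^sup>2)) =
    (%q. ennreal ((V (S n) q - (%(r, v, w). \<phi> r v w) q)\<^sup>2))" for n
   by (auto simp: N_V[OF t])
  show ?thesis unfolding eq by (rule iff)
 qed
 then show ?thesis
  unfolding has_levy_integral_def has_int_def Let_def adm N_J[OF t]
  by blast
qed

end

section \<open>Deterministic integrands and their step approximations\<close>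

lemma l2norm_time_restrict:
 assumes "0 <= s" "s <= t"
 shows "l2norm (time_measure t) (%r. f r * indicator {..s} r) = l2norm (time_measure s) f"
  "(%r. f r * indicator {..s} r) \<in> borel_measurable (time_measure t) \<longleftrightarrow> f \<in> borel_measurable (time_measure s)"
proof -
 have 1: "(%r. indicator {0..t} r *\<^sub>R (f r * indicator {..s} r)) = (%r. indicator {0..s} r *\<^sub>R f r)"
  using assms by (auto simp: indicator_def)
 have 2: "(%r. indicator {0..t} r *\<^sub>R (f r * indicator {..s} r)\<^sup>2) = (%r. indicator {0..s} r *\<^sub>R (f r)\<^sup>2)"
  using assms by (auto simp: indicator_def)
 show m: "(%r. f r * indicator {..s} r) \<in> borel_measurable (time_measure t) \<longleftrightarrow> f \<in> borel_measurable (time_measure s)"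
  by (simp add: borel_measurable_restrict_space_iff 1 del: real_scaleR_def)
 show "l2norm (time_measure t) (%r. f r * indicator {..s} r) = l2norm (time_measure s) f"
  unfolding l2norm_def m
  by (simp add: integrable_restrict_space integral_restrict_space 2 del: real_scaleR_def)
qed

lemma measurable_Ioc_measure:
 fixes f :: "real => real"
 assumes "f \<in> borel_measurable (time_measure t)"
 shows "f \<in> borel_measurable (restrict_space lborel {0<..t})"
proof -
 have "restrict_space lborel {0<..t} = restrict_space (time_measure t) {0<..t}"
  by (subst restrict_restrict_space) (auto intro!: arg_cong[where f = "restrict_space lborel"])
 then show ?thesis using measurable_restrict_space1[OF assms, of "{0<..t}"] by simp
qed

text \<open>The Levy integral lives on (0,t] and the Wiener integral on [0,t]; the point 0 carries
  no mass, so both share \<open>time_measure\<close>.\<close>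

lemma l2norm_Ioc:
 fixes f :: "real => real"
 assumes [measurable]: "f \<in> borel_measurable (time_measure t)"
 shows "l2norm (restrict_space lborel {0<..t}) f = l2norm (time_measure t) f"
proof -
 let ?g = "%r. indicator {0..t} r *\<^sub>R (f r)\<^sup>2" and ?h = "%r. indicator {0<..t} r *\<^sub>R (f r)\<^sup>2"
 have "(%r. (f r)\<^sup>2) \<in> borel_measurable (time_measure t)" by measurable
 then have g: "?g \<in> borel_measurable lborel" by (simp add: borel_measurable_restrict_space_iff del: real_scaleR_def)
 have "(%r. (f r)\<^sup>2) \<in> borel_measurable (restrict_space lborel {0<..t})"
  using measurable_Ioc_measure[OF assms] by measurable
 then have h: "?h \<in> borel_measurable lborel" by (simp add: borel_measurable_restrict_space_iff del: real_scaleR_def)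
 have eq: "AE r in lborel. ?g r = ?h r"
  using AE_lborel_singleton[of "0::real"] by eventually_elim (auto simp: indicator_def)
 have "integrable lborel ?g \<longleftrightarrow> integrable lborel ?h" by (rule integrable_cong_AE[OF g h eq])
 moreover have "integral\<^sup>L lborel ?g = integral\<^sup>L lborel ?h" by (rule integral_cong_AE[OF g h eq])
 ultimately show ?thesis
  using assms measurable_Ioc_measure[OF assms] unfolding l2norm_def
  by (simp add: integrable_restrict_space integral_restrict_space del: real_scaleR_def)
qed

definition step_value :: "(real \<times> real \<times> real) list => real => real" where
 "step_value D r = (\<Sum>(a, b, k)\<leftarrow>D. k * indicator {a<..b} r)"

text \<open>The bound b <= s makes all increments measurable for \<open>F s\<close> and lets the
  same list serve every integration horizon t >= s.\<close>

definition steps_upto :: "real => (real \<times> real \<times> real) list => bool" where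
 "steps_upto s D \<longleftrightarrow> (\<forall>(a, b, k)\<in>set D. 0 <= a \<and> a <= b \<and> b <= s)"

lemma step_value_of_lin_comb:
 "fst ` set L \<subseteq> subintervals s ==> \<exists>D. steps_upto s D \<and> (\<forall>r. lin_comb L r = step_value D r)"
proof (induction L)
 case Nil
 then show ?case by (intro exI[of _ "[]"]) (auto simp: steps_upto_def lin_comb_def step_value_def)
next
 case (Cons p L)
 then obtain D where D: "steps_upto s D" "!!r. lin_comb L r = step_value D r" by auto
 obtain A k where p: "p = (A, k)" by (cases p)
 with Cons.prems obtain a b where "A = {a<..b}" "0 <= a" "a <= b" "b <= s" by (auto simp: subintervals_def)
 with D p show ?case
  by (intro exI[of _ "(a, b, k) # D"]) (auto simp: steps_upto_def lin_comb_def step_value_def)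
qed

lemma exists_step_approximation:
 assumes "0 <= s" "l2norm (time_measure s) \<phi> < \<infinity>"
 obtains D where "!!n. steps_upto s (D n)" "(%n. l2norm (time_measure s) (%r. step_value (D n) r - \<phi> r)) \<longlonglongrightarrow> 0"
proof -
 obtain L where L: "!!n. fst ` set (L n) \<subseteq> subintervals s"
  "(%n. l2norm (time_measure s) (%r. lin_comb (L n) r - \<phi> r)) \<longlonglongrightarrow> 0"
  using approximableD_seq[OF step_functions_dense[OF assms]] by blast
 obtain D where D: "!!n. steps_upto s (D n)" "!!n r. lin_comb (L n) r = step_value (D n) r"
  using step_value_of_lin_comb[OF L(1)] by metis
 from L(2) show ?thesis by (intro that[of D] D(1)) (simp add: D(2))
qed

lemma step_value_measurable [measurable]: "step_value D \<in> borel_measurable borel"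
proof -
 have "(%r. \<Sum>(a, b, k)\<leftarrow>D. k * indicator {a<..b} r :: real) \<in> borel_measurable borel"
  by (induction D) (auto simp: case_prod_beta)
 then show ?thesis by (simp add: step_value_def[abs_def])
qed

lemma step_value_beyond: "steps_upto s D ==> s < r ==> step_value D r = 0"
 by (induction D) (auto simp: steps_upto_def step_value_def)

text \<open>
  \<open>R t \<phi> I\<close>: the random variable \<open>I\<close> is the stochastic integral over \<open>[0,t]\<close> of the deterministic
  integrand \<open>\<phi>\<close>; \<open>\<kappa>\<close> is the intensity of the noise.
\<close>

locale l2_noise =
 fixes M :: "'a measure" and F :: "real => 'a measure" and \<kappa> :: real
  and R :: "real => (real => real) => ('a => real) => bool"
 assumes \<kappa>_nonneg: "0 <= \<kappa>"
  and R_l2: "R t \<phi> I ==> l2norm (time_measure t) \<phi> < \<infinity>"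
  and R_exists: "0 <= t ==> l2norm (time_measure t) \<phi> < \<infinity> ==> \<exists>I. R t \<phi> I"
  and R_linear: "0 <= t ==> R t \<phi> I ==> R t \<psi> J ==> R t (%r. a * \<phi> r + b * \<psi> r) (%w. a * I w + b * J w)"
  and R_norm: "0 <= t ==> R t \<phi> I ==> l2norm M I = ennreal \<kappa> * l2norm (time_measure t) \<phi>"
  and R_restrict: "0 <= s ==> s <= t ==> R s \<phi> I ==> R t (%r. \<phi> r * indicator {..s} r) I"
  and R_adapted: "0 <= t ==> R t \<phi> I ==> I \<in> borel_measurable (F t)"
  and R_cong: "0 <= t ==> R t \<phi> I ==> (!!r. 0 <= r ==> r <= t ==> \<phi> r = \<psi> r) ==> R t \<psi> I"

lemma (in isometric_family) has_int_AE:
 assumes "has_int \<phi> I" "AE w in M. I w = I' w" "I' \<in> borel_measurable M"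
 shows "has_int \<phi> I'"
proof -
 have IM: "I \<in> borel_measurable M" using l2norm_finiteD(1)[OF has_int_norm(2)[OF assms(1)]] .
 have eq: "l2norm M (%w. J S w - I w) = l2norm M (%w. J S w - I' w)" if "set S \<subseteq> Adm" for S
 proof (rule l2norm_cong_AE)
  show "AE w in M. J S w - I w = J S w - I' w" using assms(2) by eventually_elim simp
 qed (use l2norm_finiteD(1)[OF J_l2[OF that]] IM assms(3) in auto)
 from assms(1) obtain S where "\<phi> \<in> borel_measurable Q" "!!n. set (S n) \<subseteq> Adm"
  "(%n. l2norm Q (%q. V (S n) q - \<phi> q)) \<longlonglongrightarrow> 0" "(%n. l2norm M (%w. J (S n) w - I w)) \<longlonglongrightarrow> 0"
  unfolding has_int_def by blast
 then show ?thesis unfolding has_int_def using eq by (intro conjI exI[of _ S]) auto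
qed

lemma l2norm_one: "prob_space M ==> l2norm M (%_. 1) = 1"
 by (simp add: l2norm_def prob_space.prob_space finite_measure.integrable_const prob_space.finite_measure)

lemma sum_list_product:
 "(\<Sum>e\<leftarrow>concat (map (%x. map (h x) G) D). f e) = (\<Sum>x\<leftarrow>D. \<Sum>y\<leftarrow>G. f (h x y))"
 by (induction D) (simp_all add: o_def)

lemma sum_list_mult_product:
 "(\<Sum>x\<leftarrow>D. f x) * (\<Sum>y\<leftarrow>G. g y) = (\<Sum>x\<leftarrow>D. \<Sum>y\<leftarrow>G. f x * g y :: real)"
 by (induction D) (simp_all add: distrib_right sum_list_const_mult)

lemma measurable_sum_list:
 "(!!e. e \<in> set S ==> f e \<in> borel_measurable N) ==> (%w. \<Sum>e\<leftarrow>S. f e w :: real) \<in> borel_measurable N"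
 by (induction S) auto

lemma integral_sum_list_product_zero:
 fixes f :: "'x => 'a => real" and g :: "'y => 'a => real"
 assumes "!!x y. x \<in> set xs ==> y \<in> set ys ==> integrable M (%w. f x w * g y w) \<and> (\<integral>w. f x w * g y w \<partial>M) = 0"
 shows "integrable M (%w. (\<Sum>x\<leftarrow>xs. f x w) * (\<Sum>y\<leftarrow>ys. g y w)) \<and>
  (\<integral>w. (\<Sum>x\<leftarrow>xs. f x w) * (\<Sum>y\<leftarrow>ys. g y w) \<partial>M) = 0"
 using assms
proof (induction xs)
 case (Cons x xs)
 have row: "integrable M (%w. f x w * (\<Sum>y\<leftarrow>ys. g y w)) \<and> (\<integral>w. f x w * (\<Sum>y\<leftarrow>ys. g y w) \<partial>M) = 0"
  using Cons.prems[of x]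
 proof (induction ys)
  case (Cons y ys)
  then show ?case by (simp add: distrib_left)
 qed simp
 show ?case using row Cons.IH Cons.prems by (simp add: distrib_right)
qed simp

text \<open>Replacing both factors by approximations within e changes the integral of the product by
  at most e (||X|| + ||Y|| + e), and e is arbitrary.\<close>

lemma integral_l2_limit_zero:
 assumes X: "(%n. l2norm M (%w. Xn n w - X w)) \<longlonglongrightarrow> 0" "l2norm M X < \<infinity>"
  and Y: "(%n. l2norm M (%w. Yn n w - Y w)) \<longlonglongrightarrow> 0" "l2norm M Y < \<infinity>"
  and zero: "!!n. (\<integral>w. Xn n w * Yn n w \<partial>M) = 0"
 shows "(\<integral>w. X w * Y w \<partial>M) = 0"
proof -
 have le: "\<bar>\<integral>w. X w * Y w \<partial>M\<bar> <= e * rnorm M Y + (rnorm M X * e + e * e)" if e: "e > 0" for e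
 proof -
  obtain n where n: "l2norm M (%w. Xn n w - X w) <= ennreal e" "l2norm M (%w. Yn n w - Y w) <= ennreal e"
   using eventually_conj[OF tendsto_ennreal_0D[OF X(1) e] tendsto_ennreal_0D[OF Y(1) e]]
   by (auto simp: eventually_sequentially)
  let ?dX = "%w. Xn n w - X w" and ?dY = "%w. Yn n w - Y w"
  note dX = l2norm_le_rnorm[OF n(1) less_imp_le[OF e]] and dY = l2norm_le_rnorm[OF n(2) less_imp_le[OF e]]
  note c1 = cauchy_schwarz_l2[OF dX(2) Y(2)] and c2 = cauchy_schwarz_l2[OF X(2) dY(2)]
   and c3 = cauchy_schwarz_l2[OF dX(2) dY(2)] and c4 = cauchy_schwarz_l2[OF X(2) Y(2)]
  have "(%w. Xn n w * Yn n w) = (%w. ((X w * Y w + ?dX w * Y w) + X w * ?dY w) + ?dX w * ?dY w)"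
   by (auto simp: algebra_simps)
  then have "0 = (\<integral>w. ((X w * Y w + ?dX w * Y w) + X w * ?dY w) + ?dX w * ?dY w \<partial>M)"
   using zero[of n] by simp
  also have "... = (\<integral>w. (X w * Y w + ?dX w * Y w) + X w * ?dY w \<partial>M) + (\<integral>w. ?dX w * ?dY w \<partial>M)"
   by (intro Bochner_Integration.integral_add Bochner_Integration.integrable_add c1(1) c2(1) c3(1) c4(1))
  also have "(\<integral>w. (X w * Y w + ?dX w * Y w) + X w * ?dY w \<partial>M) =
    (\<integral>w. X w * Y w + ?dX w * Y w \<partial>M) + (\<integral>w. X w * ?dY w \<partial>M)"
   by (intro Bochner_Integration.integral_add Bochner_Integration.integrable_add c1(1) c2(1) c4(1))
  also have "(\<integral>w. X w * Y w + ?dX w * Y w \<partial>M) = (\<integral>w. X w * Y w \<partial>M) + (\<integral>w. ?dX w * Y w \<partial>M)"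
   by (intro Bochner_Integration.integral_add c1(1) c4(1))
  finally have sum: "\<bar>\<integral>w. X w * Y w \<partial>M\<bar> <= \<bar>\<integral>w. ?dX w * Y w \<partial>M\<bar> + (\<bar>\<integral>w. X w * ?dY w \<partial>M\<bar> + \<bar>\<integral>w. ?dX w * ?dY w \<partial>M\<bar>)"
   by linarith
  have b1: "\<bar>\<integral>w. ?dX w * Y w \<partial>M\<bar> <= e * rnorm M Y"
   using c1(3) mult_right_mono[OF dX(1) rnorm_nonneg[of M Y]] by (rule order_trans)
  have b2: "\<bar>\<integral>w. X w * ?dY w \<partial>M\<bar> <= rnorm M X * e"
   using c2(3) mult_left_mono[OF dY(1) rnorm_nonneg[of M X]] by (rule order_trans)
  have b3: "\<bar>\<integral>w. ?dX w * ?dY w \<partial>M\<bar> <= e * e"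
   using c3(3) mult_mono[OF dX(1) dY(1) less_imp_le[OF e] rnorm_nonneg] by (rule order_trans)
  from sum b1 b2 b3 show ?thesis by linarith
 qed
 have "((%e. e * rnorm M Y + (rnorm M X * e + e * e)) \<longlongrightarrow> 0 * rnorm M Y + (rnorm M X * 0 + 0 * 0)) (at_right 0)"
  by (intro tendsto_intros)
 then have "\<bar>\<integral>w. X w * Y w \<partial>M\<bar> <= 0 * rnorm M Y + (rnorm M X * 0 + 0 * 0)"
  by (rule tendsto_lowerbound) (use le in \<open>auto simp: eventually_at_right_less eventually_at_right[of 0 1] intro!: exI[of _ 1]\<close>)
 then show ?thesis by simp
qed

section \<open>Wiener integrals of deterministic functions\<close>

context noise
begin

definition W_entries :: "(real \<times> real \<times> real) list => (real \<times> real \<times> ('a => real)) list" where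
 "W_entries D = map (%(a, b, k). (a, b, %_. k)) D"

text \<open>No horizon appears: for steps ending before t the stopped increments in
  \<open>wiener_simple_integral\<close> equal the unstopped ones.\<close>

definition W_sum :: "(real \<times> real \<times> real) list => 'a => real" where
 "W_sum D w = (\<Sum>(a, b, k)\<leftarrow>D. k * (W b w - W a w))"

lemma W_entries_adm: "steps_upto s D ==> set (W_entries D) \<subseteq> W_adm"
 by (auto simp: W_entries_def W_adm_def steps_upto_def)

lemma W_entries_value: "wiener_simple_value (W_entries D) r w = step_value D r"
 by (simp add: wiener_simple_value_def W_entries_def step_value_def o_def case_prod_beta')

lemma W_entries_integral:
 assumes "steps_upto s D" "s <= t"
 shows "wiener_simple_integral W (W_entries D) t w = W_sum D w"
proof -
 have "(\<Sum>e\<leftarrow>D. snd (snd e) * (W (min (fst (snd e)) t) w - W (min (fst e) t) w)) =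
   (\<Sum>e\<leftarrow>D. snd (snd e) * (W (fst (snd e)) w - W (fst e) w))"
  using assms by (intro arg_cong[where f = sum_list] map_cong refl) (auto simp: steps_upto_def min_def)
 then show ?thesis
  by (simp add: wiener_simple_integral_def W_entries_def W_sum_def o_def case_prod_beta')
qed

lemma W_sum_adapted:
 assumes "steps_upto s D"
 shows "W_sum D \<in> borel_measurable (F s)"
 unfolding W_sum_def[abs_def]
proof (rule measurable_sum_list)
 fix e assume e: "e \<in> set D"
 obtain a b k where eq: "e = (a, b, k)" by (cases e)
 with assms e have ab: "0 <= a" "a <= b" "b <= s" by (auto simp: steps_upto_def)
 have [measurable]: "W a \<in> borel_measurable (F s)" "W b \<in> borel_measurable (F s)"
  using ab by (auto intro!: F_measurable_le[OF W_adapted])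
 show "(%w. case e of (a, b, k) => k * (W b w - W a w)) \<in> borel_measurable (F s)"
  unfolding eq prod.case by measurable
qed

lemma W_l2norm_QW:
 assumes "l2norm (time_measure t) f < \<infinity>"
 shows "l2norm (QW t) (%(r, w). f r) = l2norm (time_measure t) f"
  "(%(r, w). f r) \<in> borel_measurable (QW t)"
proof -
 interpret T: finite_measure "time_measure t" by (rule finite_time_measure)
 have 1: "l2norm M (%_. 1) = 1" by (rule l2norm_one[OF prob_space_axioms])
 then have 2: "l2norm M (%_. 1) < \<infinity>" by simp
 note P = l2norm_product[OF T.sigma_finite_measure_axioms sigma_finite_measure_axioms assms 2]
 show "l2norm (QW t) (%(r, w). f r) = l2norm (time_measure t) f" using P(1) by (simp add: 1)
 show "(%(r, w). f r) \<in> borel_measurable (QW t)" using P(2) by simp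
qed

lemma l2norm_step_diff_finite:
 assumes "l2norm (time_measure s) \<phi> < \<infinity>"
 shows "l2norm (time_measure s) (%r. step_value D r - \<phi> r) < \<infinity>"
proof (rule l2norm_diff_finite[OF _ assms])
 have "\<exists>C. \<forall>r. \<bar>step_value D r\<bar> <= C"
 proof (induction D)
  case (Cons e D)
  then obtain C where C: "!!r. \<bar>step_value D r\<bar> <= C" by blast
  have "\<bar>step_value (e # D) r\<bar> <= \<bar>snd (snd e)\<bar> + C" for r
   using C[of r] by (cases e) (auto simp: step_value_def indicator_def)
  then show ?case by blast
 qed (auto simp: step_value_def)
 then obtain C where "!!r. \<bar>step_value D r\<bar> <= C" by blast
 then show "l2norm (time_measure s) (step_value D) < \<infinity>"
  by (intro l2norm_bounded_finite[OF finite_time_measure, of _ _ C] measurable_time_measure) auto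
qed

text \<open>The steps end at s, so one limit I is the integral over every longer interval [0,t]. The
  restriction clause of \<open>l2_noise\<close> rests on this.\<close>

lemma wiener_det_integral:
 assumes st: "0 <= s" "s <= t" and \<phi>: "l2norm (time_measure s) \<phi> < \<infinity>" and D: "!!n. steps_upto s (D n)"
  and lim: "(%n. l2norm (time_measure s) (%r. step_value (D n) r - \<phi> r)) \<longlonglongrightarrow> 0"
  and I: "(%n. l2norm M (%w. W_sum (D n) w - I w)) \<longlonglongrightarrow> 0"
 shows "has_wiener_integral M F W t (%r _. \<phi> r * indicator {..s} r) I"
proof -
 have t: "0 <= t" using st by simp
 interpret isometric_family "QW t" M W_adm W_val "W_int t" W_scale by (rule W_isometric[OF t])
 have fin: "l2norm (time_measure t) (%r. \<phi> r * indicator {..s} r) < \<infinity>" using \<phi> by (simp add: l2norm_time_restrict[OF st])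
 have eq: "l2norm (QW t) (%q. V (W_entries (D n)) q - (%(r, w). \<phi> r * indicator {..s} r) q) =
   l2norm (time_measure s) (%r. step_value (D n) r - \<phi> r)" for n
 proof -
  have f: "(%q. V (W_entries (D n)) q - (%(r, w). \<phi> r * indicator {..s} r) q) =
    (%(r, w). (step_value (D n) r - \<phi> r) * indicator {..s} r)"
   using step_value_beyond[OF D[of n]] by (auto simp: W_V[OF t] W_entries_value fun_eq_iff indicator_def not_le)
  have "l2norm (time_measure t) (%r. (step_value (D n) r - \<phi> r) * indicator {..s} r) < \<infinity>"
   using l2norm_step_diff_finite[OF \<phi>] by (simp add: l2norm_time_restrict[OF st])
  from W_l2norm_QW(1)[OF this] show ?thesis
   unfolding f by (simp add: l2norm_time_restrict(1)[OF st])
 qed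
 have J: "J (W_entries (D n)) w = W_sum (D n) w" for n w
  by (simp add: W_J[OF t] W_entries_integral[OF D st(2)])
 show ?thesis
  unfolding has_wiener_integral_iff[OF t] has_int_def
 proof (intro conjI exI[of _ "%n. W_entries (D n)"] allI)
  show "(%(r, w). \<phi> r * indicator {..s} r) \<in> borel_measurable (QW t)" by (rule W_l2norm_QW(2)[OF fin])
  show "set (W_entries (D n)) \<subseteq> W_adm" for n by (rule W_entries_adm[OF D])
  show "(%n. l2norm (QW t) (%q. V (W_entries (D n)) q - (%(r, w). \<phi> r * indicator {..s} r) q)) \<longlonglongrightarrow> 0"
   unfolding eq by (rule lim)
  show "(%n. l2norm M (%w. J (W_entries (D n)) w - I w)) \<longlonglongrightarrow> 0" unfolding J by (rule I)
 qed
qed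

lemma wiener_det_exists:
 assumes s: "0 <= s" and \<phi>: "l2norm (time_measure s) \<phi> < \<infinity>"
 obtains I D where "I \<in> borel_measurable (F s)" "!!n. steps_upto s (D n)"
  "(%n. l2norm M (%w. W_sum (D n) w - I w)) \<longlonglongrightarrow> 0"
  "!!t. s <= t ==> has_wiener_integral M F W t (%r _. \<phi> r * indicator {..s} r) I"
proof -
 obtain D where D: "!!n. steps_upto s (D n)"
  and lim: "(%n. l2norm (time_measure s) (%r. step_value (D n) r - \<phi> r)) \<longlonglongrightarrow> 0"
  using exists_step_approximation[OF s \<phi>] by blast
 interpret isometric_family "QW s" M W_adm W_val "W_int s" W_scale by (rule W_isometric[OF s])
 have eq: "l2norm (QW s) (%q. V (W_entries (D n)) q - (%(r, w). \<phi> r) q) =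
   l2norm (time_measure s) (%r. step_value (D n) r - \<phi> r)" for n
 proof -
  have f: "(%q. V (W_entries (D n)) q - (%(r, w). \<phi> r) q) = (%(r, w). step_value (D n) r - \<phi> r)"
   by (auto simp: W_V[OF s] W_entries_value fun_eq_iff)
  show ?thesis unfolding f by (rule W_l2norm_QW(1)[OF l2norm_step_diff_finite[OF \<phi>]])
 qed
 have J: "J (W_entries (D n)) w = W_sum (D n) w" for n w
  by (simp add: W_J[OF s] W_entries_integral[OF D])
 obtain I where I: "I \<in> borel_measurable M" "(%n. l2norm M (%w. J (W_entries (D n)) w - I w)) \<longlonglongrightarrow> 0"
  using has_int_exists[of "%n. W_entries (D n)" "%(r, w). \<phi> r", OF W_entries_adm[OF D] _ W_l2norm_QW(2)[OF \<phi>]] lim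
  unfolding eq by blast
 note I2 = I(2)[unfolded J]
 have "I \<in> borel_measurable (F s)"
  by (rule l2_limit_subalgebra[OF complete_M F_subalgebra null_F[OF s] W_sum_adapted[OF D] I(1) I2])
 from that[OF this D I2 wiener_det_integral[OF s _ \<phi> D lim I2]] show ?thesis by blast
qed

definition W_rel :: "real => (real => real) => ('a => real) => bool" where
 "W_rel t \<phi> I \<longleftrightarrow> l2norm (time_measure t) \<phi> < \<infinity> \<and> has_wiener_integral M F W t (%r _. \<phi> r) I"

lemma wiener_integral_unique:
 assumes "0 <= t" "has_wiener_integral M F W t \<phi> I" "has_wiener_integral M F W t \<phi> I'"
 shows "AE w in M. I w = I' w"
 using isometric_family.has_int_unique[OF W_isometric[OF assms(1)]] assms(2,3)
 unfolding has_wiener_integral_iff[OF assms(1)] by blast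

lemma wiener_integral_measurable:
 assumes "0 <= t" "has_wiener_integral M F W t \<phi> I"
 shows "I \<in> borel_measurable M" "l2norm M I < \<infinity>"
 using isometric_family.has_int_norm(2)[OF W_isometric[OF assms(1)]] assms(2) l2norm_finiteD(1)
 unfolding has_wiener_integral_iff[OF assms(1)] by blast+

lemma wiener_integral_cong:
 assumes "0 <= t" "has_wiener_integral M F W t \<phi> I" "!!r w. 0 <= r ==> r <= t ==> \<phi> r w = \<psi> r w"
 shows "has_wiener_integral M F W t \<psi> I"
 using assms(2) unfolding has_wiener_integral_iff[OF assms(1)]
 by (rule isometric_family.has_int_cong[OF W_isometric[OF assms(1)]])
  (use assms(3) in \<open>auto simp: space_pair_measure space_restrict_space\<close>)

text \<open>An integral I may have been obtained from random simple integrands. By uniqueness it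
  agrees almost surely with a limit of deterministic step sums, from which adaptedness and the
  change of horizon can be read off.\<close>

lemma W_rel_det:
 assumes t: "0 <= t" and R: "W_rel t \<phi> I"
 obtains I' D where "I' \<in> borel_measurable (F t)" "!!n. steps_upto t (D n)"
  "(%n. l2norm M (%w. W_sum (D n) w - I' w)) \<longlonglongrightarrow> 0"
  "!!u. t <= u ==> has_wiener_integral M F W u (%r _. \<phi> r * indicator {..t} r) I'"
  "AE w in M. I' w = I w"
proof -
 from R have \<phi>: "l2norm (time_measure t) \<phi> < \<infinity>" and hI: "has_wiener_integral M F W t (%r _. \<phi> r) I"
  by (auto simp: W_rel_def)
 obtain I' D where I': "I' \<in> borel_measurable (F t)" "!!n. steps_upto t (D n)"
  "(%n. l2norm M (%w. W_sum (D n) w - I' w)) \<longlonglongrightarrow> 0"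
  "!!u. t <= u ==> has_wiener_integral M F W u (%r _. \<phi> r * indicator {..t} r) I'"
  using wiener_det_exists[OF t \<phi>] by blast
 have "has_wiener_integral M F W t (%r _. \<phi> r) I'"
  by (rule wiener_integral_cong[OF t I'(4)[OF order_refl]]) auto
 from that[OF I' wiener_integral_unique[OF t this hI]] show ?thesis by blast
qed

lemma W_noise: "l2_noise M F 1 W_rel"
proof
 show "0 <= (1::real)" by simp
 fix t :: real and \<phi> \<psi> :: "real => real" and I J :: "'a => real" and a b :: real
 show "W_rel t \<phi> I ==> l2norm (time_measure t) \<phi> < \<infinity>" by (simp add: W_rel_def)
 show "\<exists>I. W_rel t \<phi> I" if t: "0 <= t" and \<phi>: "l2norm (time_measure t) \<phi> < \<infinity>"
 proof -
  obtain I D where "I \<in> borel_measurable (F t)" "!!n. steps_upto t (D n)"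
   "(%n. l2norm M (%w. W_sum (D n) w - I w)) \<longlonglongrightarrow> 0"
   and I: "!!u. t <= u ==> has_wiener_integral M F W u (%r _. \<phi> r * indicator {..t} r) I"
   using wiener_det_exists[OF t \<phi>] by blast
  have "has_wiener_integral M F W t (%r _. \<phi> r) I"
   by (rule wiener_integral_cong[OF t I[OF order_refl]]) simp
  with \<phi> show ?thesis unfolding W_rel_def by blast
 qed
 show "W_rel t (%r. a * \<phi> r + b * \<psi> r) (%w. a * I w + b * J w)"
  if t: "0 <= t" and R: "W_rel t \<phi> I" "W_rel t \<psi> J"
 proof -
  have "l2norm (time_measure t) (%r. a * \<phi> r + b * \<psi> r) < \<infinity>"
   using R by (intro l2norm_add_finite l2norm_scale_finite) (auto simp: W_rel_def)
  moreover have "has_wiener_integral M F W t (%r _. a * \<phi> r + b * \<psi> r) (%w. a * I w + b * J w)"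
   using isometric_family.has_int_linear[OF W_isometric[OF t], of "%(r, w). \<phi> r" I "%(r, w). \<psi> r" J a b] R
   unfolding W_rel_def has_wiener_integral_iff[OF t] case_prod_beta' by blast
  ultimately show ?thesis by (simp add: W_rel_def)
 qed
 show "l2norm M I = ennreal 1 * l2norm (time_measure t) \<phi>" if t: "0 <= t" and R: "W_rel t \<phi> I"
 proof -
  have "l2norm M I = l2norm (QW t) (%(r, w). \<phi> r)"
   using isometric_family.has_int_norm(1)[OF W_isometric[OF t]] R
   unfolding W_rel_def has_wiener_integral_iff[OF t] by blast
  then show ?thesis using W_l2norm_QW(1)[of t \<phi>] R by (simp add: W_rel_def)
 qed
 show "W_rel t (%r. \<phi> r * indicator {..s} r) I" if s: "0 <= s" "s <= t" and R: "W_rel s \<phi> I" for s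
 proof -
  obtain I' D where "I' \<in> borel_measurable (F s)" "!!n. steps_upto s (D n)"
   "(%n. l2norm M (%w. W_sum (D n) w - I' w)) \<longlonglongrightarrow> 0"
   and I'0: "!!u. s <= u ==> has_wiener_integral M F W u (%r _. \<phi> r * indicator {..s} r) I'"
   and I'1: "AE w in M. I' w = I w"
   using W_rel_det[OF s(1) R] by blast
  note I' = I'0[OF s(2)] I'1
  have t: "0 <= t" using s by simp
  have "I \<in> borel_measurable M" using wiener_integral_measurable(1)[OF s(1)] R unfolding W_rel_def by blast
  from isometric_family.has_int_AE[OF W_isometric[OF t] I'(1)[unfolded has_wiener_integral_iff[OF t]] I'(2) this]
  have "has_wiener_integral M F W t (%r _. \<phi> r * indicator {..s} r) I"
   unfolding has_wiener_integral_iff[OF t] .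
  then show ?thesis using R unfolding W_rel_def l2norm_time_restrict[OF s] by blast
 qed
 show "I \<in> borel_measurable (F t)" if t: "0 <= t" and R: "W_rel t \<phi> I"
 proof -
  obtain I' D where I'0: "I' \<in> borel_measurable (F t)" "!!n. steps_upto t (D n)"
   "(%n. l2norm M (%w. W_sum (D n) w - I' w)) \<longlonglongrightarrow> 0"
   "!!u. t <= u ==> has_wiener_integral M F W u (%r _. \<phi> r * indicator {..t} r) I'"
   and I'1: "AE w in M. I' w = I w"
   using W_rel_det[OF t R] by blast
  note I' = I'0(1) I'1
  have "I \<in> borel_measurable M" using wiener_integral_measurable(1)[OF t] R unfolding W_rel_def by blast
  from F_measurable_AE[OF t this I'(1)] I'(2) show ?thesis by (simp add: eq_commute)
 qed
 show "W_rel t \<psi> I" if t: "0 <= t" and R: "W_rel t \<phi> I" and eq: "!!r. 0 <= r ==> r <= t ==> \<phi> r = \<psi> r"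
 proof -
  have l: "l2norm (time_measure t) \<phi> = l2norm (time_measure t) \<psi>"
   using eq by (intro l2norm_cong) (auto simp: space_restrict_space)
  have "has_wiener_integral M F W t (%r _. \<psi> r) I"
   by (rule wiener_integral_cong[OF t, of "%r _. \<phi> r"]) (use R eq in \<open>simp_all add: W_rel_def\<close>)
  with l R show ?thesis unfolding W_rel_def by metis
 qed
qed

end

section \<open>Poisson integrals of products of a function of time and a function of the
  mark\<close>

context noise
begin

text \<open>Expands the product of a step function of time and a simple function of the mark into a
  list of weighted rectangles.\<close>

definition N_flat :: "(real \<times> real \<times> real) list => ('e set \<times> real) list => (real \<times> real \<times> 'e set \<times> real) list" where
 "N_flat D G = concat (map (%x. map (%y. (fst x, fst (snd x), fst y, snd (snd x) * snd y)) G) D)"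

definition rectangles_upto :: "real => (real \<times> real \<times> 'e set \<times> real) list => bool" where
 "rectangles_upto s H \<longleftrightarrow> (\<forall>(a, b, A, k)\<in>set H. 0 <= a \<and> a <= b \<and> b <= s \<and> A \<in> finite_marks)"

definition N_entries :: "(real \<times> real \<times> 'e set \<times> real) list => (real \<times> real \<times> 'e set \<times> ('a => real)) list" where
 "N_entries H = map (%(a, b, A, k). (a, b, A, %_. k)) H"

definition N_sum :: "(real \<times> real \<times> 'e set \<times> real) list => 'a => real" where
 "N_sum H w = (\<Sum>(a, b, A, k)\<leftarrow>H. k * compensated \<nu> N a b A w)"

lemma N_flat_rectangles: "steps_upto s D ==> fst ` set G \<subseteq> finite_marks ==> rectangles_upto s (N_flat D G)"
 by (fastforce simp: rectangles_upto_def N_flat_def steps_upto_def)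

lemma N_entries_adm: "rectangles_upto s H ==> set (N_entries H) \<subseteq> N_adm"
 by (auto simp: N_entries_def N_adm_def rectangles_upto_def)

lemma N_flat_value: "levy_simple_value (N_entries (N_flat D G)) r v w = step_value D r * lin_comb G v"
proof -
 have "levy_simple_value (N_entries (N_flat D G)) r v w =
   (\<Sum>e\<leftarrow>N_flat D G. snd (snd (snd e)) * indicator {fst e<..fst (snd e)} r * indicator (fst (snd (snd e))) v)"
  by (simp add: levy_simple_value_def N_entries_def o_def case_prod_beta')
 also have "... = (\<Sum>x\<leftarrow>D. \<Sum>y\<leftarrow>G. (snd (snd x) * indicator {fst x<..fst (snd x)} r) * (snd y * indicator (fst y) v))"
  unfolding N_flat_def sum_list_product by (simp add: ac_simps)
 also have "... = step_value D r * lin_comb G v"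
  unfolding sum_list_mult_product[symmetric] by (simp add: step_value_def lin_comb_def case_prod_beta')
 finally show ?thesis .
qed

lemma N_entries_integral:
 assumes "rectangles_upto s H" "s <= t"
 shows "levy_simple_integral \<nu> N (N_entries H) t w = N_sum H w"
proof -
 have "(\<Sum>e\<leftarrow>H. snd (snd (snd e)) * compensated \<nu> N (min (fst e) t) (min (fst (snd e)) t) (fst (snd (snd e))) w) =
   (\<Sum>e\<leftarrow>H. snd (snd (snd e)) * compensated \<nu> N (fst e) (fst (snd e)) (fst (snd (snd e))) w)"
  using assms by (intro arg_cong[where f = sum_list] map_cong refl) (auto simp: rectangles_upto_def min_def)
 then show ?thesis
  by (simp add: levy_simple_integral_def N_entries_def N_sum_def o_def case_prod_beta')
qed

lemma N_sum_adapted: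
 assumes "rectangles_upto s H"
 shows "N_sum H \<in> borel_measurable (F s)"
 unfolding N_sum_def[abs_def]
proof (rule measurable_sum_list)
 fix e assume e: "e \<in> set H"
 obtain a b A k where eq: "e = (a, b, A, k)" by (cases e)
 with assms e have ab: "0 <= a" "a <= b" "b <= s" "A \<in> finite_marks" by (auto simp: rectangles_upto_def)
 have [measurable]: "compensated \<nu> N a b A \<in> borel_measurable (F s)"
  using ab by (auto intro!: F_measurable_le[OF compensated_adapted])
 show "(%w. case e of (a, b, A, k) => k * compensated \<nu> N a b A w) \<in> borel_measurable (F s)"
  unfolding eq prod.case by measurable
qed

lemma N_l2norm_QL:
 assumes f: "l2norm (time_measure t) f < \<infinity>" and h: "l2norm \<nu> h < \<infinity>"
 shows "l2norm (QL t) (%(r, v, w). f r * h v) = l2norm (time_measure t) f * l2norm \<nu> h"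
  "(%(r, v, w). f r * h v) \<in> borel_measurable (QL t)"
proof -
 interpret T: finite_measure "restrict_space lborel {0<..t}" by (rule finite_Ioc_measure)
 have 1: "l2norm M (%_. 1) = 1" by (rule l2norm_one[OF prob_space_axioms])
 then have 2: "l2norm M (%_. 1) < \<infinity>" by simp
 note P = l2norm_product[OF nu.sigma_finite_measure_axioms sigma_finite_measure_axioms h 2]
 have P1: "l2norm (\<nu> \<Otimes>\<^sub>M M) (%(v, w). h v * 1) = l2norm \<nu> h" using P(1) by (simp add: 1)
 have P2: "l2norm (\<nu> \<Otimes>\<^sub>M M) (%(v, w). h v * 1) < \<infinity>" unfolding P1 by (rule h)
 have f': "l2norm (restrict_space lborel {0<..t}) f < \<infinity>"
  using f l2norm_Ioc[OF l2norm_finiteD(1)[OF f]] by simp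
 note R = l2norm_product[OF T.sigma_finite_measure_axioms nuM.sigma_finite_measure_axioms f' P2]
 have eq: "(%(x, y). f x * (case y of (v, w) => h v * 1)) = (%(r, v, w). f r * h v)" by auto
 show "l2norm (QL t) (%(r, v, w). f r * h v) = l2norm (time_measure t) f * l2norm \<nu> h"
  using R(1) unfolding eq P1 l2norm_Ioc[OF l2norm_finiteD(1)[OF f]] .
 show "(%(r, v, w). f r * h v) \<in> borel_measurable (QL t)" using R(2) unfolding eq .
qed

lemma lin_comb_l2: "fst ` set G \<subseteq> finite_marks ==> l2norm \<nu> (lin_comb G) < \<infinity>"
proof (induction G)
 case (Cons p G)
 obtain A k where p: "p = (A, k)" by (cases p)
 then have A: "A \<in> sets \<nu>" "emeasure \<nu> A < \<infinity>" using Cons.prems by (auto simp: finite_marks_def)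
 have "(%v. (indicator A v)\<^sup>2) = (indicator A :: 'e => real)" by (auto simp: indicator_def)
 then have "l2norm \<nu> (indicator A) < \<infinity>" using A by (simp add: l2norm_def)
 then have "l2norm \<nu> (%v. k * indicator A v + lin_comb G v) < \<infinity>"
  using Cons by (intro l2norm_add_finite l2norm_scale_finite) auto
 then show ?case by (simp add: p lin_comb_def[abs_def])
qed (simp add: lin_comb_def[abs_def])

text \<open>The error of the product splits into (D - \<phi>) G + \<phi> (G - g), and the norm of G
  is eventually at most 1 + ||g||.\<close>

lemma levy_approximation:
 assumes t: "0 <= t" and \<phi>: "l2norm (time_measure t) \<phi> < \<infinity>" and g: "l2norm \<nu> g < \<infinity>"
  and D: "(%n. l2norm (time_measure t) (%r. step_value (D n) r - \<phi> r)) \<longlonglongrightarrow> 0"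
  and G: "!!n. fst ` set (G n) \<subseteq> finite_marks" "(%n. l2norm \<nu> (%v. lin_comb (G n) v - g v)) \<longlonglongrightarrow> 0"
 shows "(%n. l2norm (QL t) (%q. isometric_family.V N_val (N_entries (N_flat (D n) (G n))) q - (%(r, v, w). \<phi> r * g v) q)) \<longlonglongrightarrow> 0"
proof -
 let ?a = "%n. l2norm (time_measure t) (%r. step_value (D n) r - \<phi> r)"
 let ?c = "%n. l2norm \<nu> (%v. lin_comb (G n) v - g v)"
 have bound: "l2norm (QL t) (%q. isometric_family.V N_val (N_entries (N_flat (D n) (G n))) q - (%(r, v, w). \<phi> r * g v) q) <=
   ?a n * l2norm \<nu> (lin_comb (G n)) + l2norm (time_measure t) \<phi> * ?c n" for n
 proof -
  have f: "(%q. isometric_family.V N_val (N_entries (N_flat (D n) (G n))) q - (%(r, v, w). \<phi> r * g v) q) =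
    (%q. (%(r, v, w). (step_value (D n) r - \<phi> r) * lin_comb (G n) v) q + (%(r, v, w). \<phi> r * (lin_comb (G n) v - g v)) q)"
   by (auto simp: N_V[OF t] N_flat_value fun_eq_iff algebra_simps)
  note 1 = N_l2norm_QL(1)[OF l2norm_step_diff_finite[OF \<phi>, of "D n"] lin_comb_l2[OF G(1)[of n]]]
  note 2 = N_l2norm_QL(1)[OF \<phi> l2norm_diff_finite[OF lin_comb_l2[OF G(1)[of n]] g]]
  show ?thesis unfolding f using l2norm_triangle[of "QL t" "%(r, v, w). (step_value (D n) r - \<phi> r) * lin_comb (G n) v"
    "%(r, v, w). \<phi> r * (lin_comb (G n) v - g v)"] unfolding 1 2 .
 qed
 have ev: "eventually (%n. ?a n * l2norm \<nu> (lin_comb (G n)) + l2norm (time_measure t) \<phi> * ?c n <=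
   (1 + l2norm \<nu> g) * ?a n + l2norm (time_measure t) \<phi> * ?c n) sequentially"
  using tendsto_ennreal_0D[OF G(2), of 1, simplified]
 proof eventually_elim
  case (elim n)
  have "l2norm \<nu> (lin_comb (G n)) <= 1 + l2norm \<nu> g"
   using l2norm_triangle_ineq[of \<nu> "lin_comb (G n)" g] add_right_mono[OF elim] by (rule order_trans)
  from mult_left_mono[OF this, of "?a n"] show ?case
   by (intro add_right_mono) (simp only: mult.commute zero_le)
 qed
 have "(%n. (1 + l2norm \<nu> g) * ?a n + l2norm (time_measure t) \<phi> * ?c n) \<longlonglongrightarrow>
   (1 + l2norm \<nu> g) * 0 + l2norm (time_measure t) \<phi> * 0"
  using \<phi> g by (intro tendsto_add ennreal_tendsto_cmult D G(2)) (auto simp: ennreal_add_eq_top less_top)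
 then have lim: "(%n. (1 + l2norm \<nu> g) * ?a n + l2norm (time_measure t) \<phi> * ?c n) \<longlonglongrightarrow> 0" by simp
 show ?thesis
 proof (rule tendsto_ennreal_0_le[OF lim])
  show "eventually (%n. l2norm (QL t) (%q. isometric_family.V N_val (N_entries (N_flat (D n) (G n))) q - (%(r, v, w). \<phi> r * g v) q) <=
    (1 + l2norm \<nu> g) * ?a n + l2norm (time_measure t) \<phi> * ?c n) sequentially"
   using ev by eventually_elim (rule order_trans[OF bound])
 qed
qed

lemma levy_integral_unique:
 assumes "0 <= t" "has_levy_integral M F \<nu> N t \<phi> I" "has_levy_integral M F \<nu> N t \<phi> I'"
 shows "AE w in M. I w = I' w"
 using isometric_family.has_int_unique[OF N_isometric[OF assms(1)]] assms(2,3)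
 unfolding has_levy_integral_iff[OF assms(1)] by blast

lemma levy_integral_measurable:
 assumes "0 <= t" "has_levy_integral M F \<nu> N t \<phi> I"
 shows "I \<in> borel_measurable M" "l2norm M I < \<infinity>"
 using isometric_family.has_int_norm(2)[OF N_isometric[OF assms(1)]] assms(2) l2norm_finiteD(1)
 unfolding has_levy_integral_iff[OF assms(1)] by blast+

lemma levy_integral_cong:
 assumes "0 <= t" "has_levy_integral M F \<nu> N t \<phi> I"
  "!!r v w. 0 <= r ==> r <= t ==> \<phi> r v w = \<psi> r v w"
 shows "has_levy_integral M F \<nu> N t \<psi> I"
 using assms(2) unfolding has_levy_integral_iff[OF assms(1)]
 by (rule isometric_family.has_int_cong[OF N_isometric[OF assms(1)]])
  (use assms(3) in \<open>auto simp: space_pair_measure space_restrict_space\<close>)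

lemma levy_det_exists:
 assumes s: "0 <= s" and \<phi>: "l2norm (time_measure s) \<phi> < \<infinity>"
  and g: "l2norm \<nu> g < \<infinity>" "approximable \<nu> finite_marks g"
 obtains I H where "I \<in> borel_measurable (F s)" "!!n. rectangles_upto s (H n)"
  "(%n. l2norm M (%w. N_sum (H n) w - I w)) \<longlonglongrightarrow> 0"
  "!!t. s <= t ==> has_levy_integral M F \<nu> N t (%r v _. (\<phi> r * indicator {..s} r) * g v) I"
proof -
 obtain D where D: "!!n. steps_upto s (D n)"
  and limD: "(%n. l2norm (time_measure s) (%r. step_value (D n) r - \<phi> r)) \<longlonglongrightarrow> 0"
  using exists_step_approximation[OF s \<phi>] by blast
 obtain G where G: "!!n. fst ` set (G n) \<subseteq> finite_marks"
  and limG: "(%n. l2norm \<nu> (%v. lin_comb (G n) v - g v)) \<longlonglongrightarrow> 0"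
  using approximableD_seq[OF g(2)] by blast
 define H where "H n = N_flat (D n) (G n)" for n
 have H: "rectangles_upto s (H n)" for n unfolding H_def by (rule N_flat_rectangles[OF D G])
 have lim: "(%n. l2norm (QL t) (%q. isometric_family.V N_val (N_entries (H n)) q -
   (%(r, v, w). (\<phi> r * indicator {..s} r) * g v) q)) \<longlonglongrightarrow> 0"
  "l2norm (time_measure t) (%r. \<phi> r * indicator {..s} r) < \<infinity>" if t: "s <= t" for t
 proof -
  have "l2norm (time_measure t) (%r. step_value (D n) r - \<phi> r * indicator {..s} r) =
    l2norm (time_measure s) (%r. step_value (D n) r - \<phi> r)" for n
  proof -
   have "(%r. step_value (D n) r - \<phi> r * indicator {..s} r) = (%r. (step_value (D n) r - \<phi> r) * indicator {..s} r)"
    using step_value_beyond[OF D[of n]] by (auto simp: fun_eq_iff indicator_def not_le)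
   then show ?thesis by (simp add: l2norm_time_restrict[OF s t])
  qed
  with limD have "(%n. l2norm (time_measure t) (%r. step_value (D n) r - \<phi> r * indicator {..s} r)) \<longlonglongrightarrow> 0" by simp
  moreover show fin: "l2norm (time_measure t) (%r. \<phi> r * indicator {..s} r) < \<infinity>"
   using \<phi> by (simp add: l2norm_time_restrict[OF s t])
  ultimately show "(%n. l2norm (QL t) (%q. isometric_family.V N_val (N_entries (H n)) q -
   (%(r, v, w). (\<phi> r * indicator {..s} r) * g v) q)) \<longlonglongrightarrow> 0"
   unfolding H_def using s t by (intro levy_approximation g G limG) auto
 qed
 have J: "isometric_family.J (N_int t) (N_entries (H n)) w = N_sum (H n) w" if t: "s <= t" for t n w
  using s t by (simp add: N_J N_entries_integral[OF H t])
 interpret isometric_family "QL s" M N_adm N_val "N_int s" N_scale by (rule N_isometric[OF s])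
 obtain I where I: "I \<in> borel_measurable M" "(%n. l2norm M (%w. J (N_entries (H n)) w - I w)) \<longlonglongrightarrow> 0"
  using has_int_exists[OF N_entries_adm[OF H] lim(1)[OF order_refl] N_l2norm_QL(2)[OF lim(2)[OF order_refl] g(1)]] by blast
 note I2 = I(2)[unfolded J[OF order_refl]]
 have IF: "I \<in> borel_measurable (F s)"
  by (rule l2_limit_subalgebra[OF complete_M F_subalgebra null_F[OF s] N_sum_adapted[OF H] I(1) I2])
 have "has_levy_integral M F \<nu> N t (%r v _. (\<phi> r * indicator {..s} r) * g v) I" if t: "s <= t" for t
 proof -
  have t0: "0 <= t" using s t by simp
  interpret T: isometric_family "QL t" M N_adm N_val "N_int t" N_scale by (rule N_isometric[OF t0])
  show ?thesis
   unfolding has_levy_integral_iff[OF t0] T.has_int_def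
  proof (intro conjI exI[of _ "%n. N_entries (H n)"] allI)
   show "(%(r, v, w). (\<phi> r * indicator {..s} r) * g v) \<in> borel_measurable (QL t)"
    by (rule N_l2norm_QL(2)[OF lim(2)[OF t] g(1)])
   show "set (N_entries (H n)) \<subseteq> N_adm" for n by (rule N_entries_adm[OF H])
   show "(%n. l2norm (QL t) (%q. T.V (N_entries (H n)) q - (%(r, v, w). (\<phi> r * indicator {..s} r) * g v) q)) \<longlonglongrightarrow> 0"
    by (rule lim(1)[OF t])
   show "(%n. l2norm M (%w. T.J (N_entries (H n)) w - I w)) \<longlonglongrightarrow> 0" unfolding J[OF t] by (rule I2)
  qed
 qed
 from that[OF IF H I2 this] show ?thesis by blast
qed

definition N_rel :: "('e => real) => real => (real => real) => ('a => real) => bool" where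
 "N_rel g t \<phi> J \<longleftrightarrow> l2norm (time_measure t) \<phi> < \<infinity> \<and> has_levy_integral M F \<nu> N t (%r v _. \<phi> r * g v) J"

lemma N_rel_det:
 assumes t: "0 <= t" and R: "N_rel g t \<phi> I" and g: "l2norm \<nu> g < \<infinity>" "approximable \<nu> finite_marks g"
 obtains I' H where "I' \<in> borel_measurable (F t)" "!!n. rectangles_upto t (H n)"
  "(%n. l2norm M (%w. N_sum (H n) w - I' w)) \<longlonglongrightarrow> 0"
  "!!u. t <= u ==> has_levy_integral M F \<nu> N u (%r v _. (\<phi> r * indicator {..t} r) * g v) I'"
  "AE w in M. I' w = I w"
proof -
 from R have \<phi>: "l2norm (time_measure t) \<phi> < \<infinity>" and hI: "has_levy_integral M F \<nu> N t (%r v _. \<phi> r * g v) I"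
  unfolding N_rel_def by blast+
 obtain I' H where I': "I' \<in> borel_measurable (F t)" "!!n. rectangles_upto t (H n)"
  "(%n. l2norm M (%w. N_sum (H n) w - I' w)) \<longlonglongrightarrow> 0"
  "!!u. t <= u ==> has_levy_integral M F \<nu> N u (%r v _. (\<phi> r * indicator {..t} r) * g v) I'"
  using levy_det_exists[OF t \<phi> g] by blast
 have "has_levy_integral M F \<nu> N t (%r v _. \<phi> r * g v) I'"
  by (rule levy_integral_cong[OF t I'(4)[OF order_refl]]) simp
 from that[OF I' levy_integral_unique[OF t this hI]] show ?thesis by blast
qed

text \<open>With g fixed, integration of \<phi>(r) g(v) depends on \<phi> alone; g only sets the
  intensity, through its norm in L2(\<nu>).\<close>

lemma N_noise:
 assumes g: "l2norm \<nu> g < \<infinity>" "approximable \<nu> finite_marks g"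
 shows "l2_noise M F (rnorm \<nu> g) (N_rel g)"
proof
 show "0 <= rnorm \<nu> g" by simp
 fix t :: real and \<phi> \<psi> :: "real => real" and I J :: "'a => real" and a b :: real
 show "N_rel g t \<phi> I ==> l2norm (time_measure t) \<phi> < \<infinity>" by (simp add: N_rel_def)
 show "\<exists>I. N_rel g t \<phi> I" if t: "0 <= t" and \<phi>: "l2norm (time_measure t) \<phi> < \<infinity>"
 proof -
  obtain I H where "I \<in> borel_measurable (F t)" "!!n. rectangles_upto t (H n)"
   "(%n. l2norm M (%w. N_sum (H n) w - I w)) \<longlonglongrightarrow> 0"
   and I: "!!u. t <= u ==> has_levy_integral M F \<nu> N u (%r v _. (\<phi> r * indicator {..t} r) * g v) I"
   using levy_det_exists[OF t \<phi> g] by blast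
  have "has_levy_integral M F \<nu> N t (%r v _. \<phi> r * g v) I"
   by (rule levy_integral_cong[OF t I[OF order_refl]]) simp
  with \<phi> show ?thesis unfolding N_rel_def by blast
 qed
 show "N_rel g t (%r. a * \<phi> r + b * \<psi> r) (%w. a * I w + b * J w)"
  if t: "0 <= t" and R: "N_rel g t \<phi> I" "N_rel g t \<psi> J"
 proof -
  have "l2norm (time_measure t) (%r. a * \<phi> r + b * \<psi> r) < \<infinity>"
   using R by (intro l2norm_add_finite l2norm_scale_finite) (auto simp: N_rel_def)
  moreover have "has_levy_integral M F \<nu> N t (%r v _. a * (\<phi> r * g v) + b * (\<psi> r * g v)) (%w. a * I w + b * J w)"
   using isometric_family.has_int_linear[OF N_isometric[OF t], of "%(r, v, w). \<phi> r * g v" I "%(r, v, w). \<psi> r * g v" J a b] R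
   unfolding N_rel_def has_levy_integral_iff[OF t] case_prod_beta' by blast
  then have "has_levy_integral M F \<nu> N t (%r v _. (a * \<phi> r + b * \<psi> r) * g v) (%w. a * I w + b * J w)"
   by (rule levy_integral_cong[OF t]) (simp add: algebra_simps)
  ultimately show ?thesis unfolding N_rel_def by blast
 qed
 show "l2norm M I = ennreal (rnorm \<nu> g) * l2norm (time_measure t) \<phi>" if t: "0 <= t" and R: "N_rel g t \<phi> I"
 proof -
  have "l2norm M I = l2norm (QL t) (%(r, v, w). \<phi> r * g v)"
   using isometric_family.has_int_norm(1)[OF N_isometric[OF t]] R
   unfolding N_rel_def has_levy_integral_iff[OF t] by blast
  also have "... = l2norm (time_measure t) \<phi> * l2norm \<nu> g"
   using R by (intro N_l2norm_QL(1) g) (simp add: N_rel_def)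
  finally show ?thesis by (simp only: l2norm_finiteD(3)[OF g(1)] mult.commute)
 qed
 show "N_rel g t (%r. \<phi> r * indicator {..s} r) I" if s: "0 <= s" "s <= t" and R: "N_rel g s \<phi> I" for s
 proof -
  obtain I' H where "I' \<in> borel_measurable (F s)" "!!n. rectangles_upto s (H n)"
   "(%n. l2norm M (%w. N_sum (H n) w - I' w)) \<longlonglongrightarrow> 0"
   and I'0: "!!u. s <= u ==> has_levy_integral M F \<nu> N u (%r v _. (\<phi> r * indicator {..s} r) * g v) I'"
   and I'1: "AE w in M. I' w = I w"
   using N_rel_det[OF s(1) R g] by blast
  note I' = I'0[OF s(2)] I'1
  have t: "0 <= t" using s by simp
  have "I \<in> borel_measurable M" using levy_integral_measurable(1)[OF s(1)] R unfolding N_rel_def by blast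
  from isometric_family.has_int_AE[OF N_isometric[OF t] I'(1)[unfolded has_levy_integral_iff[OF t]] I'(2) this]
  have "has_levy_integral M F \<nu> N t (%r v _. (\<phi> r * indicator {..s} r) * g v) I"
   unfolding has_levy_integral_iff[OF t] .
  then show ?thesis using R unfolding N_rel_def l2norm_time_restrict[OF s] by blast
 qed
 show "I \<in> borel_measurable (F t)" if t: "0 <= t" and R: "N_rel g t \<phi> I"
 proof -
  obtain I' H where I'0: "I' \<in> borel_measurable (F t)" "!!n. rectangles_upto t (H n)"
   "(%n. l2norm M (%w. N_sum (H n) w - I' w)) \<longlonglongrightarrow> 0"
   "!!u. t <= u ==> has_levy_integral M F \<nu> N u (%r v _. (\<phi> r * indicator {..t} r) * g v) I'"
   and I'1: "AE w in M. I' w = I w"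
   using N_rel_det[OF t R g] by blast
  note I' = I'0(1) I'1
  have "I \<in> borel_measurable M" using levy_integral_measurable(1)[OF t] R unfolding N_rel_def by blast
  from F_measurable_AE[OF t this I'(1)] I'(2) show ?thesis by (simp add: eq_commute)
 qed
 show "N_rel g t \<psi> I" if t: "0 <= t" and R: "N_rel g t \<phi> I" and eq: "!!r. 0 <= r ==> r <= t ==> \<phi> r = \<psi> r"
 proof -
  have l: "l2norm (time_measure t) \<phi> = l2norm (time_measure t) \<psi>"
   using eq by (intro l2norm_cong) (auto simp: space_restrict_space)
  have "has_levy_integral M F \<nu> N t (%r v _. \<psi> r * g v) I"
   by (rule levy_integral_cong[OF t, of "%r v _. \<phi> r * g v"]) (use R eq in \<open>simp_all add: N_rel_def\<close>)
  with l R show ?thesis unfolding N_rel_def by metis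
 qed
qed

text \<open>Sets on which g has no zero keep a positive distance from 0, so they lie in
  \<open>finite_marks\<close>.\<close>

lemma jump_data_l2:
 assumes "jump_data c \<nu> g"
 shows "l2norm \<nu> g < \<infinity>" "approximable \<nu> finite_marks g"
proof -
 show g: "l2norm \<nu> g < \<infinity>" using assms by (simp add: jump_data_def l2norm_def)
 from assms obtain U where U: "open U" "0 \<in> U" "!!v. v \<in> marks c ==> v \<in> U ==> g v = 0"
  by (auto simp: jump_data_def)
 then obtain e where e: "e > 0" "ball 0 e \<subseteq> U" by (auto simp: open_contains_ball)
 show "approximable \<nu> finite_marks g"
 proof (rule approximable_of_sets[OF g approximable_generator])
  fix A assume A: "A \<in> sets \<nu>" "!!v. v \<in> A ==> g v \<noteq> 0"
  have "A \<subseteq> {v \<in> marks c. e <= norm v}"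
  proof
   fix v assume v: "v \<in> A"
   then have "v \<in> marks c" using A(1) by (auto simp: sets_nu)
   with U(3)[of v] A(2)[OF v] e(2) have "v \<notin> ball 0 e" by blast
   with \<open>v \<in> marks c\<close> show "v \<in> {v \<in> marks c. e <= norm v}" by simp
  qed
  moreover have "{v \<in> marks c. e <= norm v} \<in> sets \<nu>" using marks_borel by (auto simp: sets_nu)
  ultimately have "emeasure \<nu> A <= emeasure \<nu> {v \<in> marks c. e <= norm v}" by (rule emeasure_mono)
  with emeasure_nu_away[OF e(1)] A(1) show "A \<in> finite_marks" by (simp add: finite_marks_def le_less_trans)
 qed
qed

text \<open>Independence is given for the sigma-algebras generated by the single values
  \<open>W t\<close> and by the compensated counts. An increment of W is measurable for the first,
  and both factors are centred.\<close>

lemma noises_uncorrelated: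
 assumes W: "0 <= a" "a <= b" and N: "0 <= a'" "a' <= b'" "A \<in> finite_marks"
 shows "integrable M (%w. (W b w - W a w) * compensated \<nu> N a' b' A w)"
  "(\<integral>w. (W b w - W a w) * compensated \<nu> N a' b' A w \<partial>M) = 0"
proof -
 have Wl2: "l2norm M (%w. W b w - W a w) < \<infinity>" using W.m_l2[OF UNIV_I W] .
 note Nl2 = compensated_l2[OF N(3) N(1,2)]
 show "integrable M (%w. (W b w - W a w) * compensated \<nu> N a' b' A w)"
  by (rule cauchy_schwarz_l2(1)[OF Wl2 Nl2])
 let ?G = "\<Union>t\<in>{0..}. events_of M (W t)"
 let ?H = "\<Union>(s, t, A)\<in>{(s, t, A). 0 <= s \<and> s <= t \<and> A \<in> sets \<nu> \<and> emeasure \<nu> A < \<infinity>}. events_of M (compensated \<nu> N s t A)"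
 have G: "?G \<subseteq> Pow (space M)" by (auto simp: events_of_def)
 define S where "S = sigma (space M) ?G"
 have S: "sets S = sigma_sets (space M) ?G" "space S = space M" unfolding S_def using G by simp_all
 have ind: "indep_set (sets S) (sigma_sets (space M) ?H)"
  unfolding S using independent unfolding independent_noises_def .
 have "sigma_sets (space M) ?G \<subseteq> sets M"
  using ind unfolding S indep_sets2_eq by blast
 then have sub: "subalgebra M S" unfolding subalgebra_def S by simp
 have WS: "W t \<in> borel_measurable S" if "0 <= t" for t
 proof (rule measurableI)
  fix B :: "real set" assume "B \<in> sets borel"
  then have "W t -` B \<inter> space S \<in> ?G" using that unfolding S events_of_def by blast
  then show "W t -` B \<inter> space S \<in> sets S" unfolding S by (rule sigma_sets.Basic)
 qed simp
 have "events_of M (compensated \<nu> N a' b' A) \<subseteq> ?H" using N by (auto simp: finite_marks_def)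
 then have sub2: "events_of M (compensated \<nu> N a' b' A) \<subseteq> sigma_sets (space M) ?H" by (auto intro: sigma_sets.Basic)
 have ind2: "indep_set (sets S) (events_of M (compensated \<nu> N a' b' A))"
  using ind sub2 unfolding indep_sets2_eq by blast
 have "(\<integral>w. (W b w - W a w) * compensated \<nu> N a' b' A w \<partial>M) =
   (\<integral>w. W b w - W a w \<partial>M) * (\<integral>w. compensated \<nu> N a' b' A w \<partial>M)"
 proof (rule indep_events_of_integral[OF ind2 sub, where g = "%x. x"])
  show "(%w. W b w - W a w) \<in> borel_measurable S" using W by (intro borel_measurable_diff WS) auto
  show "integrable M (%w. W b w - W a w)" by (rule l2norm_finite_integrable[OF Wl2])
  show "integrable M (compensated \<nu> N a' b' A)" by (rule N_moments(2)[OF N])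
 qed (use N_moments(2)[OF N] in auto)
 then show "(\<integral>w. (W b w - W a w) * compensated \<nu> N a' b' A w \<partial>M) = 0"
  unfolding N_moments(3)[OF N] by simp
qed

text \<open>The integrands are deterministic, so both integrals are limits of step sums with
  constant coefficients and only products of one increment of each noise occur.\<close>

theorem integrals_orthogonal:
 assumes t: "0 <= t" and W: "W_rel t \<phi> I" and N: "N_rel g t \<psi> J"
  and g: "l2norm \<nu> g < \<infinity>" "approximable \<nu> finite_marks g"
 shows "(\<integral>w. I w * J w \<partial>M) = 0"
proof -
 obtain I' D where I': "I' \<in> borel_measurable (F t)" "!!n. steps_upto t (D n)"
  "(%n. l2norm M (%w. W_sum (D n) w - I' w)) \<longlonglongrightarrow> 0"
  "!!u. t <= u ==> has_wiener_integral M F W u (%r _. \<phi> r * indicator {..t} r) I'"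
  and I'1: "AE w in M. I' w = I w"
  using W_rel_det[OF t W] by blast
 obtain J' H where J': "J' \<in> borel_measurable (F t)" "!!n. rectangles_upto t (H n)"
  "(%n. l2norm M (%w. N_sum (H n) w - J' w)) \<longlonglongrightarrow> 0"
  "!!u. t <= u ==> has_levy_integral M F \<nu> N u (%r v _. (\<psi> r * indicator {..t} r) * g v) J'"
  and J'1: "AE w in M. J' w = J w"
  using N_rel_det[OF t N g] by blast
 have I: "I \<in> borel_measurable M" using wiener_integral_measurable(1)[OF t] W unfolding W_rel_def by blast
 have J: "J \<in> borel_measurable M" using levy_integral_measurable(1)[OF t] N unfolding N_rel_def by blast
 have "(\<integral>w. I' w * J' w \<partial>M) = 0"
 proof (rule integral_l2_limit_zero[OF I'(3) wiener_integral_measurable(2)[OF t I'(4)[OF order_refl]]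
    J'(3) levy_integral_measurable(2)[OF t J'(4)[OF order_refl]]])
  fix n
  have *: "integrable M (%w. (case x of (a, b, k) => k * (W b w - W a w)) * (case y of (a, b, A, k) => k * compensated \<nu> N a b A w)) \<and>
    (\<integral>w. (case x of (a, b, k) => k * (W b w - W a w)) * (case y of (a, b, A, k) => k * compensated \<nu> N a b A w) \<partial>M) = 0"
   if "x \<in> set (D n)" "y \<in> set (H n)" for x y
  proof -
   obtain a b k where x: "x = (a, b, k)" by (cases x)
   obtain a' b' A l where y: "y = (a', b', A, l)" by (cases y)
   have ab: "0 <= a" "a <= b" "0 <= a'" "a' <= b'" "A \<in> finite_marks"
    using that I'(2)[of n] J'(2)[of n] by (auto simp: x y steps_upto_def rectangles_upto_def)
   have eq: "(%w. k * (W b w - W a w) * (l * compensated \<nu> N a' b' A w)) =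
     (%w. (k * l) * ((W b w - W a w) * compensated \<nu> N a' b' A w))" by (auto simp: ac_simps)
   note un = noises_uncorrelated[OF ab]
   show ?thesis
    unfolding x y prod.case eq using un(1) by (simp only: integral_mult_right_zero un(2) integrable_mult_right mult_zero_right simp_thms)
  qed
  show "(\<integral>w. W_sum (D n) w * N_sum (H n) w \<partial>M) = 0"
   unfolding W_sum_def N_sum_def by (rule conjunct2[OF integral_sum_list_product_zero]) (rule *)
 qed
 also have "(\<integral>w. I' w * J' w \<partial>M) = (\<integral>w. I w * J w \<partial>M)"
 proof (rule integral_cong_AE)
  show "AE w in M. I' w * J' w = I w * J w" using I'1 J'1 by eventually_elim simp
  show "(%w. I' w * J' w) \<in> borel_measurable M" using F_measurable_M[OF I'(1)] F_measurable_M[OF J'(1)] by (rule borel_measurable_times)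
  show "(%w. I w * J w) \<in> borel_measurable M" using I J by (rule borel_measurable_times)
 qed
 finally show ?thesis .
qed

end

section \<open>The heat semigroup on Hoelder functions\<close>

lemma heat_kernel_normal: "0 < s ==> heat_kernel s u = normal_density 0 (sqrt s) u"
 by (simp add: heat_kernel_def normal_density_def powr_minus powr_half_sqrt inverse_eq_divide)

text \<open>By the convention \<open>0 powr a = 0\<close>, the end point r = t of the time integrals
  gets the value 0.\<close>

lemma heat_kernel_zero_time [simp]: "heat_kernel 0 u = 0"
 by (simp add: heat_kernel_def)

lemma heat_kernel_nonneg [simp]: "0 <= heat_kernel s u"
 by (simp add: heat_kernel_def)

lemma heat_kernel_measurable [measurable]: "(%(s, u). heat_kernel s u) \<in> borel_measurable (borel \<Otimes>\<^sub>M borel)"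
 unfolding heat_kernel_def by measurable

definition heat_kernel_deriv :: "real => real => real" where
 "heat_kernel_deriv s u = - (u / s) * heat_kernel s u"

definition heat_kernel_deriv2 :: "real => real => real" where
 "heat_kernel_deriv2 s u = (u\<^sup>2 / s - 1) / s * heat_kernel s u"

lemma heat_kernel_deriv_measurable [measurable]:
 "(%(s, u). heat_kernel_deriv s u) \<in> borel_measurable (borel \<Otimes>\<^sub>M borel)"
 unfolding heat_kernel_deriv_def by measurable

lemma heat_kernel_has_derivative:
 assumes s: "0 < s"
 shows "(heat_kernel s has_real_derivative heat_kernel_deriv s u) (at u)"
  "(heat_kernel_deriv s has_real_derivative heat_kernel_deriv2 s u) (at u)"
proof -
 have 1: "(heat_kernel s has_real_derivative heat_kernel_deriv s u) (at u)" for u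
  unfolding heat_kernel_def[abs_def] heat_kernel_deriv_def
  by (rule derivative_eq_intros refl | use s in \<open>simp add: field_simps power2_eq_square\<close>)+
 show "(heat_kernel s has_real_derivative heat_kernel_deriv s u) (at u)" by (rule 1)
 show "(heat_kernel_deriv s has_real_derivative heat_kernel_deriv2 s u) (at u)"
  unfolding heat_kernel_deriv_def[abs_def] heat_kernel_deriv2_def
  by (rule derivative_eq_intros 1 refl | use s in \<open>simp add: heat_kernel_deriv_def field_simps power2_eq_square\<close>)+
qed

lemma heat_kernel_moments:
 assumes s: "0 < s"
 shows "integrable lborel (%u. heat_kernel s u * u ^ k)"
  "(\<integral>u. heat_kernel s u \<partial>lborel) = 1" "(\<integral>u. heat_kernel s u * u \<partial>lborel) = 0"
  "(\<integral>u. heat_kernel s u * u\<^sup>2 \<partial>lborel) = s" "(\<integral>u. heat_kernel s u * u ^ 4 \<partial>lborel) = 3 * s\<^sup>2"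
proof -
 have \<sigma>: "0 < sqrt s" using s by simp
 show "integrable lborel (%u. heat_kernel s u * u ^ k)"
  using integrable_normal_moment[OF \<sigma>, of 0 k] by (simp add: heat_kernel_normal[OF s])
 show "(\<integral>u. heat_kernel s u \<partial>lborel) = 1"
  using integral_normal_density[OF \<sigma>, of 0] by (simp add: heat_kernel_normal[OF s])
 show "(\<integral>u. heat_kernel s u * u \<partial>lborel) = 0"
  using integral_normal_moment_odd[OF \<sigma>, of 0 0] by (simp add: heat_kernel_normal[OF s])
 show "(\<integral>u. heat_kernel s u * u\<^sup>2 \<partial>lborel) = s"
  using integral_normal_moment_even[OF \<sigma>, of 0 1] s by (simp add: heat_kernel_normal[OF s] fact_numeral)
 show "(\<integral>u. heat_kernel s u * u ^ 4 \<partial>lborel) = 3 * s\<^sup>2"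
  using integral_normal_moment_even[OF \<sigma>, of 0 2] s
  by (simp add: heat_kernel_normal[OF s] fact_numeral power2_eq_square field_simps)
qed

text \<open>An integrable majorant, up to powers of s, of the kernel and its first two derivatives,
  with or without a factor |u|^\<gamma>. One factor 1 + u^2/s absorbs the derivatives and the other
  absorbs |u|^\<gamma>. Its mass 6 = 1 + 2 + 3 comes from the Gaussian moments of order 0, 2 and
  4.\<close>

definition gauss_weight :: "real => real => real" where
 "gauss_weight s u = heat_kernel s u * (1 + u\<^sup>2 / s)\<^sup>2"

lemma gauss_weight:
 assumes s: "0 < s"
 shows "integrable lborel (gauss_weight s)" "(\<integral>u. gauss_weight s u \<partial>lborel) = 6"
  "0 <= gauss_weight s u" "gauss_weight s (- u) = gauss_weight s u"
proof -
 have eq: "gauss_weight s = (%u. (heat_kernel s u * u ^ 0 + 2 / s * (heat_kernel s u * u\<^sup>2)) + 1 / s\<^sup>2 * (heat_kernel s u * u ^ 4))"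
  using s by (auto simp: gauss_weight_def fun_eq_iff field_simps power2_eq_square eval_nat_numeral)
 note m = heat_kernel_moments[OF s]
 show "integrable lborel (gauss_weight s)"
  unfolding eq using m(1) by (intro Bochner_Integration.integrable_add integrable_mult_right)
 have "(\<integral>u. gauss_weight s u \<partial>lborel) = (\<integral>u. heat_kernel s u * u ^ 0 \<partial>lborel) + 2 / s * (\<integral>u. heat_kernel s u * u\<^sup>2 \<partial>lborel) +
   1 / s\<^sup>2 * (\<integral>u. heat_kernel s u * u ^ 4 \<partial>lborel)"
  unfolding eq using m(1)[of 0] m(1)[of 2] m(1)[of 4]
  by (simp add: Bochner_Integration.integral_add Bochner_Integration.integrable_add integrable_mult_right del: power_0)
 also have "... = 6" using s m(2,4,5) by (simp add: field_simps)
 finally show "(\<integral>u. gauss_weight s u \<partial>lborel) = 6" .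
 show "0 <= gauss_weight s u" by (simp add: gauss_weight_def)
 show "gauss_weight s (- u) = gauss_weight s u" by (simp add: gauss_weight_def heat_kernel_def)
qed

lemma powr_le_one_plus_square:
 fixes x \<gamma> :: real
 assumes "0 <= x" "0 < \<gamma>" "\<gamma> <= 1"
 shows "x powr \<gamma> <= 1 + x\<^sup>2"
proof (cases "x <= 1")
 case True
 then have "x powr \<gamma> <= 1 powr \<gamma>" using assms by (intro powr_mono2) auto
 then show ?thesis by (simp add: add_increasing2)
next
 case False
 then have "x powr \<gamma> <= x powr 1" using assms by (intro powr_mono) auto
 also have "... <= x\<^sup>2" using False by (simp add: power2_eq_square)
 finally show ?thesis by simp
qed

lemma abs_powr_scaled:
 fixes s u \<gamma> :: real
 assumes s: "0 < s" and \<gamma>: "0 < \<gamma>" "\<gamma> <= 1"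
 shows "\<bar>u\<bar> powr \<gamma> <= s powr (\<gamma>/2) * (1 + u\<^sup>2 / s)"
proof -
 have "\<bar>u\<bar> powr \<gamma> = (sqrt s * (\<bar>u\<bar> / sqrt s)) powr \<gamma>" using s by simp
 also have "... = sqrt s powr \<gamma> * (\<bar>u\<bar> / sqrt s) powr \<gamma>" using s by (subst powr_mult) auto
 also have "sqrt s powr \<gamma> = s powr (\<gamma>/2)" using s by (simp add: powr_half_sqrt[symmetric] powr_powr)
 also have "s powr (\<gamma>/2) * (\<bar>u\<bar> / sqrt s) powr \<gamma> <= s powr (\<gamma>/2) * (1 + (\<bar>u\<bar> / sqrt s)\<^sup>2)"
  using s \<gamma> by (intro mult_left_mono powr_le_one_plus_square) auto
 also have "(\<bar>u\<bar> / sqrt s)\<^sup>2 = u\<^sup>2 / s" using s by (simp add: power_divide)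
 finally show ?thesis .
qed

text \<open>Parabolic scaling: each derivative costs \<open>s powr (-1/2)\<close>, while the weight
  |u|^\<gamma> gains \<open>s powr (\<gamma>/2)\<close>.\<close>

lemma heat_kernel_weighted:
 assumes s: "0 < s" and \<gamma>: "0 < \<gamma>" "\<gamma> <= 1"
 shows "\<bar>heat_kernel s u\<bar> * \<bar>u\<bar> powr \<gamma> <= s powr (\<gamma>/2) * gauss_weight s u"
  "\<bar>heat_kernel_deriv s u\<bar> * \<bar>u\<bar> powr \<gamma> <= s powr (-1/2 + \<gamma>/2) * gauss_weight s u"
  "\<bar>heat_kernel_deriv2 s u\<bar> * \<bar>u\<bar> powr \<gamma> <= s powr (-1 + \<gamma>/2) * gauss_weight s u"
  "\<bar>heat_kernel s u\<bar> <= gauss_weight s u"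
  "\<bar>heat_kernel_deriv s u\<bar> <= s powr (-1/2) * gauss_weight s u"
  "\<bar>heat_kernel_deriv2 s u\<bar> <= s powr (-1) * gauss_weight s u"
proof -
 define q where "q = 1 + u\<^sup>2 / s"
 have q1: "1 <= q" using s by (simp add: q_def)
 then have q: "1 <= q" "0 <= q" "q <= q\<^sup>2"
  using mult_left_mono[of 1 q q] by (simp_all add: power2_eq_square)
 have w: "gauss_weight s u = heat_kernel s u * (q * q)" by (simp add: gauss_weight_def q_def power2_eq_square)
 have p: "\<bar>u\<bar> powr \<gamma> <= s powr (\<gamma>/2) * q" unfolding q_def by (rule abs_powr_scaled[OF s \<gamma>])
 have d1: "\<bar>heat_kernel_deriv s u\<bar> <= heat_kernel s u * (s powr (-1/2) * q)"
 proof -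
  have "\<bar>u\<bar> <= sqrt s * q"
   using abs_powr_scaled[OF s, of 1 u] s by (simp add: q_def powr_half_sqrt)
  then have "\<bar>u\<bar> / s <= sqrt s * q / s" using s by (intro divide_right_mono) auto
  also have "... = s powr (-1/2) * q" using s by (simp add: powr_minus powr_half_sqrt field_simps)
  finally have "heat_kernel s u * (\<bar>u\<bar> / s) <= heat_kernel s u * (s powr (-1/2) * q)" by (rule mult_left_mono) simp
  moreover have "\<bar>heat_kernel_deriv s u\<bar> = heat_kernel s u * (\<bar>u\<bar> / s)"
   using s by (simp add: heat_kernel_deriv_def abs_mult)
  ultimately show ?thesis by simp
 qed
 have d2: "\<bar>heat_kernel_deriv2 s u\<bar> <= heat_kernel s u * (s powr (-1) * q)"
 proof -
  have "\<bar>u\<^sup>2 / s - 1\<bar> <= q" using s by (auto simp: q_def abs_le_iff)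
  then have "\<bar>u\<^sup>2 / s - 1\<bar> / s <= q / s" using s by (intro divide_right_mono) auto
  also have "... = s powr (-1) * q" using s by (simp add: powr_minus field_simps)
  finally have "heat_kernel s u * (\<bar>u\<^sup>2 / s - 1\<bar> / s) <= heat_kernel s u * (s powr (-1) * q)" by (rule mult_left_mono) simp
  moreover have "\<bar>heat_kernel_deriv2 s u\<bar> = heat_kernel s u * (\<bar>u\<^sup>2 / s - 1\<bar> / s)"
   using s by (simp add: heat_kernel_deriv2_def abs_mult)
  ultimately show ?thesis by simp
 qed
 have qq: "a * q <= a * (q * q)" if "0 <= a" for a using q that by (intro mult_left_mono) (auto simp: power2_eq_square)
 have qq1: "a <= a * (q * q)" if "0 <= a" for a
  using mult_left_mono[OF q(1) that] qq[OF that] by simp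
 show "\<bar>heat_kernel s u\<bar> <= gauss_weight s u" unfolding w using qq1[of "heat_kernel s u"] by simp
 show "\<bar>heat_kernel_deriv s u\<bar> <= s powr (-1/2) * gauss_weight s u"
  using d1 qq[of "heat_kernel s u * s powr (-1/2)"] unfolding w by (simp add: ac_simps)
 show "\<bar>heat_kernel_deriv2 s u\<bar> <= s powr (-1) * gauss_weight s u"
  using d2 qq[of "heat_kernel s u * s powr (-1)"] unfolding w by (simp add: ac_simps)
 show "\<bar>heat_kernel s u\<bar> * \<bar>u\<bar> powr \<gamma> <= s powr (\<gamma>/2) * gauss_weight s u"
 proof -
  have "\<bar>heat_kernel s u\<bar> * \<bar>u\<bar> powr \<gamma> <= heat_kernel s u * (s powr (\<gamma>/2) * q)"
   using mult_left_mono[OF p heat_kernel_nonneg] by simp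
  then show ?thesis using qq[of "heat_kernel s u * s powr (\<gamma>/2)"] unfolding w by (simp add: ac_simps)
 qed
 show "\<bar>heat_kernel_deriv s u\<bar> * \<bar>u\<bar> powr \<gamma> <= s powr (-1/2 + \<gamma>/2) * gauss_weight s u"
 proof -
  have "\<bar>heat_kernel_deriv s u\<bar> * \<bar>u\<bar> powr \<gamma> <= (heat_kernel s u * (s powr (-1/2) * q)) * (s powr (\<gamma>/2) * q)"
   using q by (intro mult_mono d1 p) auto
  also have "... = (s powr (-1/2) * s powr (\<gamma>/2)) * (heat_kernel s u * (q * q))" by (simp add: ac_simps)
  finally show ?thesis unfolding w powr_add .
 qed
 show "\<bar>heat_kernel_deriv2 s u\<bar> * \<bar>u\<bar> powr \<gamma> <= s powr (-1 + \<gamma>/2) * gauss_weight s u"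
 proof -
  have "\<bar>heat_kernel_deriv2 s u\<bar> * \<bar>u\<bar> powr \<gamma> <= (heat_kernel s u * (s powr (-1) * q)) * (s powr (\<gamma>/2) * q)"
   using q by (intro mult_mono d2 p) auto
  also have "... = (s powr (-1) * s powr (\<gamma>/2)) * (heat_kernel s u * (q * q))" by (simp add: ac_simps)
  finally show ?thesis unfolding w powr_add .
 qed
qed

lemma gauss_weight_measurable [measurable]: "(%(s, u). gauss_weight s u) \<in> borel_measurable (borel \<Otimes>\<^sub>M borel)"
 unfolding gauss_weight_def by measurable

lemma heat_kernel_measurable1 [measurable]: "heat_kernel s \<in> borel_measurable borel"
 "heat_kernel_deriv s \<in> borel_measurable borel" "heat_kernel_deriv2 s \<in> borel_measurable borel"
 "gauss_weight s \<in> borel_measurable borel"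
 unfolding heat_kernel_deriv_def[abs_def] heat_kernel_deriv2_def[abs_def] gauss_weight_def[abs_def]
  heat_kernel_def[abs_def] by measurable

lemma heat_kernels_integrable:
 assumes s: "0 < s"
 shows "integrable lborel (heat_kernel s)" "integrable lborel (heat_kernel_deriv s)" "integrable lborel (heat_kernel_deriv2 s)"
  "(\<integral>u. heat_kernel_deriv s u \<partial>lborel) = 0" "(\<integral>u. heat_kernel_deriv2 s u \<partial>lborel) = 0"
proof -
 note w = gauss_weight[OF s] and hw = heat_kernel_weighted[OF s, of 1] and m = heat_kernel_moments[OF s]
 show "integrable lborel (heat_kernel s)"
  by (rule Bochner_Integration.integrable_bound[OF w(1)]) (use hw(4) w(3) in auto)
 show "integrable lborel (heat_kernel_deriv s)"
  by (rule Bochner_Integration.integrable_bound[OF integrable_mult_right[OF w(1), of "s powr (-1/2)"]])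
   (use hw(5) w(3) in \<open>auto simp: abs_mult\<close>)
 show "integrable lborel (heat_kernel_deriv2 s)"
  by (rule Bochner_Integration.integrable_bound[OF integrable_mult_right[OF w(1), of "s powr (-1)"]])
   (use hw(6) w(3) in \<open>auto simp: abs_mult\<close>)
 have "heat_kernel_deriv s = (%u. (- 1 / s) * (heat_kernel s u * u))" by (auto simp: heat_kernel_deriv_def fun_eq_iff)
 then show "(\<integral>u. heat_kernel_deriv s u \<partial>lborel) = 0" using m(3) by simp
 have "heat_kernel_deriv2 s = (%u. (1 / s\<^sup>2) * (heat_kernel s u * u\<^sup>2) - (1 / s) * (heat_kernel s u * u ^ 0))"
  using s by (auto simp: heat_kernel_deriv2_def fun_eq_iff field_simps power2_eq_square)
 then have "(\<integral>u. heat_kernel_deriv2 s u \<partial>lborel) = (1 / s\<^sup>2) * (\<integral>u. heat_kernel s u * u\<^sup>2 \<partial>lborel) - (1 / s) * (\<integral>u. heat_kernel s u * u ^ 0 \<partial>lborel)"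
  using m(1)[of 2] m(1)[of 0] by (simp del: power_0)
 then show "(\<integral>u. heat_kernel_deriv2 s u \<partial>lborel) = 0"
  using m(2,4) s by (simp add: power2_eq_square)
qed

section \<open>Heat convolutions of Hoelder functions\<close>

lemma integrable_reflect_translate:
 fixes k :: "real => real"
 assumes "integrable lborel k"
 shows "integrable lborel (%y. k (x - y))" "(\<integral>y. k (x - y) \<partial>lborel) = (\<integral>u. k u \<partial>lborel)"
 using lborel_integrable_real_affine[OF assms, of "-1" x] lborel_integral_real_affine[of "-1" k x] by simp_all

lemma integrable_convolution:
 fixes k f :: "real => real"
 assumes k: "integrable lborel k" and [measurable]: "f \<in> borel_measurable borel" and B: "!!y. \<bar>f y\<bar> <= B"
 shows "integrable lborel (%y. k (x - y) * f y)"
proof (rule Bochner_Integration.integrable_bound)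
 show "integrable lborel (%y. \<bar>k (x - y)\<bar> * B)"
  using integrable_reflect_translate(1)[OF k, of x] by (intro integrable_mult_left integrable_abs)
 have [measurable]: "k \<in> borel_measurable borel" using k by simp
 show "(%y. k (x - y) * f y) \<in> borel_measurable lborel" by measurable
 show "AE y in lborel. norm (k (x - y) * f y) <= norm (\<bar>k (x - y)\<bar> * B)"
  using B by (intro AE_I2) (auto simp: abs_mult intro!: mult_left_mono order_trans[OF B abs_ge_self])
qed

text \<open>Differences of convolutions are controlled by the convolution with the derivative, by Fubini.\<close>

lemma convolution_taylor:
 fixes k k' f :: "real => real"
 assumes k: "integrable lborel k" and k': "integrable lborel k'" and deriv: "!!u. (k has_real_derivative k' u) (at u)"
  and cont: "continuous_on UNIV k'"
  and f[measurable]: "f \<in> borel_measurable borel" and B: "!!y. \<bar>f y\<bar> <= B"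
  and ab: "a <= b" and m: "!!\<xi>. a <= \<xi> ==> \<xi> <= b ==> \<bar>(\<integral>y. k' (\<xi> - y) * f y \<partial>lborel) - d\<bar> <= m"
 shows "\<bar>(\<integral>y. k (b - y) * f y \<partial>lborel) - (\<integral>y. k (a - y) * f y \<partial>lborel) - (b - a) * d\<bar> <= (b - a) * m"
proof -
 have [measurable]: "k \<in> borel_measurable borel" "k' \<in> borel_measurable borel" using k k' by simp_all
 have B0: "0 <= B" using B[of 0] by linarith
 let ?I = "indicator {a..b} :: real => real"
 have int_I: "integrable lborel ?I"
  by (rule integrable_real_indicator) (auto simp: emeasure_lborel_Icc_eq)
 let ?A = "%\<xi>. \<integral>y. k' (\<xi> - y) * f y \<partial>lborel"
 have A_le: "(\<integral>y. norm (k' (\<xi> - y) * f y) \<partial>lborel) <= (\<integral>u. \<bar>k' u\<bar> \<partial>lborel) * B" for \<xi>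
 proof -
  have "(\<integral>y. norm (k' (\<xi> - y) * f y) \<partial>lborel) <= (\<integral>y. \<bar>k' (\<xi> - y)\<bar> * B \<partial>lborel)"
   using integrable_norm[OF integrable_convolution[OF k' f B, of \<xi>]] integrable_reflect_translate(1)[OF k', of \<xi>] B
   by (intro integral_mono integrable_mult_left integrable_abs) (auto simp: abs_mult mult_left_mono)
  also have "... = (\<integral>u. \<bar>k' u\<bar> \<partial>lborel) * B"
   using integrable_reflect_translate(2)[OF integrable_abs[OF k'], of \<xi>] by simp
  finally show ?thesis .
 qed
 have int2: "integrable (lborel \<Otimes>\<^sub>M lborel) (%(\<xi>, y). ?I \<xi> * (k' (\<xi> - y) * f y))"
 proof (rule lborel_pair.Fubini_integrable)
  show "(%(\<xi>, y). ?I \<xi> * (k' (\<xi> - y) * f y)) \<in> borel_measurable (lborel \<Otimes>\<^sub>M lborel)" by measurable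
  show "integrable lborel (%\<xi>. \<integral>y. norm (case (\<xi>, y) of (\<xi>, y) => ?I \<xi> * (k' (\<xi> - y) * f y)) \<partial>lborel)"
  proof (rule Bochner_Integration.integrable_bound)
   show "integrable lborel (%\<xi>. ?I \<xi> * ((\<integral>u. \<bar>k' u\<bar> \<partial>lborel) * B))"
    by (intro integrable_mult_left int_I)
   show "AE \<xi> in lborel. norm (\<integral>y. norm (case (\<xi>, y) of (\<xi>, y) => ?I \<xi> * (k' (\<xi> - y) * f y)) \<partial>lborel) <=
     norm (?I \<xi> * ((\<integral>u. \<bar>k' u\<bar> \<partial>lborel) * B))"
    using A_le B0 by (intro AE_I2) (auto simp: abs_mult indicator_def intro!: mult_nonneg_nonneg)
  qed measurable
  show "AE \<xi> in lborel. integrable lborel (%y. case (\<xi>, y) of (\<xi>, y) => ?I \<xi> * (k' (\<xi> - y) * f y))"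
   using integrable_convolution[OF k' f B] by (intro AE_I2) simp
 qed
 have "(\<integral>\<xi>. ?I \<xi> * ?A \<xi> \<partial>lborel) = (\<integral>y. (\<integral>\<xi>. ?I \<xi> * (k' (\<xi> - y) * f y) \<partial>lborel) \<partial>lborel)"
  using lborel_pair.Fubini_integral[OF int2] by simp
 also have "... = (\<integral>y. k (b - y) * f y - k (a - y) * f y \<partial>lborel)"
 proof (rule Bochner_Integration.integral_cong[OF refl])
  fix y
  have "(\<integral>\<xi>. k' (\<xi> - y) * indicator {a..b} \<xi> \<partial>lborel) = k (b - y) - k (a - y)"
  proof (rule integral_FTC_Icc_real[OF ab])
   fix \<xi>
   have "((%\<xi>. k (\<xi> - y)) has_real_derivative k' (\<xi> - y) * 1) (at \<xi>)"
    by (rule DERIV_chain'[where f = "%\<xi>. \<xi> - y" and g = k]) (auto intro!: derivative_eq_intros deriv)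
   then show "((%\<xi>. k (\<xi> - y)) has_real_derivative k' (\<xi> - y)) (at \<xi>)" by simp
   show "isCont (%\<xi>. k' (\<xi> - y)) \<xi>"
   proof (rule isCont_o2[where f = "%\<xi>. \<xi> - y" and g = k'])
    show "isCont (%\<xi>. \<xi> - y) \<xi>" by (intro continuous_intros)
    show "isCont k' (\<xi> - y)" using cont continuous_on_eq_continuous_at[OF open_UNIV, of k'] by blast
   qed
  qed
  moreover have "(%\<xi>. ?I \<xi> * (k' (\<xi> - y) * f y)) = (%\<xi>. (k' (\<xi> - y) * indicator {a..b} \<xi>) * f y)"
   by (auto simp: ac_simps)
  ultimately show "(\<integral>\<xi>. ?I \<xi> * (k' (\<xi> - y) * f y) \<partial>lborel) = k (b - y) * f y - k (a - y) * f y"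
   by (simp add: left_diff_distrib)
 qed
 also have "... = (\<integral>y. k (b - y) * f y \<partial>lborel) - (\<integral>y. k (a - y) * f y \<partial>lborel)"
  by (intro Bochner_Integration.integral_diff integrable_convolution[OF k f B])
 finally have A: "(\<integral>\<xi>. ?I \<xi> * ?A \<xi> \<partial>lborel) = (\<integral>y. k (b - y) * f y \<partial>lborel) - (\<integral>y. k (a - y) * f y \<partial>lborel)" .
 have intA: "integrable lborel (%\<xi>. ?I \<xi> * ?A \<xi>)"
  using lborel_pair.integrable_fst[OF int2] by simp
 \<comment> \<open>The number d is arbitrary. With d = 0 the estimate bounds an increment; with d
   the derivative at an end point it bounds the first order Taylor remainder.\<close>
 have d: "(\<integral>\<xi>. ?I \<xi> * d \<partial>lborel) = (b - a) * d" using ab by simp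
 have "\<bar>(\<integral>\<xi>. ?I \<xi> * ?A \<xi> \<partial>lborel) - (b - a) * d\<bar> = \<bar>\<integral>\<xi>. ?I \<xi> * ?A \<xi> - ?I \<xi> * d \<partial>lborel\<bar>"
  unfolding d[symmetric] by (subst Bochner_Integration.integral_diff[OF intA integrable_mult_left[OF int_I]]) simp
 also have "... <= (\<integral>\<xi>. \<bar>?I \<xi> * ?A \<xi> - ?I \<xi> * d\<bar> \<partial>lborel)" by (rule integral_abs_bound)
 also have "... <= (\<integral>\<xi>. ?I \<xi> * m \<partial>lborel)"
 proof (rule integral_mono)
  show "integrable lborel (%\<xi>. \<bar>?I \<xi> * ?A \<xi> - ?I \<xi> * d\<bar>)"
   by (intro integrable_abs Bochner_Integration.integrable_diff intA integrable_mult_left int_I)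
  show "\<bar>?I \<xi> * ?A \<xi> - ?I \<xi> * d\<bar> <= ?I \<xi> * m" for \<xi> using m[of \<xi>] by (auto simp: indicator_def)
 qed (intro integrable_mult_left int_I)
 also have "... = (b - a) * m" using ab by simp
 finally show ?thesis unfolding A .
qed

definition heat_deriv :: "real => (real => real) => real => real" where
 "heat_deriv t \<phi> x = (LINT y|lborel. heat_kernel_deriv t (x - y) * \<phi> y)"

locale hoelder_function =
 fixes f :: "real => real" and B H \<gamma> :: real
 assumes f_measurable [measurable]: "f \<in> borel_measurable borel"
  and f_bound: "\<bar>f x\<bar> <= B" and f_hoelder: "\<bar>f x - f y\<bar> <= H * \<bar>x - y\<bar> powr \<gamma>"
  and \<gamma>: "0 < \<gamma>" "\<gamma> <= 1" and H_nonneg: "0 <= H"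
begin

text \<open>Here j is the mass of k, 1 for the heat kernel and 0 for its derivatives. It allows
  \<open>f x\<close> to be subtracted under the integral, where Hoelder continuity of f pays. The 6
  is the mass of \<open>gauss_weight\<close>.\<close>

lemma weighted_bound:
 assumes s: "0 < s" and k: "integrable lborel k" and zero: "(\<integral>u. k u \<partial>lborel) = j"
  and w: "!!u. \<bar>k u\<bar> * \<bar>u\<bar> powr \<gamma> <= c * gauss_weight s u"
 shows "\<bar>(\<integral>y. k (x - y) * f y \<partial>lborel) - j * f x\<bar> <= 6 * c * H"
proof -
 note W = gauss_weight[OF s]
 have [measurable]: "k \<in> borel_measurable borel" using k by simp
 have ik: "integrable lborel (%y. k (x - y))" using integrable_reflect_translate(1)[OF k] .
 have "(\<integral>y. k (x - y) * f y \<partial>lborel) - j * f x = (\<integral>y. k (x - y) * f y - k (x - y) * f x \<partial>lborel)"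
  unfolding zero[symmetric] integrable_reflect_translate(2)[OF k, of x, symmetric]
  by (subst Bochner_Integration.integral_diff[OF integrable_convolution[OF k f_measurable f_bound]]) (use ik in auto)
 also have "\<bar>...\<bar> <= (\<integral>y. \<bar>k (x - y) * f y - k (x - y) * f x\<bar> \<partial>lborel)" by (rule integral_abs_bound)
 also have "... <= (\<integral>y. H * c * gauss_weight s (x - y) \<partial>lborel)"
 proof (rule integral_mono)
  show "integrable lborel (%y. \<bar>k (x - y) * f y - k (x - y) * f x\<bar>)"
   using ik by (intro integrable_abs Bochner_Integration.integrable_diff integrable_convolution[OF k f_measurable f_bound]) auto
  show "integrable lborel (%y. H * c * gauss_weight s (x - y))"
   using integrable_reflect_translate(1)[OF W(1)] by (intro integrable_mult_right)
  fix y
  have "\<bar>k (x - y) * f y - k (x - y) * f x\<bar> = \<bar>k (x - y)\<bar> * \<bar>f y - f x\<bar>"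
   by (simp add: abs_mult[symmetric] right_diff_distrib)
  also have "... <= \<bar>k (x - y)\<bar> * (H * \<bar>x - y\<bar> powr \<gamma>)"
   using f_hoelder[of y x] by (intro mult_left_mono) (auto simp: abs_minus_commute)
  also have "... = H * (\<bar>k (x - y)\<bar> * \<bar>x - y\<bar> powr \<gamma>)" by simp
  also have "... <= H * (c * gauss_weight s (x - y))" by (rule mult_left_mono[OF w H_nonneg])
  finally show "\<bar>k (x - y) * f y - k (x - y) * f x\<bar> <= H * c * gauss_weight s (x - y)" by (simp add: mult.assoc)
 qed
 also have "... = 6 * c * H"
  using integrable_reflect_translate(2)[OF W(1), of x] W(2) by simp
 finally show ?thesis .
qed

lemma heat_semigroup_bound:
 assumes s: "0 < s" shows "\<bar>heat_semigroup s f x\<bar> <= B"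
proof -
 have B0: "0 <= B" using f_bound[of 0] by linarith
 have "\<bar>heat_semigroup s f x\<bar> <= (\<integral>y. \<bar>heat_kernel s (x - y) * f y\<bar> \<partial>lborel)"
  unfolding heat_semigroup_def by (rule integral_abs_bound)
 also have "... <= (\<integral>y. heat_kernel s (x - y) * B \<partial>lborel)"
  using integrable_convolution[OF heat_kernels_integrable(1)[OF s] f_measurable f_bound]
   integrable_reflect_translate(1)[OF heat_kernels_integrable(1)[OF s]] f_bound
  by (intro integral_mono integrable_abs integrable_mult_left) (auto simp: abs_mult mult_left_mono)
 also have "... = B" using integrable_reflect_translate(2)[OF heat_kernels_integrable(1)[OF s], of x] heat_kernel_moments(2)[OF s] by simp
 finally show ?thesis .
qed

text \<open>Serves the lower bound for the noise: for s small compared with x^2 the semigroup moves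
  f by little on the scale |x|^\<gamma>.\<close>

lemma heat_semigroup_near_identity:
 assumes s: "0 < s" shows "\<bar>heat_semigroup s f x - f x\<bar> <= 6 * H * s powr (\<gamma>/2)"
 using weighted_bound[OF s heat_kernels_integrable(1)[OF s] heat_kernel_moments(2)[OF s] heat_kernel_weighted(1)[OF s \<gamma>], of x]
 by (simp add: heat_semigroup_def ac_simps)

lemma heat_deriv_bound:
 assumes s: "0 < s" shows "\<bar>heat_deriv s f x\<bar> <= 6 * H * s powr (-1/2 + \<gamma>/2)"
 using weighted_bound[OF s heat_kernels_integrable(2)[OF s] heat_kernels_integrable(4)[OF s] heat_kernel_weighted(2)[OF s \<gamma>], of x]
 by (simp add: heat_deriv_def ac_simps)

text \<open>Bounds increments of \<open>heat_deriv s f\<close> over distance d. The first branch is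
  the triangle inequality, better for s < d^2, and the second the bound by the second derivative,
  better for s > d^2. The 12 is twice the 6 of \<open>heat_deriv_bound\<close>; the second branch
  alone would give 6.\<close>

definition deriv_modulus :: "real => real => real" where
 "deriv_modulus s d = 12 * H * min (s powr (-1/2 + \<gamma>/2)) (s powr (-1 + \<gamma>/2) * d)"

lemma heat_deriv_continuity:
 assumes s: "0 < s" shows "\<bar>heat_deriv s f x - heat_deriv s f y\<bar> <= deriv_modulus s \<bar>x - y\<bar>"
proof -
 have le: "\<bar>heat_deriv s f b - heat_deriv s f a\<bar> <= deriv_modulus s (b - a)" if ab: "a <= b" for a b
 proof -
  have "\<bar>heat_deriv s f b - heat_deriv s f a - (b - a) * 0\<bar> <= (b - a) * (6 * H * s powr (-1 + \<gamma>/2))"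
   unfolding heat_deriv_def
  proof (rule convolution_taylor[OF heat_kernels_integrable(2,3)[OF s] heat_kernel_has_derivative(2)[OF s] _ f_measurable f_bound ab])
   show "continuous_on UNIV (heat_kernel_deriv2 s)"
    unfolding heat_kernel_deriv2_def[abs_def] heat_kernel_def using s by (intro continuous_intros) auto
   show "\<bar>(\<integral>y. heat_kernel_deriv2 s (\<xi> - y) * f y \<partial>lborel) - 0\<bar> <= 6 * H * s powr (-1 + \<gamma>/2)" for \<xi>
    using weighted_bound[OF s heat_kernels_integrable(3)[OF s] heat_kernels_integrable(5)[OF s] heat_kernel_weighted(3)[OF s \<gamma>], of \<xi>]
    by (simp add: ac_simps)
  qed
  also have "... <= (b - a) * (12 * H * s powr (-1 + \<gamma>/2))"
   using ab H_nonneg by (intro mult_left_mono mult_right_mono) auto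
  finally have "\<bar>heat_deriv s f b - heat_deriv s f a\<bar> <= 12 * H * (s powr (-1 + \<gamma>/2) * (b - a))" by (simp add: ac_simps)
  moreover have "\<bar>heat_deriv s f b - heat_deriv s f a\<bar> <= 12 * H * s powr (-1/2 + \<gamma>/2)"
   using heat_deriv_bound[OF s, of a] heat_deriv_bound[OF s, of b] by linarith
  ultimately show ?thesis unfolding deriv_modulus_def by (simp add: min_def)
 qed
 show ?thesis
  using le[of x y] le[of y x] by (cases "x <= y") (auto simp: abs_minus_commute)
qed

lemma deriv_modulus_mono: "0 <= d ==> d <= d' ==> deriv_modulus s d <= deriv_modulus s d'"
 unfolding deriv_modulus_def using H_nonneg
 by (intro mult_left_mono min.mono) (auto intro: mult_left_mono)

text \<open>Subtracting the derivative at the end point x leaves increments of the derivative over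
  distances up to |e|, which the modulus controls. Both signs of e are covered for the sake of a
  two-sided derivative.\<close>

lemma heat_semigroup_taylor:
 assumes s: "0 < s"
 shows "\<bar>heat_semigroup s f (x + e) - heat_semigroup s f x - e * heat_deriv s f x\<bar> <= \<bar>e\<bar> * deriv_modulus s \<bar>e\<bar>"
proof -
 have cont: "continuous_on UNIV (heat_kernel_deriv s)"
  unfolding heat_kernel_deriv_def[abs_def] heat_kernel_def using s by (intro continuous_intros) auto
 have le: "\<bar>heat_semigroup s f b - heat_semigroup s f a - (b - a) * heat_deriv s f x\<bar> <= (b - a) * deriv_modulus s (b - a)"
  if ab: "a <= b" "x = a \<or> x = b" for a b
  unfolding heat_semigroup_def
 proof (rule convolution_taylor[OF heat_kernels_integrable(1,2)[OF s] heat_kernel_has_derivative(1)[OF s] cont f_measurable f_bound ab(1)])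
  fix \<xi> assume \<xi>: "a <= \<xi>" "\<xi> <= b"
  have "\<bar>heat_deriv s f \<xi> - heat_deriv s f x\<bar> <= deriv_modulus s \<bar>\<xi> - x\<bar>" by (rule heat_deriv_continuity[OF s])
  also have "... <= deriv_modulus s (b - a)" using \<xi> ab by (intro deriv_modulus_mono) auto
  finally show "\<bar>(\<integral>y. heat_kernel_deriv s (\<xi> - y) * f y \<partial>lborel) - heat_deriv s f x\<bar> <= deriv_modulus s (b - a)"
   by (simp add: heat_deriv_def)
 qed
 show ?thesis
 proof (cases "0 <= e")
  case True
  then show ?thesis using le[of x "x + e"] by simp
 next
  case False
  then have "\<bar>heat_semigroup s f x - heat_semigroup s f (x + e) - (- e) * heat_deriv s f x\<bar> <= (- e) * deriv_modulus s (- e)"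
   using le[of "x + e" x] by simp
  then show ?thesis using False by (simp add: abs_minus_commute algebra_simps)
 qed
qed

text \<open>The substitution y = x + sqrt s * z moves the time from the kernel into the argument of
  f, so that two times can be compared without differentiating the kernel in s.\<close>

lemma heat_semigroup_std:
 assumes s: "0 < s"
 shows "heat_semigroup s f x = (\<integral>z. std_normal_density z * f (x + sqrt s * z) \<partial>lborel)"
proof -
 have "heat_semigroup s f x = \<bar>sqrt s\<bar> *\<^sub>R (\<integral>z. heat_kernel s (x - (x + sqrt s * z)) * f (x + sqrt s * z) \<partial>lborel)"
  unfolding heat_semigroup_def using s by (intro lborel_integral_real_affine) auto
 also have "... = (\<integral>z. sqrt s * (heat_kernel s (sqrt s * z) * f (x + sqrt s * z)) \<partial>lborel)"
  using s by (simp add: heat_kernel_def)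
 also have "... = (\<integral>z. std_normal_density z * f (x + sqrt s * z) \<partial>lborel)"
 proof (rule Bochner_Integration.integral_cong[OF refl])
  fix z
  have "sqrt s * heat_kernel s (sqrt s * z) = std_normal_density z"
   using s by (simp add: heat_kernel_def std_normal_density_def powr_minus powr_half_sqrt real_sqrt_mult power_mult_distrib field_simps)
  then show "sqrt s * (heat_kernel s (sqrt s * z) * f (x + sqrt s * z)) = std_normal_density z * f (x + sqrt s * z)"
   by (simp add: mult.assoc[symmetric])
 qed
 finally show ?thesis .
qed

text \<open>In the standard normal form the arguments of f differ by (sqrt s - sqrt s') z, and |sqrt
  s - sqrt s'| <= sqrt |s - s'| produces the exponent \<gamma>/2. The constant 2 is the Gaussian
  integral of 1 + z^2, which dominates |z|^\<gamma>.\<close>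

lemma heat_semigroup_time:
 assumes s: "0 < s" and s': "0 < s'"
 shows "\<bar>heat_semigroup s f x - heat_semigroup s' f x\<bar> <= 2 * H * \<bar>s - s'\<bar> powr (\<gamma>/2)"
proof -
 let ?n = std_normal_density
 have int: "integrable lborel (%z. ?n z * f (x + a * z))" for a
 proof (rule Bochner_Integration.integrable_bound)
  show "integrable lborel (%z. ?n z * B)" by (intro integrable_mult_left) auto
  show "AE z in lborel. norm (?n z * f (x + a * z)) <= norm (?n z * B)"
   using f_bound by (intro AE_I2) (auto simp: abs_mult intro!: mult_left_mono order_trans[OF f_bound abs_ge_self])
 qed measurable
 have "\<bar>sqrt s - sqrt s'\<bar> <= sqrt \<bar>s - s'\<bar>"
 proof -
  have *: "sqrt a - sqrt b <= sqrt (a - b)" if "0 <= b" "b <= a" for a b :: real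
   using sqrt_add_le_add_sqrt[of b "a - b"] that by simp
  show ?thesis using *[of s s'] *[of s' s] s s' by (cases "s <= s'") (auto simp: abs_if)
 qed
 then have "\<bar>sqrt s - sqrt s'\<bar> powr \<gamma> <= sqrt \<bar>s - s'\<bar> powr \<gamma>" using \<gamma> by (intro powr_mono2) auto
 also have "... = \<bar>s - s'\<bar> powr (\<gamma>/2)" by (simp add: powr_half_sqrt[symmetric] powr_powr)
 finally have root: "\<bar>sqrt s - sqrt s'\<bar> powr \<gamma> <= \<bar>s - s'\<bar> powr (\<gamma>/2)" .
 have m0: "integrable lborel ?n" and m2: "integrable lborel (%z. ?n z * z\<^sup>2)"
  using integrable_std_normal_moment[of 2] by auto
 have m2v: "(\<integral>z. ?n z * z\<^sup>2 \<partial>lborel) = 1"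
  using integral_std_normal_moment_even[of 1] by (simp add: fact_numeral)
 have m0v: "(\<integral>z. ?n z \<partial>lborel) = 1" by simp
 have "\<bar>heat_semigroup s f x - heat_semigroup s' f x\<bar> = \<bar>\<integral>z. ?n z * f (x + sqrt s * z) - ?n z * f (x + sqrt s' * z) \<partial>lborel\<bar>"
  unfolding heat_semigroup_std[OF s] heat_semigroup_std[OF s'] by (subst Bochner_Integration.integral_diff[OF int int]) simp
 also have "... <= (\<integral>z. \<bar>?n z * f (x + sqrt s * z) - ?n z * f (x + sqrt s' * z)\<bar> \<partial>lborel)" by (rule integral_abs_bound)
 also have "... <= (\<integral>z. H * \<bar>s - s'\<bar> powr (\<gamma>/2) * (?n z + ?n z * z\<^sup>2) \<partial>lborel)"
 proof (rule integral_mono)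
  show "integrable lborel (%z. \<bar>?n z * f (x + sqrt s * z) - ?n z * f (x + sqrt s' * z)\<bar>)"
   by (intro integrable_abs Bochner_Integration.integrable_diff int)
  show "integrable lborel (%z. H * \<bar>s - s'\<bar> powr (\<gamma>/2) * (?n z + ?n z * z\<^sup>2))"
   by (intro integrable_mult_right Bochner_Integration.integrable_add m0 m2)
  fix z
  have "\<bar>f (x + sqrt s * z) - f (x + sqrt s' * z)\<bar> <= H * \<bar>(sqrt s - sqrt s') * z\<bar> powr \<gamma>"
   using f_hoelder[of "x + sqrt s * z" "x + sqrt s' * z"] by (simp add: left_diff_distrib)
  also have "\<bar>(sqrt s - sqrt s') * z\<bar> powr \<gamma> = \<bar>sqrt s - sqrt s'\<bar> powr \<gamma> * \<bar>z\<bar> powr \<gamma>"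
   by (simp add: abs_mult powr_mult)
  also have "H * ... <= H * (\<bar>s - s'\<bar> powr (\<gamma>/2) * (1 + z\<^sup>2))"
   using powr_le_one_plus_square[of "\<bar>z\<bar>" \<gamma>] \<gamma> H_nonneg root by (intro mult_left_mono mult_mono) auto
  finally have "?n z * \<bar>f (x + sqrt s * z) - f (x + sqrt s' * z)\<bar> <= ?n z * (H * (\<bar>s - s'\<bar> powr (\<gamma>/2) * (1 + z\<^sup>2)))"
   by (rule mult_left_mono) simp
  moreover have "\<bar>?n z * f (x + sqrt s * z) - ?n z * f (x + sqrt s' * z)\<bar> = ?n z * \<bar>f (x + sqrt s * z) - f (x + sqrt s' * z)\<bar>"
   by (simp add: abs_mult right_diff_distrib[symmetric])
  ultimately show "\<bar>?n z * f (x + sqrt s * z) - ?n z * f (x + sqrt s' * z)\<bar> <= H * \<bar>s - s'\<bar> powr (\<gamma>/2) * (?n z + ?n z * z\<^sup>2)"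
   by (simp add: algebra_simps)
 qed
 also have "... = H * \<bar>s - s'\<bar> powr (\<gamma>/2) * 2"
  using m0 m2 by (simp add: m0v m2v)
 finally show ?thesis by simp
qed

end

section \<open>Mean square regular fields\<close>

text \<open>Rounding is downwards, so that the discretized time never exceeds t and the
  discretizations stay adapted.\<close>

definition dyadic :: "nat => real => real" where
 "dyadic n r = of_int \<lfloor>2 ^ n * r\<rfloor> / 2 ^ n"

lemma dyadic: "dyadic n r <= r" "r - dyadic n r <= (1/2) ^ n" "0 <= r ==> 0 <= dyadic n r"
proof -
 have "of_int \<lfloor>2 ^ n * r\<rfloor> <= 2 ^ n * r" by simp
 then show "dyadic n r <= r" by (simp add: dyadic_def field_simps)
 have "2 ^ n * r - of_int \<lfloor>2 ^ n * r\<rfloor> <= 1" by linarith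
 then have "(2 ^ n * r - of_int \<lfloor>2 ^ n * r\<rfloor>) / 2 ^ n <= 1 / 2 ^ n" by (rule divide_right_mono) simp
 then show "r - dyadic n r <= (1/2) ^ n" by (simp add: dyadic_def diff_divide_distrib power_divide)
 show "0 <= r ==> 0 <= dyadic n r" by (simp add: dyadic_def)
qed

text \<open>
  A field that is Hoelder continuous in mean square is the almost sure limit of its dyadic
  discretizations, which are jointly measurable.
\<close>

theorem measurable_modification:
 fixes X :: "real => real => 'a => real"
 assumes XF: "!!t x. 0 <= t ==> X t x \<in> borel_measurable (F t)"
  and sub: "!!t. subalgebra M (F t)"
  and mono: "!!s t Z. 0 <= s ==> s <= t ==> Z \<in> borel_measurable (F s) ==> (Z :: 'a => real) \<in> borel_measurable (F t)"
  and \<rho>: "0 < \<rho>"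
  and cont: "!!t. 0 <= t ==> \<exists>C\<ge>0. \<forall>s x y. 0 <= s --> s <= t --> t - s <= 1 --> \<bar>x - y\<bar> <= 1 -->
   l2norm M (%w. X t x w - X s y w) <= ennreal (C * ((t - s) powr \<rho> + \<bar>x - y\<bar> powr \<rho>))"
 shows "\<exists>u. jointly_measurable M u \<and> adapted_field F u \<and> (\<forall>t\<ge>0. \<forall>x. AE w in M. u t x w = X t x w)"
proof -
 define u where "u t x w = lim (%n. X (dyadic n t) (dyadic n x) w)" for t x w
 have XM: "X t x \<in> borel_measurable M" if "0 <= t" for t x
  using measurable_from_subalg[OF sub XF[OF that]] .
 let ?S = "restrict_space borel {0..} \<Otimes>\<^sub>M (borel \<Otimes>\<^sub>M M) :: (real \<times> real \<times> 'a) measure"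
 have joint: "(%(t, x, w). X (dyadic n t) (dyadic n x) w) \<in> borel_measurable ?S" for n
 proof -
  \<comment> \<open>The field is known to be measurable at nonnegative times only. Negative indices
    get the value 0; they do not occur on the domain t >= 0.\<close>
  define Y where "Y i j w = (if 0 <= i then X (of_int i / 2 ^ n) (of_int j / 2 ^ n) w else 0)" for i j :: int and w
  have [measurable]: "Y i j \<in> borel_measurable M" for i j
   using XM[of "of_int i / 2 ^ n" "of_int j / 2 ^ n"] by (cases "0 <= i") (auto simp: Y_def[abs_def])
  have [measurable]: "fst \<in> borel_measurable ?S"
   using measurable_comp[OF measurable_fst[of "restrict_space borel {0..}" "borel \<Otimes>\<^sub>M M"] measurable_restrict_space1[OF measurable_ident, of borel "{0..}"]]
   by (simp add: comp_def id_def)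
  have "(%p. Y \<lfloor>2 ^ n * fst p\<rfloor> \<lfloor>2 ^ n * fst (snd p)\<rfloor> (snd (snd p))) \<in> borel_measurable ?S"
  proof (rule measurable_compose_countable[where g = "%p. \<lfloor>2 ^ n * fst p\<rfloor>"])
   fix i
   show "(%p. Y i \<lfloor>2 ^ n * fst (snd p)\<rfloor> (snd (snd p))) \<in> borel_measurable ?S"
    by (rule measurable_compose_countable[where g = "%p. \<lfloor>2 ^ n * fst (snd p)\<rfloor>"]) measurable
  qed measurable
  also have "(%p. Y \<lfloor>2 ^ n * fst p\<rfloor> \<lfloor>2 ^ n * fst (snd p)\<rfloor> (snd (snd p))) \<in> borel_measurable ?S \<longleftrightarrow>
    (%(t, x, w). X (dyadic n t) (dyadic n x) w) \<in> borel_measurable ?S"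
   by (rule measurable_cong) (auto simp: space_pair_measure space_restrict_space Y_def dyadic_def)
  finally show ?thesis .
 qed
 have "jointly_measurable M u"
 proof -
  have "(%p. lim (%n. (%(t, x, w). X (dyadic n t) (dyadic n x) w) p)) \<in> borel_measurable ?S"
   by (rule borel_measurable_lim_metric[OF joint])
  also have "(%p. lim (%n. (%(t, x, w). X (dyadic n t) (dyadic n x) w) p)) = (%(t, x, w). u t x w)"
   by (auto simp: u_def)
  finally show ?thesis unfolding jointly_measurable_def .
 qed
 moreover have "adapted_field F u"
  unfolding adapted_field_def
 proof (intro allI impI)
  fix t x :: real assume t: "0 <= t"
  have "X (dyadic n t) (dyadic n x) \<in> borel_measurable (F t)" for n
   by (rule mono[OF dyadic(3)[OF t] dyadic(1) XF[OF dyadic(3)[OF t]]])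
  then show "u t x \<in> borel_measurable (F t)"
   unfolding u_def[abs_def] by (rule borel_measurable_lim_metric)
 qed
 moreover have "AE w in M. u t x w = X t x w" if t: "0 <= t" for t x
 proof -
  obtain C where C: "0 <= C" "!!s y. 0 <= s ==> s <= t ==> t - s <= 1 ==> \<bar>x - y\<bar> <= 1 ==>
    l2norm M (%w. X t x w - X s y w) <= ennreal (C * ((t - s) powr \<rho> + \<bar>x - y\<bar> powr \<rho>))"
   using cont[OF t] by blast
  \<comment> \<open>Dyadic points lie within 2^(-n), so the Hoelder bound decays geometrically with
    ratio 2^(-\<rho>), as \<open>l2_AE_tendsto\<close> requires.\<close>
  define q where "q = (1/2::real) powr \<rho>"
  have q: "0 <= q" "q < 1" using \<rho> powr_less_mono2[of \<rho> "1/2" 1] by (auto simp: q_def)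
  have qn: "((1/2) ^ n) powr \<rho> = q ^ n" for n
   by (simp add: q_def powr_realpow[symmetric] powr_powr powr_powr_swap mult.commute)
  have "AE w in M. (%n. X (dyadic n t) (dyadic n x) w) \<longlonglongrightarrow> X t x w"
  proof (rule l2_AE_tendsto[OF _ _ q, where C = "2 * C"])
   show "eventually (%n. l2norm M (%w. X (dyadic n t) (dyadic n x) w - X t x w) <= ennreal (2 * C * q ^ n)) sequentially"
   proof (intro always_eventually allI)
    fix n
    have h: "(1/2::real) ^ n <= 1" by (simp add: power_le_one)
    have d: "0 <= t - dyadic n t" "t - dyadic n t <= (1/2) ^ n" "\<bar>x - dyadic n x\<bar> <= (1/2) ^ n"
     using dyadic(1,2)[where n = n and r = t] dyadic(1,2)[where n = n and r = x] by auto
    have "l2norm M (%w. X t x w - X (dyadic n t) (dyadic n x) w) <=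
      ennreal (C * ((t - dyadic n t) powr \<rho> + \<bar>x - dyadic n x\<bar> powr \<rho>))"
     using d h by (intro C(2) dyadic(3) t dyadic(1)) linarith+
    also have "... <= ennreal (C * (q ^ n + q ^ n))"
     unfolding qn[symmetric] using d C(1) \<rho> by (intro ennreal_leI mult_left_mono add_mono powr_mono2) auto
    finally show "l2norm M (%w. X (dyadic n t) (dyadic n x) w - X t x w) <= ennreal (2 * C * q ^ n)"
     by (simp add: l2norm_minus_commute[of M "X t x"] algebra_simps)
   qed
  qed (use C(1) XM[OF dyadic(3)[OF t]] XM[OF t] in auto)
  then show ?thesis by eventually_elim (simp add: u_def limI)
 qed
 ultimately show ?thesis by blast
qed

text \<open>Mean square size, differentiability in x with a rate, Hoelder continuity of the
  derivative X', and continuity in time looking back from t, all with one constant. Time steps are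
  limited to 1 so that a single exponent \<rho> can dominate several powers.\<close>

definition regular_bounds :: "'a measure => real => real => (real => real => 'a => real) => (real => real => 'a => real) => real => real => bool" where
 "regular_bounds M \<gamma> \<rho> X X' C t \<longleftrightarrow>
  (\<forall>x. l2norm M (X t x) <= ennreal C) \<and> (\<forall>x. l2norm M (X' t x) <= ennreal C) \<and>
  (\<forall>x y. l2norm M (%w. X' t x w - X' t y w) <= ennreal (C * \<bar>x - y\<bar> powr \<gamma>)) \<and>
  (\<forall>x e. e \<noteq> 0 --> \<bar>e\<bar> <= 1 -->
    l2norm M (%w. (X t (x + e) w - X t x w) / e - X' t x w) <= ennreal (C * \<bar>e\<bar> powr \<gamma>)) \<and>
  (\<forall>s x. 0 <= s --> s <= t --> t - s <= 1 -->
    l2norm M (%w. X t x w - X s x w) <= ennreal (C * (t - s) powr \<rho>))"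

lemma regular_boundsD:
 assumes "regular_bounds M \<gamma> \<rho> X X' C t"
 shows "l2norm M (X t x) <= ennreal C" "l2norm M (X' t x) <= ennreal C"
  "l2norm M (%w. X' t x w - X' t y w) <= ennreal (C * \<bar>x - y\<bar> powr \<gamma>)"
  "e \<noteq> 0 ==> \<bar>e\<bar> <= 1 ==>
   l2norm M (%w. (X t (x + e) w - X t x w) / e - X' t x w) <= ennreal (C * \<bar>e\<bar> powr \<gamma>)"
  "0 <= s ==> s <= t ==> t - s <= 1 ==> l2norm M (%w. X t x w - X s x w) <= ennreal (C * (t - s) powr \<rho>)"
 using assms unfolding regular_bounds_def by blast+

text \<open>The bounds concern positive times and are uniform up to T; at time 0 the field is
  required to vanish identically, which replaces them there.\<close>

definition regular_field :: "'a measure => real => real => (real => real => 'a => real) => (real => real => 'a => real) => bool" where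
 "regular_field M \<gamma> \<rho> X X' \<longleftrightarrow> (\<forall>x. X 0 x = (%_. 0)) \<and>
  (\<forall>T>0. \<exists>C\<ge>0. \<forall>t. 0 < t --> t <= T --> regular_bounds M \<gamma> \<rho> X X' C t)"

lemma l2norm_add_le:
 assumes "l2norm M f <= ennreal (a * p)" "l2norm M g <= ennreal (b * p)" "0 <= a" "0 <= b" "0 <= p"
 shows "l2norm M (%w. f w + g w) <= ennreal ((a + b) * p)"
proof -
 have "l2norm M (%w. f w + g w) <= ennreal (a * p) + ennreal (b * p)"
  using l2norm_triangle[of M f g] add_mono[OF assms(1,2)] by (rule order_trans)
 then show ?thesis using assms(3-5) by (simp add: ennreal_plus[symmetric] distrib_right del: ennreal_plus)
qed

lemma regular_field_add:
 assumes "regular_field M \<gamma> \<rho> X X'" "regular_field M \<gamma> \<rho> Y Y'"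
 shows "regular_field M \<gamma> \<rho> (%t x w. X t x w + Y t x w) (%t x w. X' t x w + Y' t x w)"
 unfolding regular_field_def
proof (intro conjI allI impI)
 show "(%w. X 0 x w + Y 0 x w) = (%_. 0)" for x using assms by (simp add: regular_field_def)
 fix T :: real assume T: "0 < T"
 obtain C where C: "0 <= C" and XC: "!!t. 0 < t ==> t <= T ==> regular_bounds M \<gamma> \<rho> X X' C t"
  using assms(1) T unfolding regular_field_def by blast
 obtain D where D: "0 <= D" and YD: "!!t. 0 < t ==> t <= T ==> regular_bounds M \<gamma> \<rho> Y Y' D t"
  using assms(2) T unfolding regular_field_def by blast
 note add = l2norm_add_le[OF _ _ C D]
 show "\<exists>C\<ge>0. \<forall>t. 0 < t --> t <= T -->
   regular_bounds M \<gamma> \<rho> (%t x w. X t x w + Y t x w) (%t x w. X' t x w + Y' t x w) C t"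
  unfolding regular_bounds_def
 proof (rule exI[of _ "C + D"], intro conjI allI impI)
  show "0 <= C + D" using C D by simp
  fix t assume t: "0 < t" "t <= T"
  note X = regular_boundsD[OF XC[OF t]] and Y = regular_boundsD[OF YD[OF t]]
  fix x
  show "l2norm M (%w. X t x w + Y t x w) <= ennreal (C + D)"
   using add[of M "X t x" 1 "Y t x"] X(1)[of x] Y(1)[of x] by simp
  show "l2norm M (%w. X' t x w + Y' t x w) <= ennreal (C + D)"
   using add[of M "X' t x" 1 "Y' t x"] X(2)[of x] Y(2)[of x] by simp
  show "l2norm M (%w. (X' t x w + Y' t x w) - (X' t y w + Y' t y w)) <= ennreal ((C + D) * \<bar>x - y\<bar> powr \<gamma>)" for y
   using add[OF X(3)[of x y] Y(3)[of x y]] by (simp add: algebra_simps)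
  show "l2norm M (%w. ((X t (x + e) w + Y t (x + e) w) - (X t x w + Y t x w)) / e - (X' t x w + Y' t x w)) <= ennreal ((C + D) * \<bar>e\<bar> powr \<gamma>)"
   if e: "e \<noteq> 0" "\<bar>e\<bar> <= 1" for e
  proof -
   have "(%w. ((X t (x + e) w + Y t (x + e) w) - (X t x w + Y t x w)) / e - (X' t x w + Y' t x w)) =
     (%w. ((X t (x + e) w - X t x w) / e - X' t x w) + ((Y t (x + e) w - Y t x w) / e - Y' t x w))"
    by (auto simp: diff_divide_distrib add_divide_distrib)
   then show ?thesis using add[OF X(4)[OF e, of x] Y(4)[OF e, of x]] by simp
  qed
  show "l2norm M (%w. (X t x w + Y t x w) - (X s x w + Y s x w)) <= ennreal ((C + D) * (t - s) powr \<rho>)"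
   if s: "0 <= s" "s <= t" "t - s <= 1" for s
   using add[OF X(5)[OF s, of x] Y(5)[OF s, of x]] by (simp add: algebra_simps)
 qed
qed

lemma ennreal_divide_leI: "a <= ennreal (C * p) ==> 0 < p ==> 0 <= C ==> a / ennreal p <= ennreal C"
 using divide_right_mono_ennreal[of a "ennreal (C * p)" "ennreal p"] by (simp add: divide_ennreal)

lemma tendsto_powr_at_0:
 assumes "0 < \<gamma>"
 shows "((%e::real. C * \<bar>e\<bar> powr \<gamma>) \<longlongrightarrow> 0) (at 0)"
proof -
 have "((%e::real. \<bar>e\<bar> powr \<gamma>) \<longlongrightarrow> 0) (at 0)"
  using assms by (intro tendsto_zero_powrI[where b = \<gamma>] tendsto_rabs_zero tendsto_ident_at tendsto_const) auto
 then show ?thesis by (rule tendsto_mult_right_zero)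
qed

lemma tendsto_ennreal_dominated_0:
 fixes g :: "real => real"
 assumes "eventually (%e. f e <= ennreal (g e)) A" "(g \<longlongrightarrow> 0) A"
 shows "(f \<longlongrightarrow> 0) A"
proof (rule tendsto_ennreal_0_le[OF _ assms(1)])
 have "((%e. ennreal (g e)) \<longlongrightarrow> ennreal 0) A" by (rule tendsto_ennrealI[OF assms(2)])
 then show "((%e. ennreal (g e)) \<longlongrightarrow> 0) A" by simp
qed

text \<open>Norms do not see null sets, so u only has to be a measurable version at each point. No
  joint measurability is asked of u, which lets the lemma apply directly to an iterated drift
  integral.\<close>

lemma regular_field_holder:
 assumes reg: "regular_field M \<gamma> \<rho> X X'" and \<gamma>: "0 < \<gamma>"
  and u: "!!t x. 0 < t ==> u t x \<in> borel_measurable M" "!!t x. 0 < t ==> AE w in M. u t x w = X t x w"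
 shows "linf_loc (holder1_l2_norm M \<gamma>) u"
 unfolding linf_loc_def
proof (intro allI impI)
 fix T :: real assume "0 <= T"
 \<comment> \<open>T may be 0, whereas constants are available for positive horizons.\<close>
 then have "0 < T + 1" by simp
 then obtain C where C: "0 <= C" and XC: "!!t. 0 < t ==> t <= T + 1 ==> regular_bounds M \<gamma> \<rho> X X' C t"
  using reg unfolding regular_field_def by blast
 have "holder1_l2_norm M \<gamma> (u t) <= ennreal (C + C + C)" if t: "0 < t" "t <= T" for t
 proof -
  have "t <= T + 1" using t by simp
  note X = regular_boundsD[OF XC[OF t(1) this]]
  have XM: "X t x \<in> borel_measurable M" "X' t x \<in> borel_measurable M" for x
   using X(1)[of x] X(2)[of x] C by (auto simp: l2norm_le_iff)
  have "has_l2_derivative M (u t) (X' t)"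
   unfolding has_l2_derivative_def
  proof
   fix x
   have "l2norm M (%w. (u t (x + e) w - u t x w) / e - X' t x w) =
     l2norm M (%w. (X t (x + e) w - X t x w) / e - X' t x w)" for e
   proof (rule l2norm_cong_AE)
    show "AE w in M. (u t (x + e) w - u t x w) / e - X' t x w = (X t (x + e) w - X t x w) / e - X' t x w"
     using u(2)[OF t(1), of x] u(2)[OF t(1), of "x + e"] by eventually_elim simp
   qed (use u(1)[OF t(1)] XM in auto)
   moreover have "eventually (%e::real. l2norm M (%w. (X t (x + e) w - X t x w) / e - X' t x w) <= ennreal (C * \<bar>e\<bar> powr \<gamma>)) (at 0)"
    unfolding eventually_at using X(4)[where x = x] by (intro exI[of _ 1]) auto
   ultimately show "((%e. l2norm M (%w. (u t (x + e) w - u t x w) / e - X' t x w)) \<longlongrightarrow> 0) (at 0)"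
    using tendsto_ennreal_dominated_0[OF _ tendsto_powr_at_0[OF \<gamma>]] by simp
  qed
  then have "holder1_l2_norm M \<gamma> (u t) <= (SUP x. l2norm M (u t x)) + (SUP x. l2norm M (X' t x)) +
    holder_quotient \<gamma> (%x y. l2norm M (%w. X' t x w - X' t y w))"
   unfolding holder1_l2_norm_def by (intro INF_lower) simp
  also have "... <= ennreal C + ennreal C + ennreal C"
  proof (intro add_mono SUP_least)
   fix x
   have "l2norm M (u t x) = l2norm M (X t x)" by (rule l2norm_cong_AE[OF u(2)[OF t(1)] u(1)[OF t(1)] XM(1)])
   then show "l2norm M (u t x) <= ennreal C" using X(1) by simp
   show "l2norm M (X' t x) <= ennreal C" by (rule X(2))
  next
   show "holder_quotient \<gamma> (%x y. l2norm M (%w. X' t x w - X' t y w)) <= ennreal C"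
    unfolding holder_quotient_def
    using X(3) C by (intro SUP_least) (auto intro!: ennreal_divide_leI)
  qed
  also have "... = ennreal (C + C + C)" using C by (simp add: ennreal_plus[symmetric] del: ennreal_plus)
  finally show ?thesis .
 qed
 then show "\<exists>K. AE t in lborel. t \<in> {0..T} --> holder1_l2_norm M \<gamma> (u t) <= ennreal K"
  using AE_lborel_singleton[of "0::real"]
  by (intro exI[of _ "C + C + C"]) (auto elim!: eventually_mono)
qed

text \<open>Supplies the measurability in x needed to bound an \<open>esssup\<close>: the norm is a
  continuous function of x.\<close>

lemma measurable_l2norm_of_continuous:
 fixes Z :: "real => 'a => real"
 assumes fin: "!!x. l2norm M (Z x) < \<infinity>" and C: "0 <= C" "0 < \<gamma>"
  and cont: "!!x y. \<bar>x - y\<bar> <= 1 ==> l2norm M (%w. Z x w - Z y w) <= ennreal (C * \<bar>x - y\<bar> powr \<gamma>)"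
 shows "(%x. l2norm M (Z x)) \<in> borel_measurable borel"
proof -
 have le: "rnorm M (Z x) <= rnorm M (Z y) + C * \<bar>x - y\<bar> powr \<gamma>" if "\<bar>x - y\<bar> <= 1" for x y
 proof -
  have "ennreal (rnorm M (Z x)) <= ennreal (C * \<bar>x - y\<bar> powr \<gamma>) + ennreal (rnorm M (Z y))"
   using l2norm_triangle_ineq[of M "Z x" "Z y"] add_right_mono[OF cont[OF that]]
   unfolding l2norm_finiteD(3)[OF fin, symmetric] by (rule order_trans)
  then show ?thesis using C by (simp add: ennreal_plus[symmetric] add.commute del: ennreal_plus)
 qed
 have "continuous_on UNIV (%x. rnorm M (Z x))"
  unfolding continuous_on_eq_continuous_at[OF open_UNIV] isCont_def
 proof
  fix x
  show "((%y. rnorm M (Z y)) \<longlongrightarrow> rnorm M (Z x)) (at x)"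
  proof (rule LIM_offset_zero_cancel, rule Lim_transform_bound[THEN Lim_null[THEN iffD2]])
   show "((%e::real. C * \<bar>e\<bar> powr \<gamma>) \<longlongrightarrow> 0) (at 0)" by (rule tendsto_powr_at_0[OF C(2)])
   show "eventually (%e. norm (rnorm M (Z (x + e)) - rnorm M (Z x)) <= norm (C * \<bar>e\<bar> powr \<gamma>)) (at 0)"
    unfolding eventually_at
   proof (intro exI[of _ 1] conjI ballI impI)
    fix e :: real assume "e \<noteq> 0 \<and> dist e 0 < 1"
    then have "\<bar>e\<bar> <= 1" by simp
    then show "norm (rnorm M (Z (x + e)) - rnorm M (Z x)) <= norm (C * \<bar>e\<bar> powr \<gamma>)"
     using le[of "x + e" x] le[of x "x + e"] C by (simp add: abs_le_iff)
   qed simp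
  qed
 qed
 then have "(%x. rnorm M (Z x)) \<in> borel_measurable borel" by (rule borel_measurable_continuous_onI)
 then show ?thesis unfolding l2norm_finiteD(3)[OF fin] by simp
qed

text \<open>By Cauchy-Schwarz, pairing with a fixed Y turns mean square differentiability into
  ordinary differentiability of a scalar function.\<close>

lemma l2_derivative_test:
 assumes Y: "l2norm M Y < \<infinity>" and fin: "!!x. l2norm M (\<phi> x) < \<infinity>" "l2norm M (\<psi> x) < \<infinity>"
  and lim: "((%e. l2norm M (%w. (\<phi> (x + e) w - \<phi> x w) / e - \<psi> x w)) \<longlongrightarrow> 0) (at 0)"
 shows "((%x. \<integral>w. \<phi> x w * Y w \<partial>M) has_real_derivative (\<integral>w. \<psi> x w * Y w \<partial>M)) (at x)"
 unfolding DERIV_def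
proof (rule Lim_null[THEN iffD2], rule tendsto_rabs_zero_cancel)
 let ?a = "%x. \<integral>w. \<phi> x w * Y w \<partial>M" and ?b = "\<integral>w. \<psi> x w * Y w \<partial>M"
 let ?q = "%e w. (\<phi> (x + e) w - \<phi> x w) / e - \<psi> x w"
 have qfin: "l2norm M (?q e) < \<infinity>" for e
 proof -
  have "(%w. (1 / e) * (\<phi> (x + e) w - \<phi> x w) - \<psi> x w) = ?q e" by auto
  then show ?thesis using l2norm_diff_finite[OF l2norm_scale_finite[OF l2norm_diff_finite[OF fin(1) fin(1)]] fin(2)] by metis
 qed
 have eq: "(?a (x + e) - ?a x) / e - ?b = (\<integral>w. ?q e w * Y w \<partial>M)" for e
 proof -
  note c = cauchy_schwarz_l2(1)[OF fin(1) Y] cauchy_schwarz_l2(1)[OF fin(2) Y]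
  have "(%w. ?q e w * Y w) = (%w. (1 / e) * (\<phi> (x + e) w * Y w - \<phi> x w * Y w) - \<psi> x w * Y w)"
   by (auto simp: left_diff_distrib diff_divide_distrib)
  then show ?thesis using c by (simp add: diff_divide_distrib)
 qed
 have "((%e. l2norm M (?q e) * l2norm M Y) \<longlongrightarrow> 0 * l2norm M Y) (at 0)"
  using Y lim by (intro tendsto_mult_ennreal tendsto_const) auto
 then have "((%e. ennreal (rnorm M (?q e) * rnorm M Y)) \<longlongrightarrow> 0) (at 0)"
  by (simp add: l2norm_finiteD(3)[OF qfin] l2norm_finiteD(3)[OF Y] ennreal_mult)
 then have lim2: "((%e. rnorm M (?q e) * rnorm M Y) \<longlongrightarrow> 0) (at 0)"
  using tendsto_ennreal_iff[of "%e. rnorm M (?q e) * rnorm M Y" "at 0" 0] by simp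
 show "((%e. \<bar>(?a (x + e) - ?a x) / e - ?b\<bar>) \<longlongrightarrow> 0) (at 0)"
  by (rule Lim_null_comparison[OF _ lim2], intro always_eventually allI)
   (use cauchy_schwarz_l2(3)[OF qfin Y] in \<open>simp add: eq\<close>)
qed

section \<open>Weak derivatives of mean square differentiable fields\<close>

lemma test_function_props:
 assumes "test_function \<eta>"
 shows "!!x. (\<eta> has_real_derivative deriv \<eta> x) (at x)" "continuous_on UNIV \<eta>" "continuous_on UNIV (deriv \<eta>)"
  "\<exists>R>0. \<forall>x. R < \<bar>x\<bar> --> \<eta> x = 0 \<and> deriv \<eta> x = 0"
proof -
 have d: "((deriv ^^ n) \<eta>) differentiable (at x)" for n x using assms by (simp add: test_function_def)
 have d0: "\<eta> differentiable (at x)" for x using d[of 0 x] by simp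
 have d1: "deriv \<eta> differentiable (at x)" for x using d[of 1 x] by simp
 show D: "(\<eta> has_real_derivative deriv \<eta> x) (at x)" for x
  using d0[of x] DERIV_deriv_iff_real_differentiable by blast
 show "continuous_on UNIV \<eta>"
  by (intro continuous_at_imp_continuous_on ballI differentiable_imp_continuous_within d0)
 show "continuous_on UNIV (deriv \<eta>)"
  by (intro continuous_at_imp_continuous_on ballI differentiable_imp_continuous_within d1)
 let ?S = "closure {x. \<eta> x \<noteq> 0}"
 have "compact ?S" using assms by (simp add: test_function_def)
 then have "bounded ?S" by (rule compact_imp_bounded)
 then obtain R where R: "0 < R" "!!x. x \<in> ?S ==> \<bar>x\<bar> <= R"
  unfolding bounded_pos real_norm_def by blast
 have out: "\<eta> x = 0" if "R < \<bar>x\<bar>" for x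
  using R(2)[of x] that closure_subset[of "{x. \<eta> x \<noteq> 0}"] by fastforce
 have "deriv \<eta> x = 0" if x: "R < \<bar>x\<bar>" for x
 proof -
  have "open {y::real. R < \<bar>y\<bar>}" by (intro open_Collect_less continuous_intros)
  then have "(\<eta> has_real_derivative 0) (at x)"
   using has_field_derivative_transform_within_open[of "%_. 0" 0 x "{y. R < \<bar>y\<bar>}" \<eta>] x out by auto
  then show ?thesis by (rule DERIV_imp_deriv)
 qed
 with out R(1) show "\<exists>R>0. \<forall>x. R < \<bar>x\<bar> --> \<eta> x = 0 \<and> deriv \<eta> x = 0" by blast
qed

lemma integrable_continuous_compact_support:
 fixes f :: "real => real"
 assumes "continuous_on UNIV f" "!!x. R < \<bar>x\<bar> ==> f x = 0"
 shows "integrable lborel f"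
proof -
 have "integrable lborel (%x. indicator {-R..R} x *\<^sub>R f x)"
  using borel_integrable_compact[of "{-R..R}" f] continuous_on_subset[OF assms(1)] by auto
 moreover have "(%x. indicator {-R..R} x *\<^sub>R f x) = f"
 proof
  fix x
  show "indicator {-R..R} x *\<^sub>R f x = f x"
   using assms(2)[of x] by (cases "R < \<bar>x\<bar>") (auto simp: indicator_def)
 qed
 ultimately show ?thesis by simp
qed

lemma integral_by_parts_compact_support:
 fixes a b \<eta> \<eta>' :: "real => real"
 assumes a: "!!x. (a has_real_derivative b x) (at x)" and b: "continuous_on UNIV b"
  and \<eta>: "!!x. (\<eta> has_real_derivative \<eta>' x) (at x)" "continuous_on UNIV \<eta>'"
  and R: "0 < R" "!!x. R < \<bar>x\<bar> ==> \<eta> x = 0 \<and> \<eta>' x = 0"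
 shows "(\<integral>x. \<eta>' x * a x \<partial>lborel) + (\<integral>x. \<eta> x * b x \<partial>lborel) = 0"
proof -
 have ca: "continuous_on UNIV a" and c\<eta>: "continuous_on UNIV \<eta>"
  using a \<eta>(1) by (auto intro!: continuous_at_imp_continuous_on DERIV_isCont)
 have i1: "integrable lborel (%x. \<eta>' x * a x)" and i2: "integrable lborel (%x. \<eta> x * b x)"
  using R(2) by (intro integrable_continuous_compact_support[where R = R] continuous_on_mult ca c\<eta> b \<eta>(2); simp)+
 have cont: "continuous_on UNIV (%x. \<eta>' x * a x + \<eta> x * b x)"
  by (intro continuous_intros ca c\<eta> b \<eta>(2))
 \<comment> \<open>The test function is known to vanish only strictly beyond R, so the boundary
   terms are taken at R + 1.\<close>
 let ?R = "R + 1"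
 have "(\<integral>x. (\<eta>' x * a x + \<eta> x * b x) * indicator {-?R..?R} x \<partial>lborel) = \<eta> ?R * a ?R - \<eta> (-?R) * a (-?R)"
 proof (rule integral_FTC_Icc_real)
  fix x
  show "((%x. \<eta> x * a x) has_real_derivative \<eta>' x * a x + \<eta> x * b x) (at x)"
   using DERIV_mult[OF \<eta>(1)[of x] a[of x]] by (simp add: mult.commute)
  show "isCont (%x. \<eta>' x * a x + \<eta> x * b x) x" using cont continuous_on_eq_continuous_at[OF open_UNIV] by blast
 qed (use R in simp)
 moreover have "\<eta> ?R = 0" "\<eta> (-?R) = 0" using R(2)[of ?R] R(2)[of "-?R"] R(1) by auto
 moreover have "(%x. (\<eta>' x * a x + \<eta> x * b x) * indicator {-?R..?R} x) = (%x. \<eta>' x * a x + \<eta> x * b x)"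
 proof
  fix x
  show "(\<eta>' x * a x + \<eta> x * b x) * indicator {-?R..?R} x = \<eta>' x * a x + \<eta> x * b x"
   using R(2)[of x] by (cases "R < \<bar>x\<bar>") (auto simp: indicator_def)
 qed
 ultimately have "(\<integral>x. \<eta>' x * a x + \<eta> x * b x \<partial>lborel) = 0" by simp
 then show ?thesis by (simp add: Bochner_Integration.integral_add[OF i1 i2])
qed

text \<open>Paired with Y, the two pathwise integrals become scalar and integration by parts
  applies. Their sum is thus orthogonal to every Y, has norm 0 and vanishes almost surely.\<close>

lemma weak_derivative_of_l2_derivative:
 fixes \<phi> \<psi> :: "real => 'a => real"
 assumes M: "prob_space M" and \<gamma>: "0 < \<gamma>" and C: "0 <= C"
  and \<phi>: "(%(x, w). \<phi> x w) \<in> borel_measurable (borel \<Otimes>\<^sub>M M)" "!!x. l2norm M (\<phi> x) <= ennreal C"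
  and \<psi>: "(%(x, w). \<psi> x w) \<in> borel_measurable (borel \<Otimes>\<^sub>M M)" "!!x. l2norm M (\<psi> x) <= ennreal C"
   "!!x y. l2norm M (%w. \<psi> x w - \<psi> y w) <= ennreal (C * \<bar>x - y\<bar> powr \<gamma>)"
  and d: "!!x. ((%e. l2norm M (%w. (\<phi> (x + e) w - \<phi> x w) / e - \<psi> x w)) \<longlongrightarrow> 0) (at 0)"
 shows "has_weak_l2_derivative M \<phi> \<psi>"
 unfolding has_weak_l2_derivative_def
proof (intro conjI allI impI)
 interpret prob_space M by (rule M)
 show "(%(x, w). \<psi> x w) \<in> borel_measurable (borel \<Otimes>\<^sub>M M)" by (rule \<psi>(1))
 fix \<eta> assume "test_function \<eta>"
 note \<eta> = test_function_props[OF this]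
 obtain R where R: "0 < R" "!!x. R < \<bar>x\<bar> ==> \<eta> x = 0 \<and> deriv \<eta> x = 0" using \<eta>(4) by blast
 have i: "integrable lborel \<eta>" "integrable lborel (deriv \<eta>)"
  using R(2) by (intro integrable_continuous_compact_support[where R = R] \<eta>; simp)+
 have m: "(%(x, w). \<phi> x w) \<in> borel_measurable (lborel \<Otimes>\<^sub>M M)" "(%(x, w). \<psi> x w) \<in> borel_measurable (lborel \<Otimes>\<^sub>M M)"
  using \<phi>(1) \<psi>(1) by (simp_all cong: measurable_cong_sets sets_pair_measure_cong)
 interpret A: kernel_operator M lborel \<phi> "deriv \<eta>" C
  by standard (use m i C \<phi>(2) in auto)
 interpret B: kernel_operator M lborel \<psi> \<eta> C
  by standard (use m i C \<psi>(2) in auto)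
 have fin: "l2norm M (\<phi> x) < \<infinity>" "l2norm M (\<psi> x) < \<infinity>" for x
  using l2norm_le_rnorm(2)[OF \<phi>(2) C] l2norm_le_rnorm(2)[OF \<psi>(2) C] by auto
 have "l2norm M (%w. A.T w + B.T w) <= ennreal 0"
 proof (rule l2norm_le_dual[OF finite_measure_axioms])
  fix Y assume Y: "l2norm M Y < \<infinity>"
  let ?a = "%x. \<integral>w. \<phi> x w * Y w \<partial>M" and ?b = "%x. \<integral>w. \<psi> x w * Y w \<partial>M"
  have Tfin: "l2norm M A.T < \<infinity>" "l2norm M B.T < \<infinity>"
   using A.T_bound B.T_bound by (auto intro: le_less_trans)
  have "(\<integral>w. (A.T w + B.T w) * Y w \<partial>M) = (\<integral>w. A.T w * Y w \<partial>M) + (\<integral>w. B.T w * Y w \<partial>M)"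
   unfolding distrib_right by (intro Bochner_Integration.integral_add cauchy_schwarz_l2(1) Tfin Y)
  also have "... = (\<integral>x. deriv \<eta> x * ?a x \<partial>lborel) + (\<integral>x. \<eta> x * ?b x \<partial>lborel)"
   unfolding A.T_test[OF Y] B.T_test[OF Y] ..
  also have "... = 0"
  proof (rule integral_by_parts_compact_support[OF _ _ \<eta>(1,3) R])
   show "(?a has_real_derivative ?b x) (at x)" for x by (rule l2_derivative_test[OF Y fin d])
   show "continuous_on UNIV ?b"
    unfolding continuous_on_eq_continuous_at[OF open_UNIV] isCont_def
   proof
    fix x
    show "(?b \<longlongrightarrow> ?b x) (at x)"
    proof (rule LIM_offset_zero_cancel, rule Lim_transform_bound[THEN Lim_null[THEN iffD2]])
     show "((%e::real. C * rnorm M Y * \<bar>e\<bar> powr \<gamma>) \<longlongrightarrow> 0) (at 0)" by (rule tendsto_powr_at_0[OF \<gamma>])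
     show "eventually (%e. norm (?b (x + e) - ?b x) <= norm (C * rnorm M Y * \<bar>e\<bar> powr \<gamma>)) (at 0)"
     proof (intro always_eventually allI)
      fix e
      have le: "l2norm M (%w. \<psi> (x + e) w - \<psi> x w) <= ennreal (C * \<bar>e\<bar> powr \<gamma>)" using \<psi>(3)[of "x + e" x] by simp
      have C': "0 <= C * \<bar>e\<bar> powr \<gamma>" using C by simp
      note l = l2norm_le_rnorm[OF le C']
      have "?b (x + e) - ?b x = (\<integral>w. (\<psi> (x + e) w - \<psi> x w) * Y w \<partial>M)"
       unfolding left_diff_distrib
       by (intro Bochner_Integration.integral_diff[symmetric] cauchy_schwarz_l2(1) fin Y)
      also have "\<bar>...\<bar> <= (C * \<bar>e\<bar> powr \<gamma>) * rnorm M Y"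
       using cauchy_schwarz_l2(3)[OF l(2) Y] mult_right_mono[OF l(1) rnorm_nonneg[of M Y]] by linarith
      finally show "norm (?b (x + e) - ?b x) <= norm (C * rnorm M Y * \<bar>e\<bar> powr \<gamma>)"
       using C by (simp add: abs_mult ac_simps)
     qed
    qed
   qed
  qed
  finally show "\<bar>\<integral>w. (A.T w + B.T w) * Y w \<partial>M\<bar> <= 0 * rnorm M Y" by simp
 qed auto
 then have "l2norm M (%w. A.T w + B.T w) = 0" by simp
 from l2norm_eq_0D[OF this]
 show "AE w in M. (\<integral>x. \<phi> x w * deriv \<eta> x \<partial>lborel) = - (\<integral>x. \<psi> x w * \<eta> x \<partial>lborel)"
  by eventually_elim (simp add: A.T_def B.T_def mult.commute[of "deriv \<eta> _"] mult.commute[of "\<eta> _"])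
qed

lemma jointly_measurable_section:
 assumes "jointly_measurable M u" "0 <= t"
 shows "(%(x, w). u t x w) \<in> borel_measurable (borel \<Otimes>\<^sub>M M)"
 using measurable_Pair2[OF assms(1)[unfolded jointly_measurable_def], of t] assms(2)
 by (simp add: space_restrict_space case_prod_beta')

text \<open>The difference quotient is within C |e|^\<gamma> <= C of a derivative of norm at most C,
  whence the constant 2 C.\<close>

lemma regular_bounds_space:
 assumes reg: "regular_bounds M \<gamma> \<rho> X X' C t" and C: "0 <= C" and \<gamma>: "0 < \<gamma>" and xy: "\<bar>x - y\<bar> <= 1"
 shows "l2norm M (%w. X t x w - X t y w) <= ennreal (2 * C * \<bar>x - y\<bar>)"
proof (cases "x = y")
 case False
 define e where "e = x - y"
 have e: "e \<noteq> 0" "\<bar>e\<bar> <= 1" using False xy by (auto simp: e_def)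
 have "l2norm M (%w. (X t (y + e) w - X t y w) / e) <=
   l2norm M (%w. (X t (y + e) w - X t y w) / e - X' t y w) + l2norm M (X' t y)"
  by (rule l2norm_triangle_ineq)
 also have "... <= ennreal (C * \<bar>e\<bar> powr \<gamma>) + ennreal C"
  by (intro add_mono regular_boundsD(4)[OF reg e] regular_boundsD(2)[OF reg])
 also have "... <= ennreal (2 * C)"
 proof -
  have "\<bar>e\<bar> powr \<gamma> <= 1 powr \<gamma>" using e \<gamma> by (intro powr_mono2) auto
  then have "C * \<bar>e\<bar> powr \<gamma> <= C" using C by (simp add: mult_left_le)
  then show ?thesis using C by (simp add: ennreal_plus[symmetric] ennreal_leI del: ennreal_plus)
 qed
 finally have "ennreal \<bar>e\<bar> * l2norm M (%w. (X t (y + e) w - X t y w) / e) <= ennreal \<bar>e\<bar> * ennreal (2 * C)"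
  by (rule mult_left_mono) simp
 moreover have "ennreal \<bar>e\<bar> * l2norm M (%w. (X t (y + e) w - X t y w) / e) = l2norm M (%w. X t x w - X t y w)"
  unfolding l2norm_scale[symmetric] using e by (simp add: e_def)
 ultimately show ?thesis using C by (simp add: ennreal_mult[symmetric] e_def mult.commute)
qed (use C in simp)

section \<open>From regular fields to fields with the properties of a mild solution\<close>

context noise
begin

text \<open>All clauses on norms are insensitive to versions, so they pass from X to a jointly
  measurable, adapted modification, which exists because X is Hoelder continuous in mean
  square.\<close>

theorem regular_field_solution:
 assumes reg: "regular_field M \<gamma> \<rho> X X'" and \<gamma>: "0 < \<gamma>" and \<rho>: "0 < \<rho>" "\<rho> <= 1"
  and XF: "!!t x. 0 <= t ==> X t x \<in> borel_measurable (F t)"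
 shows "\<exists>u. jointly_measurable M u \<and> adapted_field F u \<and> (\<forall>t\<ge>0. \<forall>x. AE w in M. u t x w = X t x w) \<and>
  (\<forall>x. l2_cadlag M (%t. u t x)) \<and> linf_loc (w1inf_l2_norm M) u \<and> linf_loc (holder1_l2_norm M \<gamma>) u"
proof -
 have X0: "X 0 x = (%_. 0)" for x using reg by (simp add: regular_field_def)
 have XC: "\<exists>C\<ge>0. \<forall>t. 0 < t --> t <= T --> regular_bounds M \<gamma> \<rho> X X' C t" if "0 < T" for T
  using reg that unfolding regular_field_def by blast
 have XM: "X t x \<in> borel_measurable M" if "0 <= t" for t x using F_measurable_M[OF XF[OF that]] .
 have time: "\<exists>C\<ge>0. \<forall>s t x. 0 <= s --> s <= t --> t <= T --> t - s <= 1 --> l2norm M (%w. X t x w - X s x w) <= ennreal (C * (t - s) powr \<rho>)"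
  if T: "0 < T" for T
 proof -
  obtain C where C: "0 <= C" "!!t. 0 < t ==> t <= T ==> regular_bounds M \<gamma> \<rho> X X' C t" using XC[OF T] by blast
  have "l2norm M (%w. X t x w - X s x w) <= ennreal (C * (t - s) powr \<rho>)"
   if "0 <= s" "s <= t" "t <= T" "t - s <= 1" for s t x
  proof (cases "t = 0")
   case False
   then show ?thesis using regular_boundsD(5)[OF C(2)[of t] that(1,2,4), of x] that by simp
  qed (use that in simp)
  with C(1) show ?thesis by blast
 qed
 have cont: "\<exists>C\<ge>0. \<forall>s x y. 0 <= s --> s <= t --> t - s <= 1 --> \<bar>x - y\<bar> <= 1 -->
   l2norm M (%w. X t x w - X s y w) <= ennreal (C * ((t - s) powr \<rho> + \<bar>x - y\<bar> powr \<rho>))" if t: "0 <= t" for t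
 proof -
  have T: "0 < t + 1" using t by simp
  obtain C where C: "0 <= C" "!!s. 0 < s ==> s <= t + 1 ==> regular_bounds M \<gamma> \<rho> X X' C s" using XC[OF T] by blast
  obtain D where D: "0 <= D" "!!s t' x. 0 <= s ==> s <= t' ==> t' <= t + 1 ==> t' - s <= 1 ==>
    l2norm M (%w. X t' x w - X s x w) <= ennreal (D * (t' - s) powr \<rho>)" using time[OF T] by blast
  have "l2norm M (%w. X t x w - X s y w) <= ennreal ((2 * C + D) * ((t - s) powr \<rho> + \<bar>x - y\<bar> powr \<rho>))"
   if s: "0 <= s" "s <= t" "t - s <= 1" "\<bar>x - y\<bar> <= 1" for s x y
  proof -
   \<comment> \<open>Since |x - y| <= 1 and \<rho> <= 1, the Lipschitz bound in space also holds
     with the exponent \<rho> used for time.\<close>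
   have sp: "l2norm M (%w. X s x w - X s y w) <= ennreal (2 * C * \<bar>x - y\<bar> powr \<rho>)"
   proof (cases "s = 0")
    case False
    then have "l2norm M (%w. X s x w - X s y w) <= ennreal (2 * C * \<bar>x - y\<bar>)"
     using s by (intro regular_bounds_space[OF C(2) C(1) \<gamma> s(4)]) auto
    also have "... <= ennreal (2 * C * \<bar>x - y\<bar> powr \<rho>)"
    proof -
     have "\<bar>x - y\<bar> <= \<bar>x - y\<bar> powr \<rho>"
      using powr_mono'[of \<rho> 1 "\<bar>x - y\<bar>"] s(4) \<rho> by (cases "x = y") auto
     then show ?thesis using C(1) by (intro ennreal_leI mult_left_mono) auto
    qed
    finally show ?thesis .
   qed (simp add: X0)
   have "l2norm M (%w. X t x w - X s y w) <= l2norm M (%w. X t x w - X s x w) + l2norm M (%w. X s x w - X s y w)"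
    by (rule l2norm_triangle3)
   also have "... <= ennreal (D * (t - s) powr \<rho>) + ennreal (2 * C * \<bar>x - y\<bar> powr \<rho>)"
    using s by (intro add_mono sp D(2)) auto
   also have "... <= ennreal ((2 * C + D) * ((t - s) powr \<rho> + \<bar>x - y\<bar> powr \<rho>))"
   proof -
    have "0 <= C * (t - s) powr \<rho>" "0 <= D * \<bar>x - y\<bar> powr \<rho>" using C(1) D(1) by auto
    then have "D * (t - s) powr \<rho> + 2 * C * \<bar>x - y\<bar> powr \<rho> <= (2 * C + D) * ((t - s) powr \<rho> + \<bar>x - y\<bar> powr \<rho>)"
     by (simp add: algebra_simps)
    then show ?thesis using C(1) D(1) by (simp add: ennreal_plus[symmetric] ennreal_leI del: ennreal_plus)
   qed
   finally show ?thesis .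
  qed
  then show ?thesis using C(1) D(1) by (intro exI[of _ "2 * C + D"]) auto
 qed
 obtain u where u: "jointly_measurable M u" "adapted_field F u" "!!t x. 0 <= t ==> AE w in M. u t x w = X t x w"
  using measurable_modification[of X F M \<rho>, OF XF F_subalgebra _ \<rho>(1) cont] F_measurable_le by blast
 have uM: "u t x \<in> borel_measurable M" if "0 <= t" for t x
  using u(2) that F_measurable_M unfolding adapted_field_def by blast
 have u_diff: "l2norm M (%w. u s x w - u t y w) = l2norm M (%w. X s x w - X t y w)" if "0 <= s" "0 <= t" for s t x y
 proof (rule l2norm_cong_AE)
  show "AE w in M. u s x w - u t y w = X s x w - X t y w" using u(3)[OF that(1), of x] u(3)[OF that(2), of y] by eventually_elim simp
 qed (use uM XM that in auto)
 have u_norm: "l2norm M (u t x) = l2norm M (X t x)" if "0 <= t" for t x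
  by (rule l2norm_cong_AE[OF u(3)[OF that] uM[OF that] XM[OF that]])
 have "l2_cadlag M (%t. u t x)" for x
  unfolding l2_cadlag_def
 proof (intro conjI allI impI)
  show fin: "l2norm M (u t x) < \<infinity>" if t: "0 <= t" for t
  proof (cases "t = 0")
   case True
   then show ?thesis using u_norm[of 0 x] by (simp add: X0)
  next
   case False
   with t have "0 < t" by simp
   then obtain C where "0 <= C" "regular_bounds M \<gamma> \<rho> X X' C t" using XC[of t] by auto
   from l2norm_le_rnorm(2)[OF regular_boundsD(1)[OF this(2)] this(1)] show ?thesis by (simp add: u_norm[OF t])
  qed
  fix t :: real
  have lim: "((%s. C * (s - t) powr \<rho>) \<longlongrightarrow> 0) (at_right t)" "((%s. C * (t - s) powr \<rho>) \<longlongrightarrow> 0) (at_left t)" for C :: real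
  proof -
   have "((%s. s - t) \<longlongrightarrow> t - t) (at_right t)" "((%s. t - s) \<longlongrightarrow> t - t) (at_left t)" by (intro tendsto_intros)+
   then have l: "((%s. s - t) \<longlongrightarrow> 0) (at_right t)" "((%s. t - s) \<longlongrightarrow> 0) (at_left t)" by simp_all
   have "((%s. (s - t) powr \<rho>) \<longlongrightarrow> 0) (at_right t)"
    by (rule tendsto_zero_powrI[OF l(1) tendsto_const]) (use \<rho>(1) in \<open>auto simp: eventually_at_right_less eventually_at_filter\<close>)
   then show "((%s. C * (s - t) powr \<rho>) \<longlongrightarrow> 0) (at_right t)" by (rule tendsto_mult_right_zero)
   have "((%s. (t - s) powr \<rho>) \<longlongrightarrow> 0) (at_left t)"
    by (rule tendsto_zero_powrI[OF l(2) tendsto_const]) (use \<rho>(1) in \<open>auto simp: eventually_at_filter\<close>)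
   then show "((%s. C * (t - s) powr \<rho>) \<longlongrightarrow> 0) (at_left t)" by (rule tendsto_mult_right_zero)
  qed
  show "((%s. l2norm M (%w. u s x w - u t x w)) \<longlongrightarrow> 0) (at_right t)" if t: "0 <= t"
  proof -
   have "0 < t + 1" using t by simp
   from time[OF this] obtain C where C: "!!s t' x. 0 <= s ==> s <= t' ==> t' <= t + 1 ==> t' - s <= 1 ==>
     l2norm M (%w. X t' x w - X s x w) <= ennreal (C * (t' - s) powr \<rho>)" by blast
   have "eventually (%s. s \<in> {t<..<t + 1}) (at_right t)" by (rule eventually_at_right_real) simp
   then have "eventually (%s. l2norm M (%w. u s x w - u t x w) <= ennreal (C * (s - t) powr \<rho>)) (at_right t)"
   proof eventually_elim
    case (elim s)
    then show ?case using C[of t s x] t by (subst u_diff) auto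
   qed
   from tendsto_ennreal_dominated_0[OF this lim(1)] show ?thesis .
  qed
  show "\<exists>L. l2norm M L < \<infinity> \<and> ((%s. l2norm M (%w. u s x w - L w)) \<longlongrightarrow> 0) (at_left t)" if t: "0 < t"
  proof (intro exI[of _ "u t x"] conjI)
   show "l2norm M (u t x) < \<infinity>" using t by (intro fin) simp
   from time[OF t] obtain C where C: "!!s t' x. 0 <= s ==> s <= t' ==> t' <= t ==> t' - s <= 1 ==>
     l2norm M (%w. X t' x w - X s x w) <= ennreal (C * (t' - s) powr \<rho>)" by blast
   have "eventually (%s. s \<in> {max 0 (t - 1)<..<t}) (at_left t)" by (rule eventually_at_left_real) (use t in simp)
   then have "eventually (%s. l2norm M (%w. u s x w - u t x w) <= ennreal (C * (t - s) powr \<rho>)) (at_left t)"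
   proof eventually_elim
    case (elim s)
    then show ?case using C[of s t x] t by (subst l2norm_minus_commute, subst u_diff) auto
   qed
   from tendsto_ennreal_dominated_0[OF this lim(2)]
   show "((%s. l2norm M (%w. u s x w - u t x w)) \<longlongrightarrow> 0) (at_left t)" .
  qed
 qed
 moreover have "linf_loc (holder1_l2_norm M \<gamma>) u"
  by (rule regular_field_holder[OF reg \<gamma>]) (use uM u(3) in auto)
 moreover have "linf_loc (w1inf_l2_norm M) u"
  unfolding linf_loc_def
 proof (intro allI impI)
  fix T :: real assume "0 <= T"
  then have "0 < T + 1" by simp
  then obtain C where C: "0 <= C" "!!t. 0 < t ==> t <= T + 1 ==> regular_bounds M \<gamma> \<rho> X X' C t" using XC by blast
  have "w1inf_l2_norm M (u t) <= ennreal (C + C)" if t: "0 < t" "t <= T" for t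
  proof -
   have "t <= T + 1" using t by simp
   note rb = C(2)[OF t(1) this]
   note X = regular_boundsD[OF rb]
   have t0: "0 <= t" using t by simp
   have X'M: "X' t x \<in> borel_measurable M" for x using X(2)[of x] C(1) by (simp add: l2norm_le_iff)
   \<comment> \<open>A weak derivative must be jointly measurable in x and \<omega>, which X' is not
     known to be. The modification theorem is applied to the field frozen at t, constant in time,
     with the constant filtration M, and its result is read at time 0.\<close>
   have "\<exists>\<psi>. jointly_measurable M \<psi> \<and> adapted_field (%_. M) \<psi> \<and> (\<forall>s\<ge>0. \<forall>x. AE w in M. \<psi> s x w = X' t x w)"
   proof (rule measurable_modification[of "%_. X' t" "%_. M" M \<gamma>])
    show "subalgebra M M" by (simp add: subalgebra_def)
    show "\<exists>C\<ge>0. \<forall>r x y. 0 <= r --> r <= s --> s - r <= 1 --> \<bar>x - y\<bar> <= 1 -->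
      l2norm M (%w. X' t x w - X' t y w) <= ennreal (C * ((s - r) powr \<gamma> + \<bar>x - y\<bar> powr \<gamma>))" for s
    proof (intro exI[of _ C] conjI allI impI C(1))
     fix r x y :: real
     have "C * \<bar>x - y\<bar> powr \<gamma> <= C * ((s - r) powr \<gamma> + \<bar>x - y\<bar> powr \<gamma>)" using C(1) by (intro mult_left_mono) auto
     with X(3)[of x y] show "l2norm M (%w. X' t x w - X' t y w) <= ennreal (C * ((s - r) powr \<gamma> + \<bar>x - y\<bar> powr \<gamma>))"
      by (meson ennreal_leI order_trans)
    qed
   qed (use X'M \<gamma> in auto)
   then obtain \<psi> where \<psi>: "jointly_measurable M \<psi>" "adapted_field (%_. M) \<psi>" "!!s x. 0 <= s ==> AE w in M. \<psi> s x w = X' t x w" by blast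
   have \<psi>M: "\<psi> 0 x \<in> borel_measurable M" for x using \<psi>(2) unfolding adapted_field_def by simp
   have \<psi>_eq: "l2norm M (\<psi> 0 x) = l2norm M (X' t x)" for x by (rule l2norm_cong_AE[OF \<psi>(3)[OF order_refl] \<psi>M X'M])
   have \<psi>_diff: "l2norm M (%w. \<psi> 0 x w - \<psi> 0 y w) = l2norm M (%w. X' t x w - X' t y w)" for x y
   proof (rule l2norm_cong_AE)
    show "AE w in M. \<psi> 0 x w - \<psi> 0 y w = X' t x w - X' t y w"
     using \<psi>(3)[OF order_refl, of x] \<psi>(3)[OF order_refl, of y] by eventually_elim simp
   qed (use \<psi>M X'M in auto)
   have weak: "has_weak_l2_derivative M (u t) (\<psi> 0)"
   proof (rule weak_derivative_of_l2_derivative[OF prob_space_axioms \<gamma> C(1)])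
    show "(%(x, w). u t x w) \<in> borel_measurable (borel \<Otimes>\<^sub>M M)" by (rule jointly_measurable_section[OF u(1) t0])
    show "(%(x, w). \<psi> 0 x w) \<in> borel_measurable (borel \<Otimes>\<^sub>M M)" by (rule jointly_measurable_section[OF \<psi>(1)]) simp
    show "l2norm M (u t x) <= ennreal C" for x using X(1) by (simp add: u_norm[OF t0])
    show "l2norm M (\<psi> 0 x) <= ennreal C" for x using X(2) by (simp add: \<psi>_eq)
    show "l2norm M (%w. \<psi> 0 x w - \<psi> 0 y w) <= ennreal (C * \<bar>x - y\<bar> powr \<gamma>)" for x y using X(3) by (simp add: \<psi>_diff)
    fix x
    have "l2norm M (%w. (u t (x + e) w - u t x w) / e - \<psi> 0 x w) =
      l2norm M (%w. (X t (x + e) w - X t x w) / e - X' t x w)" for e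
    proof (rule l2norm_cong_AE)
     show "AE w in M. (u t (x + e) w - u t x w) / e - \<psi> 0 x w = (X t (x + e) w - X t x w) / e - X' t x w"
      using u(3)[OF t0, of x] u(3)[OF t0, of "x + e"] \<psi>(3)[OF order_refl, of x] by eventually_elim simp
    qed (use uM[OF t0] XM[OF t0] \<psi>M X'M in auto)
    moreover have "eventually (%e::real. l2norm M (%w. (X t (x + e) w - X t x w) / e - X' t x w) <= ennreal (C * \<bar>e\<bar> powr \<gamma>)) (at 0)"
     unfolding eventually_at using X(4)[where x = x] by (intro exI[of _ 1]) auto
    ultimately show "((%e. l2norm M (%w. (u t (x + e) w - u t x w) / e - \<psi> 0 x w)) \<longlongrightarrow> 0) (at 0)"
     using tendsto_ennreal_dominated_0[OF _ tendsto_powr_at_0[OF \<gamma>]] by simp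
   qed
   have m1: "(%x. l2norm M (u t x)) \<in> borel_measurable borel"
   proof (rule measurable_l2norm_of_continuous[of _ _ "2 * C" 1])
    show "l2norm M (u t x) < \<infinity>" for x using l2norm_le_rnorm(2)[OF X(1) C(1)] by (simp add: u_norm[OF t0])
    show "l2norm M (%w. u t x w - u t y w) <= ennreal (2 * C * \<bar>x - y\<bar> powr 1)" if "\<bar>x - y\<bar> <= 1" for x y
     using regular_bounds_space[OF rb C(1) \<gamma> that] by (simp add: u_diff[OF t0 t0])
   qed (use C(1) in auto)
   have m2: "(%x. l2norm M (\<psi> 0 x)) \<in> borel_measurable borel"
   proof (rule measurable_l2norm_of_continuous[of _ _ C \<gamma>])
    show "l2norm M (\<psi> 0 x) < \<infinity>" for x using l2norm_le_rnorm(2)[OF X(2) C(1)] by (simp add: \<psi>_eq)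
    show "l2norm M (%w. \<psi> 0 x w - \<psi> 0 y w) <= ennreal (C * \<bar>x - y\<bar> powr \<gamma>)" for x y using X(3) by (simp add: \<psi>_diff)
   qed (use C(1) \<gamma> in auto)
   have "w1inf_l2_norm M (u t) <= esssup lborel (%x. l2norm M (u t x)) + esssup lborel (%x. l2norm M (\<psi> 0 x))"
    unfolding w1inf_l2_norm_def using weak by (intro INF_lower) simp
   also have "... <= ennreal C + ennreal C"
   proof (rule add_mono)
    show "esssup lborel (%x. l2norm M (u t x)) <= ennreal C"
     by (rule esssup_I) (use m1 X(1) u_norm[OF t0] in auto)
    show "esssup lborel (%x. l2norm M (\<psi> 0 x)) <= ennreal C"
     by (rule esssup_I) (use m2 X(2) \<psi>_eq in auto)
   qed
   also have "... = ennreal (C + C)" using C(1) by (simp add: ennreal_plus[symmetric] del: ennreal_plus)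
   finally show ?thesis .
  qed
  then show "\<exists>K. AE t in lborel. t \<in> {0..T} --> w1inf_l2_norm M (u t) <= ennreal K"
   using AE_lborel_singleton[of "0::real"] by (intro exI[of _ "C + C"]) (auto elim!: eventually_mono)
 qed
 ultimately show ?thesis using u by blast
qed

end

section \<open>Noise and drift\<close>

text \<open>The derivative is required in the open interval only, to admit integrands such as
  \<open>s powr a\<close> with a < 0 that blow up at 0.\<close>

lemma nn_integral_FTC_interior:
 fixes F f :: "real => real"
 assumes ab: "a <= b" and F: "continuous_on {a..b} F" "!!x. a < x ==> x < b ==> (F has_real_derivative f x) (at x)"
  and f: "f \<in> borel_measurable borel" "!!x. 0 <= f x"
 shows "(\<integral>\<^sup>+x. ennreal (indicator {a..b} x * f x) \<partial>lborel) = ennreal (F b - F a)"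
proof (rule nn_integral_has_integral_lborel)
 have "(f has_integral F b - F a) {a..b}"
  using F by (intro fundamental_theorem_of_calculus_interior ab) (auto simp: has_real_derivative_iff_has_vector_derivative)
 then have "((%x. if x \<in> {a..b} then f x else 0) has_integral F b - F a) UNIV"
  by (simp only: has_integral_restrict_UNIV)
 also have "(%x. if x \<in> {a..b} then f x else 0) = (%x. indicator {a..b} x * f x)" by (auto simp: indicator_def)
 finally show "((%x. indicator {a..b} x * f x) has_integral F b - F a) UNIV" .
qed (use f in auto)

lemma nn_integral_powr:
 fixes a t :: real
 assumes a: "-1 < a" and t: "0 <= t"
 shows "(\<integral>\<^sup>+s. ennreal (indicator {0..t} s * s powr a) \<partial>lborel) = ennreal (t powr (a + 1) / (a + 1))"
proof -
 have "(\<integral>\<^sup>+s. ennreal (indicator {0..t} s * s powr a) \<partial>lborel) = ennreal (t powr (a + 1) / (a + 1) - 0 powr (a + 1) / (a + 1))"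
 proof (rule nn_integral_FTC_interior[OF t])
  show "continuous_on {0..t} (%s. s powr (a + 1) / (a + 1))"
   using a by (intro continuous_on_divide continuous_on_powr' continuous_intros) auto
  fix s :: real assume "0 < s"
  then show "((%s. s powr (a + 1) / (a + 1)) has_real_derivative s powr a) (at s)"
   using a by (auto intro!: derivative_eq_intros)
 qed auto
 then show ?thesis by simp
qed

lemma powr_le_Suc:
 fixes a t T :: real
 assumes "0 <= t" "t <= T" "0 <= a" "a <= 1"
 shows "t powr a <= T + 1"
proof -
 have "t powr a <= (T + 1) powr a" using assms by (intro powr_mono2) auto
 also have "... <= (T + 1) powr 1" using assms by (intro powr_mono) auto
 finally show ?thesis using assms by simp
qed

lemma nn_integral_reflect:
 fixes f :: "real => ennreal"
 assumes "f \<in> borel_measurable borel"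
 shows "(\<integral>\<^sup>+r. f (t - r) \<partial>lborel) = (\<integral>\<^sup>+s. f s \<partial>lborel)"
 using nn_integral_real_affine[OF assms, of "-1" t] by simp

lemma indicator_reflect: "indicator {0..t} (t - r :: real) = (indicator {0..t} r :: real)"
 by (auto simp: indicator_def)

text \<open>For d <= 1 the linear branch is used, for d > 1 the constant one. In the L1 cost of the
  drift both a and b are integrable powers of s, so every exponent \<gamma> <= 1 is reached.\<close>

lemma min_powr_interpolate:
 fixes a b d \<gamma> :: real
 assumes "0 <= a" "0 <= b" "0 <= d" "0 < \<gamma>" "\<gamma> <= 1"
 shows "min a (b * d) <= (a + b) * d powr \<gamma>"
proof (cases "d <= 1")
 case True
 have "d <= d powr \<gamma>" using powr_mono'[of \<gamma> 1 d] assms True by (cases "d = 0") auto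
 then have "b * d <= b * d powr \<gamma>" using assms by (intro mult_left_mono) auto
 then show ?thesis using assms by (simp add: distrib_right min.coboundedI2 add_increasing)
next
 case False
 then have "1 powr \<gamma> <= d powr \<gamma>" using assms by (intro powr_mono2) auto
 then have "a * 1 <= a * d powr \<gamma>" using assms by (intro mult_left_mono) auto
 then show ?thesis using assms by (simp add: distrib_right min.coboundedI1 add_increasing2)
qed

text \<open>Split at s = d^2, where the branches cross. Below, s^(-1+\<gamma>) integrates to
  d^(2\<gamma>)/\<gamma>; above, d^2 s^(-2+\<gamma>) integrates to at most
  d^(2\<gamma>)/(1-\<gamma>). The tail is what forces \<gamma> < 1.\<close>

lemma nn_integral_modulus_square:
 fixes t d \<gamma> :: real
 assumes t: "0 <= t" and d: "0 < d" and \<gamma>: "0 < \<gamma>" "\<gamma> < 1"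
 shows "(\<integral>\<^sup>+s. ennreal (indicator {0..t} s * (min (s powr (-1/2 + \<gamma>/2)) (s powr (-1 + \<gamma>/2) * d))\<^sup>2) \<partial>lborel) <=
  ennreal ((1 / \<gamma> + 1 / (1 - \<gamma>)) * (d powr \<gamma>)\<^sup>2)"
proof -
 \<comment> \<open>The maximum keeps d^2 <= u, so the upper interval is legitimate also when t <
   d^2.\<close>
 define u where "u = max t (d\<^sup>2)"
 have d2: "0 < d\<^sup>2" "d\<^sup>2 <= u" using d by (auto simp: u_def)
 then have "0 < u" by linarith
 note d2 = d2 this
 have dp: "(d\<^sup>2) powr a = d powr (2 * a)" for a using d by (simp add: powr_powr[of d 2, symmetric])
 have sq: "(s powr a)\<^sup>2 = s powr (2 * a)" for s a :: real by (simp add: power2_eq_square powr_add[symmetric])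
 have i1: "(\<integral>\<^sup>+s. ennreal (indicator {0..d\<^sup>2} s * s powr (-1 + \<gamma>)) \<partial>lborel) = ennreal ((d powr \<gamma>)\<^sup>2 / \<gamma>)"
  using nn_integral_powr[of "-1 + \<gamma>" "d\<^sup>2"] \<gamma> by (simp add: dp sq)
 have i2: "(\<integral>\<^sup>+s. ennreal (indicator {d\<^sup>2..u} s * (d\<^sup>2 * s powr (-2 + \<gamma>))) \<partial>lborel) <= ennreal ((d powr \<gamma>)\<^sup>2 / (1 - \<gamma>))"
 proof -
  have "(\<integral>\<^sup>+s. ennreal (indicator {d\<^sup>2..u} s * (d\<^sup>2 * s powr (-2 + \<gamma>))) \<partial>lborel) =
    ennreal (- (d\<^sup>2 * u powr (-1 + \<gamma>) / (1 - \<gamma>)) - - (d\<^sup>2 * (d\<^sup>2) powr (-1 + \<gamma>) / (1 - \<gamma>)))"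
  proof (rule nn_integral_FTC_interior[OF d2(2)])
   show "continuous_on {d\<^sup>2..u} (%s. - (d\<^sup>2 * s powr (-1 + \<gamma>) / (1 - \<gamma>)))"
    using d2 \<gamma> by (intro continuous_intros) auto
   fix s :: real assume "d\<^sup>2 < s"
   with d2(1) have s: "0 < s" by linarith
   have "((%s. s powr (-1 + \<gamma>)) has_real_derivative (-1 + \<gamma>) * s powr (-1 + \<gamma> - 1)) (at s)"
    by (rule has_real_derivative_powr[OF s])
   then have "((%s. - (d\<^sup>2 / (1 - \<gamma>)) * s powr (-1 + \<gamma>)) has_real_derivative - (d\<^sup>2 / (1 - \<gamma>)) * ((-1 + \<gamma>) * s powr (-1 + \<gamma> - 1))) (at s)"
    by (rule DERIV_cmult)
   moreover have "- (d\<^sup>2 / (1 - \<gamma>)) * ((-1 + \<gamma>) * s powr (-1 + \<gamma> - 1)) = d\<^sup>2 * s powr (-2 + \<gamma>)"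
    using \<gamma> by (simp add: field_simps)
   ultimately show "((%s. - (d\<^sup>2 * s powr (-1 + \<gamma>) / (1 - \<gamma>))) has_real_derivative d\<^sup>2 * s powr (-2 + \<gamma>)) (at s)"
    by simp
  qed auto
  also have "... <= ennreal (d\<^sup>2 * (d\<^sup>2) powr (-1 + \<gamma>) / (1 - \<gamma>))"
   using \<gamma> by (intro ennreal_leI) simp
  also have "d\<^sup>2 * (d\<^sup>2) powr (-1 + \<gamma>) = (d\<^sup>2) powr 1 * (d\<^sup>2) powr (-1 + \<gamma>)" using d2 by simp
  also have "... = (d powr \<gamma>)\<^sup>2" unfolding powr_add[symmetric] dp sq by simp
  finally show ?thesis .
 qed
 have "(\<integral>\<^sup>+s. ennreal (indicator {0..t} s * (min (s powr (-1/2 + \<gamma>/2)) (s powr (-1 + \<gamma>/2) * d))\<^sup>2) \<partial>lborel) <=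
   (\<integral>\<^sup>+s. ennreal (indicator {0..d\<^sup>2} s * s powr (-1 + \<gamma>)) + ennreal (indicator {d\<^sup>2..u} s * (d\<^sup>2 * s powr (-2 + \<gamma>))) \<partial>lborel)"
 proof (rule nn_integral_mono)
  fix s :: real
  let ?m = "min (s powr (-1/2 + \<gamma>/2)) (s powr (-1 + \<gamma>/2) * d)"
  have m0: "0 <= ?m" using d by simp
  have "?m\<^sup>2 <= (s powr (-1/2 + \<gamma>/2))\<^sup>2" using m0 by (intro power_mono) auto
  then have 1: "?m\<^sup>2 <= s powr (-1 + \<gamma>)" by (simp add: sq)
  have "?m\<^sup>2 <= (s powr (-1 + \<gamma>/2) * d)\<^sup>2" using m0 by (intro power_mono) auto
  then have 2: "?m\<^sup>2 <= d\<^sup>2 * s powr (-2 + \<gamma>)" by (simp add: sq power_mult_distrib mult.commute)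
  have "indicator {0..t} s * ?m\<^sup>2 <= indicator {0..d\<^sup>2} s * s powr (-1 + \<gamma>) + indicator {d\<^sup>2..u} s * (d\<^sup>2 * s powr (-2 + \<gamma>))"
  proof (cases "s \<in> {0..t}")
   case True
   then have ind: "indicator {0..t} s = (1::real)" by simp
   show ?thesis
   proof (cases "s <= d\<^sup>2")
    case True
    with \<open>s \<in> {0..t}\<close> have ind1: "indicator {0..d\<^sup>2} s = (1::real)" by simp
    have "0 <= indicator {d\<^sup>2..u} s * (d\<^sup>2 * s powr (-2 + \<gamma>))" by simp
    then show ?thesis using 1 unfolding ind ind1 by linarith
   next
    case False
    with \<open>s \<in> {0..t}\<close> have ind2: "indicator {d\<^sup>2..u} s = (1::real)" by (simp add: u_def max_def)
    have "0 <= indicator {0..d\<^sup>2} s * s powr (-1 + \<gamma>)" by simp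
    then show ?thesis using 2 unfolding ind ind2 by linarith
   qed
  next
   case False
   then have "indicator {0..t} s = (0::real)" by simp
   then show ?thesis by (simp add: add_nonneg_nonneg)
  qed
  then show "ennreal (indicator {0..t} s * ?m\<^sup>2) <= ennreal (indicator {0..d\<^sup>2} s * s powr (-1 + \<gamma>)) + ennreal (indicator {d\<^sup>2..u} s * (d\<^sup>2 * s powr (-2 + \<gamma>)))"
   by (simp add: ennreal_plus[symmetric] ennreal_leI del: ennreal_plus)
 qed
 also have "... = (\<integral>\<^sup>+s. ennreal (indicator {0..d\<^sup>2} s * s powr (-1 + \<gamma>)) \<partial>lborel) + (\<integral>\<^sup>+s. ennreal (indicator {d\<^sup>2..u} s * (d\<^sup>2 * s powr (-2 + \<gamma>))) \<partial>lborel)"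
  by (rule nn_integral_add) auto
 also have "... <= ennreal ((d powr \<gamma>)\<^sup>2 / \<gamma>) + ennreal ((d powr \<gamma>)\<^sup>2 / (1 - \<gamma>))"
  unfolding i1 by (rule add_left_mono[OF i2])
 also have "... = ennreal ((1 / \<gamma> + 1 / (1 - \<gamma>)) * (d powr \<gamma>)\<^sup>2)"
  using \<gamma> by (simp add: ennreal_plus[symmetric] distrib_right del: ennreal_plus)
 finally show ?thesis .
qed

text \<open>The exponent here may be smaller than that of the data: stochastic convolutions are
  estimated with exponents below 1, also when \<alpha> >= 1.\<close>

definition hoelder_noise_data :: "real => (real => real => real) => bool" where
 "hoelder_noise_data \<gamma> f \<longleftrightarrow>
  (%(t, x). f t x) \<in> borel_measurable (restrict_space borel {0..} \<Otimes>\<^sub>M borel) \<and>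
  (\<forall>T\<ge>0. \<exists>K\<ge>0. AE r in lborel. 0 <= r --> r <= T --> hoelder_function (f r) K K \<gamma>)"

text \<open>Extends data from t >= 0 to the whole line, where integrals with respect to
  \<open>lborel\<close> and Fubini can be used.\<close>

lemma measurable_extend_time:
 assumes "(%(t, y). f t y) \<in> borel_measurable (restrict_space borel {0..} \<Otimes>\<^sub>M N)"
 shows "(%(t::real, y). f (max 0 t) y) \<in> borel_measurable (borel \<Otimes>\<^sub>M N)"
proof -
 have "(%t::real. max 0 t) \<in> measurable borel (restrict_space borel {0..})"
  by (rule measurable_restrict_space2) auto
 then have "(%p. (max (0::real) (fst p), snd p)) \<in> measurable (borel \<Otimes>\<^sub>M N) (restrict_space borel {0..} \<Otimes>\<^sub>M N)"
  by (intro measurable_Pair measurable_compose[OF measurable_fst] measurable_snd)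
 from measurable_compose[OF this assms] show ?thesis by (simp add: case_prod_beta')
qed

text \<open>Bounds are expressed in the elapsed time s = t - r, reached by reflection; the single
  time r = t, where the kernel degenerates, is discarded.\<close>

lemma l2norm_time_bound:
 assumes t: "0 <= t" and \<phi>: "\<phi> \<in> borel_measurable (time_measure t)" and m: "m \<in> borel_measurable borel"
  and le: "AE r in lborel. 0 <= r --> r < t --> \<bar>\<phi> r\<bar> <= m (t - r)"
  and c: "0 <= c" "(\<integral>\<^sup>+s. ennreal (indicator {0..t} s * (m s)\<^sup>2) \<partial>lborel) <= ennreal (c\<^sup>2)"
 shows "l2norm (time_measure t) \<phi> <= ennreal c"
proof (subst l2norm_le_iff[OF c(1)], intro conjI \<phi>)
 have "(\<integral>\<^sup>+r. ennreal ((\<phi> r)\<^sup>2) \<partial>time_measure t) = (\<integral>\<^sup>+r. ennreal ((\<phi> r)\<^sup>2) * indicator {0..t} r \<partial>lborel)"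
  by (subst nn_integral_restrict_space) auto
 also have "... <= (\<integral>\<^sup>+r. ennreal (indicator {0..t} (t - r) * (m (t - r))\<^sup>2) \<partial>lborel)"
 proof (rule nn_integral_mono_AE)
  show "AE r in lborel. ennreal ((\<phi> r)\<^sup>2) * indicator {0..t} r <= ennreal (indicator {0..t} (t - r) * (m (t - r))\<^sup>2)"
   using le AE_lborel_singleton[of t]
  proof eventually_elim
   case (elim r)
   show ?case
   proof (cases "r \<in> {0..t}")
    case True
    with elim have "\<bar>\<phi> r\<bar> <= \<bar>m (t - r)\<bar>" by auto
    then have "(\<phi> r)\<^sup>2 <= (m (t - r))\<^sup>2" by (simp only: abs_le_square_iff)
    then show ?thesis using True by (simp add: indicator_reflect ennreal_leI)
   qed simp
  qed
 qed
 also have "... = (\<integral>\<^sup>+s. ennreal (indicator {0..t} s * (m s)\<^sup>2) \<partial>lborel)"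
  using m by (intro nn_integral_reflect) auto
 also have "... <= ennreal (c\<^sup>2)" by (rule c(2))
 finally show "(\<integral>\<^sup>+r. ennreal ((\<phi> r)\<^sup>2) \<partial>time_measure t) <= ennreal (c\<^sup>2)" .
qed

lemma nn_integral_const_time: "0 <= t ==> 0 <= a ==> (\<integral>\<^sup>+s. ennreal (indicator {0..t} s * a) \<partial>lborel) = ennreal (a * t)"
proof -
 assume "0 <= t" "0 <= a"
 have "(\<integral>\<^sup>+s. ennreal (indicator {0..t} s * a) \<partial>lborel) = (\<integral>\<^sup>+s. ennreal a * indicator {0..t} s \<partial>lborel)"
  by (intro nn_integral_cong) (auto simp: indicator_def)
 also have "... = ennreal (a * t)" using \<open>0 <= t\<close> \<open>0 <= a\<close> by (simp add: nn_integral_cmult ennreal_mult)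
 finally show ?thesis .
qed

lemma nn_integral_scale_time:
 fixes k :: "real => real"
 assumes [measurable]: "k \<in> borel_measurable borel" and "0 <= a" "!!s. 0 <= k s"
 shows "(\<integral>\<^sup>+s. ennreal (indicator {0..t} s * (a * k s)) \<partial>lborel) = ennreal a * (\<integral>\<^sup>+s. ennreal (indicator {0..t} s * k s) \<partial>lborel)"
proof -
 have "(\<integral>\<^sup>+s. ennreal (indicator {0..t} s * (a * k s)) \<partial>lborel) = (\<integral>\<^sup>+s. ennreal a * ennreal (indicator {0..t} s * k s) \<partial>lborel)"
  using assms(2,3) by (intro nn_integral_cong) (simp add: ennreal_mult[symmetric] ac_simps)
 then show ?thesis by (simp add: nn_integral_cmult)
qed

lemma nn_integral_time_step:
 fixes a b \<delta> t :: real
 assumes "0 <= t" "0 <= \<delta>" "0 <= a" "0 <= b"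
 shows "(\<integral>\<^sup>+s. ennreal (indicator {0..t} s * (if s <= \<delta> then a else b)) \<partial>lborel) <= ennreal (a * \<delta> + b * t)"
proof -
 have "(\<integral>\<^sup>+s. ennreal (indicator {0..t} s * (if s <= \<delta> then a else b)) \<partial>lborel) <=
   (\<integral>\<^sup>+s. ennreal (indicator {0..\<delta>} s * a) + ennreal (indicator {0..t} s * b) \<partial>lborel)"
  using assms by (intro nn_integral_mono) (auto simp: indicator_def ennreal_plus[symmetric] simp del: ennreal_plus)
 also have "... = ennreal (a * \<delta>) + ennreal (b * t)"
  using assms by (simp add: nn_integral_add nn_integral_const_time)
 finally show ?thesis using assms by simp
qed

text \<open>
  Stochastic convolutions and the drift satisfy the same estimates up to the way in which a bound
  on the integrand turns into a bound on the integral: an \<open>L\<^sup>2\<close>-norm in time for the noise and,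
  after testing against \<open>Y \<in> L\<^sup>2(\<Omega>)\<close>, an \<open>L\<^sup>1\<close>-norm in time for the drift. \<open>cost t m c\<close>
  stands for the norm of \<open>m\<close> being at most \<open>c\<close>, and \<open>Q\<close> is the set of tests, with weights \<open>w\<close>.
\<close>

locale heat_field =
 fixes M :: "'a measure" and Q :: "'y set" and w :: "'y => real" and f :: "'y => real => real => real"
  and R :: "real => ('y => real => real) => ('a => real) => bool"
  and cost :: "real => (real => real) => real => bool" and \<beta> \<gamma> \<rho> :: real
  and X X' :: "real => real => 'a => real"
 assumes linear: "0 <= t ==> R t \<phi> I ==> R t \<psi> J ==> R t (%y r. a * \<phi> y r + b * \<psi> y r) (%w. a * I w + b * J w)"
  and restrict: "0 <= s ==> s <= t ==> R s \<phi> I ==> R t (%y r. \<phi> y r * indicator {..s} r) I"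
  and X_0: "X 0 x = (%_. 0)"
  and X: "0 < t ==> R t (%y r. heat_semigroup (t - r) (f y r) x) (X t x)"
  and X': "0 < t ==> R t (%y r. heat_deriv (t - r) (f y r) x) (X' t x)"
  and w_nonneg: "y \<in> Q ==> 0 <= w y"
  and data: "0 < T ==> \<exists>K\<ge>0. \<forall>y\<in>Q. AE r in lborel. 0 <= r --> r <= T --> hoelder_function (f y r) (K * w y) (K * w y) \<beta>"
  and bound: "0 < t ==> R t \<phi> I ==> 0 <= k ==> m \<in> borel_measurable borel ==>
   (!!y. y \<in> Q ==> AE r in lborel. 0 <= r --> r < t --> \<bar>\<phi> y r\<bar> <= k * w y * m (t - r)) ==>
   0 <= c ==> cost t m c ==> l2norm M I <= ennreal (k * c)"
  and costs: "0 < T ==> \<exists>c\<ge>0. \<forall>t. 0 < t --> t <= T --> cost t (%_. 1) c \<and> cost t (%s. s powr (-1/2 + \<beta>/2)) c \<and>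
   (\<forall>d>0. cost t (%s. min (s powr (-1/2 + \<beta>/2)) (s powr (-1 + \<beta>/2) * d)) (c * d powr \<gamma>)) \<and>
   (\<forall>\<delta>. 0 <= \<delta> --> \<delta> <= 1 --> cost t (%s. if s <= \<delta> then 1 else \<delta> powr (\<beta>/2)) (c * \<delta> powr \<rho>))"
begin

text \<open>The four profiles in \<open>costs\<close> correspond to the four heat estimates: size,
  derivative, modulus of the derivative, and increments in time. The factor 12 in C is the largest
  constant among these estimates.\<close>

theorem regular: "regular_field M \<gamma> \<rho> X X'"
 unfolding regular_field_def
proof (intro conjI allI impI)
 show "X 0 x = (%_. 0)" for x by (rule X_0)
 fix T :: real assume T: "0 < T"
 obtain K where K: "0 <= K" "!!y. y \<in> Q ==> AE r in lborel. 0 <= r --> r <= T --> hoelder_function (f y r) (K * w y) (K * w y) \<beta>"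
  using data[OF T] by blast
 obtain c where c: "0 <= c" and cT: "!!t. 0 < t ==> t <= T ==> cost t (%_. 1) c \<and> cost t (%s. s powr (-1/2 + \<beta>/2)) c \<and>
   (\<forall>d>0. cost t (%s. min (s powr (-1/2 + \<beta>/2)) (s powr (-1 + \<beta>/2) * d)) (c * d powr \<gamma>)) \<and>
   (\<forall>\<delta>. 0 <= \<delta> --> \<delta> <= 1 --> cost t (%s. if s <= \<delta> then 1 else \<delta> powr (\<beta>/2)) (c * \<delta> powr \<rho>))"
  using costs[OF T] by blast
 define C where "C = 12 * K * c"
 have C: "0 <= C" using K c by (simp add: C_def)
 show "\<exists>C\<ge>0. \<forall>t. 0 < t --> t <= T --> regular_bounds M \<gamma> \<rho> X X' C t"
  unfolding regular_bounds_def
 proof (intro exI[of _ C] conjI C allI impI)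
  fix t assume t: "0 < t" "t <= T"
  then have t0: "0 <= t" by simp
  note X = X[OF t(1)] and X' = X'[OF t(1)]
  have c1: "cost t (%_. 1) c" and c2: "cost t (%s. s powr (-1/2 + \<beta>/2)) c"
   and c3: "0 < d ==> cost t (%s. min (s powr (-1/2 + \<beta>/2)) (s powr (-1 + \<beta>/2) * d)) (c * d powr \<gamma>)"
   and c4: "0 <= \<delta> ==> \<delta> <= 1 ==> cost t (%s. if s <= \<delta> then 1 else \<delta> powr (\<beta>/2)) (c * \<delta> powr \<rho>)" for d \<delta>
   using cT[OF t] by blast+
  \<comment> \<open>The factor k is the constant of the pointwise heat estimate. One exceptional
    time s may be left out, which matters for increments in time.\<close>
  have main: "l2norm M I <= ennreal (C * p)"
   if R: "R t \<phi> I" and k: "0 <= k" "k <= 12" and m: "m \<in> borel_measurable borel" and p: "0 <= p" "cost t m (c * p)"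
    and le: "!!y r. y \<in> Q ==> 0 <= r ==> r < t ==> r \<noteq> s ==> hoelder_function (f y r) (K * w y) (K * w y) \<beta> ==> \<bar>\<phi> y r\<bar> <= k * (K * w y) * m (t - r)"
   for \<phi> I k m p s
  proof -
   have "l2norm M I <= ennreal (k * K * (c * p))"
   proof (rule bound[OF t(1) R _ m _ _ p(2)])
    show "AE r in lborel. 0 <= r --> r < t --> \<bar>\<phi> y r\<bar> <= k * K * w y * m (t - r)" if y: "y \<in> Q" for y
     using K(2)[OF y] AE_lborel_singleton[of s]
    proof eventually_elim
     case (elim r)
     then show ?case using le[OF y, of r] t by (simp add: mult.assoc)
    qed
   qed (use k K c p in auto)
   also have "... <= ennreal (C * p)"
    unfolding C_def using k K c p by (intro ennreal_leI) (simp add: mult.assoc mult_right_mono)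
   finally show ?thesis .
  qed
  fix x
  show "l2norm M (X t x) <= ennreal C"
  proof (rule main[OF X, of 1 "%_. 1" 1 t, simplified])
   fix y r assume "r < t" "hoelder_function (f y r) (K * w y) (K * w y) \<beta>"
   then show "\<bar>heat_semigroup (t - r) (f y r) x\<bar> <= K * w y"
    by (intro hoelder_function.heat_semigroup_bound) auto
  qed (use c1 in auto)
  show "l2norm M (X' t x) <= ennreal C"
  proof (rule main[OF X', of 6 "%s. s powr (-1/2 + \<beta>/2)" 1 t, simplified mult_1_right])
   fix y r assume r: "r < t" and "hoelder_function (f y r) (K * w y) (K * w y) \<beta>"
   then interpret hoelder_function "f y r" "K * w y" "K * w y" \<beta> by simp
   show "\<bar>heat_deriv (t - r) (f y r) x\<bar> <= 6 * (K * w y) * (t - r) powr (-1/2 + \<beta>/2)"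
    using heat_deriv_bound[of "t - r"] r by simp
  qed (use c2 in auto)
  show "l2norm M (%w. X' t x w - X' t y w) <= ennreal (C * \<bar>x - y\<bar> powr \<gamma>)" for y
  proof (cases "x = y")
   case False
   then have d: "0 < \<bar>x - y\<bar>" by simp
   have "l2norm M (%w. 1 * X' t x w + (-1) * X' t y w) <= ennreal (C * \<bar>x - y\<bar> powr \<gamma>)"
   proof (rule main[OF linear[OF t0 X' X'], of 12 _ _ t, OF _ _ _ _ c3[OF d]])
    fix z r assume r: "r < t" and "hoelder_function (f z r) (K * w z) (K * w z) \<beta>"
    then interpret hoelder_function "f z r" "K * w z" "K * w z" \<beta> by simp
    show "\<bar>1 * heat_deriv (t - r) (f z r) x + (-1) * heat_deriv (t - r) (f z r) y\<bar> <=
      12 * (K * w z) * min ((t - r) powr (-1/2 + \<beta>/2)) ((t - r) powr (-1 + \<beta>/2) * \<bar>x - y\<bar>)"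
     using heat_deriv_continuity[of "t - r" x y] r by (simp add: deriv_modulus_def)
   qed auto
   then show ?thesis by simp
  qed simp
  show "l2norm M (%w. (X t (x + e) w - X t x w) / e - X' t x w) <= ennreal (C * \<bar>e\<bar> powr \<gamma>)"
   if e: "e \<noteq> 0" "\<bar>e\<bar> <= 1" for e
  proof -
   have d: "0 < \<bar>e\<bar>" using e by simp
   have "l2norm M (%w. (1/e) * (1 * X t (x + e) w + (-1) * X t x w) + (-1) * X' t x w) <= ennreal (C * \<bar>e\<bar> powr \<gamma>)"
   proof (rule main[OF linear[OF t0 linear[OF t0 X X] X'], of 12 _ _ t, OF _ _ _ _ c3[OF d]])
    fix z r assume r: "r < t" and "hoelder_function (f z r) (K * w z) (K * w z) \<beta>"
    then interpret hoelder_function "f z r" "K * w z" "K * w z" \<beta> by simp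
    have "(1/e) * (1 * heat_semigroup (t - r) (f z r) (x + e) + (-1) * heat_semigroup (t - r) (f z r) x) + (-1) * heat_deriv (t - r) (f z r) x =
      (heat_semigroup (t - r) (f z r) (x + e) - heat_semigroup (t - r) (f z r) x - e * heat_deriv (t - r) (f z r) x) / e"
     using e by (simp add: field_simps)
    also have "\<bar>...\<bar> <= (\<bar>e\<bar> * deriv_modulus (t - r) \<bar>e\<bar>) / \<bar>e\<bar>"
     unfolding abs_divide using heat_semigroup_taylor[of "t - r" x e] r by (intro divide_right_mono) auto
    also have "... = deriv_modulus (t - r) \<bar>e\<bar>" using e by simp
    finally show "\<bar>(1/e) * (1 * heat_semigroup (t - r) (f z r) (x + e) + (-1) * heat_semigroup (t - r) (f z r) x) + (-1) * heat_deriv (t - r) (f z r) x\<bar> <=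
      12 * (K * w z) * min ((t - r) powr (-1/2 + \<beta>/2)) ((t - r) powr (-1 + \<beta>/2) * \<bar>e\<bar>)"
     unfolding deriv_modulus_def .
   qed auto
   then show ?thesis by simp
  qed
  show "l2norm M (%w. X t x w - X s x w) <= ennreal (C * (t - s) powr \<rho>)"
   if s: "0 <= s" "s <= t" "t - s <= 1" for s
  proof -
   define \<delta> where "\<delta> = t - s"
   have \<delta>: "0 <= \<delta>" "\<delta> <= 1" using s by (auto simp: \<delta>_def)
   \<comment> \<open>At s = 0 the field vanishes and is represented by the integrand 0, since the
     semigroup representation is available at positive times.\<close>
   have Xs: "R t (%y r. if s = 0 then 0 else heat_semigroup (s - r) (f y r) x * indicator {..s} r) (X s x)"
   proof (cases "s = 0")
    case True
    then show ?thesis using linear[OF t0 X X, of 0 x 0 x] by (simp add: X_0)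
   next
    case False
    with s have "0 < s" by simp
    from restrict[OF s(1,2) heat_field.X[OF heat_field_axioms this]] False show ?thesis by simp
   qed
   \<comment> \<open>The condition t - r <= \<delta> means r >= s. Before s two semigroups are
     compared in time, with constant 2; after s only one is left, bounded by its data and hence by
     twice as much.\<close>
   have "l2norm M (%w. 1 * X t x w + (-1) * X s x w) <= ennreal (C * \<delta> powr \<rho>)"
   proof (rule main[OF linear[OF t0 X Xs], of 2 _ _ s, OF _ _ _ _ c4[OF \<delta>]])
    fix z r assume zr: "z \<in> Q" "0 <= r" "r < t" "r \<noteq> s" and "hoelder_function (f z r) (K * w z) (K * w z) \<beta>"
    then interpret hoelder_function "f z r" "K * w z" "K * w z" \<beta> by simp
    have Kw: "0 <= K * w z" using K w_nonneg[OF zr(1)] by simp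
    show "\<bar>1 * heat_semigroup (t - r) (f z r) x + (-1) * (if s = 0 then 0 else heat_semigroup (s - r) (f z r) x * indicator {..s} r)\<bar> <=
      2 * (K * w z) * (if t - r <= \<delta> then 1 else \<delta> powr (\<beta>/2))"
    proof (cases "r < s")
     case True
     then show ?thesis using heat_semigroup_time[of "t - r" "s - r" x] zr s by (simp add: \<delta>_def)
    next
     case False
     then show ?thesis using heat_semigroup_bound[of "t - r" x] zr Kw by (simp add: \<delta>_def)
    qed
   qed auto
   then show ?thesis by (simp add: \<delta>_def)
  qed
 qed
qed

end

section \<open>Stochastic convolutions\<close>

context l2_noise
begin

lemma noise_bound:
 assumes t: "0 <= t" and R: "R t \<phi> I" and m: "m \<in> borel_measurable borel"
  and le: "AE r in lborel. 0 <= r --> r < t --> \<bar>\<phi> r\<bar> <= m (t - r)"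
  and c: "0 <= c" "(\<integral>\<^sup>+s. ennreal (indicator {0..t} s * (m s)\<^sup>2) \<partial>lborel) <= ennreal (c\<^sup>2)"
 shows "l2norm M I <= ennreal (\<kappa> * c)"
proof -
 have "l2norm M I = ennreal \<kappa> * l2norm (time_measure t) \<phi>" by (rule R_norm[OF t R])
 also have "... <= ennreal \<kappa> * ennreal c"
  by (intro mult_left_mono l2norm_time_bound[OF t l2norm_finiteD(1)[OF R_l2[OF R]] m le c]) simp
 finally show ?thesis using \<kappa>_nonneg c(1) by (simp add: ennreal_mult)
qed

text \<open>Integrals are determined up to null sets, so a version is chosen at each point;
  measurability in the parameters is repaired later by a modification. The value 0 at t = 0 is the
  one \<open>regular_field\<close> demands.\<close>

definition Z :: "(real => real => real) => real => real => 'a => real" where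
 "Z f t x = (if 0 < t then SOME I. R t (%r. heat_semigroup (t - r) (f r) x) I else (%_. 0))"

definition Z' :: "(real => real => real) => real => real => 'a => real" where
 "Z' f t x = (SOME I. R t (%r. heat_deriv (t - r) (f r) x) I)"

end

lemma heat_integrands_measurable:
 assumes "hoelder_noise_data \<gamma> f"
 shows "(%r. heat_semigroup (t - r) (f r) x) \<in> borel_measurable (time_measure t)"
  "(%r. heat_deriv (t - r) (f r) x) \<in> borel_measurable (time_measure t)"
proof -
 have [measurable]: "(%(r, z). f (max 0 r) z) \<in> borel_measurable (borel \<Otimes>\<^sub>M borel)"
  using assms by (intro measurable_extend_time) (simp add: hoelder_noise_data_def)
 have 1: "(%r. \<integral>z. heat_kernel (t - r) (x - z) * f (max 0 r) z \<partial>lborel) \<in> borel_measurable (time_measure t)"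
  by (intro measurable_time_measure) measurable
 have 2: "(%r. \<integral>z. heat_kernel_deriv (t - r) (x - z) * f (max 0 r) z \<partial>lborel) \<in> borel_measurable (time_measure t)"
  by (intro measurable_time_measure) measurable
 show "(%r. heat_semigroup (t - r) (f r) x) \<in> borel_measurable (time_measure t)"
  by (rule measurable_cong[THEN iffD1, OF _ 1]) (auto simp: heat_semigroup_def space_restrict_space)
 show "(%r. heat_deriv (t - r) (f r) x) \<in> borel_measurable (time_measure t)"
  by (rule measurable_cong[THEN iffD1, OF _ 2]) (auto simp: heat_deriv_def space_restrict_space)
qed

lemma hoelder_noise_dataD:
 assumes "hoelder_noise_data \<gamma> f" "0 < T"
 obtains K where "0 <= K" "AE r in lborel. 0 <= r --> r <= T --> hoelder_function (f r) K K \<gamma>"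
 using assms unfolding hoelder_noise_data_def by (meson less_imp_le)

text \<open>Generous constants: T + 1 and (T + 1)/\<gamma> are at least 1 and may replace their
  square roots. The bounds serve to make the integrands square integrable.\<close>

lemma heat_integrands_l2:
 assumes f: "hoelder_noise_data \<gamma> f" and t: "0 < t" "t <= T"
  and K: "0 <= K" "AE r in lborel. 0 <= r --> r <= T --> hoelder_function (f r) K K \<gamma>" and \<gamma>: "0 < \<gamma>" "\<gamma> < 1"
 shows "l2norm (time_measure t) (%r. heat_semigroup (t - r) (f r) x) <= ennreal (K * (T + 1))"
  "l2norm (time_measure t) (%r. heat_deriv (t - r) (f r) x) <= ennreal (6 * K * ((T + 1) / \<gamma>))"
proof -
 have T: "0 < T" using t by simp
 show "l2norm (time_measure t) (%r. heat_semigroup (t - r) (f r) x) <= ennreal (K * (T + 1))"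
 proof (rule l2norm_time_bound[where m = "%_. K"])
  show "AE r in lborel. 0 <= r --> r < t --> \<bar>heat_semigroup (t - r) (f r) x\<bar> <= K"
   using K(2)
  proof eventually_elim
   case (elim r)
   then show ?case using t by (auto intro!: hoelder_function.heat_semigroup_bound)
  qed
  have "t <= (T + 1)\<^sup>2" using t mult_mono[of 1 "T + 1" t "T + 1"] by (simp add: power2_eq_square)
  then have "K\<^sup>2 * t <= (K * (T + 1))\<^sup>2" by (simp add: power_mult_distrib mult_left_mono)
  then show "(\<integral>\<^sup>+s. ennreal (indicator {0..t} s * K\<^sup>2) \<partial>lborel) <= ennreal ((K * (T + 1))\<^sup>2)"
   using t by (subst nn_integral_const_time) (auto intro!: ennreal_leI)
 qed (use t K T heat_integrands_measurable[OF f] in auto)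
 show "l2norm (time_measure t) (%r. heat_deriv (t - r) (f r) x) <= ennreal (6 * K * ((T + 1) / \<gamma>))"
 proof (rule l2norm_time_bound[where m = "%s. 6 * K * s powr (-1/2 + \<gamma>/2)"])
  show "AE r in lborel. 0 <= r --> r < t --> \<bar>heat_deriv (t - r) (f r) x\<bar> <= 6 * K * (t - r) powr (-1/2 + \<gamma>/2)"
   using K(2)
  proof eventually_elim
   case (elim r)
   then show ?case using t hoelder_function.heat_deriv_bound[of "f r" K K \<gamma> "t - r" x] by auto
  qed
  have sq: "(6 * K * s powr (-1/2 + \<gamma>/2))\<^sup>2 = (6 * K)\<^sup>2 * s powr (-1 + \<gamma>)" for s :: real
   by (simp add: power_mult_distrib power2_eq_square powr_add[symmetric])
  have "(\<integral>\<^sup>+s. ennreal (indicator {0..t} s * (6 * K * s powr (-1/2 + \<gamma>/2))\<^sup>2) \<partial>lborel) = ennreal ((6 * K)\<^sup>2) * ennreal (t powr \<gamma> / \<gamma>)"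
   unfolding sq using nn_integral_powr[of "-1 + \<gamma>" t] t \<gamma> by (subst nn_integral_scale_time) auto
  also have "... = ennreal ((6 * K)\<^sup>2 * (t powr \<gamma> / \<gamma>))" using \<gamma> by (intro ennreal_mult[symmetric]) auto
  also have "... <= ennreal ((6 * K * ((T + 1) / \<gamma>))\<^sup>2)"
  proof (rule ennreal_leI)
   have "t powr \<gamma> / \<gamma> <= (T + 1) / \<gamma>" using powr_le_Suc[of t T \<gamma>] t \<gamma> by (intro divide_right_mono) auto
   also have "... <= ((T + 1) / \<gamma>)\<^sup>2"
    using T \<gamma> by (intro self_le_power) (auto simp: field_simps)
   finally show "(6 * K)\<^sup>2 * (t powr \<gamma> / \<gamma>) <= (6 * K * ((T + 1) / \<gamma>))\<^sup>2"
    unfolding power_mult_distrib[of "6 * K" "(T + 1) / \<gamma>"] by (intro mult_left_mono) auto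
  qed
  finally show "(\<integral>\<^sup>+s. ennreal (indicator {0..t} s * (6 * K * s powr (-1/2 + \<gamma>/2))\<^sup>2) \<partial>lborel) <= ennreal ((6 * K * ((T + 1) / \<gamma>))\<^sup>2)" .
 qed (use t K T \<gamma> heat_integrands_measurable[OF f] in auto)
qed

context l2_noise
begin

lemma Z_integral:
 assumes f: "hoelder_noise_data \<gamma> f" and \<gamma>: "0 < \<gamma>" "\<gamma> < 1" and t: "0 < t"
 shows "R t (%r. heat_semigroup (t - r) (f r) x) (Z f t x)" "R t (%r. heat_deriv (t - r) (f r) x) (Z' f t x)"
proof -
 obtain K where K: "0 <= K" "AE r in lborel. 0 <= r --> r <= t --> hoelder_function (f r) K K \<gamma>"
  using hoelder_noise_dataD[OF f t] by blast
 note l2 = heat_integrands_l2[OF f t order_refl K \<gamma>, of x]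
 have "\<exists>I. R t (%r. heat_semigroup (t - r) (f r) x) I"
  using t le_less_trans[OF l2(1)] by (intro R_exists) auto
 then show "R t (%r. heat_semigroup (t - r) (f r) x) (Z f t x)" unfolding Z_def using t by (simp add: someI_ex)
 have "\<exists>I. R t (%r. heat_deriv (t - r) (f r) x) I"
  using t le_less_trans[OF l2(2)] by (intro R_exists) auto
 then show "R t (%r. heat_deriv (t - r) (f r) x) (Z' f t x)" unfolding Z'_def by (rule someI_ex)
qed

lemma Z_adapted:
 assumes "hoelder_noise_data \<gamma> f" "0 < \<gamma>" "\<gamma> < 1" "0 <= t"
 shows "Z f t x \<in> borel_measurable (F t)"
proof (cases "t = 0")
 case False
 then show ?thesis using R_adapted[OF assms(4) Z_integral(1)[OF assms(1-3)]] assms(4) by simp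
qed (simp add: Z_def)

text \<open>The isometry makes the cost \<kappa> times an L2 norm in time, with a single test of
  weight 1. The restriction \<gamma> < 1 stems from \<open>nn_integral_modulus_square\<close>;
  \<rho> <= \<gamma>/2 because a time step \<delta> costs at most sqrt (\<delta> + \<delta>^\<gamma>
  t).\<close>

theorem noise_field_regular:
 assumes f: "hoelder_noise_data \<gamma> f" and \<gamma>: "0 < \<gamma>" "\<gamma> < 1" and \<rho>: "0 < \<rho>" "\<rho> <= \<gamma>/2"
 shows "regular_field M \<gamma> \<rho> (Z f) (Z' f)"
proof -
 define cost where "cost t m c \<longleftrightarrow> (\<exists>b\<ge>0. c = \<kappa> * b \<and>
  (\<integral>\<^sup>+s. ennreal (indicator {0..t} s * (m s)\<^sup>2) \<partial>lborel) <= ennreal (b\<^sup>2))" for t :: real and m c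
 have cost_mono: "cost t m (\<kappa> * b * p)" if "(\<integral>\<^sup>+s. ennreal (indicator {0..t} s * (m s)\<^sup>2) \<partial>lborel) <= ennreal (b'\<^sup>2 * p\<^sup>2)"
  "0 <= b'" "b' <= b" "0 <= p" for t m b b' p
 proof -
  have "b'\<^sup>2 * p\<^sup>2 <= (b * p)\<^sup>2" unfolding power_mult_distrib using that by (intro mult_right_mono power_mono) auto
  then show ?thesis unfolding cost_def mult.assoc using that
   by (intro exI[of _ "b * p"]) (auto intro: order_trans ennreal_leI)
 qed
 interpret heat_field M "{()}" "%_. 1" "%_. f" "%t \<phi>. R t (\<phi> ())" cost \<gamma> \<gamma> \<rho> "Z f" "Z' f"
 proof
  show "R t (%r. a * \<phi> () r + b * \<psi> () r) (%w. a * I w + b * J w)"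
   if "0 <= t" "R t (\<phi> ()) I" "R t (\<psi> ()) J" for t \<phi> \<psi> I J a b by (rule R_linear[OF that])
  show "R t (%r. \<phi> () r * indicator {..s} r) I" if "0 <= s" "s <= t" "R s (\<phi> ()) I" for s t \<phi> I by (rule R_restrict[OF that])
  show "Z f 0 x = (%_. 0)" for x by (simp add: Z_def)
  show "\<exists>K\<ge>0. \<forall>y\<in>{()}. AE r in lborel. 0 <= r --> r <= T --> hoelder_function (f r) (K * 1) (K * 1) \<gamma>" if "0 < T" for T
   using f that unfolding hoelder_noise_data_def by simp
  show "l2norm M I <= ennreal (k * c)"
   if "0 < t" and R: "R t (\<phi> ()) I" and k: "0 <= k" and m: "m \<in> borel_measurable borel"
    and le: "!!y. y \<in> {()} ==> AE r in lborel. 0 <= r --> r < t --> \<bar>\<phi> y r\<bar> <= k * 1 * m (t - r)"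
    and "0 <= c" and cost: "cost t m c" for t \<phi> I k m c
  proof -
   obtain b where b: "0 <= b" "c = \<kappa> * b" "(\<integral>\<^sup>+s. ennreal (indicator {0..t} s * (m s)\<^sup>2) \<partial>lborel) <= ennreal (b\<^sup>2)"
    using cost unfolding cost_def by blast
   have "l2norm M I <= ennreal (\<kappa> * (k * b))"
   proof (rule noise_bound[OF _ R])
    show "AE r in lborel. 0 <= r --> r < t --> \<bar>\<phi> () r\<bar> <= k * m (t - r)" using le by simp
    have "(\<integral>\<^sup>+s. ennreal (indicator {0..t} s * (k * m s)\<^sup>2) \<partial>lborel) = ennreal (k\<^sup>2) * (\<integral>\<^sup>+s. ennreal (indicator {0..t} s * (m s)\<^sup>2) \<partial>lborel)"
     unfolding power_mult_distrib using m by (intro nn_integral_scale_time) auto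
    also have "... <= ennreal (k\<^sup>2) * ennreal (b\<^sup>2)" by (rule mult_left_mono[OF b(3)]) simp
    finally show "(\<integral>\<^sup>+s. ennreal (indicator {0..t} s * (k * m s)\<^sup>2) \<partial>lborel) <= ennreal ((k * b)\<^sup>2)"
     by (simp add: power_mult_distrib ennreal_mult)
   qed (use that b in auto)
   then show ?thesis by (simp add: b(2) ac_simps)
  qed
  show "\<exists>c\<ge>0. \<forall>t. 0 < t --> t <= T --> cost t (%_. 1) c \<and> cost t (%s. s powr (-1/2 + \<gamma>/2)) c \<and>
   (\<forall>d>0. cost t (%s. min (s powr (-1/2 + \<gamma>/2)) (s powr (-1 + \<gamma>/2) * d)) (c * d powr \<gamma>)) \<and>
   (\<forall>\<delta>. 0 <= \<delta> --> \<delta> <= 1 --> cost t (%s. if s <= \<delta> then 1 else \<delta> powr (\<gamma>/2)) (c * \<delta> powr \<rho>))" if T: "0 < T" for T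
  proof -
   define b1 where "b1 = sqrt (T + 1)"
   define b2 where "b2 = sqrt ((T + 1) / \<gamma>)"
   define b3 where "b3 = sqrt (1 / \<gamma> + 1 / (1 - \<gamma>))"
   define b where "b = b1 + b2 + b3"
   have sqrts: "b1\<^sup>2 = T + 1" "b2\<^sup>2 = (T + 1) / \<gamma>" "b3\<^sup>2 = 1 / \<gamma> + 1 / (1 - \<gamma>)" "0 <= b1" "0 <= b2" "0 <= b3"
    using T \<gamma> by (auto simp: b1_def b2_def b3_def)
   then have bs: "b1 <= b" "b2 <= b" "b3 <= b" by (auto simp: b_def)
   have sq: "(s powr a)\<^sup>2 = s powr (2 * a)" for s a :: real by (simp add: power2_eq_square powr_add[symmetric])
   show ?thesis
   proof (intro exI[of _ "\<kappa> * b"] conjI allI impI)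
    show "0 <= \<kappa> * b" using \<kappa>_nonneg sqrts by (simp add: b_def)
    fix t assume t: "0 < t" "t <= T"
    show "cost t (%_. 1) (\<kappa> * b)"
     using t sqrts bs nn_integral_const_time[of t 1] by (intro cost_mono[where b' = b1 and p = 1, simplified]) (auto simp del: ennreal_plus intro!: ennreal_leI)
    show "cost t (%s. s powr (-1/2 + \<gamma>/2)) (\<kappa> * b)"
    proof (rule cost_mono[where b' = b2 and p = 1, simplified mult_1_right power_one])
     have "t powr \<gamma> / \<gamma> <= (T + 1) / \<gamma>" using powr_le_Suc[of t T \<gamma>] t \<gamma> by (intro divide_right_mono) auto
     then show "(\<integral>\<^sup>+s. ennreal (indicator {0..t} s * (s powr (-1/2 + \<gamma>/2))\<^sup>2) \<partial>lborel) <= ennreal (b2\<^sup>2)"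
      using nn_integral_powr[of "-1 + \<gamma>" t] t \<gamma> by (simp add: sq sqrts ennreal_leI)
    qed (use bs sqrts in auto)
    show "cost t (%s. min (s powr (-1/2 + \<gamma>/2)) (s powr (-1 + \<gamma>/2) * d)) (\<kappa> * b * d powr \<gamma>)" if d: "0 < d" for d
     by (rule cost_mono[where b' = b3]) (use nn_integral_modulus_square[OF _ d \<gamma>, of t] t bs sqrts in auto)
    fix \<delta> :: real assume \<delta>: "0 <= \<delta>" "\<delta> <= 1"
    show "cost t (%s. if s <= \<delta> then 1 else \<delta> powr (\<gamma>/2)) (\<kappa> * b * \<delta> powr \<rho>)"
    proof (rule cost_mono[where b' = b1])
     \<comment> \<open>As 2 \<rho> <= \<gamma> < 1 and \<delta> <= 1, both \<delta> and
       \<delta>^\<gamma> are at most \<delta>^(2\<rho>).\<close>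
     have p: "\<delta> powr a <= \<delta> powr (2 * \<rho>)" if "2 * \<rho> <= a" for a
      using \<delta> that by (cases "\<delta> = 0") (auto intro!: powr_mono')
     have 1: "\<delta> <= \<delta> powr (2 * \<rho>)" using p[of 1] \<rho> \<gamma> \<delta> by (cases "\<delta> = 0") auto
     have "\<delta> powr \<gamma> <= \<delta> powr (2 * \<rho>)" using \<rho> by (intro p) auto
     then have "\<delta> powr \<gamma> * t <= \<delta> powr (2 * \<rho>) * T" using t by (intro mult_mono) auto
     with 1 have le: "1 * \<delta> + \<delta> powr \<gamma> * t <= b1\<^sup>2 * (\<delta> powr \<rho>)\<^sup>2" by (simp add: sqrts sq algebra_simps)
     have m2: "(if s <= \<delta> then 1 else \<delta> powr (\<gamma>/2))\<^sup>2 = (if s <= \<delta> then 1 else \<delta> powr \<gamma>)" for s by (simp add: sq)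
     show "(\<integral>\<^sup>+s. ennreal (indicator {0..t} s * (if s <= \<delta> then 1 else \<delta> powr (\<gamma>/2))\<^sup>2) \<partial>lborel) <= ennreal (b1\<^sup>2 * (\<delta> powr \<rho>)\<^sup>2)"
      unfolding m2 using t \<delta> by (intro order_trans[OF nn_integral_time_step ennreal_leI[OF le]]) auto
    qed (use bs sqrts in auto)
   qed
  qed
 qed (use Z_integral[OF f \<gamma>] in auto)
 show ?thesis by (rule regular)
qed

end

section \<open>The drift\<close>

lemma AE_lborel_fst:
 assumes "AE r in lborel. P (r::real)"
 shows "AE p in lborel \<Otimes>\<^sub>M (lborel :: real measure). P (fst p)"
proof -
 obtain N where N: "{r \<in> space lborel. \<not> P r} \<subseteq> N" "N \<in> null_sets lborel"
  using assms by (auto elim!: AE_E simp: null_sets_def)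
 have "N \<times> UNIV \<in> null_sets (lborel \<Otimes>\<^sub>M (lborel :: real measure))"
  by (rule lborel.times_in_null_sets1[OF N(2)]) simp
 then show ?thesis by (rule AE_I'[where N = "N \<times> UNIV"]) (use N(1) in \<open>auto simp: space_pair_measure\<close>)
qed

text \<open>The condition a > -1 makes the spatial L1 norms integrable in time down to s = 0. The
  heat kernel has a = 0, its derivative a = -1/2.\<close>

definition time_kernel :: "(real => real => real) => bool" where
 "time_kernel k \<longleftrightarrow> (%(s, u). k s u) \<in> borel_measurable (borel \<Otimes>\<^sub>M borel) \<and>
  (\<exists>C\<ge>0. \<exists>a>-1. \<forall>s>0. integrable lborel (k s) \<and> (\<integral>u. \<bar>k s u\<bar> \<partial>lborel) <= C * s powr a)"

lemma heat_time_kernels: "time_kernel heat_kernel" "time_kernel heat_kernel_deriv"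
proof -
 show "time_kernel heat_kernel" unfolding time_kernel_def
  using heat_kernels_integrable(1) heat_kernel_moments(2) by (intro conjI exI[of _ 1] exI[of _ 0]) auto
 have "(\<integral>u. \<bar>heat_kernel_deriv s u\<bar> \<partial>lborel) <= 6 * s powr (-1/2)" if s: "0 < s" for s
 proof -
  have "(\<integral>u. \<bar>heat_kernel_deriv s u\<bar> \<partial>lborel) <= (\<integral>u. s powr (-1/2) * gauss_weight s u \<partial>lborel)"
   using heat_kernels_integrable(2)[OF s] gauss_weight(1)[OF s] heat_kernel_weighted(5)[OF s, of 1]
   by (intro integral_mono integrable_abs integrable_mult_right) auto
  then show ?thesis using gauss_weight(2)[OF s] by (simp add: mult.commute)
 qed
 then show "time_kernel heat_kernel_deriv" unfolding time_kernel_def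
  using heat_kernels_integrable(2) by (intro conjI exI[of _ 6] exI[of _ "-1/2"]) auto
qed

definition kernel_at :: "(real => real => real) => real => real => real \<times> real => real" where
 "kernel_at k t x p = indicator {0..t} (fst p) * k (t - fst p) (x - snd p)"

lemma integrable_kernel_at:
 assumes k: "time_kernel k"
 shows "integrable (lborel \<Otimes>\<^sub>M lborel) (kernel_at k t x)"
proof -
 have [measurable]: "(%(s, u). k s u) \<in> borel_measurable (borel \<Otimes>\<^sub>M borel)" using k by (simp add: time_kernel_def)
 obtain C a where C: "0 <= C" "-1 < a" and ki: "!!s. 0 < s ==> integrable lborel (k s)"
  and kb: "!!s. 0 < s ==> (\<integral>u. \<bar>k s u\<bar> \<partial>lborel) <= C * s powr a"
  using k unfolding time_kernel_def by blast
 have norm_eq: "(\<integral>z. norm (kernel_at k t x (r, z)) \<partial>lborel) = indicator {0..t} r * (\<integral>u. \<bar>k (t - r) u\<bar> \<partial>lborel)" if "r < t" for r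
  using integrable_reflect_translate(2)[OF integrable_abs[OF ki[of "t - r"]], of x] that by (simp add: kernel_at_def abs_mult)
 show ?thesis
 proof (rule lborel_pair.Fubini_integrable)
  show "kernel_at k t x \<in> borel_measurable (lborel \<Otimes>\<^sub>M lborel)" unfolding kernel_at_def[abs_def] by measurable
  show "AE r in lborel. integrable lborel (%z. kernel_at k t x (r, z))"
   using AE_lborel_singleton[of t]
  proof eventually_elim
   case (elim r)
   then show ?case using integrable_reflect_translate(1)[OF ki, of "t - r" x]
    by (cases "r < t") (auto simp: kernel_at_def)
  qed
  show "integrable lborel (%r. \<integral>z. norm (kernel_at k t x (r, z)) \<partial>lborel)"
  proof (rule Bochner_Integration.integrable_bound)
   show "integrable lborel (%r. C * (indicator {0..t} (t - r) * (t - r) powr a))"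
   proof (intro integrable_mult_right integrableI_nonneg)
    have "(\<integral>\<^sup>+r. ennreal (indicator {0..t} (t - r) * (t - r) powr a) \<partial>lborel) = (\<integral>\<^sup>+s. ennreal (indicator {0..t} s * s powr a) \<partial>lborel)"
     by (rule nn_integral_reflect) measurable
    also have "... < \<infinity>" using nn_integral_powr[OF C(2), of t] by (cases "0 <= t") auto
    finally show "(\<integral>\<^sup>+r. ennreal (indicator {0..t} (t - r) * (t - r) powr a) \<partial>lborel) < \<infinity>" .
   qed auto
   show "(%r. \<integral>z. norm (kernel_at k t x (r, z)) \<partial>lborel) \<in> borel_measurable lborel"
    unfolding kernel_at_def fst_conv snd_conv by measurable
   show "AE r in lborel. norm (\<integral>z. norm (kernel_at k t x (r, z)) \<partial>lborel) <= norm (C * (indicator {0..t} (t - r) * (t - r) powr a))"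
    using AE_lborel_singleton[of t]
   proof eventually_elim
    case (elim r)
    show ?case
    proof (cases "r < t")
     case True
     then show ?thesis using norm_eq[OF True] kb[of "t - r"] C by (auto simp: indicator_def)
    next
     case False
     with elim have "kernel_at k t x (r, z) = 0" for z by (simp add: kernel_at_def)
     then show ?thesis by simp
    qed
   qed
  qed
 qed
qed

text \<open>No adaptedness is included: in the product h1 * h2 of the optimality statement, h2 is an
  arbitrary square integrable variable.\<close>

definition l2_hoelder_drift :: "'a measure => real => (real => real => 'a => real) => bool" where
 "l2_hoelder_drift M \<beta> h \<longleftrightarrow> jointly_measurable M h \<and>
  (\<forall>T\<ge>0. \<exists>K\<ge>0. AE r in lborel. 0 <= r --> r <= T --> (\<forall>z. l2norm M (h r z) <= ennreal K) \<and>
    (\<forall>z z'. l2norm M (%w. h r z w - h r z' w) <= ennreal (K * \<bar>z - z'\<bar> powr \<beta>)))"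

locale l2_drift = prob_space M for M :: "'a measure" +
 fixes h :: "real => real => 'a => real" and \<beta> :: real
 assumes drift: "l2_hoelder_drift M \<beta> h" and \<beta>: "0 < \<beta>" "\<beta> <= 1"
begin

text \<open>One integral over the time-space plane, so that \<open>kernel_operator\<close> applies;
  it agrees almost surely with the iterated integral of the mild formula. The extension by
  \<open>max 0\<close> concerns times to which the kernel gives no weight.\<close>

definition drift_integral :: "(real => real => real) => real => real => 'a => real" where
 "drift_integral k t x w = (\<integral>p. kernel_at k t x p * h (max 0 (fst p)) (snd p) w \<partial>(lborel \<Otimes>\<^sub>M lborel))"

text \<open>Scalar sections of the drift. At almost every time they are Hoelder in z with constants
  proportional to \<open>rnorm M Y\<close>, so the deterministic heat estimates apply to
  them.\<close>

definition tested :: "('a => real) => real => real => real" where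
 "tested Y r z = (\<integral>w. h r z w * Y w \<partial>M)"

lemma kernel_operator_drift:
 assumes k: "time_kernel k"
 obtains K where "kernel_operator M (lborel \<Otimes>\<^sub>M lborel) (%p. h (max 0 (fst p)) (snd p)) (kernel_at k t x) K"
  "0 <= K" "AE r in lborel. 0 <= r --> r <= t --> (\<forall>z. l2norm M (h r z) <= ennreal K)"
proof -
 obtain K where K: "0 <= K" "AE r in lborel. 0 <= r --> r <= max 0 t --> (\<forall>z. l2norm M (h r z) <= ennreal K) \<and>
    (\<forall>z z'. l2norm M (%w. h r z w - h r z' w) <= ennreal (K * \<bar>z - z'\<bar> powr \<beta>))"
  using drift unfolding l2_hoelder_drift_def by (meson max.cobounded1)
 then have b: "AE r in lborel. 0 <= r --> r <= t --> (\<forall>z. l2norm M (h r z) <= ennreal K)"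
  by (auto elim!: eventually_mono)
 have m: "(%(t, y). case y of (x, w) => h (max 0 t) x w) \<in> borel_measurable (borel \<Otimes>\<^sub>M (borel \<Otimes>\<^sub>M M))"
  using drift unfolding l2_hoelder_drift_def jointly_measurable_def by (intro measurable_extend_time) auto
 have m': "(%(p, w). h (max 0 (fst p)) (snd p) w) \<in> borel_measurable ((lborel \<Otimes>\<^sub>M lborel) \<Otimes>\<^sub>M M)"
 proof -
  have "(%q. (fst (fst q), snd (fst q), snd q)) \<in> measurable ((lborel \<Otimes>\<^sub>M lborel) \<Otimes>\<^sub>M M) (borel \<Otimes>\<^sub>M (borel \<Otimes>\<^sub>M M))"
   by measurable
  from measurable_compose[OF this m] show ?thesis by (simp add: case_prod_beta')
 qed
 have "kernel_operator M (lborel \<Otimes>\<^sub>M lborel) (%p. h (max 0 (fst p)) (snd p)) (kernel_at k t x) K"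
 proof (intro kernel_operator.intro kernel_operator_axioms.intro prob_space_axioms m' integrable_kernel_at[OF k] K(1))
  show "sigma_finite_measure (lborel \<Otimes>\<^sub>M lborel :: (real \<times> real) measure)" by (rule lborel_pair.sigma_finite_measure_axioms)
  show "AE p in lborel \<Otimes>\<^sub>M lborel. kernel_at k t x p \<noteq> 0 --> l2norm M (h (max 0 (fst p)) (snd p)) <= ennreal K"
   using AE_lborel_fst[OF b] by eventually_elim (auto simp: kernel_at_def indicator_def split: if_splits)
 qed
 then show ?thesis using K(1) b by (rule that)
qed

lemma kernel_at_integral:
 assumes "integrable (lborel \<Otimes>\<^sub>M lborel) (%p. kernel_at k t x p * q (max 0 (fst p)) (snd p))"
 shows "set_integrable lborel {0..t} (%r. \<integral>z. k (t - r) (x - z) * q r z \<partial>lborel)"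
  "(\<integral>p. kernel_at k t x p * q (max 0 (fst p)) (snd p) \<partial>(lborel \<Otimes>\<^sub>M lborel)) = (LINT r:{0..t}|lborel. \<integral>z. k (t - r) (x - z) * q r z \<partial>lborel)"
proof -
 have eq: "(\<integral>z. kernel_at k t x (r, z) * q (max 0 r) z \<partial>lborel) = indicator {0..t} r *\<^sub>R (\<integral>z. k (t - r) (x - z) * q r z \<partial>lborel)" for r
  by (cases "r \<in> {0..t}") (auto simp: kernel_at_def max_absorb2)
 show "set_integrable lborel {0..t} (%r. \<integral>z. k (t - r) (x - z) * q r z \<partial>lborel)"
  using lborel_pair.integrable_fst'[OF assms] unfolding set_integrable_def fst_conv snd_conv eq .
 show "(\<integral>p. kernel_at k t x p * q (max 0 (fst p)) (snd p) \<partial>(lborel \<Otimes>\<^sub>M lborel)) = (LINT r:{0..t}|lborel. \<integral>z. k (t - r) (x - z) * q r z \<partial>lborel)"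
  using lborel_pair.integral_fst'[OF assms] unfolding set_lebesgue_integral_def fst_conv snd_conv eq by (rule sym)
qed

lemma drift_integral:
 assumes k: "time_kernel k"
 shows "l2norm M (drift_integral k t x) < \<infinity>"
  "l2norm M Y < \<infinity> ==> set_integrable lborel {0..t} (%r. \<integral>z. k (t - r) (x - z) * tested Y r z \<partial>lborel)"
  "l2norm M Y < \<infinity> ==> (\<integral>w. drift_integral k t x w * Y w \<partial>M) = (LINT r:{0..t}|lborel. \<integral>z. k (t - r) (x - z) * tested Y r z \<partial>lborel)"
  "AE w in M. drift_integral k t x w = (LINT r:{0..t}|lborel. \<integral>z. k (t - r) (x - z) * h r z w \<partial>lborel)"
  "complete_measure M ==> subalgebra M G ==> null_sets M \<subseteq> sets G ==>
   (!!r z. 0 <= r ==> r <= t ==> h r z \<in> borel_measurable G) ==> drift_integral k t x \<in> borel_measurable G"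
proof -
 obtain K where K: "kernel_operator M (lborel \<Otimes>\<^sub>M lborel) (%p. h (max 0 (fst p)) (snd p)) (kernel_at k t x) K" "0 <= K"
  using kernel_operator_drift[OF k, of t x] by metis
 interpret A: kernel_operator M "lborel \<Otimes>\<^sub>M lborel" "%p. h (max 0 (fst p)) (snd p)" "kernel_at k t x" K by (rule K(1))
 have T: "A.T = drift_integral k t x" by (simp add: fun_eq_iff A.T_def drift_integral_def)
 show "l2norm M (drift_integral k t x) < \<infinity>"
  by (rule l2norm_le_rnorm(2)[OF A.T_bound[unfolded T]]) (use K(2) in simp)
 show "AE w in M. drift_integral k t x w = (LINT r:{0..t}|lborel. \<integral>z. k (t - r) (x - z) * h r z w \<partial>lborel)"
  using A.AE_integrable
 proof eventually_elim
  case (elim w)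
  from kernel_at_integral(2)[of k t x "%r z. h r z w", OF elim] show ?case unfolding drift_integral_def .
 qed
 show "drift_integral k t x \<in> borel_measurable G" if "complete_measure M" "subalgebra M G" "null_sets M \<subseteq> sets G"
   "!!r z. 0 <= r ==> r <= t ==> h r z \<in> borel_measurable G"
  unfolding T[symmetric] by (rule A.T_subalgebra_measurable[OF that(1-3)])
   (auto intro!: that(4) simp: kernel_at_def indicator_def split: if_splits)
 assume Y: "l2norm M Y < \<infinity>"
 note q = A.integrable_D_test[OF Y, folded tested_def]
 show "set_integrable lborel {0..t} (%r. \<integral>z. k (t - r) (x - z) * tested Y r z \<partial>lborel)"
  by (rule kernel_at_integral(1)[OF q])
 show "(\<integral>w. drift_integral k t x w * Y w \<partial>M) = (LINT r:{0..t}|lborel. \<integral>z. k (t - r) (x - z) * tested Y r z \<partial>lborel)"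
  using A.T_test[OF Y] unfolding T tested_def[symmetric] kernel_at_integral(2)[OF q] .
qed

lemma tested_hoelder:
 assumes T: "0 < T"
 shows "\<exists>K\<ge>0. \<forall>Y\<in>{Y. l2norm M Y < \<infinity>}. AE r in lborel. 0 <= r --> r <= T -->
  hoelder_function (tested Y r) (K * rnorm M Y) (K * rnorm M Y) \<beta>"
proof -
 obtain K where K: "0 <= K" "AE r in lborel. 0 <= r --> r <= T --> (\<forall>z. l2norm M (h r z) <= ennreal K) \<and>
    (\<forall>z z'. l2norm M (%w. h r z w - h r z' w) <= ennreal (K * \<bar>z - z'\<bar> powr \<beta>))"
  using drift T unfolding l2_hoelder_drift_def by (meson less_imp_le)
 show ?thesis
 proof (intro exI[of _ K] conjI K(1) ballI)
  fix Y assume "Y \<in> {Y. l2norm M Y < \<infinity>}"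
  then have Y: "l2norm M Y < \<infinity>" by simp
  show "AE r in lborel. 0 <= r --> r <= T --> hoelder_function (tested Y r) (K * rnorm M Y) (K * rnorm M Y) \<beta>"
   using K(2)
  proof eventually_elim
   case (elim r)
   show ?case
   proof (intro impI)
    assume r: "0 <= r" "r <= T"
    have b: "l2norm M (h r z) <= ennreal K" and d: "l2norm M (%w. h r z w - h r z' w) <= ennreal (K * \<bar>z - z'\<bar> powr \<beta>)" for z z'
     using elim r by auto
    have le: "\<bar>\<integral>w. Z w * Y w \<partial>M\<bar> <= L * rnorm M Y" if "l2norm M Z <= ennreal L" "0 <= L" for Z L
     using cauchy_schwarz_l2(3)[OF l2norm_le_rnorm(2)[OF that] Y] mult_right_mono[OF l2norm_le_rnorm(1)[OF that] rnorm_nonneg[of M Y]]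
     by linarith
    have [measurable]: "(%(z, w). h r z w) \<in> borel_measurable (borel \<Otimes>\<^sub>M M)"
     using drift r by (intro jointly_measurable_section) (auto simp: l2_hoelder_drift_def)
    have [measurable]: "Y \<in> borel_measurable M" using l2norm_finiteD(1)[OF Y] .
    show "hoelder_function (tested Y r) (K * rnorm M Y) (K * rnorm M Y) \<beta>"
    proof
     show "tested Y r \<in> borel_measurable borel" unfolding tested_def[abs_def] by measurable
     show "\<bar>tested Y r z\<bar> <= K * rnorm M Y" for z unfolding tested_def by (rule le[OF b K(1)])
     show "\<bar>tested Y r z - tested Y r z'\<bar> <= K * rnorm M Y * \<bar>z - z'\<bar> powr \<beta>" for z z'
     proof -
      note c = cauchy_schwarz_l2(1)[OF l2norm_le_rnorm(2)[OF b K(1)] Y]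
      have "tested Y r z - tested Y r z' = (\<integral>w. (h r z w - h r z' w) * Y w \<partial>M)"
       unfolding tested_def left_diff_distrib by (rule Bochner_Integration.integral_diff[OF c c, symmetric])
      then show ?thesis using le[OF d[of z z']] K(1) by (simp add: ac_simps)
     qed
    qed (use \<beta> K(1) in auto)
   qed
  qed
 qed
qed

text \<open>The semigroup is a contraction in the supremum norm, so the drift is of order t, against
  the order sqrt t of the noise.\<close>

lemma drift_small:
 assumes T: "0 < T"
 shows "\<exists>K\<ge>0. \<forall>t x. 0 < t --> t <= T --> l2norm M (drift_integral heat_kernel t x) <= ennreal (K * t)"
proof -
 obtain K where K: "0 <= K" "!!Y. l2norm M Y < \<infinity> ==> AE r in lborel. 0 <= r --> r <= T -->
   hoelder_function (tested Y r) (K * rnorm M Y) (K * rnorm M Y) \<beta>"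
  using tested_hoelder[OF T] by blast
 have "l2norm M (drift_integral heat_kernel t x) <= ennreal (K * t)" if t: "0 < t" "t <= T" for t x
 proof (rule l2norm_le_dual)
  show "finite_measure M" by (rule finite_measure_axioms)
  show "drift_integral heat_kernel t x \<in> borel_measurable M"
   using drift_integral(1)[OF heat_time_kernels(1)] by (rule l2norm_finiteD(1))
  fix Y assume Y: "l2norm M Y < \<infinity>"
  let ?\<phi> = "%r. \<integral>z. heat_kernel (t - r) (x - z) * tested Y r z \<partial>lborel"
  have i: "integrable lborel (%r. indicator {0..t} r *\<^sub>R ?\<phi> r)"
   using drift_integral(2)[OF heat_time_kernels(1) Y] unfolding set_integrable_def .
  have "\<bar>\<integral>w. drift_integral heat_kernel t x w * Y w \<partial>M\<bar> <= (\<integral>r. \<bar>indicator {0..t} r *\<^sub>R ?\<phi> r\<bar> \<partial>lborel)"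
   unfolding drift_integral(3)[OF heat_time_kernels(1) Y] set_lebesgue_integral_def by (rule integral_abs_bound)
  also have "... <= (\<integral>r. indicator {0..t} r *\<^sub>R (K * rnorm M Y) \<partial>lborel)"
  proof (rule integral_mono_AE)
   show "integrable lborel (%r. \<bar>indicator {0..t} r *\<^sub>R ?\<phi> r\<bar>)" using i by (rule integrable_abs)
   show "integrable lborel (%r. indicator {0..t} r *\<^sub>R (K * rnorm M Y))"
    using t by (intro integrable_scaleR_left integrable_real_indicator) auto
   show "AE r in lborel. \<bar>indicator {0..t} r *\<^sub>R ?\<phi> r\<bar> <= indicator {0..t} r *\<^sub>R (K * rnorm M Y)"
    using K(2)[OF Y] AE_lborel_singleton[of t]
   proof eventually_elim
    case (elim r)
    show ?case
    proof (cases "r \<in> {0..t}")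
     case True
     then show ?thesis using elim t hoelder_function.heat_semigroup_bound[of "tested Y r" "K * rnorm M Y" "K * rnorm M Y" \<beta> "t - r" x]
      by (auto simp: heat_semigroup_def)
    qed simp
   qed
  qed
  also have "... = K * t * rnorm M Y" using t by simp
  finally show "\<bar>\<integral>w. drift_integral heat_kernel t x w * Y w \<partial>M\<bar> <= K * t * rnorm M Y" .
 qed (use K t in auto)
 with K(1) show ?thesis by blast
qed

text \<open>The tests are all square integrable Y, weighted by their norms, and the cost is an L1
  norm in time. By \<open>min_powr_interpolate\<close> the exponent \<gamma> may be any number up to
  1, however small \<beta> is.\<close>

theorem drift_field_regular:
 assumes \<gamma>: "0 < \<gamma>" "\<gamma> <= 1" and \<rho>: "0 < \<rho>" "\<rho> <= \<beta>/2"
 shows "regular_field M \<gamma> \<rho> (drift_integral heat_kernel) (drift_integral heat_kernel_deriv)"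
proof -
 let ?Q = "{Y. l2norm M Y < \<infinity>}"
 define R where "R t \<phi> I \<longleftrightarrow> l2norm M I < \<infinity> \<and> (\<forall>Y\<in>?Q. set_integrable lborel {0..t} (\<phi> Y) \<and>
  (\<integral>w. I w * Y w \<partial>M) = (LINT r:{0..t}|lborel. \<phi> Y r))" for t :: real and \<phi> :: "('a => real) => real => real" and I
 define cost where "cost t m c \<longleftrightarrow> (\<integral>\<^sup>+s. ennreal (indicator {0..t} s * m s) \<partial>lborel) <= ennreal c" for t :: real and m c
 interpret heat_field M ?Q "rnorm M" tested R cost \<beta> \<gamma> \<rho> "drift_integral heat_kernel" "drift_integral heat_kernel_deriv"
 proof
  show "R t (%y r. a * \<phi> y r + b * \<psi> y r) (%w. a * I w + b * J w)"
   if "0 <= t" and I: "R t \<phi> I" and J: "R t \<psi> J" for t \<phi> \<psi> I J a b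
   unfolding R_def
  proof (intro conjI ballI)
   have fin: "l2norm M I < \<infinity>" "l2norm M J < \<infinity>" using I J by (auto simp: R_def)
   show "l2norm M (%w. a * I w + b * J w) < \<infinity>" by (intro l2norm_add_finite l2norm_scale_finite fin)
   fix Y assume Y: "Y \<in> ?Q"
   then have i: "set_integrable lborel {0..t} (%r. a * \<phi> Y r)" "set_integrable lborel {0..t} (%r. b * \<psi> Y r)"
    using I J by (auto simp: R_def intro: set_integrable_mult_right)
   show "set_integrable lborel {0..t} (%r. a * \<phi> Y r + b * \<psi> Y r)" by (rule set_integral_add(1)[OF i])
   have c: "integrable M (%w. a * (I w * Y w))" "integrable M (%w. b * (J w * Y w))"
    using fin Y by (auto intro!: integrable_mult_right cauchy_schwarz_l2(1))
   have "(\<integral>w. (a * I w + b * J w) * Y w \<partial>M) = a * (\<integral>w. I w * Y w \<partial>M) + b * (\<integral>w. J w * Y w \<partial>M)"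
    using Bochner_Integration.integral_add[OF c] by (simp add: distrib_right mult.assoc)
   also have "... = (LINT r:{0..t}|lborel. a * \<phi> Y r + b * \<psi> Y r)"
    using I J Y by (simp add: R_def set_integral_add(2)[OF i])
   finally show "(\<integral>w. (a * I w + b * J w) * Y w \<partial>M) = (LINT r:{0..t}|lborel. a * \<phi> Y r + b * \<psi> Y r)" .
  qed
  show "R t (%y r. \<phi> y r * indicator {..s} r) I" if "0 <= s" "s <= t" "R s \<phi> I" for s t \<phi> I
  proof -
   have eq: "indicator {0..t} r *\<^sub>R (\<phi> y r * indicator {..s} r) = indicator {0..s} r *\<^sub>R \<phi> y r" for y r
    using that(2) by (auto simp: indicator_def)
   show ?thesis using that(3) unfolding R_def set_integrable_def set_lebesgue_integral_def eq .
  qed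
  show "drift_integral heat_kernel 0 x = (%_. 0)" for x
  proof -
   have "kernel_at heat_kernel 0 x p = 0" for p by (cases "fst p = 0") (auto simp: kernel_at_def)
   then show ?thesis by (simp add: drift_integral_def[abs_def])
  qed
  show "R t (%y r. heat_semigroup (t - r) (tested y r) x) (drift_integral heat_kernel t x)"
   "R t (%y r. heat_deriv (t - r) (tested y r) x) (drift_integral heat_kernel_deriv t x)" for t x
   using drift_integral(1-3)[OF heat_time_kernels(1)] drift_integral(1-3)[OF heat_time_kernels(2)]
   unfolding R_def heat_semigroup_def heat_deriv_def by blast+
  show "0 <= rnorm M y" for y by simp
  show "\<exists>K\<ge>0. \<forall>Y\<in>?Q. AE r in lborel. 0 <= r --> r <= T -->
    hoelder_function (tested Y r) (K * rnorm M Y) (K * rnorm M Y) \<beta>" if "0 < T" for T by (rule tested_hoelder[OF that])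
  show "l2norm M I <= ennreal (k * c)"
   if t: "0 < t" and R: "R t \<phi> I" and k: "0 <= k" and m: "m \<in> borel_measurable borel"
    and le: "!!Y. Y \<in> ?Q ==> AE r in lborel. 0 <= r --> r < t --> \<bar>\<phi> Y r\<bar> <= k * rnorm M Y * m (t - r)"
    and c: "0 <= c" and cost: "cost t m c" for t \<phi> I k m c
  proof (rule l2norm_le_dual)
   show "finite_measure M" by (rule finite_measure_axioms)
   show "I \<in> borel_measurable M" using R by (auto simp: R_def l2norm_finiteD(1))
   fix Y assume "l2norm M Y < \<infinity>"
   then have Y: "Y \<in> ?Q" by simp
   then have i: "set_integrable lborel {0..t} (\<phi> Y)" and e: "(\<integral>w. I w * Y w \<partial>M) = (LINT r:{0..t}|lborel. \<phi> Y r)"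
    using R by (auto simp: R_def)
   have a0: "0 <= k * rnorm M Y" using k by simp
   note [measurable] = m
   have [measurable]: "(%r. m (t - r)) \<in> borel_measurable borel" by (rule measurable_compose[OF _ m]) simp
   have "ennreal \<bar>LINT r:{0..t}|lborel. \<phi> Y r\<bar> <= (\<integral>\<^sup>+r. ennreal \<bar>indicator {0..t} r *\<^sub>R \<phi> Y r\<bar> \<partial>lborel)"
    unfolding set_lebesgue_integral_def using integral_norm_bound_ennreal[OF i[unfolded set_integrable_def]] by simp
   also have "... <= (\<integral>\<^sup>+r. ennreal (k * rnorm M Y) * ennreal (indicator {0..t} (t - r) * m (t - r)) \<partial>lborel)"
   proof (rule nn_integral_mono_AE)
    show "AE r in lborel. ennreal \<bar>indicator {0..t} r *\<^sub>R \<phi> Y r\<bar> <= ennreal (k * rnorm M Y) * ennreal (indicator {0..t} (t - r) * m (t - r))"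
     using le[OF Y] AE_lborel_singleton[of t]
    proof eventually_elim
     case (elim r)
     show ?case
     proof (cases "r \<in> {0..t}")
      case True
      with elim have "\<bar>\<phi> Y r\<bar> <= k * rnorm M Y * m (t - r)" by auto
      then show ?thesis using True a0 by (simp add: indicator_reflect ennreal_mult'[symmetric] ennreal_leI)
     qed simp
    qed
   qed
   also have "... = ennreal (k * rnorm M Y) * (\<integral>\<^sup>+r. ennreal (indicator {0..t} (t - r) * m (t - r)) \<partial>lborel)"
    by (intro nn_integral_cmult) measurable
   also have "(\<integral>\<^sup>+r. ennreal (indicator {0..t} (t - r) * m (t - r)) \<partial>lborel) = (\<integral>\<^sup>+s. ennreal (indicator {0..t} s * m s) \<partial>lborel)"
    using m by (intro nn_integral_reflect[where f = "%s. ennreal (indicator {0..t} s * m s)"]) measurable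
   also have "ennreal (k * rnorm M Y) * ... <= ennreal (k * rnorm M Y) * ennreal c"
    using cost unfolding cost_def by (rule mult_left_mono) simp
   also have "... = ennreal (k * c * rnorm M Y)" using a0 c by (simp add: ennreal_mult[symmetric] ac_simps)
   finally show "\<bar>\<integral>w. I w * Y w \<partial>M\<bar> <= k * c * rnorm M Y" unfolding e using k c by (simp add: ennreal_le_iff)
  qed (use k c in auto)
  show "\<exists>c\<ge>0. \<forall>t. 0 < t --> t <= T --> cost t (%_. 1) c \<and> cost t (%s. s powr (-1/2 + \<beta>/2)) c \<and>
   (\<forall>d>0. cost t (%s. min (s powr (-1/2 + \<beta>/2)) (s powr (-1 + \<beta>/2) * d)) (c * d powr \<gamma>)) \<and>
   (\<forall>\<delta>. 0 <= \<delta> --> \<delta> <= 1 --> cost t (%s. if s <= \<delta> then 1 else \<delta> powr (\<beta>/2)) (c * \<delta> powr \<rho>))" if T: "0 < T" for T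
  proof -
   define c where "c = (T + 1) / (1/2 + \<beta>/2) + (T + 1) / (\<beta>/2)"
   have c: "0 <= c" "(T + 1) / (1/2 + \<beta>/2) <= c" "T + 1 <= c"
   proof -
    have "(T + 1) / 1 <= (T + 1) / (1/2 + \<beta>/2)" using T \<beta> by (intro divide_left_mono) auto
    moreover have "0 <= (T + 1) / (\<beta>/2)" using T \<beta> by simp
    ultimately show "0 <= c" "(T + 1) / (1/2 + \<beta>/2) <= c" "T + 1 <= c" using T by (auto simp: c_def)
   qed
   show ?thesis
   proof (intro exI[of _ c] conjI allI impI c(1))
    fix t assume t: "0 < t" "t <= T"
    have p: "(\<integral>\<^sup>+s. ennreal (indicator {0..t} s * s powr (-1/2 + \<beta>/2)) \<partial>lborel) <= ennreal ((T + 1) / (1/2 + \<beta>/2))"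
     "(\<integral>\<^sup>+s. ennreal (indicator {0..t} s * s powr (-1 + \<beta>/2)) \<partial>lborel) <= ennreal ((T + 1) / (\<beta>/2))"
     using nn_integral_powr[of "-1/2 + \<beta>/2" t] nn_integral_powr[of "-1 + \<beta>/2" t] powr_le_Suc[of t T "1/2 + \<beta>/2"] powr_le_Suc[of t T "\<beta>/2"] t \<beta>
     by (auto intro!: ennreal_leI divide_right_mono)
    show "cost t (%_. 1) c" unfolding cost_def using t c nn_integral_const_time[of t 1] by (auto intro!: ennreal_leI)
    show "cost t (%s. s powr (-1/2 + \<beta>/2)) c"
     unfolding cost_def by (rule order_trans[OF p(1) ennreal_leI[OF c(2)]])
    show "cost t (%s. min (s powr (-1/2 + \<beta>/2)) (s powr (-1 + \<beta>/2) * d)) (c * d powr \<gamma>)" if d: "0 < d" for d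
    proof -
     have "(\<integral>\<^sup>+s. ennreal (indicator {0..t} s * min (s powr (-1/2 + \<beta>/2)) (s powr (-1 + \<beta>/2) * d)) \<partial>lborel) <=
       (\<integral>\<^sup>+s. ennreal (d powr \<gamma>) * (ennreal (indicator {0..t} s * s powr (-1/2 + \<beta>/2)) + ennreal (indicator {0..t} s * s powr (-1 + \<beta>/2))) \<partial>lborel)"
     proof (rule nn_integral_mono)
      fix s :: real
      have "min (s powr (-1/2 + \<beta>/2)) (s powr (-1 + \<beta>/2) * d) <= (s powr (-1/2 + \<beta>/2) + s powr (-1 + \<beta>/2)) * d powr \<gamma>"
       using d \<gamma> by (intro min_powr_interpolate) auto
      then show "ennreal (indicator {0..t} s * min (s powr (-1/2 + \<beta>/2)) (s powr (-1 + \<beta>/2) * d)) <=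
        ennreal (d powr \<gamma>) * (ennreal (indicator {0..t} s * s powr (-1/2 + \<beta>/2)) + ennreal (indicator {0..t} s * s powr (-1 + \<beta>/2)))"
       by (auto simp: indicator_def ennreal_plus[symmetric] ennreal_mult[symmetric] mult.commute simp del: ennreal_plus intro!: ennreal_leI)
     qed
     also have "... = ennreal (d powr \<gamma>) * ((\<integral>\<^sup>+s. ennreal (indicator {0..t} s * s powr (-1/2 + \<beta>/2)) \<partial>lborel) + (\<integral>\<^sup>+s. ennreal (indicator {0..t} s * s powr (-1 + \<beta>/2)) \<partial>lborel))"
      by (subst nn_integral_cmult, measurable, subst nn_integral_add) auto
     also have "... <= ennreal (d powr \<gamma>) * (ennreal ((T + 1) / (1/2 + \<beta>/2)) + ennreal ((T + 1) / (\<beta>/2)))"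
      by (intro mult_left_mono add_mono p) simp
     also have "... = ennreal (c * d powr \<gamma>)"
      using T \<beta> by (simp add: c_def ennreal_plus[symmetric] ennreal_mult[symmetric] mult.commute del: ennreal_plus)
     finally show ?thesis unfolding cost_def .
    qed
    fix \<delta> :: real assume \<delta>: "0 <= \<delta>" "\<delta> <= 1"
    have p: "\<delta> powr a <= \<delta> powr \<rho>" if "\<rho> <= a" for a
     using \<delta> that by (cases "\<delta> = 0") (auto intro!: powr_mono')
    have 1: "\<delta> <= \<delta> powr \<rho>" using p[of 1] \<rho> \<beta> \<delta> by (cases "\<delta> = 0") auto
    have "\<delta> powr (\<beta>/2) * t <= \<delta> powr \<rho> * T" using t p[OF \<rho>(2)] by (intro mult_mono) auto
    with 1 have "1 * \<delta> + \<delta> powr (\<beta>/2) * t <= (T + 1) * \<delta> powr \<rho>" by (simp add: algebra_simps)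
    also have "... <= c * \<delta> powr \<rho>" using c by (intro mult_right_mono) auto
    finally show "cost t (%s. if s <= \<delta> then 1 else \<delta> powr (\<beta>/2)) (c * \<delta> powr \<rho>)"
     unfolding cost_def using t \<delta> by (intro order_trans[OF nn_integral_time_step ennreal_leI]) auto
   qed
  qed
 qed
 show ?thesis by (rule regular)
qed

end

section \<open>Existence and uniqueness\<close>

lemma holder_quotientD:
 assumes "holder_quotient \<alpha> D <= ennreal K" "0 <= K" "x \<noteq> y"
 shows "D x y <= ennreal (K * \<bar>x - y\<bar> powr \<alpha>)"
proof -
 have p: "0 < \<bar>x - y\<bar> powr \<alpha>" using assms(3) by simp
 have "D x y / ennreal (\<bar>x - y\<bar> powr \<alpha>) <= holder_quotient \<alpha> D"
  unfolding holder_quotient_def using assms(3) by (intro SUP_upper2[of "(x, y)"]) auto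
 then have le: "D x y / ennreal (\<bar>x - y\<bar> powr \<alpha>) <= ennreal K" using assms(1) by (rule order_trans)
 show ?thesis
 proof (cases "D x y")
  case (real r)
  then show ?thesis using le p assms(2) by (simp add: divide_ennreal pos_divide_le_eq ennreal_leI)
 next
  case top
  then show ?thesis using le p by (simp add: ennreal_top_divide top_unique)
 qed
qed

lemma holder_normD:
 assumes "holder_norm \<alpha> \<phi> <= ennreal K" "0 <= K"
 shows "\<bar>\<phi> x\<bar> <= K" "\<bar>\<phi> x - \<phi> y\<bar> <= K * \<bar>x - y\<bar> powr \<alpha>"
proof -
 have "ennreal \<bar>\<phi> x\<bar> <= (SUP x. ennreal \<bar>\<phi> x\<bar>)" by (rule SUP_upper) simp
 also have "... <= holder_norm \<alpha> \<phi>" unfolding holder_norm_def by (rule add_increasing2) auto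
 also note assms(1)
 finally show "\<bar>\<phi> x\<bar> <= K" using assms(2) by simp
 have "holder_quotient \<alpha> (%x y. ennreal \<bar>\<phi> x - \<phi> y\<bar>) <= holder_norm \<alpha> \<phi>"
  unfolding holder_norm_def by (rule add_increasing) auto
 also note assms(1)
 finally have q: "holder_quotient \<alpha> (%x y. ennreal \<bar>\<phi> x - \<phi> y\<bar>) <= ennreal K" .
 show "\<bar>\<phi> x - \<phi> y\<bar> <= K * \<bar>x - y\<bar> powr \<alpha>"
  using holder_quotientD[OF q assms(2), of x y] assms(2) by (cases "x = y") auto
qed

lemma holder_l2_normD:
 assumes "holder_l2_norm M \<alpha> \<phi> <= ennreal K" "0 <= K"
 shows "l2norm M (\<phi> x) <= ennreal K" "l2norm M (%w. \<phi> x w - \<phi> y w) <= ennreal (K * \<bar>x - y\<bar> powr \<alpha>)"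
proof -
 have "l2norm M (\<phi> x) <= (SUP x. l2norm M (\<phi> x))" by (rule SUP_upper) simp
 also have "... <= holder_l2_norm M \<alpha> \<phi>" unfolding holder_l2_norm_def by (rule add_increasing2) auto
 also note assms(1)
 finally show "l2norm M (\<phi> x) <= ennreal K" .
 have "holder_quotient \<alpha> (%x y. l2norm M (%w. \<phi> x w - \<phi> y w)) <= holder_l2_norm M \<alpha> \<phi>"
  unfolding holder_l2_norm_def by (rule add_increasing) auto
 also note assms(1)
 finally have q: "holder_quotient \<alpha> (%x y. l2norm M (%w. \<phi> x w - \<phi> y w)) <= ennreal K" .
 show "l2norm M (%w. \<phi> x w - \<phi> y w) <= ennreal (K * \<bar>x - y\<bar> powr \<alpha>)"
  using holder_quotientD[OF q assms(2), of x y] assms(2) by (cases "x = y") auto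
qed

text \<open>A bounded Hoelder function is Hoelder for every smaller exponent: near the diagonal the
  power decreases, and far from it the oscillation 2 K suffices.\<close>

lemma smaller_exponent:
 fixes d K :: real
 assumes "0 <= d" "0 < \<gamma>" "\<gamma> <= \<alpha>" "0 <= K"
 shows "min (2 * K) (K * d powr \<alpha>) <= 2 * K * d powr \<gamma>"
proof (cases "d <= 1")
 case True
 have "d powr \<alpha> <= d powr \<gamma>" using assms True by (cases "d = 0") (auto intro: powr_mono')
 then have "K * d powr \<alpha> <= K * d powr \<gamma>" using assms by (intro mult_left_mono) auto
 also have "... <= 2 * K * d powr \<gamma>" using assms by (intro mult_right_mono) auto
 finally show ?thesis by simp
next
 case False
 then have "1 powr \<gamma> <= d powr \<gamma>" using assms by (intro powr_mono2) auto
 then have "2 * K * 1 <= 2 * K * d powr \<gamma>" using assms by (intro mult_left_mono) auto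
 then show ?thesis by simp
qed

lemma hoelder_function_smaller:
 assumes \<phi>: "\<phi> \<in> borel_measurable borel" "!!x. \<bar>\<phi> x\<bar> <= K" "!!x y. \<bar>\<phi> x - \<phi> y\<bar> <= K * \<bar>x - y\<bar> powr \<alpha>"
  and \<gamma>: "0 < \<gamma>" "\<gamma> <= 1" "\<gamma> <= \<alpha>" and K: "0 <= K"
 shows "hoelder_function \<phi> (2 * K) (2 * K) \<gamma>"
proof
 fix x y
 show "\<bar>\<phi> x\<bar> <= 2 * K" using \<phi>(2)[of x] K by simp
 have "\<bar>\<phi> x - \<phi> y\<bar> <= 2 * K" using \<phi>(2)[of x] \<phi>(2)[of y] by linarith
 then show "\<bar>\<phi> x - \<phi> y\<bar> <= 2 * K * \<bar>x - y\<bar> powr \<gamma>"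
  using smaller_exponent[of "\<bar>x - y\<bar>" \<gamma> \<alpha> K] \<phi>(3)[of x y] \<gamma> K by (simp add: min_def split: if_splits)
qed (use \<phi>(1) \<gamma> K in auto)

lemma linf_locD:
 assumes "linf_loc nrm u" "0 <= T"
 obtains K where "0 <= K" "AE t in lborel. 0 <= t --> t <= T --> nrm (u t) <= ennreal K"
proof -
 obtain K where K: "AE t in lborel. t \<in> {0..T} --> nrm (u t) <= ennreal K"
  using assms unfolding linf_loc_def by blast
 have "ennreal K <= ennreal (max 0 K)" by (rule ennreal_leI) simp
 then have "AE t in lborel. 0 <= t --> t <= T --> nrm (u t) <= ennreal (max 0 K)"
  using K by (auto elim!: eventually_mono intro: order_trans)
 then show ?thesis by (intro that[of "max 0 K"]) auto
qed

lemma holder_data_noise: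
 assumes f: "holder_data \<alpha> f" and \<gamma>: "0 < \<gamma>" "\<gamma> <= 1" "\<gamma> <= \<alpha>"
 shows "hoelder_noise_data \<gamma> f"
 unfolding hoelder_noise_data_def
proof (intro conjI allI impI)
 show m: "(%(t, x). f t x) \<in> borel_measurable (restrict_space borel {0..} \<Otimes>\<^sub>M borel)"
  using f by (simp add: holder_data_def)
 fix T :: real assume T: "0 <= T"
 obtain K where K: "0 <= K" "AE t in lborel. 0 <= t --> t <= T --> holder_norm \<alpha> (f t) <= ennreal K"
  by (rule linf_locD[of "holder_norm \<alpha>" f, OF _ T]) (use f in \<open>simp add: holder_data_def\<close>)
 have "AE r in lborel. 0 <= r --> r <= T --> hoelder_function (f r) (2 * K) (2 * K) \<gamma>"
  using K(2)
 proof eventually_elim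
  case (elim r)
  show ?case
  proof (intro impI)
   assume r: "0 <= r" "r <= T"
   note h = holder_normD[OF elim[rule_format, OF r] K(1)]
   have "f r \<in> borel_measurable borel"
    using measurable_Pair2[OF m, of r] r by (simp add: space_restrict_space)
   then show "hoelder_function (f r) (2 * K) (2 * K) \<gamma>" by (rule hoelder_function_smaller[OF _ h \<gamma> K(1)])
  qed
 qed
 then show "\<exists>K\<ge>0. AE r in lborel. 0 <= r --> r <= T --> hoelder_function (f r) K K \<gamma>"
  using K(1) by (intro exI[of _ "2 * K"]) simp
qed

lemma holder_data_zero: "holder_data \<alpha> (%_ _. 0)"
 unfolding holder_data_def linf_loc_def
 by (auto simp: holder_norm_def holder_quotient_def bot_ennreal SUP_constant intro!: exI[of _ 0])

lemma sharp_profile_data: "sharp_profile Y \<alpha> f ==> holder_data \<alpha> (%_. f)"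
proof -
 assume f: "sharp_profile Y \<alpha> f"
 then have [measurable]: "f \<in> borel_measurable borel" by (auto simp: sharp_profile_def intro: borel_measurable_mono)
 have "holder_norm \<alpha> f = ennreal (enn2real (holder_norm \<alpha> f))" using f by (simp add: sharp_profile_def)
 then show ?thesis unfolding holder_data_def linf_loc_def by (auto intro: eq_refl)
qed

lemma l2_hoelder_driftI:
 assumes h: "jointly_measurable M h" and \<beta>: "0 < \<beta>'" "\<beta>' <= \<beta>"
  and b: "!!T. 0 <= T ==> \<exists>K\<ge>0. AE r in lborel. 0 <= r --> r <= T --> (\<forall>z. l2norm M (h r z) <= ennreal K) \<and>
    (\<forall>z z'. l2norm M (%w. h r z w - h r z' w) <= ennreal (K * \<bar>z - z'\<bar> powr \<beta>))"
 shows "l2_hoelder_drift M \<beta>' h"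
 unfolding l2_hoelder_drift_def
proof (intro conjI h allI impI)
 fix T :: real assume "0 <= T"
 from b[OF this] obtain K where K: "0 <= K" "AE r in lborel. 0 <= r --> r <= T --> (\<forall>z. l2norm M (h r z) <= ennreal K) \<and>
    (\<forall>z z'. l2norm M (%w. h r z w - h r z' w) <= ennreal (K * \<bar>z - z'\<bar> powr \<beta>))" by blast
 have "AE r in lborel. 0 <= r --> r <= T --> (\<forall>z. l2norm M (h r z) <= ennreal (2 * K)) \<and>
    (\<forall>z z'. l2norm M (%w. h r z w - h r z' w) <= ennreal (2 * K * \<bar>z - z'\<bar> powr \<beta>'))"
  using K(2)
 proof eventually_elim
  case (elim r)
  show ?case
  proof (intro impI conjI allI)
   assume r: "0 <= r" "r <= T"
   have n: "l2norm M (h r z) <= ennreal K" and d: "l2norm M (%w. h r z w - h r z' w) <= ennreal (K * \<bar>z - z'\<bar> powr \<beta>)" for z z'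
    using elim r by auto
   fix z z'
   show "l2norm M (h r z) <= ennreal (2 * K)" using n[of z] K(1) by (rule_tac order_trans[OF _ ennreal_leI]) auto
   have "l2norm M (%w. h r z w - h r z' w) <= ennreal K + ennreal K"
    by (rule order_trans[OF l2norm_triangle_diff add_mono[OF n n]])
   then have "l2norm M (%w. h r z w - h r z' w) <= ennreal (min (2 * K) (K * \<bar>z - z'\<bar> powr \<beta>))"
    using d[of z z'] K(1) by (simp add: min_def ennreal_plus[symmetric] del: ennreal_plus)
   also have "... <= ennreal (2 * K * \<bar>z - z'\<bar> powr \<beta>')" using \<beta> K(1) by (intro ennreal_leI smaller_exponent) auto
   finally show "l2norm M (%w. h r z w - h r z' w) <= ennreal (2 * K * \<bar>z - z'\<bar> powr \<beta>')" .
  qed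
 qed
 then show "\<exists>K\<ge>0. AE r in lborel. 0 <= r --> r <= T --> (\<forall>z. l2norm M (h r z) <= ennreal K) \<and>
    (\<forall>z z'. l2norm M (%w. h r z w - h r z' w) <= ennreal (K * \<bar>z - z'\<bar> powr \<beta>'))"
  using K(1) by (intro exI[of _ "2 * K"]) simp
qed

lemma drift_data_l2:
 assumes h: "drift_data M F \<beta> h" and \<beta>: "0 < \<beta>'" "\<beta>' <= \<beta>"
 shows "l2_hoelder_drift M \<beta>' h"
proof (rule l2_hoelder_driftI[OF _ \<beta>])
 show "jointly_measurable M h" using h by (simp add: drift_data_def)
 fix T :: real assume T: "0 <= T"
 obtain K where K: "0 <= K" "AE r in lborel. 0 <= r --> r <= T --> holder_l2_norm M \<beta> (h r) <= ennreal K"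
  by (rule linf_locD[of "holder_l2_norm M \<beta>" h, OF _ T]) (use h in \<open>simp add: drift_data_def\<close>)
 have "AE r in lborel. 0 <= r --> r <= T --> (\<forall>z. l2norm M (h r z) <= ennreal K) \<and>
    (\<forall>z z'. l2norm M (%w. h r z w - h r z' w) <= ennreal (K * \<bar>z - z'\<bar> powr \<beta>))"
  using K(2) by eventually_elim (use holder_l2_normD[OF _ K(1)] in blast)
 with K(1) show "\<exists>K\<ge>0. AE r in lborel. 0 <= r --> r <= T --> (\<forall>z. l2norm M (h r z) <= ennreal K) \<and>
    (\<forall>z z'. l2norm M (%w. h r z w - h r z' w) <= ennreal (K * \<bar>z - z'\<bar> powr \<beta>))" by blast
qed

lemma product_drift_l2:
 assumes h1: "holder_data \<beta> h1" and h2: "l2norm M h2 < \<infinity>" and \<beta>: "0 < \<beta>'" "\<beta>' <= \<beta>"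
 shows "l2_hoelder_drift M \<beta>' (%t x w. h1 t x * h2 w)"
proof (rule l2_hoelder_driftI[OF _ \<beta>])
 have m: "(%(t, x). h1 t x) \<in> borel_measurable (restrict_space borel {0..} \<Otimes>\<^sub>M borel)" using h1 by (simp add: holder_data_def)
 have [measurable]: "h2 \<in> borel_measurable M" by (rule l2norm_finiteD(1)[OF h2])
 have [measurable]: "(%q. h1 (fst q) (fst (snd q))) \<in> borel_measurable (restrict_space borel {0..} \<Otimes>\<^sub>M (borel \<Otimes>\<^sub>M M))"
 proof -
  have "(%q. (fst q, fst (snd q))) \<in> measurable (restrict_space borel {0..} \<Otimes>\<^sub>M (borel \<Otimes>\<^sub>M M)) (restrict_space borel {0..} \<Otimes>\<^sub>M borel)"
   by measurable
  from measurable_compose[OF this m] show ?thesis by (simp add: case_prod_beta')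
 qed
 show "jointly_measurable M (%t x w. h1 t x * h2 w)"
  unfolding jointly_measurable_def case_prod_beta' by measurable
 fix T :: real assume T: "0 <= T"
 obtain K where K: "0 <= K" "AE t in lborel. 0 <= t --> t <= T --> holder_norm \<beta> (h1 t) <= ennreal K"
  by (rule linf_locD[of "holder_norm \<beta>" h1, OF _ T]) (use h1 in \<open>simp add: holder_data_def\<close>)
 have scale: "l2norm M (%w. a * h2 w) <= ennreal (L * rnorm M h2)" if "\<bar>a\<bar> <= L" for a L
  using that unfolding l2norm_scale l2norm_finiteD(3)[OF h2]
  by (simp add: ennreal_mult'[symmetric] ennreal_leI mult_right_mono)
 have "AE r in lborel. 0 <= r --> r <= T --> (\<forall>z. l2norm M (%w. h1 r z * h2 w) <= ennreal (K * rnorm M h2)) \<and>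
    (\<forall>z z'. l2norm M (%w. h1 r z * h2 w - h1 r z' * h2 w) <= ennreal (K * rnorm M h2 * \<bar>z - z'\<bar> powr \<beta>))"
  using K(2)
 proof eventually_elim
  case (elim r)
  show ?case
  proof (intro impI conjI allI)
   assume r: "0 <= r" "r <= T"
   note h = holder_normD[OF elim[rule_format, OF r] K(1)]
   fix z z'
   show "l2norm M (%w. h1 r z * h2 w) <= ennreal (K * rnorm M h2)" by (rule scale[OF h(1)])
   show "l2norm M (%w. h1 r z * h2 w - h1 r z' * h2 w) <= ennreal (K * rnorm M h2 * \<bar>z - z'\<bar> powr \<beta>)"
    using scale[OF h(2)[of z z']] unfolding left_diff_distrib[symmetric] by (simp only: mult_ac)
  qed
 qed
 then show "\<exists>K\<ge>0. AE r in lborel. 0 <= r --> r <= T --> (\<forall>z. l2norm M (%w. h1 r z * h2 w) <= ennreal K) \<and>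
    (\<forall>z z'. l2norm M (%w. h1 r z * h2 w - h1 r z' * h2 w) <= ennreal (K * \<bar>z - z'\<bar> powr \<beta>))"
  using K(1) by (intro exI[of _ "K * rnorm M h2"]) auto
qed

text \<open>With uniqueness, this and the next lemma show that the integral of an absent noise is
  almost surely 0.\<close>

lemma zero_wiener_integral: "has_wiener_integral M F W t (%_ _. 0) (%_. 0)"
 unfolding has_wiener_integral_def Let_def
 by (intro conjI exI[of _ "%_. []"]) (auto simp: case_prod_beta' wiener_simple_def wiener_simple_value_def wiener_simple_integral_def)

lemma zero_levy_integral: "has_levy_integral M F \<nu> N t (%_ _ _. 0) (%_. 0)"
 unfolding has_levy_integral_def Let_def
 by (intro conjI exI[of _ "%_. []"]) (auto simp: case_prod_beta' levy_simple_def levy_simple_value_def levy_simple_integral_def)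

lemma jump_data_zero: "jump_data c \<nu> (%_. 0)"
 by (auto simp: jump_data_def intro!: exI[of _ UNIV])

lemma heat_semigroup_scale: "heat_semigroup s (%z. f z * a) x = heat_semigroup s f x * a"
 by (simp add: heat_semigroup_def mult.assoc[symmetric])

section \<open>Construction and uniqueness of mild solutions\<close>

context noise
begin

definition Z_W :: "(real => real => real) => real => real => 'a => real" where
 "Z_W = l2_noise.Z W_rel"

definition Z_N :: "('e => real) => (real => real => real) => real => real => 'a => real" where
 "Z_N g = l2_noise.Z (N_rel g)"

lemma jump_noise: "jump_data c \<nu> g ==> l2_noise M F (rnorm \<nu> g) (N_rel g)"
 by (intro N_noise jump_data_l2)

text \<open>Every mild solution is a version of the constructed field at positive times, so that
  failure of regularity can be shown for all solutions at once.\<close>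

theorem mild_solution_AE:
 assumes u: "mild_solution M F W \<nu> N h f (%_ x v. f2 x * g v) u"
  and h: "l2_hoelder_drift M \<beta> h" "0 < \<beta>" "\<beta> <= 1"
  and f: "hoelder_noise_data \<gamma> f" "hoelder_noise_data \<gamma> (%_. f2)" "0 < \<gamma>" "\<gamma> < 1" and g: "jump_data c \<nu> g"
  and t: "0 < t"
 shows "AE w in M. u t x w = l2_drift.drift_integral h heat_kernel t x w + (Z_W f t x w + Z_N g (%_. f2) t x w)"
proof -
 interpret D: l2_drift M h \<beta> by (intro l2_drift.intro l2_drift_axioms.intro prob_space_axioms h)
 have t0: "0 <= t" using t by simp
 obtain I J where I: "has_wiener_integral M F W t (%r _. heat_semigroup (t - r) (f r) x) I"
  and J: "has_levy_integral M F \<nu> N t (%r v _. heat_semigroup (t - r) (%z. f2 z * g v) x) J"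
  and eq: "AE w in M. u t x w = (LINT r:{0..t}|lborel. heat_semigroup (t - r) (%z. h r z w) x) + I w + J w"
  using u t unfolding mild_solution_def by blast
 have "W_rel t (%r. heat_semigroup (t - r) (f r) x) (Z_W f t x)"
  unfolding Z_W_def by (rule l2_noise.Z_integral(1)[OF W_noise f(1,3,4) t])
 then have "has_wiener_integral M F W t (%r _. heat_semigroup (t - r) (f r) x) (Z_W f t x)" by (simp only: W_rel_def)
 note I' = wiener_integral_unique[OF t0 I this]
 have "N_rel g t (%r. heat_semigroup (t - r) f2 x) (Z_N g (%_. f2) t x)"
  unfolding Z_N_def by (rule l2_noise.Z_integral(1)[OF jump_noise[OF g] f(2-4) t])
 then have "has_levy_integral M F \<nu> N t (%r v _. heat_semigroup (t - r) (%z. f2 z * g v) x) (Z_N g (%_. f2) t x)"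
  by (simp only: N_rel_def heat_semigroup_scale)
 note J' = levy_integral_unique[OF t0 J this]
 show ?thesis
  using eq I' J' D.drift_integral(4)[OF heat_time_kernels(1), of t x]
  by eventually_elim (simp add: heat_semigroup_def)
qed

text \<open>Both noises are always present; an absent one has coefficient zero. One construction
  thus covers all three problems.\<close>

theorem mild_existence:
 assumes \<alpha>: "0 < \<alpha>" and h: "drift_data M F \<beta> h" "0 < \<beta>" and f: "holder_data \<alpha> f" "holder_data \<alpha> (%_. f2)"
  and g: "jump_data c \<nu> g"
 shows "\<exists>u. mild_solution M F W \<nu> N h f (%_ x v. f2 x * g v) u \<and> (\<forall>x. AE w in M. u 0 x w = 0) \<and>
  (\<alpha> < 1 --> linf_loc (holder1_l2_norm M \<alpha>) u)"
proof -
 \<comment> \<open>For \<alpha> >= 1 no Hoelder bound with exponent \<alpha> is claimed, and any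
   exponent in (0,1) yields a mild solution.\<close>
 define \<gamma> where "\<gamma> = (if \<alpha> < 1 then \<alpha> else 1/2)"
 define \<beta>' where "\<beta>' = min \<beta> \<gamma>"
 have \<gamma>: "0 < \<gamma>" "\<gamma> < 1" "\<gamma> <= \<alpha>" using \<alpha> by (auto simp: \<gamma>_def)
 have \<beta>': "0 < \<beta>'" "\<beta>' <= \<beta>" "\<beta>' <= 1" "0 < \<beta>'/2" "\<beta>'/2 <= \<gamma>/2" "\<beta>'/2 <= 1" using h(2) \<gamma> by (auto simp: \<beta>'_def min_def)
 interpret D: l2_drift M h \<beta>'
  by (intro l2_drift.intro l2_drift_axioms.intro prob_space_axioms drift_data_l2[OF h(1)] \<beta>')
 have f1: "hoelder_noise_data \<gamma> f" and f2: "hoelder_noise_data \<gamma> (%_. f2)"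
  using holder_data_noise f \<gamma> by auto
 have regD: "regular_field M \<gamma> (\<beta>'/2) (D.drift_integral heat_kernel) (D.drift_integral heat_kernel_deriv)"
  using \<gamma> \<beta>' by (intro D.drift_field_regular) auto
 have regW: "regular_field M \<gamma> (\<beta>'/2) (Z_W f) (l2_noise.Z' W_rel f)"
  unfolding Z_W_def by (rule l2_noise.noise_field_regular[OF W_noise f1 \<gamma>(1,2) \<beta>'(4,5)])
 have regN: "regular_field M \<gamma> (\<beta>'/2) (Z_N g (%_. f2)) (l2_noise.Z' (N_rel g) (%_. f2))"
  unfolding Z_N_def by (rule l2_noise.noise_field_regular[OF jump_noise[OF g] f2 \<gamma>(1,2) \<beta>'(4,5)])
 define X where "X t x w = D.drift_integral heat_kernel t x w + (Z_W f t x w + Z_N g (%_. f2) t x w)" for t x w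
 note reg = regular_field_add[OF regD regular_field_add[OF regW regN], folded X_def]
 have XF: "X t x \<in> borel_measurable (F t)" if t: "0 <= t" for t x
 proof -
  have "h r z \<in> borel_measurable (F t)" if "0 <= r" "r <= t" for r z
   using h(1) that unfolding drift_data_def adapted_field_def by (blast intro: F_measurable_le)
  from D.drift_integral(5)[OF heat_time_kernels(1) complete_M F_subalgebra null_F[OF t] this]
  have "D.drift_integral heat_kernel t x \<in> borel_measurable (F t)" .
  moreover have "Z_W f t x \<in> borel_measurable (F t)"
   unfolding Z_W_def by (rule l2_noise.Z_adapted[OF W_noise f1 \<gamma>(1,2) t])
  moreover have "Z_N g (%_. f2) t x \<in> borel_measurable (F t)"
   unfolding Z_N_def by (rule l2_noise.Z_adapted[OF jump_noise[OF g] f2 \<gamma>(1,2) t])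
  ultimately show ?thesis unfolding X_def[abs_def] by (intro borel_measurable_add)
 qed
 obtain u where u: "jointly_measurable M u" "adapted_field F u" "!!t x. 0 <= t ==> AE w in M. u t x w = X t x w"
  "!!x. l2_cadlag M (%t. u t x)" "linf_loc (w1inf_l2_norm M) u" "linf_loc (holder1_l2_norm M \<gamma>) u"
  using regular_field_solution[OF reg \<gamma>(1) \<beta>'(4,6) XF] by blast
 have "mild_solution M F W \<nu> N h f (%_ x v. f2 x * g v) u"
  unfolding mild_solution_def
 proof (intro conjI u(1,2,5) allI impI)
  show "l2_cadlag M (%t. u t x)" for x by (rule u(4))
  fix t x :: real assume t: "0 < t"
  have "W_rel t (%r. heat_semigroup (t - r) (f r) x) (Z_W f t x)"
   unfolding Z_W_def by (rule l2_noise.Z_integral(1)[OF W_noise f1 \<gamma>(1,2) t])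
  then have I: "has_wiener_integral M F W t (%r _. heat_semigroup (t - r) (f r) x) (Z_W f t x)" by (simp only: W_rel_def)
  have "N_rel g t (%r. heat_semigroup (t - r) f2 x) (Z_N g (%_. f2) t x)"
   unfolding Z_N_def by (rule l2_noise.Z_integral(1)[OF jump_noise[OF g] f2 \<gamma>(1,2) t])
  then have J: "has_levy_integral M F \<nu> N t (%r v _. heat_semigroup (t - r) (%z. f2 z * g v) x) (Z_N g (%_. f2) t x)"
   by (simp only: N_rel_def heat_semigroup_scale)
  have "AE w in M. u t x w = X t x w" using u(3) t by simp
  then have "AE w in M. u t x w = (LINT r:{0..t}|lborel. heat_semigroup (t - r) (%z. h r z w) x) + Z_W f t x w + Z_N g (%_. f2) t x w"
   using D.drift_integral(4)[OF heat_time_kernels(1), of t x]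
   by eventually_elim (simp add: X_def heat_semigroup_def)
  with I J show "\<exists>I J. has_wiener_integral M F W t (%r _. heat_semigroup (t - r) (f r) x) I \<and>
    has_levy_integral M F \<nu> N t (%r v _. heat_semigroup (t - r) (%z. f2 z * g v) x) J \<and>
    (AE w in M. u t x w = (LINT r:{0..t}|lborel. heat_semigroup (t - r) (%z. h r z w) x) + I w + J w)" by blast
 qed
 moreover have "AE w in M. u 0 x w = 0" for x
 proof -
  have "X 0 x = (%_. 0)" using reg by (simp add: regular_field_def)
  then show ?thesis using u(3)[of 0 x] by simp
 qed
 moreover have "linf_loc (holder1_l2_norm M \<alpha>) u" if "\<alpha> < 1" using u(6) that by (simp add: \<gamma>_def)
 ultimately show ?thesis by blast
qed

text \<open>At positive times every term of the mild formula is determined up to null sets. The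
  formula is silent at t = 0, where mean square right continuity carries the equality over.\<close>

theorem mild_uniqueness:
 assumes u: "mild_solution M F W \<nu> N h f g u" and u': "mild_solution M F W \<nu> N h f g u'"
 shows "versions M u u'"
 unfolding versions_def
proof (intro allI impI)
 have pos: "AE w in M. u t x w = u' t x w" if t: "0 < t" for t x
 proof -
  have t0: "0 <= t" using t by simp
  obtain I J where I: "has_wiener_integral M F W t (%r _. heat_semigroup (t - r) (f r) x) I"
   and J: "has_levy_integral M F \<nu> N t (%r v _. heat_semigroup (t - r) (%z. g r z v) x) J"
   and eq: "AE w in M. u t x w = (LINT r:{0..t}|lborel. heat_semigroup (t - r) (%z. h r z w) x) + I w + J w"
   using u t unfolding mild_solution_def by blast
  obtain I' J' where I': "has_wiener_integral M F W t (%r _. heat_semigroup (t - r) (f r) x) I'"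
   and J': "has_levy_integral M F \<nu> N t (%r v _. heat_semigroup (t - r) (%z. g r z v) x) J'"
   and eq': "AE w in M. u' t x w = (LINT r:{0..t}|lborel. heat_semigroup (t - r) (%z. h r z w) x) + I' w + J' w"
   using u' t unfolding mild_solution_def by blast
  show ?thesis
   using eq eq' wiener_integral_unique[OF t0 I I'] levy_integral_unique[OF t0 J J'] by eventually_elim simp
 qed
 fix t x :: real assume "0 <= t"
 show "AE w in M. u t x w = u' t x w"
 proof (cases "t = 0")
  case True
  have c: "l2_cadlag M (%t. u t x)" "l2_cadlag M (%t. u' t x)" using u u' unfolding mild_solution_def by blast+
  then have fin: "l2norm M (u t x) < \<infinity>" "l2norm M (u' t x) < \<infinity>" if "0 <= t" for t
   using that unfolding l2_cadlag_def by blast+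
  have r: "((%s. l2norm M (%w. u s x w - u 0 x w)) \<longlongrightarrow> 0) (at_right 0)" "((%s. l2norm M (%w. u' s x w - u' 0 x w)) \<longlongrightarrow> 0) (at_right 0)"
   using c unfolding l2_cadlag_def by blast+
  have s: "filterlim (%n. 1 / real (Suc n)) (at_right 0) sequentially"
   unfolding filterlim_at by (intro conjI always_eventually allI)
    (use LIMSEQ_inverse_real_of_nat in \<open>auto simp: inverse_eq_divide simp del: of_nat_Suc\<close>)
  have lim: "(%n. l2norm M (%w. u (1 / real (Suc n)) x w - u 0 x w)) \<longlonglongrightarrow> 0"
   and lim': "(%n. l2norm M (%w. u' (1 / real (Suc n)) x w - u' 0 x w)) \<longlonglongrightarrow> 0"
   by (rule filterlim_compose[OF r(1) s], rule filterlim_compose[OF r(2) s])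
  have "l2norm M (%w. u' (1 / real (Suc n)) x w - u' 0 x w) = l2norm M (%w. u (1 / real (Suc n)) x w - u' 0 x w)" for n
  proof (rule l2norm_cong_AE)
   have "AE w in M. u (1 / real (Suc n)) x w = u' (1 / real (Suc n)) x w" by (rule pos) simp
   then show "AE w in M. u' (1 / real (Suc n)) x w - u' 0 x w = u (1 / real (Suc n)) x w - u' 0 x w"
    by eventually_elim simp
  qed (intro borel_measurable_diff l2norm_finiteD(1) fin; simp)+
  with lim' have "(%n. l2norm M (%w. u (1 / real (Suc n)) x w - u' 0 x w)) \<longlonglongrightarrow> 0" by simp
  from l2_limit_unique[OF lim this] True show ?thesis by simp
 next
  case False
  with \<open>0 <= t\<close> pos show ?thesis by simp
 qed
qed

end

section \<open>Optimality\<close>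

text \<open>Paired with Y, \<phi> becomes a scalar function a with derivative b. The mean value
  theorem for \<open>a z + a (-z) - 2 * a 0\<close> gives x (b z - b (-z)) for some z < x, and the
  points z and -z are at distance 2 z < 2 x.\<close>

lemma l2_second_difference:
 assumes fm: "finite_measure M" and n: "holder1_l2_norm M \<delta> \<phi> <= ennreal K" and K: "0 <= K" and \<delta>: "0 < \<delta>" and x: "0 < x"
 shows "l2norm M (%w. \<phi> x w + \<phi> (-x) w - 2 * \<phi> 0 w) <= ennreal ((K + 1) * 2 powr \<delta> * x powr (1 + \<delta>))"
proof -
 have K1: "0 <= K + 1" using K by simp
 \<comment> \<open>The norm is an infimum over derivatives; the room between K and K + 1 allows one
   to be picked.\<close>
 have "holder1_l2_norm M \<delta> \<phi> < ennreal (K + 1)" using n K by (rule_tac le_less_trans) (auto simp: ennreal_less_iff simp del: ennreal_plus)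
 then obtain \<psi> where \<psi>: "has_l2_derivative M \<phi> \<psi>" and b: "(SUP x. l2norm M (\<phi> x)) + (SUP x. l2norm M (\<psi> x)) +
   holder_quotient \<delta> (%x y. l2norm M (%w. \<psi> x w - \<psi> y w)) < ennreal (K + 1)" (is "?A + ?B + ?C < _")
  unfolding holder1_l2_norm_def INF_less_iff by blast
 have le: "?A <= ?A + ?B + ?C" "?B <= ?A + ?B + ?C" "?C <= ?A + ?B + ?C"
  by (auto intro: add_increasing add_increasing2)
 note le' = order_trans[OF le(1) less_imp_le[OF b]] order_trans[OF le(2) less_imp_le[OF b]] order_trans[OF le(3) less_imp_le[OF b]]
 have "l2norm M (\<phi> z) <= ennreal (K + 1)" "l2norm M (\<psi> z) <= ennreal (K + 1)" for z
  by (rule order_trans[OF SUP_upper[OF UNIV_I] le'(1)], rule order_trans[OF SUP_upper[OF UNIV_I] le'(2)])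
 then have fin: "l2norm M (\<phi> z) < \<infinity>" "l2norm M (\<psi> z) < \<infinity>" for z using l2norm_le_rnorm(2)[OF _ K1] by auto
 have hq: "l2norm M (%w. \<psi> z w - \<psi> z' w) <= ennreal ((K + 1) * \<bar>z - z'\<bar> powr \<delta>)" if "z \<noteq> z'" for z z'
  by (rule holder_quotientD[OF le'(3) K1 that])
 show ?thesis
 proof (rule l2norm_le_dual[OF fm])
  have [measurable]: "\<phi> z \<in> borel_measurable M" for z using fin(1) by (rule l2norm_finiteD(1))
  show "(%w. \<phi> x w + \<phi> (-x) w - 2 * \<phi> 0 w) \<in> borel_measurable M" by measurable
  fix Y assume Y: "l2norm M Y < \<infinity>"
  define a where "a z = (\<integral>w. \<phi> z w * Y w \<partial>M)" for z
  define b where "b z = (\<integral>w. \<psi> z w * Y w \<partial>M)" for z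
  have deriv: "(a has_real_derivative b z) (at z)" for z
   unfolding a_def[abs_def] b_def using \<psi> unfolding has_l2_derivative_def by (intro l2_derivative_test[OF Y fin]) blast
  have deriv2: "((%z. a z + a (-z) - 2 * a 0) has_real_derivative b z - b (-z)) (at z)" for z
  proof -
   have "((%z. a (-z)) has_real_derivative b (-z) * (-1)) (at z)"
    by (rule DERIV_chain2[OF deriv]) (auto intro!: derivative_eq_intros)
   from DERIV_diff[OF DERIV_add[OF deriv this] DERIV_const[of "2 * a 0"]] show ?thesis by simp
  qed
  obtain z where z: "0 < z" "z < x" "(a x + a (-x) - 2 * a 0) - (a 0 + a (-0) - 2 * a 0) = (x - 0) * (b z - b (-z))"
   using MVT2[OF x deriv2] by blast
  have "\<bar>b z - b (-z)\<bar> <= (K + 1) * (2 * z) powr \<delta> * rnorm M Y"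
  proof -
   have le: "l2norm M (%w. \<psi> z w - \<psi> (-z) w) <= ennreal ((K + 1) * (2 * z) powr \<delta>)" using hq[of z "-z"] z by simp
   have p: "0 <= (K + 1) * (2 * z) powr \<delta>" using K1 by simp
   note c = cauchy_schwarz_l2(1)[OF fin(2) Y]
   have "b z - b (-z) = (\<integral>w. (\<psi> z w - \<psi> (-z) w) * Y w \<partial>M)"
    unfolding b_def left_diff_distrib by (rule Bochner_Integration.integral_diff[OF c c, symmetric])
   then show ?thesis
    using cauchy_schwarz_l2(3)[OF l2norm_le_rnorm(2)[OF le p] Y] mult_right_mono[OF l2norm_le_rnorm(1)[OF le p] rnorm_nonneg[of M Y]]
    by linarith
  qed
  also have "... <= (K + 1) * (2 * x) powr \<delta> * rnorm M Y"
   using K1 z \<delta> by (intro mult_right_mono mult_left_mono powr_mono2) auto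
  finally have bb: "\<bar>b z - b (-z)\<bar> <= (K + 1) * (2 * x) powr \<delta> * rnorm M Y" .
  have "(\<integral>w. (\<phi> x w + \<phi> (-x) w - 2 * \<phi> 0 w) * Y w \<partial>M) = a x + a (-x) - 2 * a 0"
  proof -
   note c = cauchy_schwarz_l2(1)[OF fin(1) Y]
   have "(\<integral>w. (\<phi> x w + \<phi> (-x) w - 2 * \<phi> 0 w) * Y w \<partial>M) = (\<integral>w. (\<phi> x w * Y w + \<phi> (-x) w * Y w) - 2 * (\<phi> 0 w * Y w) \<partial>M)"
    by (intro Bochner_Integration.integral_cong) (auto simp: algebra_simps)
   also have "... = a x + a (-x) - 2 * a 0"
    unfolding a_def using c by simp
   finally show ?thesis .
  qed
  also have "... = x * (b z - b (-z))" using z(3) by simp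
  also have "\<bar>...\<bar> <= x * ((K + 1) * (2 * x) powr \<delta> * rnorm M Y)"
   using bb x by (simp add: abs_mult)
  also have "... = (K + 1) * 2 powr \<delta> * x powr (1 + \<delta>) * rnorm M Y"
   using x by (simp add: powr_mult powr_add)
  finally show "\<bar>\<integral>w. (\<phi> x w + \<phi> (-x) w - 2 * \<phi> 0 w) * Y w \<partial>M\<bar> <= (K + 1) * 2 powr \<delta> * x powr (1 + \<delta>) * rnorm M Y" .
 qed (use K1 in simp)
qed

text \<open>A nonempty open interval is not a null set, so a property that holds at almost every
  time can be met in any window.\<close>

lemma AE_lborel_interval:
 assumes "AE t in lborel. P (t::real)" "a < b"
 obtains t where "a < t" "t < b" "P t"
proof (rule ccontr)
 assume "\<not> thesis"
 then have no: "!!t. a < t ==> t < b ==> \<not> P t" using that by blast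
 have "AE t in lborel. t \<notin> {a<..<b}" using assms(1) by eventually_elim (use no in auto)
 then have "{a<..<b} \<in> null_sets lborel" by (subst AE_iff_null_sets) auto
 then have "emeasure lborel {a<..<b} = 0" by (rule null_setsD1)
 then show False using assms(2) by simp
qed

text \<open>With t of order x^2, regularity would bound a positive constant by a multiple of
  \<open>x powr (\<delta> - \<alpha>)\<close>, which fails for small x.\<close>

theorem sharp_second_difference_not_regular:
 fixes u D V :: "real => real => 'a => real"
 assumes fm: "finite_measure M" and \<alpha>: "0 < \<alpha>" "\<alpha> <= 1" "\<alpha> < \<delta>"
  and D: "0 <= K" "!!t x. 0 < t ==> t <= 1 ==> l2norm M (D t x) <= ennreal (K * t)"
  and V: "0 < c" "0 < \<tau>" "!!t x. 0 < x ==> x <= 1 ==> 0 < t ==> t <= \<tau> * x\<^sup>2 ==>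
   ennreal (c * sqrt t * x powr \<alpha>) <= l2norm M (%w. V t x w + V t (-x) w - 2 * V t 0 w)"
  and u: "!!t x. 0 < t ==> AE w in M. u t x w = D t x w + V t x w"
  and meas: "!!t x. 0 < t ==> u t x \<in> borel_measurable M" "!!t x. 0 < t ==> V t x \<in> borel_measurable M"
 shows "\<not> linf_loc (holder1_l2_norm M \<delta>) u"
proof
 assume "linf_loc (holder1_l2_norm M \<delta>) u"
 from linf_locD[of "holder1_l2_norm M \<delta>" u, OF this zero_le_one]
 obtain L where L: "0 <= L" "AE t in lborel. 0 <= t --> t <= 1 --> holder1_l2_norm M \<delta> (u t) <= ennreal L" by metis
 define C where "C = (L + 1) * 2 powr \<delta>"
 \<comment> \<open>The first two bounds keep the times below \<sigma>^2 x^2 within the ranges of V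
   and D. The third gives 16 K \<sigma> <= c: the drift enters with total weight 4, so with at most
   4 K \<sigma>^2 x^2, which is at most half of the noise term c \<sigma>/2 x^(1+\<alpha>). The
   added 1 keeps the denominator positive.\<close>
 define \<sigma> where "\<sigma> = min (sqrt \<tau>) (min 1 (c / (16 * K + 1)))"
 have \<sigma>: "0 < \<sigma>" "\<sigma> <= sqrt \<tau>" "\<sigma> <= 1" "\<sigma> <= c / (16 * K + 1)" using V D by (auto simp: \<sigma>_def)
 have \<sigma>2: "\<sigma>\<^sup>2 <= \<tau>" using power_mono[OF \<sigma>(2), of 2] \<sigma>(1) V(2) by simp
 have C: "0 < C" using L by (simp add: C_def)
 have main: "c * \<sigma> / 4 <= C * x powr (\<delta> - \<alpha>)" if x: "0 < x" "x <= 1" for x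
 proof -
  have x2: "x\<^sup>2 <= 1" "0 < x\<^sup>2" using x power_le_one[of x 2] by auto
  \<comment> \<open>The bound on u holds at almost every time only. In this window sqrt t still
    exceeds \<sigma> x / 2.\<close>
  obtain t where t: "(\<sigma> * x / 2)\<^sup>2 < t" "t < \<sigma>\<^sup>2 * x\<^sup>2" "0 <= t --> t <= 1 --> holder1_l2_norm M \<delta> (u t) <= ennreal L"
   by (rule AE_lborel_interval[OF L(2), of "(\<sigma> * x / 2)\<^sup>2" "\<sigma>\<^sup>2 * x\<^sup>2"]) (use \<sigma>(1) x in \<open>auto simp: power_mult_distrib power_divide\<close>)
  have t0: "0 < t" using t(1) zero_le_power2[of "\<sigma> * x / 2"] by linarith
  have "\<sigma>\<^sup>2 * x\<^sup>2 <= 1 * 1" using power_le_one[of \<sigma> 2] \<sigma>(1,3) x2 by (intro mult_mono) auto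
  then have t1: "t <= 1" using t(2) by simp
  have "\<sigma>\<^sup>2 * x\<^sup>2 <= \<tau> * x\<^sup>2" using \<sigma>2 by (rule mult_right_mono) simp
  then have t\<tau>: "t <= \<tau> * x\<^sup>2" using t(2) by simp
  have n: "holder1_l2_norm M \<delta> (u t) <= ennreal L" using t(3) t0 t1 by simp
  let ?S = "%X w. X t x w + X t (-x) w - 2 * X t 0 w"
  have Dt: "0 <= K * t" using D(1) t0 by simp
  have [measurable]: "D t y \<in> borel_measurable M" for y
   using l2norm_finiteD(1)[OF l2norm_le_rnorm(2)[OF D(2)[OF t0 t1] Dt]] .
  note [measurable] = meas[OF t0]
  have "ennreal (c * sqrt t * x powr \<alpha>) <= l2norm M (?S V)" by (rule V(3)[OF x t0 t\<tau>])
  also have "... = l2norm M (%w. ?S u w - ?S D w)"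
  proof (rule l2norm_cong_AE)
   show "AE w in M. ?S V w = ?S u w - ?S D w"
    using u[OF t0, of x] u[OF t0, of "-x"] u[OF t0, of 0] by eventually_elim simp
  qed measurable
  also have "... <= l2norm M (?S u) + l2norm M (?S D)" by (rule l2norm_triangle_diff)
  also have "... <= ennreal (C * x powr (1 + \<delta>)) + ennreal (4 * (K * t))"
  proof (rule add_mono)
   show "l2norm M (?S u) <= ennreal (C * x powr (1 + \<delta>))"
    unfolding C_def by (rule l2_second_difference[OF fm n L(1) _ x(1)]) (use \<alpha> in simp)
   have "l2norm M (%w. 2 * D t 0 w) <= ennreal (2 * (K * t))"
    unfolding l2norm_scale using mult_left_mono[OF D(2)[OF t0 t1, of 0], of "ennreal 2"] Dt by (simp add: ennreal_mult)
   then have "l2norm M (?S D) <= (ennreal (K * t) + ennreal (K * t)) + ennreal (2 * (K * t))"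
    by (intro order_trans[OF l2norm_triangle_diff] add_mono order_trans[OF l2norm_triangle] D(2) t0 t1)
   also have "... = ennreal (4 * (K * t))"
    using Dt by (simp add: ennreal_plus[symmetric] del: ennreal_plus)
   finally show "l2norm M (?S D) <= ennreal (4 * (K * t))" .
  qed
  finally have le: "c * sqrt t * x powr \<alpha> <= C * x powr (1 + \<delta>) + 4 * (K * t)"
   using C Dt by (simp add: ennreal_plus[symmetric] del: ennreal_plus)
  have "\<sigma> * x / 2 <= sqrt t" using t(1) by (intro real_le_rsqrt) simp
  then have "c * (\<sigma> * x / 2) * x powr \<alpha> <= c * sqrt t * x powr \<alpha>"
   using V(1) by (intro mult_right_mono mult_left_mono) auto
  moreover have "4 * (K * t) <= c * \<sigma> / 4 * (x * x powr \<alpha>)"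
  proof -
   have "x <= x powr \<alpha>" using powr_mono'[of \<alpha> 1 x] \<alpha> x by simp
   then have xx: "x\<^sup>2 <= x * x powr \<alpha>" using x by (simp add: power2_eq_square)
   have "\<sigma> * (16 * K + 1) <= c" using \<sigma>(4) D(1) by (simp add: pos_le_divide_eq)
   then have k: "16 * (K * \<sigma>) <= c" using \<sigma>(1) by (simp add: algebra_simps)
   have "4 * (K * t) <= 4 * (K * (\<sigma>\<^sup>2 * x\<^sup>2))" using t(2) D(1) by (intro mult_left_mono) auto
   also have "... = 16 * (K * \<sigma>) * (\<sigma> / 4 * x\<^sup>2)" by (simp add: power2_eq_square)
   also have "... <= c * (\<sigma> / 4 * (x * x powr \<alpha>))" using k xx \<sigma>(1) V(1) by (intro mult_mono mult_left_mono) auto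
   finally show ?thesis by simp
  qed
  ultimately have "c * \<sigma> / 4 * (x * x powr \<alpha>) <= C * x powr (1 + \<delta>)" using le by simp
  also have "x powr (1 + \<delta>) = x powr (\<delta> - \<alpha>) * (x * x powr \<alpha>)"
   using x powr_add[of x "\<delta> - \<alpha>" "1 + \<alpha>"] powr_add[of x 1 \<alpha>] by (simp add: add.commute)
  finally have "c * \<sigma> / 4 * (x * x powr \<alpha>) <= C * x powr (\<delta> - \<alpha>) * (x * x powr \<alpha>)" by (simp add: mult.assoc)
  then show ?thesis using x by (simp add: mult_le_cancel_right)
 qed
 \<comment> \<open>With \<open>x powr (\<delta> - \<alpha>) <= y\<close> the right side of
   \<open>main\<close> is at most c \<sigma>/8, below the left side c \<sigma>/4.\<close>
 define y where "y = c * \<sigma> / (8 * C)"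
 define x where "x = min 1 (y powr (1 / (\<delta> - \<alpha>)))"
 have y: "0 < y" using V(1) \<sigma>(1) C by (simp add: y_def)
 have x: "0 < x" "x <= 1" using y by (auto simp: x_def)
 have "x powr (\<delta> - \<alpha>) <= (y powr (1 / (\<delta> - \<alpha>))) powr (\<delta> - \<alpha>)" using x \<alpha>(3) by (intro powr_mono2) (auto simp: x_def)
 also have "... = y" using y \<alpha>(3) by (simp add: powr_powr)
 finally have "C * x powr (\<delta> - \<alpha>) <= C * y" using C by (intro mult_left_mono) auto
 moreover have "C * y = c * \<sigma> / 8" using C by (simp add: y_def)
 moreover have "0 < c * \<sigma>" using V(1) \<sigma>(1) by simp
 ultimately show False using main[OF x] by linarith
qed

section \<open>Lower bounds for the noise\<close>

lemma l2norm_time_const: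
 assumes "0 <= t"
 shows "l2norm (time_measure t) (%_. a) = ennreal (\<bar>a\<bar> * sqrt t)"
proof -
 interpret finite_measure "time_measure t" by (rule finite_time_measure)
 have "measure (time_measure t) (space (time_measure t)) = t"
  using assms by (simp add: space_restrict_space measure_restrict_space)
 then show ?thesis by (simp add: l2norm_def real_sqrt_mult mult.commute)
qed

text \<open>What optimality takes from a profile: it vanishes to the left of 0 and grows at least
  like x^\<alpha> to the right, the comparison being made at the base point 0.\<close>

lemma sharp_profileD:
 assumes f: "sharp_profile Y \<alpha> f" and Y: "0 \<in> Y" and \<alpha>: "0 < \<alpha>"
 shows "\<alpha> <= 1" "!!x. x <= 0 ==> f x = 0" "\<exists>c>0. \<forall>x. 0 <= x --> x <= 1 --> c * x powr \<alpha> <= f x"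
  "\<exists>H. hoelder_function f H H \<alpha>"
proof -
 define H where "H = enn2real (holder_norm \<alpha> f)"
 have "holder_norm \<alpha> f < \<infinity>" using f by (simp add: sharp_profile_def)
 then have "holder_norm \<alpha> f <= ennreal H" by (simp add: H_def)
 note h = holder_normD[OF this, unfolded H_def, OF enn2real_nonneg, folded H_def]
 have H: "0 <= H" by (simp add: H_def)
 have nn: "0 <= f x" for x using f by (simp add: sharp_profile_def)
 have neg: "f x = 0" if "x < 0" for x
 proof (rule ccontr)
  assume "f x \<noteq> 0"
  then have "x \<in> closure {x. f x \<noteq> 0}" using closure_subset[of "{x. f x \<noteq> 0}"] by blast
  then show False using f that by (auto simp: sharp_profile_def)
 qed
 \<comment> \<open>The support condition yields zeros for x < 0 only, since 0 belongs to {0..};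
   Hoelder continuity extends the value to 0.\<close>
 have zero: "f 0 = 0"
 proof -
  have "\<forall>\<^sub>F e in at 0. f 0 <= H * \<bar>e\<bar> powr \<alpha>"
   unfolding eventually_at
  proof (intro exI[of _ 1] conjI ballI impI)
   fix e :: real assume "e \<noteq> 0 \<and> dist e 0 < 1"
   then have "f (- \<bar>e\<bar>) = 0" by (intro neg) simp
   then show "f 0 <= H * \<bar>e\<bar> powr \<alpha>" using h(2)[of 0 "- \<bar>e\<bar>"] nn[of 0] by simp
  qed simp
  then have "f 0 <= 0" by (rule tendsto_lowerbound[OF tendsto_powr_at_0[OF \<alpha>, of H]]) simp
  with nn[of 0] show ?thesis by simp
 qed
 then show zero': "f x = 0" if "x <= 0" for x using neg[of x] that by (cases "x = 0") auto
 obtain c where c: "0 < c" "!!x y. x \<in> {0..1} ==> y \<in> Y ==> c * \<bar>x - y\<bar> powr \<alpha> <= \<bar>f x - f y\<bar>"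
  using f unfolding sharp_profile_def by blast
 have low: "c * x powr \<alpha> <= f x" if "0 <= x" "x <= 1" for x
  using c(2)[of x 0] Y that nn[of x] by (simp add: zero)
 then show "\<exists>c>0. \<forall>x. 0 <= x --> x <= 1 --> c * x powr \<alpha> <= f x" using c(1) by blast
 \<comment> \<open>A larger exponent would give f derivative 0 everywhere, making it constant,
   against f 0 = 0 and the lower bound at 1.\<close>
 show \<alpha>1: "\<alpha> <= 1"
 proof (rule ccontr)
  assume "\<not> \<alpha> <= 1"
  then have a: "0 < \<alpha> - 1" by simp
  have "(f has_real_derivative 0) (at x)" for x
   unfolding DERIV_def
  proof (rule Lim_null_comparison[OF _ tendsto_powr_at_0[OF a, of H]])
   show "\<forall>\<^sub>F e in at 0. norm ((f (x + e) - f x) / e) <= H * \<bar>e\<bar> powr (\<alpha> - 1)"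
    unfolding eventually_at
   proof (intro exI[of _ 1] conjI ballI impI)
    fix e :: real assume e: "e \<noteq> 0 \<and> dist e 0 < 1"
    then have "\<bar>e\<bar> powr (\<alpha> - 1) * \<bar>e\<bar> = \<bar>e\<bar> powr \<alpha>" using powr_add[of "\<bar>e\<bar>" "\<alpha> - 1" 1] by simp
    then have "\<bar>f (x + e) - f x\<bar> <= H * \<bar>e\<bar> powr (\<alpha> - 1) * \<bar>e\<bar>" using h(2)[of "x + e" x] by (simp add: mult.assoc)
    then show "norm ((f (x + e) - f x) / e) <= H * \<bar>e\<bar> powr (\<alpha> - 1)" using e by (simp add: pos_divide_le_eq)
   qed simp
  qed
  then have "f 1 = f 0" by (intro DERIV_isconst_all) blast
  then show False using low[of 1] c(1) zero by simp
 qed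
 show "\<exists>H. hoelder_function f H H \<alpha>"
 proof (intro exI[of _ H])
  show "hoelder_function f H H \<alpha>"
   by (rule hoelder_function.intro) (use f h H \<alpha> \<alpha>1 in \<open>auto simp: sharp_profile_def intro: borel_measurable_mono\<close>)
 qed
qed

context l2_noise
begin

lemma Z_second_difference:
 assumes "hoelder_noise_data \<gamma> f" "0 < \<gamma>" "\<gamma> < 1" "0 < t"
 shows "R t (%r. heat_semigroup (t - r) (f r) x + heat_semigroup (t - r) (f r) (-x) - 2 * heat_semigroup (t - r) (f r) 0)
  (%w. Z f t x w + Z f t (-x) w - 2 * Z f t 0 w)"
proof -
 have t0: "0 <= t" using assms(4) by simp
 note Z = Z_integral(1)[OF assms]
 show ?thesis using R_linear[OF t0 R_linear[OF t0 Z[of x] Z[of "-x"], of 1 1] Z[of 0], of 1 "-2"] by simp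
qed

text \<open>As f vanishes at 0 and -x, its second difference is \<open>f x\<close>, at least c
  x^\<alpha>. The semigroup preserves half of this up to times of order x^2, so the integrand is at
  least c/2 x^\<alpha> on [0,t], and the isometry contributes the factor sqrt t.\<close>

theorem Z_second_difference_lower:
 assumes f: "hoelder_noise_data \<gamma> (%_. f)" "0 < \<gamma>" "\<gamma> < 1" and Y: "sharp_profile Y \<alpha> f" "0 \<in> Y" "0 < \<alpha>" and \<kappa>: "0 < \<kappa>"
 shows "\<exists>c>0. \<exists>\<tau>>0. \<forall>t x. 0 < x --> x <= 1 --> 0 < t --> t <= \<tau> * x\<^sup>2 -->
  ennreal (c * sqrt t * x powr \<alpha>) <= l2norm M (%w. Z (%_. f) t x w + Z (%_. f) t (-x) w - 2 * Z (%_. f) t 0 w)"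
proof -
 note prof = sharp_profileD[OF Y]
 obtain c where c: "0 < c" "!!x. 0 <= x ==> x <= 1 ==> c * x powr \<alpha> <= f x" using prof(3) by blast
 obtain H where "hoelder_function f H H \<alpha>" using prof(4) by blast
 then interpret hoelder_function f H H \<alpha> .
 \<comment> \<open>By \<open>heat_semigroup_near_identity\<close> the error is 6 H s^(\<alpha>/2) at
   each of x, -x and 0, with weights 1, 1 and 2. The total 24 H s^(\<alpha>/2) must not exceed c
   x^\<alpha> / 2, and s^(\<alpha>/2) <= q x^\<alpha> for s <= \<tau> x^2, hence 48.\<close>
 define q where "q = c / (48 * H + 1)"
 define \<tau> where "\<tau> = q powr (2 / \<alpha>)"
 have q: "0 < q" using c H_nonneg by (simp add: q_def add_nonneg_pos)
 have \<tau>: "0 < \<tau>" "\<tau> powr (\<alpha>/2) = q" using q Y(3) by (auto simp: \<tau>_def powr_powr)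
 have Hq: "48 * (H * q) <= c"
 proof -
  have "q * (48 * H + 1) = c" using H_nonneg by (simp add: q_def add_nonneg_pos less_imp_neq[symmetric])
  then show ?thesis using q by (simp add: algebra_simps)
 qed
 have "ennreal (\<kappa> * c / 2 * sqrt t * x powr \<alpha>) <= l2norm M (%w. Z (%_. f) t x w + Z (%_. f) t (-x) w - 2 * Z (%_. f) t 0 w)"
  if x: "0 < x" "x <= 1" and t: "0 < t" "t <= \<tau> * x\<^sup>2" for t x
 proof -
  let ?\<phi> = "%r. heat_semigroup (t - r) f x + heat_semigroup (t - r) f (-x) - 2 * heat_semigroup (t - r) f 0"
  have t0: "0 <= t" using t by simp
  have low: "c / 2 * x powr \<alpha> <= ?\<phi> r" if r: "0 <= r" "r < t" for r
  proof -
   have "(t - r) powr (\<alpha>/2) <= (\<tau> * x\<^sup>2) powr (\<alpha>/2)" using r t Y(3) by (intro powr_mono2) auto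
   also have "... = q * x powr \<alpha>"
    using \<tau> x powr_powr[of x 2 "\<alpha>/2"] by (simp add: powr_mult)
   finally have "H * (t - r) powr (\<alpha>/2) <= H * (q * x powr \<alpha>)" using H_nonneg by (rule mult_left_mono)
   also have "48 * (H * (q * x powr \<alpha>)) <= c * x powr \<alpha>" using mult_right_mono[OF Hq, of "x powr \<alpha>"] by (simp add: mult.assoc)
   finally have e: "48 * (H * (t - r) powr (\<alpha>/2)) <= c * x powr \<alpha>" by simp
   have near: "\<bar>heat_semigroup (t - r) f z - f z\<bar> <= 6 * (H * (t - r) powr (\<alpha>/2))" for z
    using heat_semigroup_near_identity[of "t - r" z] r by (simp add: mult.assoc)
   have "f (-x) = 0" "f 0 = 0" using prof(2) x by auto
   then show ?thesis using near[of x] near[of "-x"] near[of 0] c(2)[of x] x e by (simp add: abs_le_iff)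
  qed
  have "ennreal (c / 2 * x powr \<alpha> * sqrt t) = l2norm (time_measure t) (%_. c / 2 * x powr \<alpha>)"
   using l2norm_time_const[OF t0, of "c / 2 * x powr \<alpha>"] c(1) by (simp add: abs_mult)
  also have "... <= l2norm (time_measure t) ?\<phi>"
  proof (rule l2norm_mono)
   show "AE r in time_measure t. \<bar>c / 2 * x powr \<alpha>\<bar> <= \<bar>?\<phi> r\<bar>"
   proof (subst AE_restrict_space_iff)
    show "AE r in lborel. r \<in> {0..t} --> \<bar>c / 2 * x powr \<alpha>\<bar> <= \<bar>?\<phi> r\<bar>"
     using AE_lborel_singleton[of t]
    proof eventually_elim
     case (elim r)
     show ?case
     proof
      assume "r \<in> {0..t}"
      then have "c / 2 * x powr \<alpha> <= ?\<phi> r" using elim by (intro low) auto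
      moreover have "0 <= c / 2 * x powr \<alpha>" using c(1) by simp
      ultimately show "\<bar>c / 2 * x powr \<alpha>\<bar> <= \<bar>?\<phi> r\<bar>" by linarith
     qed
    qed
   qed simp
  qed simp
  finally have "ennreal \<kappa> * ennreal (c / 2 * x powr \<alpha> * sqrt t) <= ennreal \<kappa> * l2norm (time_measure t) ?\<phi>"
   by (rule mult_left_mono) simp
  also have "... = l2norm M (%w. Z (%_. f) t x w + Z (%_. f) t (-x) w - 2 * Z (%_. f) t 0 w)"
   by (rule R_norm[OF t0 Z_second_difference[OF f t(1)], symmetric])
  also have "ennreal \<kappa> * ennreal (c / 2 * x powr \<alpha> * sqrt t) = ennreal (\<kappa> * c / 2 * sqrt t * x powr \<alpha>)"
   using \<kappa> c(1) t0 by (subst ennreal_mult[symmetric]) (auto simp: ac_simps)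
  finally show ?thesis .
 qed
 then show ?thesis using \<kappa> c(1) \<tau>(1) by (intro exI[of _ "\<kappa> * c / 2"] conjI exI[of _ \<tau>]) auto
qed

end

text \<open>Pythagoras: an orthogonal summand cannot shorten I.\<close>

lemma l2norm_orthogonal:
 assumes I: "l2norm M I < \<infinity>" and J: "l2norm M J < \<infinity>" and orth: "(\<integral>w. I w * J w \<partial>M) = 0"
 shows "l2norm M I <= l2norm M (%w. I w + J w)"
proof -
 note i = l2norm_finiteD(2)[OF I] l2norm_finiteD(2)[OF J] cauchy_schwarz_l2(1)[OF I J]
 note IJ = l2norm_add_finite[OF I J]
 have "(\<integral>w. (I w + J w)\<^sup>2 \<partial>M) = (\<integral>w. ((I w)\<^sup>2 + (J w)\<^sup>2) + 2 * (I w * J w) \<partial>M)"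
  by (intro Bochner_Integration.integral_cong) (auto simp: power2_sum)
 also have "... = (\<integral>w. (I w)\<^sup>2 \<partial>M) + (\<integral>w. (J w)\<^sup>2 \<partial>M)" using i orth by simp
 finally have "(\<integral>w. (I w)\<^sup>2 \<partial>M) <= (\<integral>w. (I w + J w)\<^sup>2 \<partial>M)" by simp
 then show ?thesis unfolding l2norm_finiteD(3)[OF I] l2norm_finiteD(3)[OF IJ] rnorm_def by (intro ennreal_leI real_sqrt_le_mono)
qed

section \<open>Failure of higher regularity\<close>

context noise
begin

text \<open>One statement for all three problems: a single sharp noise suffices. The second
  differences of the two noises are orthogonal, so their sum is at least as large as either of
  them.\<close>

theorem mild_not_regular:
 assumes u: "mild_solution M F W \<nu> N h (%_. f1) (%_ x v. f2 x * g v) u"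
  and h: "l2_hoelder_drift M \<beta> h" "0 < \<beta>" "\<beta> <= 1" and g: "jump_data c \<nu> g"
  and f: "holder_data \<alpha> (%_. f1)" "holder_data \<alpha> (%_. f2)" and \<alpha>: "0 < \<alpha>" "\<alpha> < \<delta>" and Y: "0 \<in> Y"
  and sharp: "sharp_profile Y \<alpha> f1 \<or> sharp_profile Y \<alpha> f2 \<and> \<not> (AE v in \<nu>. g v = 0)"
 shows "\<not> linf_loc (holder1_l2_norm M \<delta>) u"
proof -
 interpret D: l2_drift M h \<beta> by (intro l2_drift.intro l2_drift_axioms.intro prob_space_axioms h)
 have \<alpha>1: "\<alpha> <= 1" using sharp sharp_profileD(1)[OF _ Y \<alpha>(1)] by blast
 \<comment> \<open>The stochastic convolutions are constructed with an exponent below 1, whereas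
   \<alpha> may equal 1 here; the lower bound is still stated with \<alpha>.\<close>
 define \<gamma> where "\<gamma> = min \<alpha> (1/2)"
 have \<gamma>: "0 < \<gamma>" "\<gamma> < 1" "\<gamma> <= 1" "\<gamma> <= \<alpha>" using \<alpha> by (auto simp: \<gamma>_def)
 note f1 = holder_data_noise[OF f(1) \<gamma>(1,3,4)] and f2 = holder_data_noise[OF f(2) \<gamma>(1,3,4)]
 let ?W = "Z_W (%_. f1)" and ?N = "Z_N g (%_. f2)"
 let ?S = "%Z t x w. Z t x w + Z t (-x) w - 2 * Z t 0 w"
 have meas: "?W t x \<in> borel_measurable M" "?N t x \<in> borel_measurable M" "u t x \<in> borel_measurable M" if t: "0 < t" for t x
 proof -
  have t0: "0 <= t" using t by simp
  show "?W t x \<in> borel_measurable M"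
   unfolding Z_W_def by (rule F_measurable_M[OF l2_noise.Z_adapted[OF W_noise f1 \<gamma>(1,2) t0]])
  show "?N t x \<in> borel_measurable M"
   unfolding Z_N_def by (rule F_measurable_M[OF l2_noise.Z_adapted[OF jump_noise[OF g] f2 \<gamma>(1,2) t0]])
  have "u t x \<in> borel_measurable (F t)" using u t0 unfolding mild_solution_def adapted_field_def by blast
  then show "u t x \<in> borel_measurable M" by (rule F_measurable_M)
 qed
 have orth: "l2norm M (?S ?W t x) <= l2norm M (%w. ?S ?W t x w + ?S ?N t x w)"
  "l2norm M (?S ?N t x) <= l2norm M (%w. ?S ?W t x w + ?S ?N t x w)" if t: "0 < t" for t x
 proof -
  have t0: "0 <= t" using t by simp
  have rW: "W_rel t (%r. heat_semigroup (t - r) f1 x + heat_semigroup (t - r) f1 (-x) - 2 * heat_semigroup (t - r) f1 0) (?S ?W t x)"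
   unfolding Z_W_def by (rule l2_noise.Z_second_difference[OF W_noise f1 \<gamma>(1,2) t])
  have rN: "N_rel g t (%r. heat_semigroup (t - r) f2 x + heat_semigroup (t - r) f2 (-x) - 2 * heat_semigroup (t - r) f2 0) (?S ?N t x)"
   unfolding Z_N_def by (rule l2_noise.Z_second_difference[OF jump_noise[OF g] f2 \<gamma>(1,2) t])
  have fin: "l2norm M (?S ?W t x) < \<infinity>" "l2norm M (?S ?N t x) < \<infinity>"
   unfolding l2_noise.R_norm[OF W_noise, OF t0 rW] l2_noise.R_norm[OF jump_noise[OF g], OF t0 rN]
   using l2_noise.R_l2[OF W_noise, OF rW] l2_noise.R_l2[OF jump_noise[OF g], OF rN] by (simp_all add: ennreal_mult_less_top)
  have "(\<integral>w. ?S ?W t x w * ?S ?N t x w \<partial>M) = 0"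
   using integrals_orthogonal[where I = "?S ?W t x" and J = "?S ?N t x", OF t0 rW rN jump_data_l2[OF g]] .
  then have "(\<integral>w. ?S ?W t x w * ?S ?N t x w \<partial>M) = 0" "(\<integral>w. ?S ?N t x w * ?S ?W t x w \<partial>M) = 0"
   by (simp_all only: mult.commute)
  then show "l2norm M (?S ?W t x) <= l2norm M (%w. ?S ?W t x w + ?S ?N t x w)"
   "l2norm M (?S ?N t x) <= l2norm M (%w. ?S ?W t x w + ?S ?N t x w)"
   using l2norm_orthogonal[of M "?S ?W t x" "?S ?N t x"] l2norm_orthogonal[of M "?S ?N t x" "?S ?W t x"] fin
   by (simp_all only: add.commute)
 qed
 have "\<exists>c>0. \<exists>\<tau>>0. \<forall>t x. 0 < x --> x <= 1 --> 0 < t --> t <= \<tau> * x\<^sup>2 -->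
  ennreal (c * sqrt t * x powr \<alpha>) <= l2norm M (%w. ?S ?W t x w + ?S ?N t x w)"
  using sharp
 proof
  assume s: "sharp_profile Y \<alpha> f1"
  obtain c0 \<tau> where c0: "0 < c0" "0 < \<tau>" and low: "!!t x. 0 < x ==> x <= 1 ==> 0 < t ==> t <= \<tau> * x\<^sup>2 ==>
    ennreal (c0 * sqrt t * x powr \<alpha>) <= l2norm M (?S ?W t x)"
   using l2_noise.Z_second_difference_lower[OF W_noise f1 \<gamma>(1,2) s Y \<alpha>(1) zero_less_one, folded Z_W_def] by blast
  then show ?thesis
   by (intro exI[of _ c0] conjI exI[of _ \<tau>] allI impI) (auto intro: order_trans[OF low orth(1)])
 next
  assume s: "sharp_profile Y \<alpha> f2 \<and> \<not> (AE v in \<nu>. g v = 0)"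
  \<comment> \<open>The norm of g is the intensity of the jump noise and would be 0 only for g null
    almost everywhere.\<close>
  have "rnorm \<nu> g \<noteq> 0" using s l2norm_eq_0D[of \<nu> g] l2norm_finiteD(3)[OF jump_data_l2(1)[OF g]] by auto
  then have \<kappa>: "0 < rnorm \<nu> g" using rnorm_nonneg[of \<nu> g] by linarith
  obtain c0 \<tau> where c0: "0 < c0" "0 < \<tau>" and low: "!!t x. 0 < x ==> x <= 1 ==> 0 < t ==> t <= \<tau> * x\<^sup>2 ==>
    ennreal (c0 * sqrt t * x powr \<alpha>) <= l2norm M (?S ?N t x)"
   using l2_noise.Z_second_difference_lower[OF jump_noise[OF g] f2 \<gamma>(1,2) conjunct1[OF s] Y \<alpha>(1) \<kappa>, folded Z_N_def] by blast
  then show ?thesis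
   by (intro exI[of _ c0] conjI exI[of _ \<tau>] allI impI) (auto intro: order_trans[OF low orth(2)])
 qed
 then obtain c0 \<tau> where V: "0 < c0" "0 < \<tau>" "!!t x. 0 < x ==> x <= 1 ==> 0 < t ==> t <= \<tau> * x\<^sup>2 ==>
  ennreal (c0 * sqrt t * x powr \<alpha>) <= l2norm M (%w. ?S ?W t x w + ?S ?N t x w)" by blast
 obtain K where K: "0 <= K" "!!t x. 0 < t ==> t <= 1 ==> l2norm M (D.drift_integral heat_kernel t x) <= ennreal (K * t)"
  using D.drift_small[OF zero_less_one] by blast
 have S: "?S (%t x w. ?W t x w + ?N t x w) t x = (%w. ?S ?W t x w + ?S ?N t x w)" for t x by (auto simp: algebra_simps)
 show ?thesis
 proof (rule sharp_second_difference_not_regular[OF finite_measure_axioms \<alpha>(1) \<alpha>1 \<alpha>(2) K V(1,2)])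
  show "ennreal (c0 * sqrt t * x powr \<alpha>) <= l2norm M (?S (%t x w. ?W t x w + ?N t x w) t x)"
   if "0 < x" "x <= 1" "0 < t" "t <= \<tau> * x\<^sup>2" for t x
   unfolding S by (rule V(3)[OF that])
  show "AE w in M. u t x w = D.drift_integral heat_kernel t x w + (?W t x w + ?N t x w)" if "0 < t" for t x
   by (rule mild_solution_AE[OF u h f1 f2 \<gamma>(1,2) g that])
 qed (auto intro: meas borel_measurable_add)
qed

text \<open>Every \<delta> <= 1 is reached whatever \<beta> is, so the drift is not what limits the
  regularity of u. The iterated integral of the statement is a version of
  \<open>drift_integral\<close>.\<close>

lemma product_drift_regular:
 assumes h1: "holder_data \<beta> h1" and h2: "l2norm M h2 < \<infinity>" and \<beta>: "0 < \<beta>" and \<delta>: "0 < \<delta>" "\<delta> <= 1"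
 shows "linf_loc (holder1_l2_norm M \<delta>)
  (%t x w. LINT r:{0..t}|lborel. LINT z|lborel. heat_kernel (t - r) (x - z) * (h1 r z * h2 w))"
proof -
 define \<beta>' where "\<beta>' = min \<beta> 1"
 have \<beta>': "0 < \<beta>'" "\<beta>' <= \<beta>" "\<beta>' <= 1" using \<beta> by (auto simp: \<beta>'_def)
 interpret D: l2_drift M "%t x w. h1 t x * h2 w" \<beta>'
  by (intro l2_drift.intro l2_drift_axioms.intro prob_space_axioms product_drift_l2[OF h1 h2] \<beta>')
 have reg: "regular_field M \<delta> (\<beta>'/2) (D.drift_integral heat_kernel) (D.drift_integral heat_kernel_deriv)"
  using \<delta> \<beta>' by (intro D.drift_field_regular) auto
 show ?thesis
 proof (rule regular_field_holder[OF reg \<delta>(1)])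
  fix t x :: real
  show "(%w. LINT r:{0..t}|lborel. LINT z|lborel. heat_kernel (t - r) (x - z) * (h1 r z * h2 w)) \<in> borel_measurable M"
   using l2norm_finiteD(1)[OF h2] by (simp add: set_lebesgue_integral_def mult.assoc[symmetric])
  show "AE w in M. (LINT r:{0..t}|lborel. LINT z|lborel. heat_kernel (t - r) (x - z) * (h1 r z * h2 w)) = D.drift_integral heat_kernel t x w"
   using D.drift_integral(4)[OF heat_time_kernels(1), of t x] by eventually_elim simp
 qed
qed

lemma wiener_formula:
 assumes u: "mild_solution M F W \<nu> N h f (%_ _ _. 0) u" and t: "0 < t"
 shows "\<exists>I. has_wiener_integral M F W t (%r _. LINT z|lborel. heat_kernel (t - r) (x - z) * f r z) I \<and>
  (AE w in M. u t x w = (LINT r:{0..t}|lborel. LINT z|lborel. heat_kernel (t - r) (x - z) * h r z w) + I w)"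
proof -
 obtain I J where I: "has_wiener_integral M F W t (%r _. heat_semigroup (t - r) (f r) x) I"
  and J: "has_levy_integral M F \<nu> N t (%r v _. heat_semigroup (t - r) (%z. 0) x) J"
  and eq: "AE w in M. u t x w = (LINT r:{0..t}|lborel. heat_semigroup (t - r) (%z. h r z w) x) + I w + J w"
  using u t unfolding mild_solution_def by blast
 have "heat_semigroup s (%z. 0) x = 0" for s by (simp add: heat_semigroup_def)
 then have J: "has_levy_integral M F \<nu> N t (%r v _. 0) J" using J by simp
 have "AE w in M. J w = 0" by (rule levy_integral_unique[OF less_imp_le[OF t] J zero_levy_integral])
 with eq have "AE w in M. u t x w = (LINT r:{0..t}|lborel. heat_semigroup (t - r) (%z. h r z w) x) + I w"
  by eventually_elim simp
 with I show ?thesis unfolding heat_semigroup_def by blast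
qed

lemma levy_formula:
 assumes u: "mild_solution M F W \<nu> N h (%_ _. 0) (%_ x v. f x * g v) u" and t: "0 < t"
 shows "\<exists>J. has_levy_integral M F \<nu> N t (%r v _. LINT z|lborel. heat_kernel (t - r) (x - z) * (f z * g v)) J \<and>
  (AE w in M. u t x w = (LINT r:{0..t}|lborel. LINT z|lborel. heat_kernel (t - r) (x - z) * h r z w) + J w)"
proof -
 obtain I J where I: "has_wiener_integral M F W t (%r _. heat_semigroup (t - r) (%_. 0) x) I"
  and J: "has_levy_integral M F \<nu> N t (%r v _. heat_semigroup (t - r) (%z. f z * g v) x) J"
  and eq: "AE w in M. u t x w = (LINT r:{0..t}|lborel. heat_semigroup (t - r) (%z. h r z w) x) + I w + J w"
  using u t unfolding mild_solution_def by blast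
 have "heat_semigroup s (%z. 0) x = 0" for s by (simp add: heat_semigroup_def)
 then have I: "has_wiener_integral M F W t (%r _. 0) I" using I by simp
 have "AE w in M. I w = 0" by (rule wiener_integral_unique[OF less_imp_le[OF t] I zero_wiener_integral])
 with eq have "AE w in M. u t x w = (LINT r:{0..t}|lborel. heat_semigroup (t - r) (%z. h r z w) x) + J w"
  by eventually_elim simp
 with J show ?thesis unfolding heat_semigroup_def by blast
qed

end

text \<open>The Hoelder bound is asserted for \<alpha> < 1, where the L2-in-time estimate of the
  noise holds. For jump noise alone, optimality excludes g1 null almost everywhere, as the noise
  would vanish; with both noises the Brownian part is already sharp.\<close>

theorem mainTheorem2:
  fixes M :: "'a measure" and F :: "real \<Rightarrow> 'a measure" and W :: "real \<Rightarrow> 'a \<Rightarrow> real"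
    and c :: real and \<nu> :: "'e::euclidean_space measure" and N :: "'a \<Rightarrow> (real \<times> 'e) measure"
    and \<alpha> :: real
  assumes setting: "noise_setting M F W c \<nu> N"
    and \<alpha>_pos: "0 < \<alpha>"
  shows
    "(\<forall>f h \<beta>. holder_data \<alpha> f \<and> 0 < \<beta> \<and> \<beta> < \<alpha> \<and> drift_data M F \<beta> h \<longrightarrow>
       (\<exists>u. mild_solution M F W \<nu> N h f (\<lambda>_ _ _. 0) u \<and>
          (\<forall>x. AE \<omega> in M. u 0 x \<omega> = 0) \<and>
          (\<alpha> < 1 \<longrightarrow> linf_loc (holder1_l2_norm M \<alpha>) u) \<and>
          (\<forall>t>0. \<forall>x. \<exists>I.
             has_wiener_integral M F W t (\<lambda>r _. LINT z|lborel. heat_kernel (t - r) (x - z) * f r z) I \<and>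
             (AE \<omega> in M. u t x \<omega> =
                (LINT r:{0..t}|lborel. LINT z|lborel. heat_kernel (t - r) (x - z) * h r z \<omega>) + I \<omega>)) \<and>
          (\<forall>u'. mild_solution M F W \<nu> N h f (\<lambda>_ _ _. 0) u' \<longrightarrow> versions M u u')))
     \<and>
     (\<forall>Y f h1 h2 \<beta>.
        0 \<in> Y \<and> Y \<subseteq> {0..1} \<and> sharp_profile Y \<alpha> f \<and> 0 < \<beta> \<and> \<beta> < \<alpha> \<and> holder_data \<beta> h1 \<and>
        l2norm M h2 < \<infinity> \<longrightarrow>
          (\<forall>\<delta>. \<alpha> < \<delta> \<and> \<delta> < 1 \<longrightarrow>
             linf_loc (holder1_l2_norm M \<delta>)
               (\<lambda>t x \<omega>. LINT r:{0..t}|lborel. LINT z|lborel.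
                  heat_kernel (t - r) (x - z) * (h1 r z * h2 \<omega>))) \<and>
          (\<forall>u. mild_solution M F W \<nu> N (\<lambda>t x \<omega>. h1 t x * h2 \<omega>) (\<lambda>_. f) (\<lambda>_ _ _. 0) u \<longrightarrow>
             (\<forall>\<delta>>\<alpha>. \<not> linf_loc (holder1_l2_norm M \<delta>) u)))
     \<and>
     (\<forall>Y f g1 h \<beta>.
        0 \<in> Y \<and> Y \<subseteq> {0..1} \<and> sharp_profile Y \<alpha> f \<and> jump_data c \<nu> g1 \<and>
        0 < \<beta> \<and> \<beta> < \<alpha> \<and> drift_data M F \<beta> h \<longrightarrow>
          (\<exists>u. mild_solution M F W \<nu> N h (\<lambda>_ _. 0) (\<lambda>_ x v. f x * g1 v) u \<and>
             (\<forall>x. AE \<omega> in M. u 0 x \<omega> = 0) \<and>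
             (\<alpha> < 1 \<longrightarrow> linf_loc (holder1_l2_norm M \<alpha>) u) \<and>
             (\<forall>t>0. \<forall>x. \<exists>J.
                has_levy_integral M F \<nu> N t
                  (\<lambda>r v _. LINT z|lborel. heat_kernel (t - r) (x - z) * (f z * g1 v)) J \<and>
                (AE \<omega> in M. u t x \<omega> =
                   (LINT r:{0..t}|lborel. LINT z|lborel. heat_kernel (t - r) (x - z) * h r z \<omega>) + J \<omega>)) \<and>
             (\<forall>u'. mild_solution M F W \<nu> N h (\<lambda>_ _. 0) (\<lambda>_ x v. f x * g1 v) u' \<longrightarrow> versions M u u')) \<and>
          (\<not> (AE v in \<nu>. g1 v = 0) \<longrightarrow>
             (\<forall>u. mild_solution M F W \<nu> N h (\<lambda>_ _. 0) (\<lambda>_ x v. f x * g1 v) u \<longrightarrow>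
                (\<forall>\<delta>>\<alpha>. \<not> linf_loc (holder1_l2_norm M \<delta>) u))))
     \<and>
     (\<forall>Y f1 f2 g1 h \<beta>.
        0 \<in> Y \<and> Y \<subseteq> {0..1} \<and> sharp_profile Y \<alpha> f1 \<and> sharp_profile Y \<alpha> f2 \<and> jump_data c \<nu> g1 \<and>
        0 < \<beta> \<and> \<beta> < \<alpha> \<and> drift_data M F \<beta> h \<longrightarrow>
          (\<exists>u. mild_solution M F W \<nu> N h (\<lambda>_. f1) (\<lambda>_ x v. f2 x * g1 v) u \<and>
             (\<forall>x. AE \<omega> in M. u 0 x \<omega> = 0) \<and>
             (\<alpha> < 1 \<longrightarrow> linf_loc (holder1_l2_norm M \<alpha>) u) \<and>
             (\<forall>u'. mild_solution M F W \<nu> N h (\<lambda>_. f1) (\<lambda>_ x v. f2 x * g1 v) u' \<longrightarrow> versions M u u')) \<and>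
          (\<forall>u. mild_solution M F W \<nu> N h (\<lambda>_. f1) (\<lambda>_ x v. f2 x * g1 v) u \<longrightarrow>
             (\<forall>\<delta>>\<alpha>. \<not> linf_loc (holder1_l2_norm M \<delta>) u)))"
proof -
 interpret noise M F W c \<nu> N by (rule noise.intro[OF setting])
 \<comment> \<open>The drift estimates are for exponents up to 1, while \<beta> may exceed 1 if
   \<alpha> does; the drift is then used with the exponent 1.\<close>
 have exp: "0 < min \<beta> 1" "min \<beta> 1 <= \<beta>" "min \<beta> 1 <= 1" if "0 < \<beta>" for \<beta> :: real using that by auto
 have ex0: "\<exists>u. mild_solution M F W \<nu> N h f (%_ _ _. 0) u \<and> (\<forall>x. AE w in M. u 0 x w = 0) \<and>
   (\<alpha> < 1 --> linf_loc (holder1_l2_norm M \<alpha>) u)" if "holder_data \<alpha> f" "0 < \<beta>" "drift_data M F \<beta> h" for f h \<beta>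
  using mild_existence[OF \<alpha>_pos that(3,2,1) holder_data_zero jump_data_zero] by simp
 have no0: "\<not> linf_loc (holder1_l2_norm M \<delta>) u"
  if "mild_solution M F W \<nu> N (%t x w. h1 t x * h2 w) (%_. f) (%_ _ _. 0) u" "0 \<in> Y" "sharp_profile Y \<alpha> f"
   "0 < \<beta>" "holder_data \<beta> h1" "l2norm M h2 < \<infinity>" "\<alpha> < \<delta>" for Y f h1 h2 \<beta> u \<delta>
 proof -
  \<comment> \<open>The zero jump coefficient is written as a product, the form that
    \<open>mild_not_regular\<close> treats.\<close>
  have "mild_solution M F W \<nu> N (%t x w. h1 t x * h2 w) (%_. f) (%_ x v. (%_. 0) x * (%_. 0) v) u" using that(1) by simp
  from mild_not_regular[OF this product_drift_l2[OF that(5,6) exp(1,2)[OF that(4)]] exp(1,3)[OF that(4)] jump_data_zero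
   sharp_profile_data[OF that(3)] holder_data_zero \<alpha>_pos that(7,2)] that(3) show ?thesis by blast
 qed
 show ?thesis
 proof (intro conjI allI impI, goal_cases)
  case (1 f h \<beta>)
  then have f: "holder_data \<alpha> f" and \<beta>: "0 < \<beta>" and h: "drift_data M F \<beta> h" by auto
  obtain u where u: "mild_solution M F W \<nu> N h f (%_ _ _. 0) u" "\<forall>x. AE w in M. u 0 x w = 0"
   "\<alpha> < 1 --> linf_loc (holder1_l2_norm M \<alpha>) u" using ex0[OF f \<beta> h] by blast
  show ?case
   by (rule exI[of _ u], intro conjI u; intro allI impI; erule wiener_formula[OF u(1)] mild_uniqueness[OF u(1)])
 next
  case (2 Y f h1 h2 \<beta> \<delta>)
  then show ?case using \<alpha>_pos by (intro product_drift_regular[of \<beta>]) auto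
 next
  case (3 Y f h1 h2 \<beta> u \<delta>)
  then show ?case by (intro no0[of h1 h2 f u Y \<beta>]) auto
 next
  case (4 Y f g1 h \<beta>)
  then have f: "sharp_profile Y \<alpha> f" and g: "jump_data c \<nu> g1" and \<beta>: "0 < \<beta>" and h: "drift_data M F \<beta> h" by auto
  obtain u where u: "mild_solution M F W \<nu> N h (%_ _. 0) (%_ x v. f x * g1 v) u" "\<forall>x. AE w in M. u 0 x w = 0"
   "\<alpha> < 1 --> linf_loc (holder1_l2_norm M \<alpha>) u"
   using mild_existence[OF \<alpha>_pos h \<beta> holder_data_zero sharp_profile_data[OF f] g] by blast
  show ?case
   by (rule exI[of _ u], intro conjI u; intro allI impI; erule levy_formula[OF u(1)] mild_uniqueness[OF u(1)])
 next
  case (5 Y f g1 h \<beta> u \<delta>)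
  then have Y: "0 \<in> Y" and f: "sharp_profile Y \<alpha> f" and g: "jump_data c \<nu> g1" "\<not> (AE v in \<nu>. g1 v = 0)"
   and \<beta>: "0 < \<beta>" and h: "drift_data M F \<beta> h" and \<delta>: "\<alpha> < \<delta>"
   and u: "mild_solution M F W \<nu> N h (%_ _. 0) (%_ x v. f x * g1 v) u" by auto
  show ?case
   using mild_not_regular[OF u drift_data_l2[OF h exp(1,2)[OF \<beta>]] exp(1,3)[OF \<beta>] g(1) holder_data_zero sharp_profile_data[OF f] \<alpha>_pos \<delta> Y] f g(2)
   by blast
 next
  case (6 Y f1 f2 g1 h \<beta>)
  then have f: "sharp_profile Y \<alpha> f1" "sharp_profile Y \<alpha> f2" and g: "jump_data c \<nu> g1" and \<beta>: "0 < \<beta>" and h: "drift_data M F \<beta> h"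
   by auto
  obtain u where u: "mild_solution M F W \<nu> N h (%_. f1) (%_ x v. f2 x * g1 v) u" "\<forall>x. AE w in M. u 0 x w = 0"
   "\<alpha> < 1 --> linf_loc (holder1_l2_norm M \<alpha>) u"
   using mild_existence[OF \<alpha>_pos h \<beta> sharp_profile_data[OF f(1)] sharp_profile_data[OF f(2)] g] by blast
  show ?case by (rule exI[of _ u], intro conjI u; intro allI impI; erule mild_uniqueness[OF u(1)])
 next
  case (7 Y f1 f2 g1 h \<beta> u \<delta>)
  then have Y: "0 \<in> Y" and f: "sharp_profile Y \<alpha> f1" "sharp_profile Y \<alpha> f2" and g: "jump_data c \<nu> g1"
   and \<beta>: "0 < \<beta>" and h: "drift_data M F \<beta> h" and \<delta>: "\<alpha> < \<delta>"
   and u: "mild_solution M F W \<nu> N h (%_. f1) (%_ x v. f2 x * g1 v) u" by auto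
  show ?case
   using mild_not_regular[OF u drift_data_l2[OF h exp(1,2)[OF \<beta>]] exp(1,3)[OF \<beta>] g sharp_profile_data[OF f(1)] sharp_profile_data[OF f(2)] \<alpha>_pos \<delta> Y] f(1)
   by blast
 qed
qed

end
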